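(* Let $s\in\mathbb{R}$, $(x_0,\xi_0)\in\mathbb{R}^n\times(\mathbb{R}^n\setminus\{0\})$ and $u\in\mathcal{S}'(\mathbb{R}^n)$. The following three conditions are equivalent. (i) $(x_0,\xi_0)\notin WF_{H^s}(u)$. (ii) There exist $\phi\in\mathcal{S}(\mathbb{R}^n)\setminus\{0\}$, a neighborhood $K$ of $x_0$ and a neighborhood $V$ of $\xi_0$ such that $$\int_1^\infty\lambda^{n-1+2s}\int_V\int_K|W_{\phi_\lambda}u(x,\lambda\xi)|^2\,dx\,d\xi\,d\lambda<\infty.$$ (iii) There exist a neighborhood $K$ of $x_0$ and a neighborhood $V$ of $\xi_0$ such that for every $\phi\in\mathcal{S}(\mathbb{R}^n)\setminus\{0\}$, $$\int_1^\infty\lambda^{n-1+2s}\int_V\int_K|W_{\phi_\lambda}u(x,\lambda\xi)|^2\,dx\,d\xi\,d\lambda<\infty.$$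
   Context: Fourier transform: $\mathcal{F}[f](\xi)=\widehat f(\xi)=\int_{\mathbb{R}^n}f(x)e^{-ix\cdot\xi}dx$. $\langle\xi\rangle=(1+|\xi|^2)^{1/2}$. For $\phi\in\mathcal{S}(\mathbb{R}^n)\setminus\{0\}$ and $f\in\mathcal{S}'(\mathbb{R}^n)$, the wave packet transform is $W_\phi f(x,\xi)=\int_{\mathbb{R}^n}\overline{\phi(y-x)}f(y)e^{-iy\cdot\xi}dy$ (action of $f$ on $y\mapsto\overline{\phi(y-x)}e^{-iy\cdot\xi}$). For $\lambda\ge1$, $\phi_\lambda(x)=\lambda^{n/4}\phi(\lambda^{1/2}x)$. A conic neighborhood of $\xi_0$ is an open set $\Gamma\ni\xi_0$ invariant under multiplication by positive scalars. ($H^s$ wave front set) $(x_0,\xi_0)\notin WF_{H^s}(u)$ means: there exist a conic neighborhood $\Gamma$ of $\xi_0$ and $\chi\in C_0^\infty(\mathbb{R}^n)$ with $\chi\equiv1$ near $x_0$ such that $\|\langle\xi\rangle^s\widehat{\chi u}(\xi)\|_{L^2(\Gamma)}<\infty$. *)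

theory Defs
  imports "HOL-Analysis.Analysis"
begin

fun iter_deriv :: "'a::euclidean_space list \<Rightarrow> ('a \<Rightarrow> complex) \<Rightarrow> 'a \<Rightarrow> complex" where
  "iter_deriv [] f = f"
| "iter_deriv (v # vs) f = (\<lambda>x. frechet_derivative (iter_deriv vs f) (at x) v)"

definition smooth_fun :: "('a::euclidean_space \<Rightarrow> complex) \<Rightarrow> bool" where
  "smooth_fun f \<longleftrightarrow> (\<forall>vs. set vs \<subseteq> Basis \<longrightarrow> (\<forall>x. iter_deriv vs f differentiable at x))"

definition schwartz :: "('a::euclidean_space \<Rightarrow> complex) \<Rightarrow> bool" where
  "schwartz f \<longleftrightarrow> smooth_fun f \<and>
     (\<forall>vs k::nat. set vs \<subseteq> Basis \<longrightarrow>
        bounded (range (\<lambda>x. (1 + norm x) ^ k * norm (iter_deriv vs f x))))"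

definition test_fun :: "('a::euclidean_space \<Rightarrow> complex) \<Rightarrow> bool" where
  "test_fun f \<longleftrightarrow> smooth_fun f \<and> bounded {x. f x \<noteq> 0}"

definition schwartz_seminorm :: "nat \<Rightarrow> ('a::euclidean_space \<Rightarrow> complex) \<Rightarrow> real" where
  "schwartz_seminorm N f =
     (\<Sum>vs\<in>{vs. set vs \<subseteq> Basis \<and> length vs \<le> N}.
        (SUP x. (1 + norm x) ^ N * norm (iter_deriv vs f x)))"

(* tempered distributions S'(R^n): continuous linear functionals on S(R^n);
   values on non-Schwartz functions are irrelevant *)
definition tempered :: "(('a::euclidean_space \<Rightarrow> complex) \<Rightarrow> complex) \<Rightarrow> bool" where
  "tempered u \<longleftrightarrow>
     (\<forall>f g c. schwartz f \<longrightarrow> schwartz g \<longrightarrow> u (\<lambda>x. c * f x + g x) = c * u f + u g) \<and>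
     (\<exists>C N. \<forall>f. schwartz f \<longrightarrow> norm (u f) \<le> C * schwartz_seminorm N f)"

(* Fourier transform of the compactly supported distribution chiu, as a function *)
definition FT_cutoff :: "(('a::euclidean_space \<Rightarrow> complex) \<Rightarrow> complex) \<Rightarrow> ('a \<Rightarrow> complex) \<Rightarrow> 'a \<Rightarrow> complex" where
  "FT_cutoff u chi \<xi> = u (\<lambda>y. chi y * exp (- \<i> * complex_of_real (y \<bullet> \<xi>)))"

definition wpt :: "('a::euclidean_space \<Rightarrow> complex) \<Rightarrow> (('a \<Rightarrow> complex) \<Rightarrow> complex) \<Rightarrow> 'a \<Rightarrow> 'a \<Rightarrow> complex" where
  "wpt \<phi> f x \<xi> = f (\<lambda>y. cnj (\<phi> (y - x)) * exp (- \<i> * complex_of_real (y \<bullet> \<xi>)))"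

definition scale_win :: "real \<Rightarrow> ('a::euclidean_space \<Rightarrow> complex) \<Rightarrow> 'a \<Rightarrow> complex" where
  "scale_win lam \<phi> x = complex_of_real (lam powr (real DIM('a) / 4)) * \<phi> (sqrt lam *\<^sub>R x)"

definition japanese :: "'a::euclidean_space \<Rightarrow> real" where
  "japanese \<xi> = sqrt (1 + (norm \<xi>)\<^sup>2)"

definition conic_nbhd :: "'a::real_normed_vector set \<Rightarrow> 'a \<Rightarrow> bool" where
  "conic_nbhd \<Gamma> \<xi>0 \<longleftrightarrow> open \<Gamma> \<and> \<xi>0 \<in> \<Gamma> \<and> (\<forall>\<xi>\<in>\<Gamma>. \<forall>t>0. t *\<^sub>R \<xi> \<in> \<Gamma>)"

definition not_in_WF :: "real \<Rightarrow> (('a::euclidean_space \<Rightarrow> complex) \<Rightarrow> complex) \<Rightarrow> 'a \<Rightarrow> 'a \<Rightarrow> bool" where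
  "not_in_WF s u x0 \<xi>0 \<longleftrightarrow>
     (\<exists>\<Gamma> chi. conic_nbhd \<Gamma> \<xi>0 \<and> test_fun chi \<and> (\<exists>U. open U \<and> x0 \<in> U \<and> (\<forall>x\<in>U. chi x = 1)) \<and>
        (\<integral>\<^sup>+ \<xi>\<in>\<Gamma>. ennreal ((japanese \<xi> powr s * norm (FT_cutoff u chi \<xi>))\<^sup>2) \<partial>lborel) < \<infinity>)"

definition wp_integral :: "real \<Rightarrow> ('a::euclidean_space \<Rightarrow> complex) \<Rightarrow> (('a \<Rightarrow> complex) \<Rightarrow> complex) \<Rightarrow> 'a set \<Rightarrow> 'a set \<Rightarrow> ennreal" where
  "wp_integral s \<phi> u K V =
     (\<integral>\<^sup>+ lam\<in>{1..}. ennreal (lam powr (real DIM('a) - 1 + 2 * s)) *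
        (\<integral>\<^sup>+ \<xi>\<in>V. (\<integral>\<^sup>+ x\<in>K. ennreal ((norm (wpt (scale_win lam \<phi>) u x (lam *\<^sub>R \<xi>)))\<^sup>2) \<partial>lborel) \<partial>lborel) \<partial>lborel)"

end

theory Submission
  imports Defs "HOL-Probability.Characteristic_Functions" "HOL-Probability.Sinc_Integral"
begin

text \<open>Let \<open>chi\<close> be a cutoff equal to 1 near \<open>x0\<close>, and let \<open>g\<close> be the Fourier transform of \<open>chi u\<close>.
  Writing the window through its Fourier transform and applying Plancherel in \<open>x\<close>, the integral of
  \<open>|W (chi u) (x, lam \<xi>)|\<^sup>2\<close> over all \<open>x\<close> becomes, up to a constant, the integral of
  \<open>|FT \<phi> \<eta>|\<^sup>2 |g (lam \<xi> + sqrt lam \<eta>)|\<^sup>2\<close> over \<open>\<eta>\<close>. Since \<open>FT \<phi>\<close> decreases rapidly, the integral of this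
  over \<open>\<xi>\<close> in a ball is comparable, up to slightly changing the radius and up to \<open>O(lam ^ -M)\<close>, with the
  integral of \<open>|g (lam \<xi>)|\<^sup>2\<close> over the ball; integrating against \<open>lam powr (n - 1 + 2 s)\<close> produces the
  weighted \<open>L\<^sup>2\<close> norm of \<open>g\<close> on a cone. It remains to compare \<open>W u\<close> and \<open>W (chi u)\<close>: for \<open>x\<close> near \<open>x0\<close>
  the difference \<open>W ((1 - chi) u)\<close> is \<open>O(lam ^ -M)\<close>, and conversely \<open>W (chi u)\<close> is the convolution of \<open>W u\<close>
  in the frequency variable with the fixed rapidly decreasing function \<open>FT chi\<close>.\<close>

section \<open>Iterated derivatives and jets\<close>

text \<open>The distribution \<open>u\<close> is a bare functional, controlled by a single seminorm
  bound, so facts about it come from weighted bounds on the jets of test functions. The step that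
  resists this is moving \<open>u\<close> inside a Fourier integral; it is reduced to finite sums,
  where linearity is enough.

  The window blurs the direction \<open>\<xi>\<close> by \<open>\<eta> / sqrt lam\<close>, which a
  fixed enlargement of the ball covers. Each blur doubles the radius: one doubling when starting
  from the wave front set, two (window and cutoff) in the converse. The converse also needs a bound
  from below: a nonzero window has mass on some ball of \<open>\<eta>\<close>, which helps once
  \<open>lam\<close> passes a threshold. What remains of the cone is a bounded set of frequencies,
  where \<open>g\<close> is bounded.

  Every loss is polynomial in \<open>lam\<close> and is beaten by an arbitrary inverse power, so
  exponents are estimated generously. The neighbourhoods in (iii) are fixed by \<open>chi\<close>
  and the cone before a window is given. Measurability in \<open>lam\<close> of the wave packet
  integrals is not established; only monotonicity is applied to them.\<close>

lemma iter_deriv_has_derivative: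
  assumes "smooth_fun f" "set vs \<subseteq> Basis"
  shows "(iter_deriv vs f has_derivative frechet_derivative (iter_deriv vs f) (at x)) (at x)"
  using assms unfolding smooth_fun_def by (simp add: frechet_derivative_works)

lemma continuous_on_iter_deriv:
  assumes "smooth_fun f" "set vs \<subseteq> Basis"
  shows "continuous_on S (iter_deriv vs f)"
  by (intro continuous_at_imp_continuous_on ballI
      has_derivative_continuous[OF iter_deriv_has_derivative[OF assms]])

lemma continuous_on_smooth_fun: "smooth_fun f \<Longrightarrow> continuous_on S f"
  using continuous_on_iter_deriv[of f "[]"] by simp

text \<open>Derivatives are unique, so a family \<open>G\<close> that starts at \<open>f\<close> and
  reproduces itself under differentiation along basis vectors can only consist of the iterated
  derivatives; induction on \<open>vs\<close>. The closed formulas for products, sums, affine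
  substitutions, characters and Fourier integrals below are each obtained by supplying such a
  \<open>G\<close>.\<close>

lemma
  assumes "G [] = f"
    and "\<And>vs x. set vs \<subseteq> Basis \<Longrightarrow>
      \<exists>D. (G vs has_derivative D) (at x) \<and> (\<forall>v\<in>Basis. D v = G (v # vs) x)"
  shows smooth_fun_family: "smooth_fun f"
    and iter_deriv_eq_family: "set vs \<subseteq> Basis \<Longrightarrow> iter_deriv vs f = G vs"
proof -
  have eq: "iter_deriv vs f = G vs" if "set vs \<subseteq> Basis" for vs
    using that
  proof (induction vs)
    case Nil
    then show ?case using assms(1) by simp
  next
    case (Cons v vs)
    show ?case
    proof
      fix x
      obtain D where D: "(G vs has_derivative D) (at x)" "\<forall>v\<in>Basis. D v = G (v # vs) x"
        using assms(2) Cons by force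
      have "frechet_derivative (G vs) (at x) = D" using frechet_derivative_at[OF D(1)] ..
      then show "iter_deriv (v # vs) f x = G (v # vs) x" using Cons D by simp
    qed
  qed
  then show "set vs \<subseteq> Basis \<Longrightarrow> iter_deriv vs f = G vs" .
  show "smooth_fun f"
    unfolding smooth_fun_def
  proof safe
    fix vs :: "'a list" and x assume "set vs \<subseteq> Basis"
    then show "iter_deriv vs f differentiable at x"
      using assms(2)[of vs x] eq unfolding differentiable_def by auto
  qed
qed

text \<open>The index set of the Leibniz rule: each entry of the list is handed to the first or to
  the second factor. Equal pairs are kept with repetition, which replaces binomial
  coefficients.\<close>

fun splits :: "'a list \<Rightarrow> ('a list \<times> 'a list) list" where
  "splits [] = [([], [])]"
| "splits (v # vs) = map (\<lambda>(as, bs). (v # as, bs)) (splits vs) @ map (\<lambda>(as, bs). (as, v # bs)) (splits vs)"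

lemma length_splits: "length (splits vs) = 2 ^ length vs"
  by (induction vs) auto

lemma splits_bounds:
  "p \<in> set (splits vs) \<Longrightarrow> set (fst p) \<subseteq> set vs \<and> set (snd p) \<subseteq> set vs \<and>
     length (fst p) \<le> length vs \<and> length (snd p) \<le> length vs"
  by (induction vs arbitrary: p) (auto split: prod.splits; force)+

lemma has_derivative_sum_list:
  fixes f :: "'b \<Rightarrow> 'a::real_normed_vector \<Rightarrow> 'c::real_normed_vector"
  assumes "\<And>p. p \<in> set ps \<Longrightarrow> (f p has_derivative f' p) F"
  shows "((\<lambda>x. \<Sum>p\<leftarrow>ps. f p x) has_derivative (\<lambda>h. \<Sum>p\<leftarrow>ps. f' p h)) F"
  using assms by (induction ps) (auto intro!: derivative_intros)

lemma
  assumes "smooth_fun f" "smooth_fun g"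
  shows smooth_fun_mult: "smooth_fun (\<lambda>x. f x * g x)"
    and iter_deriv_mult: "set vs \<subseteq> Basis \<Longrightarrow> iter_deriv vs (\<lambda>x. f x * g x) =
      (\<lambda>x. \<Sum>p\<leftarrow>splits vs. iter_deriv (fst p) f x * iter_deriv (snd p) g x)"
proof -
  define G where "G = (\<lambda>vs x. \<Sum>p\<leftarrow>splits vs. iter_deriv (fst p) f x * iter_deriv (snd p) g x)"
  have *: "\<exists>D. (G vs has_derivative D) (at x) \<and> (\<forall>v\<in>Basis. D v = G (v # vs) x)"
    if "set vs \<subseteq> Basis" for vs x
  proof (intro exI conjI ballI)
    let ?d = "\<lambda>p h. iter_deriv (fst p) f x * frechet_derivative (iter_deriv (snd p) g) (at x) h
      + frechet_derivative (iter_deriv (fst p) f) (at x) h * iter_deriv (snd p) g x"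
    show "(G vs has_derivative (\<lambda>h. \<Sum>p\<leftarrow>splits vs. ?d p h)) (at x)"
      unfolding G_def
    proof (rule has_derivative_sum_list)
      fix p assume "p \<in> set (splits vs)"
      then have "set (fst p) \<subseteq> Basis" "set (snd p) \<subseteq> Basis"
        using splits_bounds that by blast+
      then show "((\<lambda>x. iter_deriv (fst p) f x * iter_deriv (snd p) g x) has_derivative ?d p) (at x)"
        using assms by (intro has_derivative_mult iter_deriv_has_derivative)
    qed
    show "(\<Sum>p\<leftarrow>splits vs. ?d p v) = G (v # vs) x" for v
      by (simp add: G_def o_def case_prod_beta sum_list_addf)
  qed
  have 0: "G [] = (\<lambda>x. f x * g x)" by (simp add: G_def)
  show "smooth_fun (\<lambda>x. f x * g x)"
    using smooth_fun_family[OF 0 *] by blast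
  show "iter_deriv vs (\<lambda>x. f x * g x) =
      (\<lambda>x. \<Sum>p\<leftarrow>splits vs. iter_deriv (fst p) f x * iter_deriv (snd p) g x)" if "set vs \<subseteq> Basis"
    using iter_deriv_eq_family[OF 0 * that] unfolding G_def by blast
qed

lemma
  assumes "smooth_fun f" "smooth_fun g"
  shows smooth_fun_add: "smooth_fun (\<lambda>x. f x + g x)"
    and iter_deriv_add: "set vs \<subseteq> Basis \<Longrightarrow>
      iter_deriv vs (\<lambda>x. f x + g x) = (\<lambda>x. iter_deriv vs f x + iter_deriv vs g x)"
proof -
  define G where "G = (\<lambda>vs x. iter_deriv vs f x + iter_deriv vs g x)"
  have *: "\<exists>D. (G vs has_derivative D) (at x) \<and> (\<forall>v\<in>Basis. D v = G (v # vs) x)"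
    if "set vs \<subseteq> Basis" for vs x
    unfolding G_def
    by (rule exI, rule conjI, rule has_derivative_add[OF iter_deriv_has_derivative[OF assms(1) that]
          iter_deriv_has_derivative[OF assms(2) that]]) simp
  have 0: "G [] = (\<lambda>x. f x + g x)" by (simp add: G_def)
  show "smooth_fun (\<lambda>x. f x + g x)"
    using smooth_fun_family[OF 0 *] by blast
  show "iter_deriv vs (\<lambda>x. f x + g x) = (\<lambda>x. iter_deriv vs f x + iter_deriv vs g x)"
    if "set vs \<subseteq> Basis"
    using iter_deriv_eq_family[OF 0 * that] unfolding G_def by blast
qed

text \<open>\<open>bounded_linear\<close> means real linear, so this serves complex conjugation as
  well as multiplication by a constant.\<close>

lemma
  assumes "smooth_fun f" "bounded_linear L"
  shows smooth_fun_bounded_linear: "smooth_fun (\<lambda>x. L (f x))"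
    and iter_deriv_bounded_linear: "set vs \<subseteq> Basis \<Longrightarrow>
      iter_deriv vs (\<lambda>x. L (f x)) = (\<lambda>x. L (iter_deriv vs f x))"
proof -
  define G where "G = (\<lambda>vs x. L (iter_deriv vs f x))"
  have *: "\<exists>D. (G vs has_derivative D) (at x) \<and> (\<forall>v\<in>Basis. D v = G (v # vs) x)"
    if "set vs \<subseteq> Basis" for vs x
    unfolding G_def
    by (rule exI, rule conjI, rule bounded_linear.has_derivative[OF assms(2)
          iter_deriv_has_derivative[OF assms(1) that]]) simp
  have 0: "G [] = (\<lambda>x. L (f x))" by (simp add: G_def)
  show "smooth_fun (\<lambda>x. L (f x))"
    using smooth_fun_family[OF 0 *] by blast
  show "iter_deriv vs (\<lambda>x. L (f x)) = (\<lambda>x. L (iter_deriv vs f x))" if "set vs \<subseteq> Basis"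
    using iter_deriv_eq_family[OF 0 * that] unfolding G_def by blast
qed

lemma
  assumes "smooth_fun f"
  shows smooth_fun_affine: "smooth_fun (\<lambda>x. f (c *\<^sub>R (x - a)))"
    and iter_deriv_affine: "set vs \<subseteq> Basis \<Longrightarrow>
      iter_deriv vs (\<lambda>x. f (c *\<^sub>R (x - a))) = (\<lambda>x. c ^ length vs *\<^sub>R iter_deriv vs f (c *\<^sub>R (x - a)))"
proof -
  define G where "G = (\<lambda>vs x. c ^ length vs *\<^sub>R iter_deriv vs f (c *\<^sub>R (x - a)))"
  have *: "\<exists>D. (G vs has_derivative D) (at x) \<and> (\<forall>v\<in>Basis. D v = G (v # vs) x)"
    if "set vs \<subseteq> Basis" for vs x
  proof (intro exI conjI ballI)
    let ?F = "frechet_derivative (iter_deriv vs f) (at (c *\<^sub>R (x - a)))"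
    have F: "(iter_deriv vs f has_derivative ?F) (at (c *\<^sub>R (x - a)))"
      using iter_deriv_has_derivative[OF assms that] .
    have "((\<lambda>x. c *\<^sub>R (x - a)) has_derivative (\<lambda>h. c *\<^sub>R h)) (at x)"
      by (auto intro!: derivative_eq_intros)
    from has_derivative_compose[OF this F]
    show "(G vs has_derivative (\<lambda>h. c ^ length vs *\<^sub>R ?F (c *\<^sub>R h))) (at x)"
      unfolding G_def by (intro has_derivative_scaleR_right)
    have "linear ?F" using F has_derivative_linear by blast
    then show "c ^ length vs *\<^sub>R ?F (c *\<^sub>R v) = G (v # vs) x" for v
      by (simp add: G_def linear_cmul)
  qed
  have 0: "G [] = (\<lambda>x. f (c *\<^sub>R (x - a)))" by (simp add: G_def)
  show "smooth_fun (\<lambda>x. f (c *\<^sub>R (x - a)))"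
    using smooth_fun_family[OF 0 *] by blast
  show "iter_deriv vs (\<lambda>x. f (c *\<^sub>R (x - a))) =
      (\<lambda>x. c ^ length vs *\<^sub>R iter_deriv vs f (c *\<^sub>R (x - a)))" if "set vs \<subseteq> Basis"
    using iter_deriv_eq_family[OF 0 * that] unfolding G_def by blast
qed

lemma smooth_fun_const: "smooth_fun (\<lambda>x. c)"
proof (rule smooth_fun_family[of "\<lambda>vs x. if vs = [] then c else 0"])
  show "\<exists>D. ((\<lambda>x. if vs = [] then c else 0) has_derivative D) (at x) \<and>
      (\<forall>v\<in>Basis. D v = (if v # vs = [] then c else 0))" for vs x
    by (rule exI, rule conjI, rule has_derivative_const) simp
qed simp

section \<open>Characters and their derivatives\<close>

definition expi :: "'a::euclidean_space \<Rightarrow> 'a \<Rightarrow> complex" where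
  "expi \<xi> y = exp (- \<i> * complex_of_real (y \<bullet> \<xi>))"

lemma norm_expi [simp]: "norm (expi \<xi> y) = 1"
  unfolding expi_def by (simp add: norm_exp_eq_Re)

lemma expi_add: "expi (\<xi> + \<eta>) y = expi \<xi> y * expi \<eta> y"
  unfolding expi_def by (simp add: inner_add_right algebra_simps flip: exp_add)

lemma expi_add_right: "expi \<xi> (x + y) = expi \<xi> x * expi \<xi> y"
  unfolding expi_def by (simp add: inner_add_left algebra_simps flip: exp_add)

lemma expi_diff_right: "expi \<xi> (x - y) = expi \<xi> x * cnj (expi \<xi> y)"
  unfolding expi_def
  by (simp add: inner_diff_left algebra_simps exp_cnj flip: exp_add)

lemma cnj_expi: "cnj (expi \<xi> y) = expi (- \<xi>) y"
  unfolding expi_def by (simp add: exp_cnj)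

lemma cnj_expi': "cnj (expi \<xi> y) = expi \<xi> (- y)"
  unfolding expi_def by (simp add: exp_cnj)

lemma expi_minus: "expi (- \<xi>) y = expi \<xi> (- y)"
  unfolding expi_def by simp

lemma expi_commute: "expi \<xi> y = expi y \<xi>"
  unfolding expi_def by (simp add: inner_commute)

lemma expi_0 [simp]: "expi 0 y = 1" "expi \<xi> 0 = 1"
  unfolding expi_def by auto

lemma expi_scaleR: "expi (c *\<^sub>R \<xi>) y = expi \<xi> (c *\<^sub>R y)"
  unfolding expi_def by simp

lemma continuous_on_expi [continuous_intros]:
  "continuous_on S f \<Longrightarrow> continuous_on S g \<Longrightarrow> continuous_on S (\<lambda>p. expi (f p) (g p))"
  unfolding expi_def by (intro continuous_intros)

lemma borel_measurable_expi [measurable]: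
  "f \<in> borel_measurable M \<Longrightarrow> g \<in> borel_measurable M \<Longrightarrow> (\<lambda>p. expi (f p) (g p)) \<in> borel_measurable M"
  unfolding expi_def by measurable

lemma has_derivative_expi:
  "(expi \<xi> has_derivative (\<lambda>h. - \<i> * (h \<bullet> \<xi>) * expi \<xi> x)) (at x)"
proof -
  have "((\<lambda>y. - \<i> * complex_of_real (y \<bullet> \<xi>)) has_derivative (\<lambda>h. - \<i> * complex_of_real (h \<bullet> \<xi>))) (at x)"
    by (auto intro!: derivative_eq_intros)
  moreover have "(exp has_derivative (\<lambda>h. exp (- \<i> * complex_of_real (x \<bullet> \<xi>)) * h))
      (at (- \<i> * complex_of_real (x \<bullet> \<xi>)))"
    using DERIV_exp has_field_derivative_def by blast
  ultimately show ?thesis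
    unfolding expi_def using has_derivative_compose[of _ _ x UNIV exp] by (fastforce simp: mult_ac)
qed

text \<open>The factor that differentiation along \<open>vs\<close> produces on the character
  \<open>expi \<xi>\<close>; in multi-index notation (-i)^|alpha| xi^alpha.\<close>

definition mono_symb :: "'a::euclidean_space list \<Rightarrow> 'a \<Rightarrow> complex" where
  "mono_symb vs \<xi> = (\<Prod>v\<leftarrow>vs. - \<i> * complex_of_real (v \<bullet> \<xi>))"

lemma mono_symb_simps [simp]:
  "mono_symb [] \<xi> = 1" "mono_symb (v # vs) \<xi> = - \<i> * complex_of_real (v \<bullet> \<xi>) * mono_symb vs \<xi>"
  unfolding mono_symb_def by auto

lemma
  shows smooth_fun_expi: "smooth_fun (expi \<xi>)"
    and iter_deriv_expi: "set vs \<subseteq> Basis \<Longrightarrow> iter_deriv vs (expi \<xi>) = (\<lambda>x. mono_symb vs \<xi> * expi \<xi> x)"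
proof -
  define G where "G = (\<lambda>vs x. mono_symb vs \<xi> * expi \<xi> x)"
  have *: "\<exists>D. (G vs has_derivative D) (at x) \<and> (\<forall>v\<in>Basis. D v = G (v # vs) x)"
    if "set vs \<subseteq> Basis" for vs x
    unfolding G_def
    by (rule exI, rule conjI, rule has_derivative_mult_right, rule has_derivative_expi) simp
  have 0: "G [] = expi \<xi>" by (auto simp: G_def)
  show "smooth_fun (expi \<xi>)"
    using smooth_fun_family[OF 0 *] by blast
  show "iter_deriv vs (expi \<xi>) = (\<lambda>x. mono_symb vs \<xi> * expi \<xi> x)" if "set vs \<subseteq> Basis"
    using iter_deriv_eq_family[OF 0 * that] unfolding G_def by blast
qed

lemma continuous_on_mono_symb [continuous_intros]:
  "continuous_on S f \<Longrightarrow> continuous_on S (\<lambda>p. mono_symb vs (f p))"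
  by (induction vs) (auto intro!: continuous_intros)

lemma borel_measurable_mono_symb [measurable]: "mono_symb vs \<in> borel_measurable borel"
  by (rule borel_measurable_continuous_onI) (intro continuous_intros)

lemma norm_mono_symb_le:
  assumes "set vs \<subseteq> Basis" shows "norm (mono_symb vs \<xi>) \<le> norm \<xi> ^ length vs"
  using assms
proof (induction vs)
  case (Cons v vs)
  then have "\<bar>v \<bullet> \<xi>\<bar> \<le> norm \<xi>" by (simp add: Basis_le_norm inner_commute)
  then show ?case using Cons by (simp add: norm_mult mult_mono)
qed simp

section \<open>Jets and weighted bounds for Schwartz functions\<close>

abbreviation indices :: "nat \<Rightarrow> 'a::euclidean_space list set" where
  "indices N \<equiv> {vs. set vs \<subseteq> Basis \<and> length vs \<le> N}"

lemma finite_indices [simp]: "finite (indices N)"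
  by (rule finite_lists_length_le) simp

text \<open>The point \<open>y\<close> stays explicit so that polynomial weights can be attached,
  moved and split by regions before any supremum is taken; the suprema of
  \<open>schwartz_seminorm\<close> appear only where \<open>u\<close> is applied.\<close>

definition jet :: "nat \<Rightarrow> ('a::euclidean_space \<Rightarrow> complex) \<Rightarrow> 'a \<Rightarrow> real" where
  "jet N f y = (\<Sum>vs\<in>indices N. norm (iter_deriv vs f y))"

lemma jet_nonneg [simp]: "0 \<le> jet N f y"
  unfolding jet_def by (simp add: sum_nonneg)

lemma iter_deriv_le_jet: "set vs \<subseteq> Basis \<Longrightarrow> length vs \<le> N \<Longrightarrow> norm (iter_deriv vs f y) \<le> jet N f y"
  unfolding jet_def by (rule member_le_sum) auto

lemma norm_le_jet: "norm (f y) \<le> jet N f y"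
  using iter_deriv_le_jet[of "[]"] by fastforce

lemma jet_leI:
  fixes f :: "'a::euclidean_space \<Rightarrow> complex"
  assumes "\<And>vs. set vs \<subseteq> Basis \<Longrightarrow> length vs \<le> N \<Longrightarrow> norm (iter_deriv vs f y) \<le> B"
  shows "jet N f y \<le> real (card (indices N :: 'a list set)) * B"
  unfolding jet_def using assms by (intro sum_bounded_above) auto

lemma norm_sum_list_map_le: "norm (\<Sum>p\<leftarrow>ps. f p) \<le> (\<Sum>p\<leftarrow>ps. norm (f p))"
  by (induction ps) (auto intro: norm_triangle_le)

text \<open>The Leibniz rule has at most \<open>2 ^ N\<close> terms, each dominated by the product
  of the two jets. The constant depends on nothing but \<open>N\<close> and the dimension, which
  matters because later factors vary with \<open>lam\<close>, \<open>x\<close> and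
  \<open>\<xi>\<close>.\<close>

lemma jet_mult_le:
  fixes N :: nat
  obtains C where "C \<ge> 0"
    "\<And>f g (y::'a::euclidean_space). smooth_fun f \<Longrightarrow> smooth_fun g \<Longrightarrow>
       jet N (\<lambda>x. f x * g x) y \<le> C * (jet N f y * jet N g y)"
proof
  let ?C = "real (card (indices N :: 'a list set)) * 2 ^ N"
  show "?C \<ge> 0" by simp
  fix f g :: "'a \<Rightarrow> complex" and y :: 'a assume fg: "smooth_fun f" "smooth_fun g"
  have "jet N (\<lambda>x. f x * g x) y \<le> real (card (indices N :: 'a list set)) * (2 ^ N * (jet N f y * jet N g y))"
  proof (rule jet_leI)
    fix vs :: "'a list" assume vs: "set vs \<subseteq> Basis" "length vs \<le> N"
    have "norm (iter_deriv vs (\<lambda>x. f x * g x) y)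
        \<le> (\<Sum>p\<leftarrow>splits vs. norm (iter_deriv (fst p) f y * iter_deriv (snd p) g y))"
      unfolding iter_deriv_mult[OF fg vs(1)] by (rule norm_sum_list_map_le)
    also have "\<dots> \<le> (\<Sum>p\<leftarrow>splits vs. jet N f y * jet N g y)"
    proof (rule sum_list_mono)
      fix p assume "p \<in> set (splits vs)"
      then show "norm (iter_deriv (fst p) f y * iter_deriv (snd p) g y) \<le> jet N f y * jet N g y"
        unfolding norm_mult using splits_bounds[of p vs] vs
        by (intro mult_mono iter_deriv_le_jet) auto
    qed
    also have "\<dots> = 2 ^ length vs * (jet N f y * jet N g y)"
      by (simp add: sum_list_triv length_splits)
    also have "\<dots> \<le> 2 ^ N * (jet N f y * jet N g y)"
      using vs by (intro mult_right_mono) auto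
    finally show "norm (iter_deriv vs (\<lambda>x. f x * g x) y) \<le> 2 ^ N * (jet N f y * jet N g y)" .
  qed
  then show "jet N (\<lambda>x. f x * g x) y \<le> ?C * (jet N f y * jet N g y)" by (simp add: mult_ac)
qed

lemma jet_add_le:
  assumes "smooth_fun f" "smooth_fun g"
  shows "jet N (\<lambda>x. f x + g x) y \<le> jet N f y + jet N g y"
  unfolding jet_def sum.distrib[symmetric]
  by (intro sum_mono) (auto simp: iter_deriv_add[OF assms] norm_triangle_ineq)

lemma jet_cmult:
  assumes "smooth_fun f" shows "jet N (\<lambda>x. c * f x) y = norm c * jet N f y"
  unfolding jet_def sum_distrib_left
  by (intro sum.cong refl)
     (auto simp: iter_deriv_bounded_linear[OF assms bounded_linear_mult_right] norm_mult)

lemma jet_cnj: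
  assumes "smooth_fun f" shows "jet N (\<lambda>x. cnj (f x)) y = jet N f y"
  unfolding jet_def
  by (intro sum.cong refl) (auto simp: iter_deriv_bounded_linear[OF assms bounded_linear_cnj])

text \<open>A derivative of order \<open>length vs\<close> costs \<open>c ^ length vs\<close>; with
  \<open>c \<ge> 1\<close> the highest order gives the largest factor.\<close>

lemma jet_affine:
  assumes "smooth_fun f" "c \<ge> 1"
  shows "jet N (\<lambda>x. f (c *\<^sub>R (x - a))) y \<le> c ^ N * jet N f (c *\<^sub>R (y - a))"
  unfolding jet_def sum_distrib_left
  using assms(2)
  by (intro sum_mono) (auto simp: iter_deriv_affine[OF assms(1)] intro!: mult_right_mono power_increasing)

lemma jet_expi_le:
  fixes y :: "'a::euclidean_space"
  shows "jet N (expi \<xi>) y \<le> real (card (indices N :: 'a list set)) * (1 + norm \<xi>) ^ N"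
proof (rule jet_leI)
  fix vs :: "'a list" assume vs: "set vs \<subseteq> Basis" "length vs \<le> N"
  have "norm (iter_deriv vs (expi \<xi>) y) \<le> norm \<xi> ^ length vs"
    using vs by (simp add: iter_deriv_expi norm_mult norm_mono_symb_le)
  also have "\<dots> \<le> (1 + norm \<xi>) ^ length vs" by (rule power_mono) auto
  also have "\<dots> \<le> (1 + norm \<xi>) ^ N" using vs by (intro power_increasing) auto
  finally show "norm (iter_deriv vs (expi \<xi>) y) \<le> (1 + norm \<xi>) ^ N" .
qed

lemma smooth_fun_cmult: "smooth_fun f \<Longrightarrow> smooth_fun (\<lambda>x. c * f x)"
  using smooth_fun_bounded_linear[OF _ bounded_linear_mult_right] .

lemma smooth_fun_cnj: "smooth_fun f \<Longrightarrow> smooth_fun (\<lambda>x. cnj (f x))"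
  using smooth_fun_bounded_linear[OF _ bounded_linear_cnj] .

lemma smooth_fun_translate: "smooth_fun f \<Longrightarrow> smooth_fun (\<lambda>x. f (x - a))"
  using smooth_fun_affine[of f 1 a] by simp

lemma schwartzD_smooth: "schwartz f \<Longrightarrow> smooth_fun f"
  unfolding schwartz_def by simp

lemma schwartz_jet_bound:
  assumes "schwartz f"
  obtains B where "B \<ge> 0" "\<And>y. (1 + norm y) ^ k * jet N f y \<le> B"
proof -
  have "\<exists>B. \<forall>y. (1 + norm y) ^ k * norm (iter_deriv vs f y) \<le> B" if "vs \<in> indices N" for vs
    using assms that unfolding schwartz_def bounded_iff by fastforce
  then obtain B where B: "\<And>vs y. vs \<in> indices N \<Longrightarrow> (1 + norm y) ^ k * norm (iter_deriv vs f y) \<le> B vs"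
    by metis
  have le: "(1 + norm y) ^ k * jet N f y \<le> (\<Sum>vs\<in>indices N. B vs)" for y
    unfolding jet_def sum_distrib_left using B by (intro sum_mono) blast
  show thesis
  proof (rule that[OF _ le])
    have "0 \<le> (1 + norm (0::'a)) ^ k * jet N f 0" by simp
    then show "0 \<le> (\<Sum>vs\<in>indices N. B vs)" using le order_trans by blast
  qed
qed

lemma schwartzI_jet:
  assumes "smooth_fun f" "\<And>k N. \<exists>B. \<forall>y. (1 + norm y) ^ k * jet N f y \<le> B"
  shows "schwartz f"
  unfolding schwartz_def
proof (intro conjI allI impI assms(1))
  fix vs :: "'a list" and k :: nat assume vs: "set vs \<subseteq> Basis"
  obtain B where B: "\<And>y. (1 + norm y) ^ k * jet (length vs) f y \<le> B" using assms(2) by blast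
  have "norm ((1 + norm y) ^ k * norm (iter_deriv vs f y)) \<le> B" for y
  proof -
    have "(1 + norm y) ^ k * norm (iter_deriv vs f y) \<le> (1 + norm y) ^ k * jet (length vs) f y"
      using vs by (intro mult_left_mono iter_deriv_le_jet) auto
    then show ?thesis using B[of y] by simp
  qed
  then show "bounded (range (\<lambda>x. (1 + norm x) ^ k * norm (iter_deriv vs f x)))"
    unfolding bounded_iff by blast
qed

text \<open>The polynomial growth of the multiplier \<open>a\<close> is paid for by a higher weight
  on \<open>f\<close>, and a Schwartz function admits every weight.\<close>

lemma schwartz_mult_moderate:
  assumes "smooth_fun a" "schwartz f" "\<And>N. \<exists>A k. \<forall>y. jet N a y \<le> A * (1 + norm y) ^ k"
  shows "schwartz (\<lambda>y. a y * f y)"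
proof (rule schwartzI_jet)
  show "smooth_fun (\<lambda>y. a y * f y)" using assms smooth_fun_mult schwartzD_smooth by blast
  fix k N
  obtain A m where A: "\<And>y. jet N a y \<le> A * (1 + norm y) ^ m" using assms(3) by blast
  obtain C where C: "C \<ge> 0" "\<And>f g (y::'a). smooth_fun f \<Longrightarrow> smooth_fun g \<Longrightarrow>
       jet N (\<lambda>x. f x * g x) y \<le> C * (jet N f y * jet N g y)" using jet_mult_le by blast
  obtain B where B: "B \<ge> 0" "\<And>y. (1 + norm y) ^ (k + m) * jet N f y \<le> B"
    using schwartz_jet_bound[OF assms(2)] by blast
  have "jet N a 0 \<le> A" using A[of 0] by simp
  then have A0: "A \<ge> 0" using jet_nonneg order_trans by blast
  have "(1 + norm y) ^ k * jet N (\<lambda>y. a y * f y) y \<le> C * (A * B)" for y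
  proof -
    have "(1 + norm y) ^ k * jet N (\<lambda>y. a y * f y) y \<le>
        (1 + norm y) ^ k * (C * (A * (1 + norm y) ^ m * jet N f y))"
      by (intro mult_left_mono order_trans[OF C(2)] mult_right_mono A assms schwartzD_smooth C(1)) auto
    also have "\<dots> = C * (A * ((1 + norm y) ^ (k + m) * jet N f y))" by (simp add: power_add)
    also have "\<dots> \<le> C * (A * B)" by (intro mult_left_mono B C A0)
    finally show ?thesis .
  qed
  then show "\<exists>B. \<forall>y. (1 + norm y) ^ k * jet N (\<lambda>y. a y * f y) y \<le> B" by blast
qed

lemma schwartz_mult_expi: "schwartz f \<Longrightarrow> schwartz (\<lambda>y. f y * expi \<xi> y)"
proof -
  assume f: "schwartz f"
  have "schwartz (\<lambda>y. expi \<xi> y * f y)"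
  proof (rule schwartz_mult_moderate[OF smooth_fun_expi f])
    fix N
    have "\<forall>y. jet N (expi \<xi>) y \<le> (card (indices N :: 'a list set) * (1 + norm \<xi>) ^ N) * (1 + norm y) ^ 0"
      using jet_expi_le[of N \<xi>] by simp
    then show "\<exists>A k. \<forall>y. jet N (expi \<xi>) y \<le> A * (1 + norm y) ^ k" by blast
  qed
  then show ?thesis by (simp add: mult.commute)
qed

lemma schwartz_cmult: assumes "schwartz f" shows "schwartz (\<lambda>y. c * f y)"
proof (rule schwartzI_jet)
  show "smooth_fun (\<lambda>y. c * f y)" using assms smooth_fun_cmult schwartzD_smooth by blast
  fix k N
  obtain B where B: "B \<ge> 0" "\<And>y. (1 + norm y) ^ k * jet N f y \<le> B"
    using schwartz_jet_bound[OF assms] by blast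
  have "(1 + norm y) ^ k * jet N (\<lambda>y. c * f y) y \<le> norm c * B" for y
    using mult_left_mono[OF B(2)[of y] norm_ge_zero[of c]] assms
    by (simp add: jet_cmult schwartzD_smooth mult_ac)
  then show "\<exists>B. \<forall>y. (1 + norm y) ^ k * jet N (\<lambda>y. c * f y) y \<le> B" by blast
qed

lemma schwartz_add: assumes "schwartz f" "schwartz g" shows "schwartz (\<lambda>y. f y + g y)"
proof (rule schwartzI_jet)
  show "smooth_fun (\<lambda>y. f y + g y)" using assms smooth_fun_add schwartzD_smooth by blast
  fix k N
  obtain B where B: "B \<ge> 0" "\<And>y. (1 + norm y) ^ k * jet N f y \<le> B"
    using schwartz_jet_bound[OF assms(1)] by blast
  obtain B' where B': "B' \<ge> 0" "\<And>y. (1 + norm y) ^ k * jet N g y \<le> B'"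
    using schwartz_jet_bound[OF assms(2)] by blast
  have "(1 + norm y) ^ k * jet N (\<lambda>y. f y + g y) y \<le> B + B'" for y
  proof -
    have "(1 + norm y) ^ k * jet N (\<lambda>y. f y + g y) y \<le> (1 + norm y) ^ k * (jet N f y + jet N g y)"
      by (intro mult_left_mono jet_add_le schwartzD_smooth assms) auto
    then show ?thesis using B(2)[of y] B'(2)[of y] by (simp add: algebra_simps)
  qed
  then show "\<exists>B. \<forall>y. (1 + norm y) ^ k * jet N (\<lambda>y. f y + g y) y \<le> B" by blast
qed

lemma schwartz_cnj: "schwartz f \<Longrightarrow> schwartz (\<lambda>y. cnj (f y))"
  by (rule schwartzI_jet) (auto simp: smooth_fun_cnj schwartzD_smooth jet_cnj elim!: schwartz_jet_bound)

text \<open>A Peetre inequality: it moves a polynomial weight from one point to another at the price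
  of a weight on their distance, which the decay of a window then absorbs.\<close>

lemma one_plus_norm_le: "1 + norm (x::'a::real_normed_vector) \<le> (1 + norm y) * (1 + norm (x - y))"
proof -
  have "norm x \<le> norm y + norm (x - y)" using norm_triangle_ineq[of y "x - y"] by simp
  moreover have "0 \<le> norm y * norm (x - y)" by simp
  moreover have "(1 + norm y) * (1 + norm (x - y)) = 1 + norm y + norm (x - y) + norm y * norm (x - y)"
    by (simp add: algebra_simps)
  ultimately show ?thesis by linarith
qed

lemma schwartz_affine: assumes "schwartz f" "c \<ge> 1" shows "schwartz (\<lambda>y. f (c *\<^sub>R (y - a)))"
proof (rule schwartzI_jet)
  show "smooth_fun (\<lambda>y. f (c *\<^sub>R (y - a)))" using assms smooth_fun_affine schwartzD_smooth by blast
  fix k N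
  obtain B where B: "B \<ge> 0" "\<And>y. (1 + norm y) ^ k * jet N f y \<le> B"
    using schwartz_jet_bound[OF assms(1)] by blast
  have "(1 + norm y) ^ k * jet N (\<lambda>y. f (c *\<^sub>R (y - a))) y \<le> (1 + norm a) ^ k * c ^ N * B" for y
  proof -
    have "norm (y - a) \<le> norm (c *\<^sub>R (y - a))" using assms(2) mult_right_mono[of 1 c "norm (y - a)"] by simp
    then have "(1 + norm a) * (1 + norm (y - a)) \<le> (1 + norm a) * (1 + norm (c *\<^sub>R (y - a)))"
      by (intro mult_left_mono) auto
    then have "(1 + norm y) ^ k \<le> ((1 + norm a) * (1 + norm (c *\<^sub>R (y - a)))) ^ k"
      using one_plus_norm_le[of y a] by (intro power_mono) auto
    then have "(1 + norm y) ^ k * jet N (\<lambda>y. f (c *\<^sub>R (y - a))) y \<le>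
       ((1 + norm a) * (1 + norm (c *\<^sub>R (y - a)))) ^ k * (c ^ N * jet N f (c *\<^sub>R (y - a)))"
      using assms by (intro mult_mono jet_affine schwartzD_smooth) auto
    also have "\<dots> = (1 + norm a) ^ k * c ^ N * ((1 + norm (c *\<^sub>R (y - a))) ^ k * jet N f (c *\<^sub>R (y - a)))"
      by (simp add: power_mult_distrib)
    also have "\<dots> \<le> (1 + norm a) ^ k * c ^ N * B" using assms(2) by (intro mult_left_mono B) auto
    finally show ?thesis .
  qed
  then show "\<exists>B. \<forall>y. (1 + norm y) ^ k * jet N (\<lambda>y. f (c *\<^sub>R (y - a))) y \<le> B" by blast
qed

lemma schwartz_translate: "schwartz f \<Longrightarrow> schwartz (\<lambda>y. f (y - a))"
  using schwartz_affine[of f 1 a] by simp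

lemma schwartz_scale_win: "schwartz f \<Longrightarrow> lam \<ge> 1 \<Longrightarrow> schwartz (scale_win lam f)"
  unfolding scale_win_def using schwartz_affine[of f "sqrt lam" 0] schwartz_cmult by auto

lemma iter_deriv_const_on:
  assumes "\<And>x. x \<in> U \<Longrightarrow> f x = c" "open U" "set vs \<subseteq> Basis" "x \<in> U"
  shows "iter_deriv vs f x = (if vs = [] then c else 0)"
  using assms(3,4)
proof (induction vs arbitrary: x)
  case (Cons v vs)
  have "(iter_deriv vs f has_derivative (\<lambda>h. 0)) (at x)"
    by (rule has_derivative_transform_within_open[OF has_derivative_const assms(2) Cons.prems(2)])
       (use Cons in auto)
  from frechet_derivative_at[OF this] have "frechet_derivative (iter_deriv vs f) (at x) v = 0"
    by (metis (no_types))
  then show ?case by simp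
qed (use assms(1) in auto)

text \<open>Derivatives are local, so only the empty list contributes. Mostly applied with
  \<open>c = 0\<close>, to discard regions where a cutoff vanishes.\<close>

lemma jet_const_on:
  fixes f :: "'a::euclidean_space \<Rightarrow> complex"
  assumes "\<And>x. x \<in> U \<Longrightarrow> f x = c" "open U" "x \<in> U"
  shows "jet N f x = norm c"
proof -
  have "jet N f x = (\<Sum>vs\<in>(indices N :: 'a list set). if vs = [] then norm c else 0)"
    unfolding jet_def
    by (rule sum.cong[OF refl]) (use iter_deriv_const_on[OF assms(1,2) _ assms(3)] in auto)
  also have "\<dots> = norm c" by (subst sum.delta) auto
  finally show ?thesis .
qed

lemma continuous_on_jet: "smooth_fun f \<Longrightarrow> continuous_on S (jet N f)"
  unfolding jet_def[abs_def] by (intro continuous_intros continuous_on_iter_deriv) auto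

lemma test_fun_schwartz:
  assumes "test_fun f" shows "schwartz f"
proof (rule schwartzI_jet)
  show f: "smooth_fun f" using assms unfolding test_fun_def by simp
  fix k N
  obtain r where r: "\<And>x. f x \<noteq> 0 \<Longrightarrow> norm x \<le> r"
    using assms unfolding test_fun_def bounded_iff by blast
  have "continuous_on (cball 0 r) (\<lambda>y. (1 + norm y) ^ k * jet N f y)"
    by (intro continuous_intros continuous_on_jet f)
  then have "compact ((\<lambda>y. (1 + norm y) ^ k * jet N f y) ` cball 0 r)"
    by (rule compact_continuous_image) simp
  from compact_imp_bounded[OF this]
  obtain B where B: "\<And>y. norm y \<le> r \<Longrightarrow> (1 + norm y) ^ k * jet N f y \<le> B"
    unfolding bounded_iff by fastforce
  have "(1 + norm y) ^ k * jet N f y \<le> max 0 B" for y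
  proof (cases "norm y \<le> r")
    case False
    have "jet N f y = norm (0::complex)"
      by (rule jet_const_on[of "- cball 0 r"]) (use r False in auto)
    then show ?thesis by simp
  qed (use B in fastforce)
  then show "\<exists>B. \<forall>y. (1 + norm y) ^ k * jet N f y \<le> B" by blast
qed

section \<open>Gaussians, Fourier inversion and Plancherel\<close>

lemma nn_integral_lborel_affine:
  fixes f :: "'a::euclidean_space \<Rightarrow> ennreal"
  assumes [measurable]: "f \<in> borel_measurable borel" and "c > 0"
  shows "(\<integral>\<^sup>+x. f x \<partial>lborel) = ennreal (c ^ DIM('a)) * (\<integral>\<^sup>+x. f (t + c *\<^sub>R x) \<partial>lborel)"
  using assms(2)
  by (subst lborel_affine[of c t])
     (auto simp: nn_integral_density nn_integral_distr nn_integral_cmult)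

lemma
  fixes f :: "'a::euclidean_space \<Rightarrow> 'b::{banach, second_countable_topology}"
  assumes c: "c \<noteq> 0"
  shows lborel_integrable_affine: "integrable lborel f \<Longrightarrow> integrable lborel (\<lambda>x. f (t + c *\<^sub>R x))"
    and lborel_integral_affine: "(\<integral>x. f x \<partial>lborel) = \<bar>c\<bar> ^ DIM('a) *\<^sub>R (\<integral>x. f (t + c *\<^sub>R x) \<partial>lborel)"
proof -
  have M: "f \<in> borel_measurable borel" if "(\<lambda>x. f (t + c *\<^sub>R x)) \<in> borel_measurable borel"
  proof -
    have "(\<lambda>y. f (t + c *\<^sub>R ((1 / c) *\<^sub>R (y - t)))) \<in> borel_measurable borel"
      by (rule measurable_compose[OF _ that]) simp
    then show ?thesis using c by simp
  qed
  show "integrable lborel (\<lambda>x. f (t + c *\<^sub>R x))" if "integrable lborel f"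
  proof -
    from that have m: "f \<in> borel_measurable borel" by auto
    have "integrable (density (distr lborel borel (\<lambda>x. t + c *\<^sub>R x)) (\<lambda>_. \<bar>c\<bar> ^ DIM('a))) f"
      using that lborel_affine[OF c, of t] by metis
    then have "integrable (distr lborel borel (\<lambda>x. t + c *\<^sub>R x)) (\<lambda>x. \<bar>c\<bar> ^ DIM('a) *\<^sub>R f x)"
      using m by (subst (asm) integrable_density) auto
    then have "integrable lborel (\<lambda>x. \<bar>c\<bar> ^ DIM('a) *\<^sub>R f (t + c *\<^sub>R x))"
      using m by (subst (asm) integrable_distr_eq) auto
    then have "integrable lborel (\<lambda>x. (1 / \<bar>c\<bar> ^ DIM('a)) *\<^sub>R (\<bar>c\<bar> ^ DIM('a) *\<^sub>R f (t + c *\<^sub>R x)))"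
      by (rule integrable_scaleR_right)
    then show ?thesis using c by simp
  qed
  show "(\<integral>x. f x \<partial>lborel) = \<bar>c\<bar> ^ DIM('a) *\<^sub>R (\<integral>x. f (t + c *\<^sub>R x) \<partial>lborel)"
  proof (cases "f \<in> borel_measurable borel")
    case True
    have "(\<integral>x. f x \<partial>lborel) = (\<integral>x. f x \<partial>density (distr lborel borel (\<lambda>x. t + c *\<^sub>R x)) (\<lambda>_. ennreal (\<bar>c\<bar> ^ DIM('a))))"
      using lborel_affine[OF c, of t] by (simp add: ennreal_power)
    also have "\<dots> = (\<integral>x. \<bar>c\<bar> ^ DIM('a) *\<^sub>R f x \<partial>distr lborel borel (\<lambda>x. t + c *\<^sub>R x))"
      using True by (intro integral_density) auto
    also have "\<dots> = (\<integral>x. \<bar>c\<bar> ^ DIM('a) *\<^sub>R f (t + c *\<^sub>R x) \<partial>lborel)"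
      using True by (intro integral_distr) auto
    finally show ?thesis by simp
  next
    \<comment> \<open>Without measurability neither function is integrable, and both Bochner
      integrals take the default value 0.\<close>
    case False
    then have "\<not> integrable lborel f" "\<not> integrable lborel (\<lambda>x. f (t + c *\<^sub>R x))"
      using M borel_measurable_integrable measurable_lborel2 by blast+
    then show ?thesis by (simp add: not_integrable_integral_eq)
  qed
qed

lemma lborel_integral_translate:
  fixes f :: "'a::euclidean_space \<Rightarrow> 'b::{banach, second_countable_topology}"
  shows "(\<integral>x. f (t + x) \<partial>lborel) = (\<integral>x. f x \<partial>lborel)"
  using lborel_integral_affine[of 1 f t] by simp

lemma lborel_integral_reflect:
  fixes f :: "'a::euclidean_space \<Rightarrow> 'b::{banach, second_countable_topology}"
  shows "(\<integral>x. f (- x) \<partial>lborel) = (\<integral>x. f x \<partial>lborel)"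
  using lborel_integral_affine[of "-1" f 0] by simp

lemma nn_integral_lborel_reflect:
  fixes f :: "'a::euclidean_space \<Rightarrow> ennreal"
  assumes [measurable]: "f \<in> borel_measurable borel"
  shows "(\<integral>\<^sup>+x. f (- x) \<partial>lborel) = (\<integral>\<^sup>+x. f x \<partial>lborel)"
  by (subst (2) lborel_affine[of "-1" 0]) (auto simp: nn_integral_density nn_integral_distr)

lemma nn_integral_lborel_translate:
  fixes f :: "'a::euclidean_space \<Rightarrow> ennreal"
  assumes [measurable]: "f \<in> borel_measurable borel"
  shows "(\<integral>\<^sup>+x. f (t + x) \<partial>lborel) = (\<integral>\<^sup>+x. f x \<partial>lborel)"
  using nn_integral_lborel_affine[OF assms, of 1 t] by simp

text \<open>\<open>lborel\<close> is the image of a product of one-dimensional Lebesgue measures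
  under the coordinate map, so functions of single coordinates integrate factor by factor. The
  values are complex because the application is a Gaussian times a character.\<close>

lemma
  fixes f :: "'a::euclidean_space \<Rightarrow> real \<Rightarrow> complex"
  assumes f: "\<And>b. b \<in> Basis \<Longrightarrow> integrable lborel (f b)"
  shows integrable_lborel_prod: "integrable lborel (\<lambda>x. \<Prod>b\<in>Basis. f b (x \<bullet> b))"
    and integral_lborel_prod: "(\<integral>x. (\<Prod>b\<in>Basis. f b (x \<bullet> b)) \<partial>lborel) = (\<Prod>b\<in>Basis. \<integral>t. f b t \<partial>lborel)"
proof -
  interpret product_sigma_finite "\<lambda>_::'a. lborel :: real measure" ..
  let ?T = "\<lambda>f::'a \<Rightarrow> real. (\<Sum>b\<in>Basis. f b *\<^sub>R b)"
  have [measurable]: "b \<in> Basis \<Longrightarrow> f b \<in> borel_measurable borel" for b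
    using f[of b] by auto
  have m: "(\<lambda>x::'a. \<Prod>b\<in>Basis. f b (x \<bullet> b)) \<in> borel_measurable borel"
    by measurable
  have T: "?T \<in> measurable (\<Pi>\<^sub>M b\<in>Basis. lborel) borel" by measurable
  have eq: "(\<Prod>b\<in>Basis. f b (?T x \<bullet> b)) = (\<Prod>b\<in>Basis. f b (x b))" for x
    by (intro prod.cong refl) (simp add: inner_sum_left inner_Basis if_distrib sum.delta cong: if_cong)
  show "integrable lborel (\<lambda>x. \<Prod>b\<in>Basis. f b (x \<bullet> b))"
    by (subst lborel_eq, subst integrable_distr_eq[OF T m], unfold eq)
       (intro product_integrable_prod f finite_Basis)
  show "(\<integral>x. (\<Prod>b\<in>Basis. f b (x \<bullet> b)) \<partial>lborel) = (\<Prod>b\<in>Basis. \<integral>t. f b t \<partial>lborel)"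
    by (subst lborel_eq, subst integral_distr[OF T m], unfold eq)
       (intro product_integral_prod f finite_Basis)
qed

text \<open>Comparison with the product of the integrable functions
  \<open>1 / (1 + t\<^sup>2)\<close> over the coordinates: each of the \<open>DIM('a)\<close>
  factors uses up \<open>(1 + norm x)\<^sup>2\<close>, which explains the exponent.\<close>

lemma integrable_inverse_one_plus_norm_power:
  assumes "k \<ge> 2 * DIM('a)"
  shows "integrable lborel (\<lambda>x::'a::euclidean_space. 1 / (1 + norm x) ^ k)"
proof -
  have "integrable lborel (\<lambda>x::real. complex_of_real (inverse (1 + x\<^sup>2)))"
    using integrable_inverse_1_plus_square
    by (intro integrable_of_real) (simp add: set_integrable_def einterval_eq(4))
  then have "integrable lborel (\<lambda>x::'a. \<Prod>b\<in>Basis. complex_of_real (inverse (1 + (x \<bullet> b)\<^sup>2)))"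
    by (rule integrable_lborel_prod)
  then show ?thesis
  proof (rule Bochner_Integration.integrable_bound)
    show "(\<lambda>x::'a. 1 / (1 + norm x) ^ k) \<in> borel_measurable lborel" by measurable
    have "norm (1 / (1 + norm x) ^ k) \<le> norm (\<Prod>b\<in>Basis. complex_of_real (inverse (1 + (x \<bullet> b)\<^sup>2)))" for x :: 'a
    proof -
      have "(\<Prod>b\<in>Basis. 1 + (x \<bullet> b)\<^sup>2) \<le> (\<Prod>b\<in>(Basis::'a set). (1 + norm x)\<^sup>2)"
      proof (intro prod_mono conjI)
        fix b :: 'a assume "b \<in> Basis"
        then have "(x \<bullet> b)\<^sup>2 \<le> (norm x)\<^sup>2" using Basis_le_norm[of b x] by (metis abs_le_square_iff abs_norm_cancel)
        moreover have "(1 + norm x)\<^sup>2 = 1 + (norm x)\<^sup>2 + 2 * norm x" by (simp add: power2_sum)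
        ultimately show "1 + (x \<bullet> b)\<^sup>2 \<le> (1 + norm x)\<^sup>2" using norm_ge_zero[of x] by linarith
      qed auto
      also have "\<dots> = (1 + norm x) ^ (2 * DIM('a))" by (simp add: power_mult)
      also have "\<dots> \<le> (1 + norm x) ^ k" using assms by (intro power_increasing) auto
      finally have "1 / (1 + norm x) ^ k \<le> 1 / (\<Prod>b\<in>Basis. 1 + (x \<bullet> b)\<^sup>2)"
        by (intro divide_left_mono mult_pos_pos prod_pos) (auto intro!: add_pos_nonneg zero_less_power)
      also have "\<dots> = norm (\<Prod>b\<in>Basis. complex_of_real (inverse (1 + (x \<bullet> b)\<^sup>2)))"
      proof -
        have "(\<Prod>b\<in>Basis. complex_of_real (inverse (1 + (x \<bullet> b)\<^sup>2))) =
            complex_of_real (inverse (\<Prod>b\<in>Basis. 1 + (x \<bullet> b)\<^sup>2))"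
          unfolding of_real_prod[symmetric] using prod_inversef[of "\<lambda>b. 1 + (x \<bullet> b)\<^sup>2" Basis]
          by (simp add: o_def)
        moreover have "0 \<le> (\<Prod>b\<in>Basis. 1 + (x \<bullet> b)\<^sup>2)" by (intro prod_nonneg) auto
        ultimately show ?thesis by (simp only: norm_of_real abs_inverse abs_of_nonneg) (simp add: inverse_eq_divide)
      qed
      finally show ?thesis by simp
    qed
    then show "AE x::'a in lborel. norm (1 / (1 + norm x) ^ k) \<le>
      norm (\<Prod>b\<in>Basis. complex_of_real (inverse (1 + (x \<bullet> b)\<^sup>2)))" by blast
  qed
qed

section \<open>Gaussians and their Fourier transforms\<close>

definition gauss :: "'a::euclidean_space \<Rightarrow> real" where
  "gauss x = exp (- (norm x)\<^sup>2 / 2)"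

lemma gauss_pos [simp]: "0 < gauss x" and gauss_le_1 [simp]: "gauss x \<le> 1" and gauss_0 [simp]: "gauss 0 = 1"
  unfolding gauss_def by auto

lemma continuous_on_gauss [continuous_intros]:
  "continuous_on S f \<Longrightarrow> continuous_on S (\<lambda>x. gauss (f x))"
  unfolding gauss_def by (intro continuous_intros) auto

lemma borel_measurable_gauss [measurable]: "gauss \<in> borel_measurable borel"
  unfolding gauss_def[abs_def] by measurable

lemma borel_measurable_cnj [measurable]:
  "f \<in> borel_measurable M \<Longrightarrow> (\<lambda>x. cnj (f x)) \<in> borel_measurable M"
  by (rule borel_measurable_continuous_on) (auto intro: continuous_intros)

definition FT :: "('a::euclidean_space \<Rightarrow> complex) \<Rightarrow> 'a \<Rightarrow> complex" where
  "FT h x = (\<integral>\<eta>. h \<eta> * expi \<eta> x \<partial>lborel)"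

lemma integrable_mult_expi:
  "integrable M h \<Longrightarrow> f \<in> borel_measurable M \<Longrightarrow> g \<in> borel_measurable M \<Longrightarrow>
    integrable M (\<lambda>\<eta>. h \<eta> * expi (f \<eta>) (g \<eta>))"
  by (rule Bochner_Integration.integrable_bound[of M h]) (auto simp: norm_mult)

text \<open>Read off from the characteristic function of the standard normal distribution at
  \<open>- t\<close>, after removing the normalising factor \<open>sqrt (2 * pi)\<close> of the
  density.\<close>

lemma
  shows integrable_gauss_1d: "integrable lborel (\<lambda>x::real. complex_of_real (exp (- x\<^sup>2 / 2)) * exp (- \<i> * complex_of_real (x * t)))" (is ?A)
    and gauss_1d: "(\<integral>x. complex_of_real (exp (- x\<^sup>2 / 2)) * exp (- \<i> * complex_of_real (x * t)) \<partial>lborel) =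
      complex_of_real (sqrt (2 * pi) * exp (- t\<^sup>2 / 2))" (is ?B)
proof -
  have eq: "complex_of_real (exp (- x\<^sup>2 / 2)) = complex_of_real (sqrt (2 * pi)) * complex_of_real (std_normal_density x)" for x
    by (simp add: std_normal_density_def)
  have "integrable lborel (\<lambda>x. sqrt (2 * pi) * std_normal_density x)"
    using integrable_std_normal_moment[of 0] by simp
  then have 1: "integrable lborel (\<lambda>x. complex_of_real (sqrt (2 * pi) * std_normal_density x))"
    by (rule integrable_of_real)
  show ?A
    unfolding eq by (rule Bochner_Integration.integrable_bound[OF 1]) (auto simp: norm_mult norm_exp_eq_Re)
  have "char std_normal_distribution (- t) = (\<integral>x. std_normal_density x *\<^sub>R exp (\<i> * complex_of_real (- t * x)) \<partial>lborel)"
    unfolding char_def by (subst integral_density) auto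
  then have *: "(\<integral>x. std_normal_density x *\<^sub>R exp (\<i> * complex_of_real (- t * x)) \<partial>lborel) = complex_of_real (exp (- t\<^sup>2 / 2))"
    unfolding char_std_normal_distribution by simp
  have "(\<integral>x. complex_of_real (exp (- x\<^sup>2 / 2)) * exp (- \<i> * complex_of_real (x * t)) \<partial>lborel) =
      (\<integral>x. complex_of_real (sqrt (2 * pi)) * (std_normal_density x *\<^sub>R exp (\<i> * complex_of_real (- t * x))) \<partial>lborel)"
    unfolding eq by (simp add: scaleR_conv_of_real mult_ac)
  also have "\<dots> = complex_of_real (sqrt (2 * pi)) * complex_of_real (exp (- t\<^sup>2 / 2))"
    using * by (subst integral_mult_right_zero) simp
  finally show ?B by simp
qed

lemma gauss_expi_prod:
  "complex_of_real (gauss x) * expi x \<xi> =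
     (\<Prod>b\<in>Basis. complex_of_real (exp (- (x \<bullet> b)\<^sup>2 / 2)) * exp (- \<i> * complex_of_real ((x \<bullet> b) * (\<xi> \<bullet> b))))"
proof -
  have "(norm x)\<^sup>2 = (\<Sum>b\<in>Basis. (x \<bullet> b)\<^sup>2)"
    unfolding power2_norm_eq_inner by (subst euclidean_inner) (simp add: power2_eq_square)
  then have "gauss x = (\<Prod>b\<in>Basis. exp (- (x \<bullet> b)\<^sup>2 / 2))"
    unfolding gauss_def by (simp add: sum_negf sum_divide_distrib flip: exp_sum)
  moreover have "expi x \<xi> = (\<Prod>b\<in>Basis. exp (- \<i> * complex_of_real ((x \<bullet> b) * (\<xi> \<bullet> b))))"
    unfolding expi_def inner_commute[of \<xi> x]
    by (subst euclidean_inner) (simp add: exp_sum sum_distrib_left flip: sum_negf)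
  ultimately show ?thesis by (simp add: prod.distrib)
qed

text \<open>This is (2 pi)^(n/2), the integral of \<open>gauss\<close>. Its square (2 pi)^n is the
  constant in Fourier inversion and in Plancherel for the transform without normalising
  factor.\<close>

definition gauss_mass :: "'a::euclidean_space itself \<Rightarrow> real" where
  "gauss_mass _ = sqrt (2 * pi) ^ DIM('a)"

lemma
  fixes \<xi> :: "'a::euclidean_space"
  shows integrable_gauss_expi: "integrable lborel (\<lambda>x. complex_of_real (gauss x) * expi x \<xi>)"
    and FT_gauss: "FT (\<lambda>x. complex_of_real (gauss x)) \<xi> = gauss_mass TYPE('a) * gauss \<xi>"
proof -
  show "integrable lborel (\<lambda>x. complex_of_real (gauss x) * expi x \<xi>)"
    unfolding gauss_expi_prod by (intro integrable_lborel_prod integrable_gauss_1d)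
  have "FT (\<lambda>x. complex_of_real (gauss x)) \<xi> =
     (\<Prod>b\<in>Basis. complex_of_real (sqrt (2 * pi) * exp (- (\<xi> \<bullet> b)\<^sup>2 / 2)))"
    unfolding FT_def gauss_expi_prod by (subst integral_lborel_prod) (auto simp only: integrable_gauss_1d gauss_1d)
  also have "\<dots> = gauss_mass TYPE('a) * gauss \<xi>"
  proof -
    have "(norm \<xi>)\<^sup>2 = (\<Sum>b\<in>Basis. (\<xi> \<bullet> b)\<^sup>2)"
      unfolding power2_norm_eq_inner by (subst euclidean_inner) (simp add: power2_eq_square)
    then have "gauss \<xi> = (\<Prod>b\<in>Basis. exp (- (\<xi> \<bullet> b)\<^sup>2 / 2))"
      unfolding gauss_def by (simp add: sum_negf sum_divide_distrib flip: exp_sum)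
    then show ?thesis by (simp add: gauss_mass_def prod.distrib power_mult_distrib)
  qed
  finally show "FT (\<lambda>x. complex_of_real (gauss x)) \<xi> = gauss_mass TYPE('a) * gauss \<xi>" .
qed

lemma integrable_gauss: "integrable lborel (\<lambda>x::'a::euclidean_space. gauss x)"
proof -
  have "integrable lborel (\<lambda>x::'a. complex_of_real (gauss x))"
    using integrable_gauss_expi[of 0] by simp
  then show ?thesis using complex_of_real_integrable_eq by blast
qed

lemma integral_gauss: "(\<integral>x. gauss (x::'a) \<partial>lborel) = gauss_mass TYPE('a::euclidean_space)"
proof -
  have "complex_of_real (\<integral>x. gauss (x::'a) \<partial>lborel) = FT (\<lambda>x. complex_of_real (gauss x)) (0::'a)"
    unfolding FT_def by simp
  then have "complex_of_real (\<integral>x. gauss (x::'a) \<partial>lborel) = complex_of_real (gauss_mass TYPE('a))"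
    unfolding FT_gauss by simp
  then show ?thesis using of_real_eq_iff by blast
qed

lemma gauss_mass_pos: "gauss_mass TYPE('a::euclidean_space) > 0"
  unfolding gauss_mass_def by simp

lemma FT_gauss_scaled:
  fixes \<xi> :: "'a::euclidean_space"
  assumes "c > 0"
  shows "FT (\<lambda>x. complex_of_real (gauss (c *\<^sub>R x))) \<xi> =
    complex_of_real (gauss_mass TYPE('a) * gauss ((1 / c) *\<^sub>R \<xi>) / c ^ DIM('a))"
proof -
  have "gauss_mass TYPE('a) * gauss ((1 / c) *\<^sub>R \<xi>) = FT (\<lambda>x. complex_of_real (gauss x)) ((1 / c) *\<^sub>R \<xi>)"
    by (simp add: FT_gauss)
  also have "\<dots> = c ^ DIM('a) *\<^sub>R (\<integral>x. complex_of_real (gauss (c *\<^sub>R x)) * expi (c *\<^sub>R x) ((1 / c) *\<^sub>R \<xi>) \<partial>lborel)"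
    unfolding FT_def using assms by (subst lborel_integral_affine[of c _ 0]) auto
  also have "(\<lambda>x. expi (c *\<^sub>R x) ((1 / c) *\<^sub>R \<xi>)) = (\<lambda>x. expi x \<xi>)"
    using assms by (simp add: expi_scaleR)
  finally show ?thesis using assms by (simp add: FT_def scaleR_conv_of_real field_simps)
qed

lemma integrable_gauss_scaled:
  assumes "c > 0"
  shows "integrable lborel (\<lambda>x::'a::euclidean_space. complex_of_real (gauss (c *\<^sub>R x)))"
  using lborel_integrable_affine[OF _ integrable_gauss, of c 0] assms by (intro integrable_of_real) simp

text \<open>Dominated convergence with a multiple of the Gaussian as majorant; continuity of
  \<open>f\<close> gives the pointwise limit, boundedness the majorant. The extra factor
  \<open>gauss_mass\<close> is kept because the transform of a Gaussian brings it along.\<close>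

lemma approximate_identity_gauss:
  fixes f :: "'a::euclidean_space \<Rightarrow> complex"
  assumes "continuous_on UNIV f" "\<And>x. norm (f x) \<le> B"
  shows "(\<lambda>m. \<integral>z. f (y + (1 / Suc m) *\<^sub>R z) * complex_of_real (gauss_mass TYPE('a) * gauss z) \<partial>lborel)
           \<longlonglongrightarrow> complex_of_real ((gauss_mass TYPE('a))\<^sup>2) * f y"
proof -
  have [measurable]: "f \<in> borel_measurable borel"
    using assms(1) by (rule borel_measurable_continuous_onI)
  have "(\<lambda>m. \<integral>z. f (y + (1 / Suc m) *\<^sub>R z) * complex_of_real (gauss_mass TYPE('a) * gauss z) \<partial>lborel)
      \<longlonglongrightarrow> (\<integral>z. f y * complex_of_real (gauss_mass TYPE('a) * gauss (z::'a)) \<partial>lborel)"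
  proof (rule integral_dominated_convergence[where w = "\<lambda>z::'a. B * (gauss_mass TYPE('a) * gauss z)"])
    show "integrable lborel (\<lambda>z::'a. B * (gauss_mass TYPE('a) * gauss z))"
      by (simp add: integrable_gauss)
    show "AE z in lborel. (\<lambda>m. f (y + (1 / Suc m) *\<^sub>R z) * complex_of_real (gauss_mass TYPE('a) * gauss z))
       \<longlonglongrightarrow> f y * complex_of_real (gauss_mass TYPE('a) * gauss z)"
    proof (intro AE_I2 tendsto_mult tendsto_const)
      fix z
      have "(\<lambda>m. y + (1 / real (Suc m)) *\<^sub>R z) \<longlonglongrightarrow> y + 0 *\<^sub>R z"
        using LIMSEQ_inverse_real_of_nat unfolding inverse_eq_divide
        by (intro tendsto_add tendsto_const tendsto_scaleR)
      then show "(\<lambda>m. f (y + (1 / Suc m) *\<^sub>R z)) \<longlonglongrightarrow> f y"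
        using assms(1) continuous_on_tendsto_compose[of UNIV f] by auto
    qed
    show "AE z in lborel. norm (f (y + (1 / Suc m) *\<^sub>R z) * complex_of_real (gauss_mass TYPE('a) * gauss z))
       \<le> B * (gauss_mass TYPE('a) * gauss z)" for m
      using assms(2) gauss_mass_pos[where 'a='a]
      by (auto simp: norm_mult abs_mult abs_of_pos less_imp_le intro!: mult_right_mono)
  qed measurable
  also have "(\<integral>z. f y * complex_of_real (gauss_mass TYPE('a) * gauss (z::'a)) \<partial>lborel) =
     f y * complex_of_real (\<integral>z. gauss_mass TYPE('a) * gauss (z::'a) \<partial>lborel)"
    by (simp del: of_real_mult)
  also have "\<dots> = complex_of_real ((gauss_mass TYPE('a))\<^sup>2) * f y"
    by (simp add: integral_gauss power2_eq_square)
  finally show ?thesis .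
qed

lemma borel_measurable_FT [measurable]:
  assumes [measurable]: "h \<in> borel_measurable borel"
  shows "FT h \<in> borel_measurable borel"
  unfolding FT_def[abs_def] by measurable

lemma norm_FT_le: "norm (FT h x) \<le> (\<integral>\<eta>. norm (h \<eta>) \<partial>lborel)"
  unfolding FT_def using integral_norm_bound[of lborel "\<lambda>\<eta>. h \<eta> * expi \<eta> x"] by (simp add: norm_mult)

lemma continuous_on_FT:
  assumes h: "integrable lborel h"
  shows "continuous_on UNIV (FT h)"
  unfolding continuous_on_sequentially FT_def o_def
proof (intro allI impI ballI)
  from h have [measurable]: "h \<in> borel_measurable borel" by auto
  fix x and X :: "nat \<Rightarrow> 'a" assume "(\<forall>n. X n \<in> UNIV) \<and> X \<longlonglongrightarrow> x"
  then have X: "X \<longlonglongrightarrow> x" by simp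
  show "(\<lambda>n. \<integral>\<eta>. h \<eta> * expi \<eta> (X n) \<partial>lborel) \<longlonglongrightarrow> (\<integral>\<eta>. h \<eta> * expi \<eta> x \<partial>lborel)"
  proof (rule integral_dominated_convergence[where w = "\<lambda>\<eta>. norm (h \<eta>)"])
    show "AE \<eta> in lborel. (\<lambda>n. h \<eta> * expi \<eta> (X n)) \<longlonglongrightarrow> h \<eta> * expi \<eta> x"
      by (intro AE_I2 tendsto_mult tendsto_const continuous_on_tendsto_compose[OF _ X, of UNIV])
         (auto intro!: continuous_intros)
  qed (use h in \<open>auto simp: norm_mult\<close>)
qed

text \<open>Fubini for \<open>a \<eta> * b x * expi \<eta> x\<close>, whose modulus is a product of
  two integrable functions; the kernel is symmetric in its two variables.\<close>

lemma FT_multiplication: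
  fixes a b :: "'a::euclidean_space \<Rightarrow> complex"
  assumes a: "integrable lborel a" and b: "integrable lborel b"
  shows "(\<integral>x. FT a x * b x \<partial>lborel) = (\<integral>x. a x * FT b x \<partial>lborel)"
proof -
  from a b have [measurable]: "a \<in> borel_measurable borel" "b \<in> borel_measurable borel" by auto
  let ?F = "\<lambda>(x, \<eta>). a \<eta> * b x * expi \<eta> x"
  have "integrable (lborel \<Otimes>\<^sub>M lborel) ?F"
  proof (rule lborel_pair.Fubini_integrable)
    have "(\<integral>\<eta>. norm (?F (x, \<eta>)) \<partial>lborel) = (\<integral>\<eta>. norm (a \<eta>) \<partial>lborel) * norm (b x)" for x
      by (simp add: norm_mult)
    then show "integrable lborel (\<lambda>x. \<integral>\<eta>. norm (?F (x, \<eta>)) \<partial>lborel)"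
      using b by simp
    show "AE x in lborel. integrable lborel (\<lambda>\<eta>. ?F (x, \<eta>))"
    proof (intro AE_I2)
      fix x
      have "integrable lborel (\<lambda>\<eta>. a \<eta> * b x * expi \<eta> x)"
        using a by (intro integrable_mult_expi integrable_mult_left) auto
      then show "integrable lborel (\<lambda>\<eta>. ?F (x, \<eta>))" by simp
    qed
    have "(\<lambda>p. a (snd p) * b (fst p) * expi (snd p) (fst p)) \<in> borel_measurable (lborel \<Otimes>\<^sub>M lborel)"
      by measurable
    then show "?F \<in> borel_measurable (lborel \<Otimes>\<^sub>M lborel)" by (simp add: case_prod_beta')
  qed
  from lborel_pair.Fubini_integral[of "\<lambda>x \<eta>. a \<eta> * b x * expi \<eta> x", OF this]
  have "(\<integral>x. (\<integral>\<eta>. a \<eta> * b x * expi \<eta> x \<partial>lborel) \<partial>lborel) = (\<integral>\<eta>. (\<integral>x. a \<eta> * b x * expi \<eta> x \<partial>lborel) \<partial>lborel)"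
    by simp
  moreover have "FT a x * b x = (\<integral>\<eta>. a \<eta> * b x * expi \<eta> x \<partial>lborel)" for x
    unfolding FT_def by (subst integral_mult_left_zero[symmetric]) (simp add: mult_ac)
  moreover have "a \<eta> * FT b \<eta> = (\<integral>x. a \<eta> * b x * expi \<eta> x \<partial>lborel)" for \<eta>
    unfolding FT_def by (subst integral_mult_right_zero[symmetric]) (simp add: mult_ac expi_commute)
  ultimately show ?thesis by simp
qed

text \<open>Against the modulated Gaussian the multiplication formula becomes a convolution
  with an approximate identity.\<close>

lemma FT_against_gauss:
  fixes f :: "'a::euclidean_space \<Rightarrow> complex"
  assumes f: "integrable lborel f" and c: "c > 0"
  shows "(\<integral>x. FT f x * (complex_of_real (gauss (c *\<^sub>R x)) * expi x (- y)) \<partial>lborel) =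
    (\<integral>z. f (y + c *\<^sub>R z) * complex_of_real (gauss_mass TYPE('a) * gauss z) \<partial>lborel)"
proof -
  from f have [measurable]: "f \<in> borel_measurable borel" by auto
  let ?b = "\<lambda>x. complex_of_real (gauss (c *\<^sub>R x)) * expi x (- y)"
  have b: "integrable lborel ?b"
    by (intro integrable_mult_expi integrable_gauss_scaled c) auto
  have FTb: "FT ?b x = complex_of_real (gauss_mass TYPE('a) * gauss ((1 / c) *\<^sub>R (x - y)) / c ^ DIM('a))" for x
    unfolding FT_gauss_scaled[OF c, symmetric]
    unfolding FT_def mult.assoc expi_add_right[symmetric] by (simp add: add.commute)
  have "(\<integral>x. FT f x * ?b x \<partial>lborel) = (\<integral>x. f x * FT ?b x \<partial>lborel)"
    by (rule FT_multiplication[OF f b])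
  also have "\<dots> = \<bar>c\<bar> ^ DIM('a) *\<^sub>R (\<integral>z. f (y + c *\<^sub>R z) * FT ?b (y + c *\<^sub>R z) \<partial>lborel)"
    by (rule lborel_integral_affine) (use c in auto)
  also have "\<dots> = (\<integral>z. \<bar>c\<bar> ^ DIM('a) *\<^sub>R (f (y + c *\<^sub>R z) * FT ?b (y + c *\<^sub>R z)) \<partial>lborel)"
    by simp
  also have "\<dots> = (\<integral>z. f (y + c *\<^sub>R z) * complex_of_real (gauss_mass TYPE('a) * gauss z) \<partial>lborel)"
    using c by (simp add: FTb scaleR_conv_of_real)
  finally show ?thesis .
qed

lemma gauss_scaled_tendsto: "(\<lambda>m. gauss ((1 / Suc m) *\<^sub>R x)) \<longlonglongrightarrow> 1"
proof -
  have "(\<lambda>m. (1 / real (Suc m)) *\<^sub>R x) \<longlonglongrightarrow> 0 *\<^sub>R x"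
    using LIMSEQ_inverse_real_of_nat unfolding inverse_eq_divide
    by (intro tendsto_scaleR tendsto_const)
  then have "(\<lambda>m. gauss ((1 / Suc m) *\<^sub>R x)) \<longlonglongrightarrow> gauss (0::'a)"
    by (intro continuous_on_tendsto_compose[of UNIV gauss]) (auto intro!: continuous_intros)
  then show ?thesis by simp
qed

text \<open>A widening Gaussian is inserted into the double transform. Dominated convergence with
  majorant \<open>norm (FT f x)\<close> removes it on one side; on the other it acts on
  \<open>f\<close> as an approximate identity, and the two limits agree.\<close>

theorem FT_inversion:
  fixes f :: "'a::euclidean_space \<Rightarrow> complex"
  assumes f: "integrable lborel f" "continuous_on UNIV f" "\<And>x. norm (f x) \<le> B"
    and F: "integrable lborel (FT f)"
  shows "FT (FT f) (- y) = complex_of_real ((gauss_mass TYPE('a))\<^sup>2) * f y"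
proof (rule LIMSEQ_unique)
  from F have [measurable]: "FT f \<in> borel_measurable borel" by auto
  show "(\<lambda>m. \<integral>x. FT f x * (complex_of_real (gauss ((1 / Suc m) *\<^sub>R x)) * expi x (- y)) \<partial>lborel) \<longlonglongrightarrow> FT (FT f) (- y)"
    unfolding FT_def[of "FT f"]
  proof (rule integral_dominated_convergence[where w = "\<lambda>x. norm (FT f x)"])
    have "(\<lambda>m. FT f x * (complex_of_real (gauss ((1 / Suc m) *\<^sub>R x)) * expi x (- y))) \<longlonglongrightarrow>
       FT f x * (complex_of_real 1 * expi x (- y))" for x
      by (intro tendsto_mult tendsto_const tendsto_of_real gauss_scaled_tendsto)
    then show "AE x in lborel. (\<lambda>m. FT f x * (complex_of_real (gauss ((1 / Suc m) *\<^sub>R x)) * expi x (- y)))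
        \<longlonglongrightarrow> FT f x * expi x (- y)" by simp
    show "AE x in lborel. norm (FT f x * (complex_of_real (gauss ((1 / Suc m) *\<^sub>R x)) * expi x (- y))) \<le> norm (FT f x)" for m
      by (auto simp: norm_mult abs_of_pos intro!: mult_left_le AE_I2)
  qed (use F in auto)
  show "(\<lambda>m. \<integral>x. FT f x * (complex_of_real (gauss ((1 / Suc m) *\<^sub>R x)) * expi x (- y)) \<partial>lborel)
     \<longlonglongrightarrow> complex_of_real ((gauss_mass TYPE('a))\<^sup>2) * f y"
    using approximate_identity_gauss[OF f(2,3), of y] FT_against_gauss[OF f(1), of "1 / Suc m" y for m]
    by simp
qed

text \<open>The same Gaussian regularisation, applied to the square of \<open>norm (FT h x)\<close>:
  the multiplication formula turns the regularised integral into one over \<open>h\<close> against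
  an approximate identity, which tends to the right-hand side.\<close>

theorem plancherel:
  fixes h :: "'a::euclidean_space \<Rightarrow> complex"
  assumes h: "integrable lborel h" "continuous_on UNIV h" "\<And>x. norm (h x) \<le> B"
  shows "(\<integral>\<^sup>+x. ennreal ((norm (FT h x))\<^sup>2) \<partial>lborel) =
    ennreal ((gauss_mass TYPE('a))\<^sup>2) * (\<integral>\<^sup>+x. ennreal ((norm (h x))\<^sup>2) \<partial>lborel)"
proof -
  from h have [measurable]: "h \<in> borel_measurable borel" by auto
  let ?\<kappa> = "gauss_mass TYPE('a)"
  have B0: "B \<ge> 0" using h(3)[of 0] norm_ge_zero order_trans by blast
  \<comment> \<open>Its transform is \<open>cnj (FT h)\<close>, so the transform of
    \<open>cnj (FT h)\<close> times a Gaussian can be evaluated by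
    \<open>FT_against_gauss\<close>.\<close>
  define h' where "h' = (\<lambda>x. cnj (h (- x)))"
  have h': "integrable lborel h'"
    unfolding h'_def using lborel_integrable_affine[of "-1" h 0] h(1) by simp
  have [measurable]: "h' \<in> borel_measurable borel" using h' by auto
  have FTh': "FT h' x = cnj (FT h x)" for x
  proof -
    have "FT h' x = (\<integral>\<eta>. cnj (h (- \<eta>)) * expi (- (- \<eta>)) x \<partial>lborel)" by (simp add: FT_def h'_def)
    also have "\<dots> = (\<integral>\<eta>. cnj (h \<eta>) * expi (- \<eta>) x \<partial>lborel)" by (rule lborel_integral_reflect)
    also have "\<dots> = (\<integral>\<eta>. cnj (h \<eta> * expi \<eta> x) \<partial>lborel)" by (simp only: cnj_expi complex_cnj_mult)
    finally show ?thesis by (simp only: Bochner_Integration.integral_cnj FT_def)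
  qed
  define J where "J = (\<lambda>m. \<integral>x. h x * (\<integral>z. h' (- x + (1 / Suc m) *\<^sub>R z) * complex_of_real (?\<kappa> * gauss z) \<partial>lborel) \<partial>lborel)"
  have bint: "integrable lborel (\<lambda>x. cnj (FT h x) * complex_of_real (gauss (c *\<^sub>R x)))" if "c > 0" for c
  proof (rule Bochner_Integration.integrable_bound)
    show "integrable lborel (\<lambda>x. (\<integral>\<eta>. norm (h \<eta>) \<partial>lborel) * complex_of_real (gauss (c *\<^sub>R x)))"
      by (intro integrable_mult_right integrable_gauss_scaled that)
    show "AE x in lborel. norm (cnj (FT h x) * complex_of_real (gauss (c *\<^sub>R x))) \<le>
        norm ((\<integral>\<eta>. norm (h \<eta>) \<partial>lborel) * complex_of_real (gauss (c *\<^sub>R x)))"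
      using norm_FT_le[of h]
      by (auto simp: norm_mult abs_of_pos intro!: mult_right_mono)
  qed measurable
  have J: "(\<integral>x. (norm (FT h x))\<^sup>2 * gauss ((1 / Suc m) *\<^sub>R x) \<partial>lborel) = J m" for m
  proof -
    let ?c = "1 / real (Suc m)"
    have "complex_of_real (\<integral>x. (norm (FT h x))\<^sup>2 * gauss (?c *\<^sub>R x) \<partial>lborel) =
       (\<integral>x. complex_of_real ((norm (FT h x))\<^sup>2 * gauss (?c *\<^sub>R x)) \<partial>lborel)"
      by (rule integral_complex_of_real[symmetric])
    also have "\<dots> = (\<integral>x. FT h x * (cnj (FT h x) * complex_of_real (gauss (?c *\<^sub>R x))) \<partial>lborel)"
      by (simp only: of_real_mult complex_norm_square mult.assoc)
    also have "\<dots> = (\<integral>x. h x * FT (\<lambda>x. cnj (FT h x) * complex_of_real (gauss (?c *\<^sub>R x))) x \<partial>lborel)"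
      by (rule FT_multiplication[OF h(1) bint]) simp
    also have "(\<lambda>y. FT (\<lambda>x. cnj (FT h x) * complex_of_real (gauss (?c *\<^sub>R x))) y) =
      (\<lambda>y. \<integral>z. h' (- y + ?c *\<^sub>R z) * complex_of_real (?\<kappa> * gauss z) \<partial>lborel)"
      unfolding FTh'[symmetric] FT_def[of "\<lambda>x. _ x * _ x"] mult.assoc
      using FT_against_gauss[OF h', of ?c "- y" for y] by simp
    finally show ?thesis unfolding J_def by simp
  qed
  have J': "J = (\<lambda>m. complex_of_real (\<integral>x. (norm (FT h x))\<^sup>2 * gauss ((1 / Suc m) *\<^sub>R x) \<partial>lborel))"
    by (rule ext) (rule J[symmetric])
  have "J \<longlonglongrightarrow> (\<integral>x. complex_of_real (?\<kappa>\<^sup>2) * (h x * cnj (h x)) \<partial>lborel)"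
    unfolding J_def
  proof (rule integral_dominated_convergence[where w = "\<lambda>x. norm (h x) * (B * ?\<kappa>\<^sup>2)"])
    have c: "continuous_on UNIV h'" unfolding h'_def
      by (intro continuous_intros continuous_on_compose2[OF h(2)]) auto
    have "norm (h' x) \<le> B" for x using h(3) by (simp add: h'_def)
    note lim = approximate_identity_gauss[OF c this]
    show "AE x in lborel. (\<lambda>m. h x * (\<integral>z. h' (- x + (1 / Suc m) *\<^sub>R z) * complex_of_real (?\<kappa> * gauss z) \<partial>lborel))
       \<longlonglongrightarrow> complex_of_real (?\<kappa>\<^sup>2) * (h x * cnj (h x))"
    proof (intro AE_I2)
      fix x show "(\<lambda>m. h x * (\<integral>z. h' (- x + (1 / Suc m) *\<^sub>R z) * complex_of_real (?\<kappa> * gauss z) \<partial>lborel))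
       \<longlonglongrightarrow> complex_of_real (?\<kappa>\<^sup>2) * (h x * cnj (h x))"
        using tendsto_mult[OF tendsto_const[of "h x"] lim[of "- x"]] by (simp add: h'_def mult_ac)
    qed
    show "AE x in lborel. norm (h x * (\<integral>z. h' (- x + (1 / Suc m) *\<^sub>R z) * complex_of_real (?\<kappa> * gauss z) \<partial>lborel))
       \<le> norm (h x) * (B * ?\<kappa>\<^sup>2)" for m
    proof (intro AE_I2)
      fix x
      have "norm (\<integral>z. h' (- x + (1 / Suc m) *\<^sub>R z) * complex_of_real (?\<kappa> * gauss z) \<partial>lborel)
         \<le> (\<integral>z. B * (?\<kappa> * gauss (z::'a)) \<partial>lborel)"
      proof (rule Bochner_Integration.integral_norm_bound_integral)
        show "integrable lborel (\<lambda>z. B * (?\<kappa> * gauss (z::'a)))" by (simp add: integrable_gauss)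
        show le: "norm (h' (- x + (1 / Suc m) *\<^sub>R z) * complex_of_real (?\<kappa> * gauss z)) \<le> B * (?\<kappa> * gauss z)" for z
          using h(3) gauss_mass_pos[where 'a='a] gauss_pos[of z]
          by (auto simp: norm_mult abs_mult h'_def less_imp_le intro!: mult_right_mono)
        show "integrable lborel (\<lambda>z. h' (- x + (1 / Suc m) *\<^sub>R z) * complex_of_real (?\<kappa> * gauss z))"
          by (rule Bochner_Integration.integrable_bound[OF \<open>integrable lborel (\<lambda>z. B * (?\<kappa> * gauss (z::'a)))\<close>])
             (use order_trans[OF le abs_ge_self] in \<open>auto simp del: of_real_mult\<close>)
      qed
      then show "norm (h x * (\<integral>z. h' (- x + (1 / Suc m) *\<^sub>R z) * complex_of_real (?\<kappa> * gauss z) \<partial>lborel))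
       \<le> norm (h x) * (B * ?\<kappa>\<^sup>2)"
        by (simp add: norm_mult mult_left_mono integral_gauss power2_eq_square)
    qed
  qed (use h(1) in auto)
  moreover have "(\<integral>x. complex_of_real (?\<kappa>\<^sup>2) * (h x * cnj (h x)) \<partial>lborel) =
      complex_of_real (\<integral>x. ?\<kappa>\<^sup>2 * (norm (h x))\<^sup>2 \<partial>lborel)"
    unfolding complex_norm_square[symmetric] of_real_mult[symmetric] by (rule integral_complex_of_real)
  ultimately have lim: "(\<lambda>m. \<integral>x. (norm (FT h x))\<^sup>2 * gauss ((1 / Suc m) *\<^sub>R x) \<partial>lborel)
      \<longlonglongrightarrow> (\<integral>x. ?\<kappa>\<^sup>2 * (norm (h x))\<^sup>2 \<partial>lborel)"
    by (simp only: J' tendsto_of_real_iff)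
  \<comment> \<open>A bounded integrable function is square integrable, because its squared norm is
    at most \<open>B * norm (h x)\<close>.\<close>
  have h2: "integrable lborel (\<lambda>x. ?\<kappa>\<^sup>2 * (norm (h x))\<^sup>2)"
  proof (rule Bochner_Integration.integrable_bound)
    show "integrable lborel (\<lambda>x. ?\<kappa>\<^sup>2 * (B * norm (h x)))" using h(1) by simp
    show "AE x in lborel. norm (?\<kappa>\<^sup>2 * (norm (h x))\<^sup>2) \<le> norm (?\<kappa>\<^sup>2 * (B * norm (h x)))"
      using h(3) B0 by (auto simp: power2_eq_square intro!: mult_left_mono mult_right_mono)
  qed measurable
  \<comment> \<open>Square integrability of \<open>FT h\<close> is not known beforehand, so this
    side is reached by monotone convergence: the widening Gaussians increase to 1.\<close>
  have "(\<lambda>m. \<integral>\<^sup>+x. ennreal ((norm (FT h x))\<^sup>2 * gauss ((1 / Suc m) *\<^sub>R x)) \<partial>lborel)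
      \<longlonglongrightarrow> (\<integral>\<^sup>+x. ennreal ((norm (FT h x))\<^sup>2) \<partial>lborel)"
  proof (rule nn_integral_LIMSEQ)
    show "incseq (\<lambda>m x. ennreal ((norm (FT h x))\<^sup>2 * gauss ((1 / Suc m) *\<^sub>R x)))"
    proof (rule incseq_SucI, rule le_funI, intro ennreal_leI mult_left_mono)
      fix m and x :: 'a
      have "norm ((1 / Suc (Suc m)) *\<^sub>R x) \<le> norm ((1 / Suc m) *\<^sub>R x)"
        by (simp add: field_simps mult_right_mono)
      then show "gauss ((1 / Suc m) *\<^sub>R x) \<le> gauss ((1 / Suc (Suc m)) *\<^sub>R x)"
        unfolding gauss_def by (simp add: power_mono del: norm_scaleR)
    qed auto
    show "(\<lambda>m. ennreal ((norm (FT h x))\<^sup>2 * gauss ((1 / Suc m) *\<^sub>R x))) \<longlonglongrightarrow> ennreal ((norm (FT h x))\<^sup>2)" for x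
      using tendsto_mult[OF tendsto_const gauss_scaled_tendsto, of "(norm (FT h x))\<^sup>2" x] by (intro tendsto_ennrealI) simp
  qed measurable
  moreover have "(\<integral>\<^sup>+x. ennreal ((norm (FT h x))\<^sup>2 * gauss ((1 / Suc m) *\<^sub>R x)) \<partial>lborel) =
     ennreal (\<integral>x. (norm (FT h x))\<^sup>2 * gauss ((1 / Suc m) *\<^sub>R x) \<partial>lborel)" for m
  proof (rule nn_integral_eq_integral)
    have "integrable lborel (\<lambda>x. norm (cnj (FT h x) * complex_of_real (gauss ((1 / Suc m) *\<^sub>R x))) * norm (FT h x))"
    proof (rule Bochner_Integration.integrable_bound)
      show "integrable lborel (\<lambda>x. norm (cnj (FT h x) * complex_of_real (gauss ((1 / Suc m) *\<^sub>R x))) * (\<integral>\<eta>. norm (h \<eta>) \<partial>lborel))"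
        using bint[of "1 / Suc m"] by (intro integrable_mult_left integrable_norm) auto
    qed (auto simp: intro!: mult_left_mono order_trans[OF norm_FT_le])
    then show "integrable lborel (\<lambda>x. (norm (FT h x))\<^sup>2 * gauss ((1 / Suc m) *\<^sub>R x))"
      using gauss_pos by (simp add: norm_mult power2_eq_square less_imp_le mult_ac)
  qed (auto intro!: AE_I2 mult_nonneg_nonneg less_imp_le[OF gauss_pos])
  ultimately have "(\<lambda>m. ennreal (\<integral>x. (norm (FT h x))\<^sup>2 * gauss ((1 / Suc m) *\<^sub>R x) \<partial>lborel))
      \<longlonglongrightarrow> (\<integral>\<^sup>+x. ennreal ((norm (FT h x))\<^sup>2) \<partial>lborel)" by simp
  moreover have "(\<lambda>m. ennreal (\<integral>x. (norm (FT h x))\<^sup>2 * gauss ((1 / Suc m) *\<^sub>R x) \<partial>lborel))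
      \<longlonglongrightarrow> ennreal (\<integral>x. ?\<kappa>\<^sup>2 * (norm (h x))\<^sup>2 \<partial>lborel)"
    using lim by (rule tendsto_ennrealI)
  ultimately have "(\<integral>\<^sup>+x. ennreal ((norm (FT h x))\<^sup>2) \<partial>lborel) = ennreal (\<integral>x. ?\<kappa>\<^sup>2 * (norm (h x))\<^sup>2 \<partial>lborel)"
    by (rule LIMSEQ_unique)
  also have "\<dots> = (\<integral>\<^sup>+x. ennreal (?\<kappa>\<^sup>2 * (norm (h x))\<^sup>2) \<partial>lborel)"
    by (rule nn_integral_eq_integral[symmetric, OF h2]) auto
  also have "\<dots> = ennreal (?\<kappa>\<^sup>2) * (\<integral>\<^sup>+x. ennreal ((norm (h x))\<^sup>2) \<partial>lborel)"
    by (subst nn_integral_cmult[symmetric]) (auto simp: ennreal_mult)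
  finally show ?thesis .
qed

section \<open>Smooth cutoff functions\<close>

text \<open>The classical function exp(-1/t), extended by 0, together with its quotients by powers
  of \<open>t\<close>: the derivative of one member is a combination of two others, so the family,
  unlike its first member alone, is closed under differentiation.\<close>

definition flat :: "nat \<Rightarrow> real \<Rightarrow> real" where
  "flat k t = (if t > 0 then exp (- 1 / t) / t ^ k else 0)"

text \<open>From \<open>exp z \<ge> (z / (k + 1)) ^ (k + 1)\<close> at \<open>z = 1 / t\<close>. The
  linear rate is what the difference quotient at 0 requires.\<close>

lemma flat_le:
  assumes "t > 0"
  shows "flat k t \<le> real (Suc k) ^ Suc k * t"
proof -
  have "1 / t / real (Suc k) \<le> exp (1 / t / real (Suc k))"
    using exp_ge_add_one_self[of "1 / t / real (Suc k)"] by linarith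
  then have "(1 / t / real (Suc k)) ^ Suc k \<le> exp (1 / t / real (Suc k)) ^ Suc k"
    using assms by (intro power_mono) auto
  also have "\<dots> = exp (1 / t)" by (simp add: exp_of_nat_mult[symmetric] del: power_Suc)
  finally have "exp (- 1 / t) \<le> 1 / (1 / t / real (Suc k)) ^ Suc k"
    using assms by (simp add: exp_minus inverse_eq_divide divide_left_mono del: power_Suc)
  also have "\<dots> = real (Suc k) ^ Suc k * t ^ Suc k" by (simp add: power_divide power_mult_distrib mult.commute del: power_Suc)
  finally have "exp (- 1 / t) / t ^ k \<le> real (Suc k) ^ Suc k * t ^ Suc k / t ^ k"
    using assms by (intro divide_right_mono) auto
  also have "\<dots> = real (Suc k) ^ Suc k * t" using assms by simp
  finally show ?thesis using assms by (simp add: flat_def)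
qed

lemma flat_nonneg: "0 \<le> flat k t"
  unfolding flat_def by auto

lemma flat_has_derivative:
  "(flat k has_real_derivative (flat (k + 2) t - real k * flat (k + 1) t)) (at t)"
proof (cases t "0::real" rule: linorder_cases)
  case less
  have "((\<lambda>_. 0) has_real_derivative 0) (at t)" by simp
  then have "(flat k has_real_derivative 0) (at t)"
    by (rule has_field_derivative_transform_within_open[where S = "{..<0}"])
       (use less in \<open>auto simp: flat_def\<close>)
  then show ?thesis using less by (simp add: flat_def)
next
  case greater
  have "((\<lambda>t. exp (- 1 / t) / t ^ k) has_real_derivative
      ((exp (- 1 / t) * (1 / t\<^sup>2)) * t ^ k - exp (- 1 / t) * (real k * t ^ (k - 1))) / (t ^ k * t ^ k)) (at t)"
    using greater by (auto intro!: derivative_eq_intros simp: power2_eq_square)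
  moreover have "((exp (- 1 / t) * (1 / t\<^sup>2)) * t ^ k - exp (- 1 / t) * (real k * t ^ (k - 1))) / (t ^ k * t ^ k)
      = flat (k + 2) t - real k * flat (k + 1) t"
    using greater by (cases k) (simp_all add: flat_def field_simps power2_eq_square)
  ultimately have "((\<lambda>t. exp (- 1 / t) / t ^ k) has_real_derivative flat (k + 2) t - real k * flat (k + 1) t) (at t)"
    by simp
  then show ?thesis
    by (rule has_field_derivative_transform_within_open[where S = "{0<..}"])
       (use greater in \<open>auto simp: flat_def\<close>)
next
  case equal
  let ?C = "real (Suc (Suc k)) ^ Suc (Suc k)"
  have "((\<lambda>h. (flat k (0 + h) - flat k 0) / h) \<longlongrightarrow> 0) (at 0)"
  proof (rule Lim_null_comparison)
    show "((\<lambda>h. ?C * \<bar>h\<bar>) \<longlongrightarrow> 0) (at 0)"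
      by (rule tendsto_eq_intros refl)+ simp
    show "\<forall>\<^sub>F h in at 0. norm ((flat k (0 + h) - flat k 0) / h) \<le> ?C * \<bar>h\<bar>"
    proof (intro always_eventually allI)
      fix h :: real
      show "norm ((flat k (0 + h) - flat k 0) / h) \<le> ?C * \<bar>h\<bar>"
      proof (cases "h > 0")
        case True
        \<comment> \<open>For \<open>h > 0\<close> the difference quotient at 0 is itself a member
          of the family, and \<open>flat_le\<close> makes it vanish linearly.\<close>
        then have "flat k h / h = flat (Suc k) h" by (simp add: flat_def)
        then show ?thesis using True flat_le[of h "Suc k"] flat_nonneg[of "Suc k" h] by (simp add: flat_def mult_ac)
      next
        case False
        then have "flat k h = 0" by (simp add: flat_def)
        then show ?thesis by (simp add: flat_def[of _ 0])
      qed
    qed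
  qed
  then show ?thesis using equal by (simp add: DERIV_def flat_def)
qed

lemma flat_mono: "s \<le> t \<Longrightarrow> flat 0 s \<le> flat 0 t"
  unfolding flat_def by (auto simp: field_simps)

text \<open>An algebra of expressions closed under directional derivatives. Smoothness of a nested
  composition then follows by induction on its construction, and no formula for its iterated
  derivatives has to be found.\<close>

inductive flat_alg :: "('a::euclidean_space \<Rightarrow> real) \<Rightarrow> bool" where
  const: "flat_alg (\<lambda>x. c)"
| inner: "flat_alg (\<lambda>x. x \<bullet> b)"
| add: "flat_alg f \<Longrightarrow> flat_alg g \<Longrightarrow> flat_alg (\<lambda>x. f x + g x)"
| mult: "flat_alg f \<Longrightarrow> flat_alg g \<Longrightarrow> flat_alg (\<lambda>x. f x * g x)"
| flat: "flat_alg f \<Longrightarrow> flat_alg (\<lambda>x. flat k (f x))"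

lemma flat_alg_sum: "finite A \<Longrightarrow> (\<And>i. i \<in> A \<Longrightarrow> flat_alg (f i)) \<Longrightarrow> flat_alg (\<lambda>x. \<Sum>i\<in>A. f i x)"
  by (induction A rule: finite_induct) (auto intro: flat_alg.intros)

lemma flat_alg_has_derivative:
  "flat_alg f \<Longrightarrow> \<exists>D. (\<forall>x. (f has_derivative D x) (at x)) \<and> (\<forall>v. flat_alg (\<lambda>x. D x v))"
proof (induction rule: flat_alg.induct)
  case (const c)
  show ?case by (rule exI[of _ "\<lambda>x h. 0"]) (auto intro: flat_alg.intros)
next
  case (inner b)
  show ?case
    by (rule exI[of _ "\<lambda>x h. h \<bullet> b"]) (auto intro: flat_alg.intros intro!: derivative_eq_intros)
next
  case (add f g)
  then obtain D E where "\<forall>x. (f has_derivative D x) (at x)" "\<forall>v. flat_alg (\<lambda>x. D x v)"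
    "\<forall>x. (g has_derivative E x) (at x)" "\<forall>v. flat_alg (\<lambda>x. E x v)" by blast
  then show ?case
    by (intro exI[of _ "\<lambda>x h. D x h + E x h"]) (auto intro!: flat_alg.intros has_derivative_add)
next
  case (mult f g)
  then obtain D E where "\<forall>x. (f has_derivative D x) (at x)" "\<forall>v. flat_alg (\<lambda>x. D x v)"
    "\<forall>x. (g has_derivative E x) (at x)" "\<forall>v. flat_alg (\<lambda>x. E x v)" by blast
  with mult show ?case
    by (intro exI[of _ "\<lambda>x h. f x * E x h + D x h * g x"])
       (auto intro!: flat_alg.intros has_derivative_mult)
next
  case (flat f k)
  then obtain D where D: "\<forall>x. (f has_derivative D x) (at x)" "\<forall>v. flat_alg (\<lambda>x. D x v)" by blast
  let ?E = "\<lambda>x h. (flat (k + 2) (f x) + (- real k) * flat (k + 1) (f x)) * D x h"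
  have "((\<lambda>x. flat k (f x)) has_derivative ?E x) (at x)" for x
    using has_derivative_compose[OF D(1)[rule_format] flat_has_derivative[unfolded has_field_derivative_def]]
    by simp
  moreover have "flat_alg (\<lambda>x. ?E x v)" for v
    by (intro flat_alg.intros flat D(2)[rule_format])
  ultimately show ?case by (intro exI[of _ ?E]) blast
qed

lemma smooth_fun_flat_alg:
  assumes "flat_alg f"
  shows "smooth_fun (\<lambda>x. complex_of_real (f x))"
proof -
  have *: "\<exists>g. flat_alg g \<and> iter_deriv vs (\<lambda>x. complex_of_real (f x)) = (\<lambda>x. complex_of_real (g x))" for vs
  proof (induction vs)
    case Nil
    then show ?case using assms by auto
  next
    case (Cons v vs)
    then obtain g where g: "flat_alg g" "iter_deriv vs (\<lambda>x. complex_of_real (f x)) = (\<lambda>x. complex_of_real (g x))"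
      by blast
    obtain D where D: "\<And>x. (g has_derivative D x) (at x)" "flat_alg (\<lambda>x. D x v)"
      using flat_alg_has_derivative[OF g(1)] by blast
    have "((\<lambda>x. complex_of_real (g x)) has_derivative (\<lambda>h. complex_of_real (D x h))) (at x)" for x
      by (rule has_derivative_of_real[OF D(1)])
    then have "frechet_derivative (\<lambda>x. complex_of_real (g x)) (at x) = (\<lambda>h. complex_of_real (D x h))" for x
      using frechet_derivative_at by metis
    then show ?case using D(2) g(2) by auto
  qed
  show ?thesis
    unfolding smooth_fun_def
  proof safe
    fix vs :: "'a list" and x
    obtain g where g: "flat_alg g" "iter_deriv vs (\<lambda>x. complex_of_real (f x)) = (\<lambda>x. complex_of_real (g x))"
      using * by blast
    obtain D where "(g has_derivative D x) (at x)"
      using flat_alg_has_derivative[OF g(1)] by blast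
    from has_derivative_of_real[OF this] g(2)
    show "iter_deriv vs (\<lambda>x. complex_of_real (f x)) differentiable at x"
      unfolding differentiable_def by auto
  qed
qed

lemma bump_function:
  fixes x0 :: "'a::euclidean_space"
  assumes "r > 0"
  obtains chi where "test_fun chi" "\<And>x. x \<in> ball x0 (r / 2) \<Longrightarrow> chi x = 1" "\<And>x. x \<notin> ball x0 r \<Longrightarrow> chi x = 0"
proof
  define c where "c = flat 0 1"
  have c0: "c > 0" by (simp add: c_def flat_def)
  \<comment> \<open>An affine function of the squared distance, normalised to be 0 at distance
    \<open>r / 2\<close> and 1 at distance \<open>r\<close>; it is spelled out through coordinates
    so that the rules of \<open>flat_alg\<close> apply.\<close>
  define q where "q = (\<lambda>x. (4 / (3 * r\<^sup>2)) * ((\<Sum>b\<in>Basis. (x \<bullet> b + - (x0 \<bullet> b)) * (x \<bullet> b + - (x0 \<bullet> b))) + - (r\<^sup>2 / 4)))"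
  \<comment> \<open>The inner \<open>flat 0\<close> vanishes where \<open>q x \<le> 0\<close>, which
    gives the plateau of height 1. Where \<open>q x \<ge> 1\<close> it is at least
    \<open>c = flat 0 1\<close>, so the argument of the outer one is not positive and
    \<open>p\<close> vanishes.\<close>
  define p where "p = (\<lambda>x. (1 / flat 0 c) * flat 0 (c + (- 1) * flat 0 (q x)))"
  have q: "q x = (4 / (3 * r\<^sup>2)) * ((norm (x - x0))\<^sup>2 - r\<^sup>2 / 4)" for x
    unfolding q_def power2_norm_eq_inner
    by (subst euclidean_inner) (simp add: inner_diff_left)
  have "flat_alg p"
    unfolding p_def q_def by (intro flat_alg.intros flat_alg_sum finite_Basis)
  then have smooth: "smooth_fun (\<lambda>x. complex_of_real (p x))" by (rule smooth_fun_flat_alg)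
  have out: "p x = 0" if "x \<notin> ball x0 r" for x
  proof -
    have "r \<le> norm (x - x0)" using that by (simp add: dist_norm norm_minus_commute)
    then have "r\<^sup>2 \<le> (norm (x - x0))\<^sup>2" using assms by (intro power_mono) auto
    then have "(4 / (3 * r\<^sup>2)) * (r\<^sup>2 - r\<^sup>2 / 4) \<le> q x"
      unfolding q by (intro mult_left_mono) auto
    moreover have "(4 / (3 * r\<^sup>2)) * (r\<^sup>2 - r\<^sup>2 / 4) = 1" using assms by (simp add: field_simps)
    ultimately have "c \<le> flat 0 (q x)" unfolding c_def by (intro flat_mono) simp
    then show ?thesis by (simp add: p_def flat_def[of 0 "c - _"])
  qed
  then show "complex_of_real (p x) = 0" if "x \<notin> ball x0 r" for x using that by simp
  show "complex_of_real (p x) = 1" if "x \<in> ball x0 (r / 2)" for x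
  proof -
    have "norm (x - x0) \<le> r / 2" using that by (simp add: dist_norm norm_minus_commute)
    then have "(norm (x - x0))\<^sup>2 \<le> (r / 2)\<^sup>2" using assms by (intro power_mono) auto
    then have "(norm (x - x0))\<^sup>2 \<le> r\<^sup>2 / 4" by (simp add: power_divide)
    then have "q x \<le> 0" unfolding q by (intro mult_nonneg_nonpos) auto
    then have "flat 0 (q x) = 0" by (simp add: flat_def)
    then show ?thesis using c0 by (simp add: p_def flat_def)
  qed
  show "test_fun (\<lambda>x. complex_of_real (p x))"
    unfolding test_fun_def
  proof
    show "bounded {x. complex_of_real (p x) \<noteq> 0}"
    proof (rule bounded_subset[OF bounded_ball], rule subsetI)
      fix x assume "x \<in> {x. complex_of_real (p x) \<noteq> 0}"
      then have "p x \<noteq> 0" by simp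
      then show "x \<in> ball x0 r" using out by meson
    qed
  qed (rule smooth)
qed

section \<open>Rapidly decreasing functions and the Fourier transform of Schwartz functions\<close>

text \<open>Decay of the function alone, without its derivatives. It is all that absolutely
  convergent integrals over frequencies ask for, so the transform of a Schwartz function only has to
  be shown continuous and rapidly decreasing.\<close>

definition rapid :: "('a::euclidean_space \<Rightarrow> complex) \<Rightarrow> bool" where
  "rapid c \<longleftrightarrow> continuous_on UNIV c \<and> (\<forall>k. \<exists>B. \<forall>\<eta>. (1 + norm \<eta>) ^ k * norm (c \<eta>) \<le> B)"

lemma rapid_measurable: "rapid c \<Longrightarrow> c \<in> borel_measurable borel"
  unfolding rapid_def by (blast intro: borel_measurable_continuous_onI)

lemma rapid_bound:
  assumes "rapid c"
  obtains B where "B \<ge> 0" "\<And>\<eta>. (1 + norm \<eta>) ^ k * norm (c \<eta>) \<le> B"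
proof -
  obtain B where B: "\<And>\<eta>. (1 + norm \<eta>) ^ k * norm (c \<eta>) \<le> B" using assms unfolding rapid_def by blast
  have "0 \<le> (1 + norm (0::'a)) ^ k * norm (c 0)" by simp
  then have "B \<ge> 0" using B order_trans by blast
  with B that show thesis by blast
qed

lemma rapid_integrable:
  assumes "rapid c"
  shows "integrable lborel (\<lambda>\<eta>. (1 + norm \<eta>) ^ k * norm (c \<eta>))"
proof -
  obtain B where B: "B \<ge> 0" "\<And>\<eta>. (1 + norm \<eta>) ^ (k + 2 * DIM('a)) * norm (c \<eta>) \<le> B"
    using rapid_bound[OF assms] by blast
  have [measurable]: "c \<in> borel_measurable borel" using rapid_measurable[OF assms] .
  show ?thesis
  proof (rule Bochner_Integration.integrable_bound)
    show "integrable lborel (\<lambda>\<eta>::'a. B * (1 / (1 + norm \<eta>) ^ (2 * DIM('a))))"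
      by (intro integrable_mult_right integrable_inverse_one_plus_norm_power) simp
    show "AE \<eta> in lborel. norm ((1 + norm \<eta>) ^ k * norm (c \<eta>)) \<le> norm (B * (1 / (1 + norm \<eta>) ^ (2 * DIM('a))))"
    proof (rule AE_I2)
      fix \<eta> :: 'a
      have "(1 + norm \<eta>) ^ k * norm (c \<eta>) * (1 + norm \<eta>) ^ (2 * DIM('a)) \<le> B"
        using B(2)[of \<eta>] by (simp add: power_add mult_ac)
      then have "(1 + norm \<eta>) ^ k * norm (c \<eta>) \<le> B / (1 + norm \<eta>) ^ (2 * DIM('a))"
        by (subst pos_le_divide_eq) (auto intro!: zero_less_power add_pos_nonneg)
      then show "norm ((1 + norm \<eta>) ^ k * norm (c \<eta>)) \<le> norm (B * (1 / (1 + norm \<eta>) ^ (2 * DIM('a))))"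
        using B(1) by simp
    qed
  qed measurable
qed

lemma rapid_integrable_self: "rapid c \<Longrightarrow> integrable lborel c"
  by (rule integrable_norm_cancel) (use rapid_integrable[of c 0] rapid_measurable[of c] in auto)

lemma rapid_mult_poly:
  assumes "rapid c" "continuous_on UNIV g" "\<And>\<eta>. norm (g \<eta>) \<le> A * (1 + norm \<eta>) ^ m"
  shows "rapid (\<lambda>\<eta>. c \<eta> * g \<eta>)"
  unfolding rapid_def
proof (intro conjI allI)
  show "continuous_on UNIV (\<lambda>\<eta>. c \<eta> * g \<eta>)"
    using assms unfolding rapid_def by (intro continuous_intros) auto
  fix k
  obtain B where B: "B \<ge> 0" "\<And>\<eta>. (1 + norm \<eta>) ^ (k + m) * norm (c \<eta>) \<le> B"
    using rapid_bound[OF assms(1)] by blast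
  have A: "A \<ge> 0" using order_trans[OF norm_ge_zero assms(3)[of 0]] by simp
  have "(1 + norm \<eta>) ^ k * norm (c \<eta> * g \<eta>) \<le> A * B" for \<eta>
  proof -
    have "(1 + norm \<eta>) ^ k * norm (c \<eta> * g \<eta>) \<le> (1 + norm \<eta>) ^ k * (norm (c \<eta>) * (A * (1 + norm \<eta>) ^ m))"
      unfolding norm_mult by (intro mult_left_mono assms(3)) auto
    also have "\<dots> = A * ((1 + norm \<eta>) ^ (k + m) * norm (c \<eta>))" by (simp add: power_add)
    also have "\<dots> \<le> A * B" using A B(2) by (intro mult_left_mono)
    finally show ?thesis .
  qed
  then show "\<exists>B. \<forall>\<eta>. (1 + norm \<eta>) ^ k * norm (c \<eta> * g \<eta>) \<le> B" by blast
qed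

lemma rapid_mult_bounded:
  assumes "rapid c" "continuous_on UNIV g" "\<And>\<eta>. norm (g \<eta>) \<le> A"
  shows "rapid (\<lambda>\<eta>. c \<eta> * g \<eta>)"
  using rapid_mult_poly[OF assms(1,2), of A 0] assms(3) by simp

lemma rapid_cnj: "rapid c \<Longrightarrow> rapid (\<lambda>\<eta>. cnj (c \<eta>))"
  unfolding rapid_def complex_mod_cnj using continuous_on_cnj by blast

lemma rapid_reflect: "rapid c \<Longrightarrow> rapid (\<lambda>\<eta>. c (- \<eta>))"
  unfolding rapid_def
proof safe
  fix k assume *: "continuous_on UNIV c" "\<forall>k. \<exists>B. \<forall>\<eta>. (1 + norm \<eta>) ^ k * norm (c \<eta>) \<le> B"
  show "continuous_on UNIV (\<lambda>\<eta>. c (- \<eta>))"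
    by (rule continuous_on_compose2[OF *(1) continuous_on_minus[OF continuous_on_id]]) simp
  obtain B where "\<forall>\<eta>. (1 + norm \<eta>) ^ k * norm (c \<eta>) \<le> B" using * by blast
  then have "\<forall>\<eta>. (1 + norm \<eta>) ^ k * norm (c (- \<eta>)) \<le> B" by (metis norm_minus_cancel)
  then show "\<exists>B. \<forall>\<eta>. (1 + norm \<eta>) ^ k * norm (c (- \<eta>)) \<le> B" by blast
qed

lemma schwartz_rapid:
  assumes "schwartz f" shows "rapid f"
  unfolding rapid_def
proof (intro conjI allI)
  show "continuous_on UNIV f" using assms continuous_on_smooth_fun schwartzD_smooth by blast
  fix k
  obtain B where B: "\<And>y. (1 + norm y) ^ k * jet 0 f y \<le> B" using schwartz_jet_bound[OF assms] by blast
  have "(1 + norm y) ^ k * norm (f y) \<le> B" for y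
    by (rule order_trans[OF mult_left_mono[OF norm_le_jet] B]) simp
  then show "\<exists>B. \<forall>\<eta>. (1 + norm \<eta>) ^ k * norm (f \<eta>) \<le> B" by blast
qed

section \<open>Decay of the Fourier transform through integration by parts\<close>

lemma iter_deriv_append: "iter_deriv (vs @ ws) f = iter_deriv vs (iter_deriv ws f)"
  by (induction vs) auto

lemma schwartz_iter_deriv:
  assumes "schwartz f" "set ws \<subseteq> Basis"
  shows "schwartz (iter_deriv ws f)"
  using assms unfolding schwartz_def smooth_fun_def iter_deriv_append[symmetric] by auto

text \<open>The mean value inequality on a segment. The bound \<open>B\<close> is demanded on that
  segment only, so it may depend on \<open>x\<close>, as a majorant must.\<close>

lemma norm_diff_quotient_le:
  assumes f: "smooth_fun f" and b: "b \<in> Basis" and t: "t > 0"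
    and B: "\<And>s. 0 \<le> s \<Longrightarrow> s \<le> t \<Longrightarrow> norm (iter_deriv [b] f (x + s *\<^sub>R b)) \<le> B"
  shows "norm (f (x + t *\<^sub>R b) - f x) \<le> B * t"
proof -
  let ?F = "\<lambda>z. frechet_derivative f (at z)"
  have F: "(f has_derivative ?F z) (at z)" for z
    using iter_deriv_has_derivative[OF f, of "[]"] by simp
  have "norm (f (x + t *\<^sub>R b) - f (x + 0 *\<^sub>R b)) \<le> B * norm (t - 0)"
  proof (rule differentiable_bound[of "{0..t}" "\<lambda>s. f (x + s *\<^sub>R b)" "\<lambda>s h. ?F (x + s *\<^sub>R b) (h *\<^sub>R b)"])
    fix s assume s: "s \<in> {0..t}"
    have "((\<lambda>s. x + s *\<^sub>R b) has_derivative (\<lambda>h. h *\<^sub>R b)) (at s within {0..t})"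
      by (auto intro!: derivative_eq_intros)
    from has_derivative_compose[OF this F]
    show "((\<lambda>s. f (x + s *\<^sub>R b)) has_derivative (\<lambda>h. ?F (x + s *\<^sub>R b) (h *\<^sub>R b))) (at s within {0..t})" .
    show "onorm (\<lambda>h. ?F (x + s *\<^sub>R b) (h *\<^sub>R b)) \<le> B"
    proof (rule onorm_le)
      fix h :: real
      have "?F (x + s *\<^sub>R b) (h *\<^sub>R b) = h *\<^sub>R ?F (x + s *\<^sub>R b) b"
        using has_derivative_linear[OF F] by (rule linear_cmul)
      then have "norm (?F (x + s *\<^sub>R b) (h *\<^sub>R b)) = \<bar>h\<bar> * norm (?F (x + s *\<^sub>R b) b)" by simp
      also have "\<dots> \<le> \<bar>h\<bar> * B" using B[of s] s by (intro mult_left_mono) auto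
      finally show "norm (?F (x + s *\<^sub>R b) (h *\<^sub>R b)) \<le> B * norm h" by (simp add: mult.commute)
    qed
  qed (use t in auto)
  then show ?thesis using t by simp
qed

lemma has_vector_derivative_imp_difference_quotient:
  fixes g :: "real \<Rightarrow> 'b::real_normed_vector"
  assumes "(g has_vector_derivative D) (at 0)"
  shows "((\<lambda>h. (g h - g 0) /\<^sub>R h) \<longlongrightarrow> D) (at 0)"
proof -
  have "((\<lambda>h. norm (g h - g 0 - (h - 0) *\<^sub>R D) / norm (h - 0)) \<longlongrightarrow> 0) (at 0)"
    using assms unfolding has_vector_derivative_def has_derivative_iff_norm by blast
  moreover have "norm (g h - g 0 - (h - 0) *\<^sub>R D) / norm (h - 0) = norm ((g h - g 0) /\<^sub>R h - D)"
    if "h \<noteq> 0" for h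
  proof -
    have "(g h - g 0) /\<^sub>R h - D = (g h - g 0 - (h - 0) *\<^sub>R D) /\<^sub>R h"
      using that by (simp add: scaleR_diff_right)
    then show ?thesis by (simp add: divide_inverse mult.commute)
  qed
  then have "\<forall>\<^sub>F h in at 0. norm (g h - g 0 - (h - 0) *\<^sub>R D) / norm (h - 0) = norm ((g h - g 0) /\<^sub>R h - D)"
    by (auto simp: eventually_at_filter)
  ultimately have "((\<lambda>h. norm ((g h - g 0) /\<^sub>R h - D)) \<longlongrightarrow> 0) (at 0)"
    by (rule Lim_transform_eventually)
  then have "((\<lambda>h. (g h - g 0) /\<^sub>R h - D) \<longlongrightarrow> 0) (at 0)" by (rule tendsto_norm_zero_cancel)
  then show ?thesis by (rule LIM_zero_cancel)
qed

text \<open>By translation invariance every difference quotient of \<open>f\<close> has integral 0;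
  dominated convergence passes this on to the derivative. No iterated integral along one coordinate
  is involved.\<close>

lemma integral_partial_zero:
  assumes f: "schwartz f" and b: "b \<in> Basis"
  shows "(\<integral>x. iter_deriv [b] f x \<partial>lborel) = 0"
proof (rule LIMSEQ_unique)
  let ?k = "2 * DIM('a)"
  let ?q = "\<lambda>m x. (f (x + (1 / real (Suc m)) *\<^sub>R b) - f x) /\<^sub>R (1 / real (Suc m))"
  have [measurable]: "f \<in> borel_measurable borel" using rapid_measurable[OF schwartz_rapid[OF f]] .
  have f': "schwartz (iter_deriv [b] f)" using schwartz_iter_deriv[OF f, of "[b]"] b by simp
  have m': "iter_deriv [b] f \<in> borel_measurable borel" using rapid_measurable[OF schwartz_rapid[OF f']] .
  obtain B where B: "B \<ge> 0" "\<And>y. (1 + norm y) ^ ?k * norm (iter_deriv [b] f y) \<le> B"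
    using rapid_bound[OF schwartz_rapid[OF f']] by blast
  have fi: "integrable lborel f" using f schwartz_rapid rapid_integrable_self by blast
  have "(\<integral>x. ?q m x \<partial>lborel) = 0" for m
  proof -
    have "integrable lborel (\<lambda>x. f (x + (1 / real (Suc m)) *\<^sub>R b))"
      using lborel_integrable_affine[OF _ fi, of 1 "(1 / real (Suc m)) *\<^sub>R b"] by (simp add: add.commute)
    moreover have "(\<integral>x. f (x + (1 / real (Suc m)) *\<^sub>R b) \<partial>lborel) = (\<integral>x. f x \<partial>lborel)"
      using lborel_integral_translate[of f "(1 / real (Suc m)) *\<^sub>R b"] by (simp add: add.commute)
    ultimately show ?thesis using fi by simp
  qed
  then show "(\<lambda>m. \<integral>x. ?q m x \<partial>lborel) \<longlonglongrightarrow> 0" by simp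
  show "(\<lambda>m. \<integral>x. ?q m x \<partial>lborel) \<longlonglongrightarrow> (\<integral>x. iter_deriv [b] f x \<partial>lborel)"
  proof (rule integral_dominated_convergence[where w = "\<lambda>x::'a. 2 ^ ?k * B * (1 / (1 + norm x) ^ ?k)"])
    show "integrable lborel (\<lambda>x::'a. 2 ^ ?k * B * (1 / (1 + norm x) ^ ?k))"
      by (intro integrable_mult_right integrable_inverse_one_plus_norm_power) simp
    show "AE x in lborel. (\<lambda>m. ?q m x) \<longlonglongrightarrow> iter_deriv [b] f x"
    proof (rule AE_I2)
      fix x
      have F: "(f has_derivative frechet_derivative f (at x)) (at x)"
        using iter_deriv_has_derivative[OF schwartzD_smooth[OF f], of "[]"] by simp
      have "((\<lambda>s. x + s *\<^sub>R b) has_derivative (\<lambda>h. h *\<^sub>R b)) (at 0)"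
        by (auto intro!: derivative_eq_intros)
      from has_derivative_compose[OF this, of f] F
      have "((\<lambda>s. f (x + s *\<^sub>R b)) has_derivative (\<lambda>h. frechet_derivative f (at x) (h *\<^sub>R b))) (at 0)" by simp
      moreover have "frechet_derivative f (at x) (h *\<^sub>R b) = h *\<^sub>R frechet_derivative f (at x) b" for h
        using has_derivative_linear[OF F] by (rule linear_cmul)
      ultimately have "((\<lambda>s. f (x + s *\<^sub>R b)) has_vector_derivative frechet_derivative f (at x) b) (at 0)"
        by (simp add: has_vector_derivative_def)
      then have lim: "((\<lambda>h. (f (x + h *\<^sub>R b) - f x) /\<^sub>R h) \<longlongrightarrow> frechet_derivative f (at x) b) (at 0)"
        using has_vector_derivative_imp_difference_quotient by force
      have "filterlim (\<lambda>m. 1 / real (Suc m)) (at 0) sequentially"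
        using LIMSEQ_inverse_real_of_nat unfolding inverse_eq_divide by (intro filterlim_atI) auto
      from filterlim_compose[OF lim this] show "(\<lambda>m. ?q m x) \<longlonglongrightarrow> iter_deriv [b] f x" by simp
    qed
    show "AE x in lborel. norm (?q m x) \<le> 2 ^ ?k * B * (1 / (1 + norm x) ^ ?k)" for m
    proof (rule AE_I2)
      fix x :: 'a
      let ?t = "1 / real (Suc m)"
      have "norm (f (x + ?t *\<^sub>R b) - f x) \<le> 2 ^ ?k * B * (1 / (1 + norm x) ^ ?k) * ?t"
      proof (rule norm_diff_quotient_le[OF schwartzD_smooth[OF f] b])
        fix s :: real assume s: "0 \<le> s" "s \<le> ?t"
        \<comment> \<open>The segment stays within distance 1 of \<open>x\<close>, so each weight
          changes by at most the factor 2; hence the \<open>2 ^ ?k\<close> in the majorant.\<close>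
        have "s \<le> 1" using s by (simp add: order_trans)
        let ?y = "x + s *\<^sub>R b"
        have "1 + norm x \<le> (1 + norm ?y) * (1 + norm (x - ?y))" by (rule one_plus_norm_le)
        also have "norm (x - ?y) = s" using s b by simp
        also have "(1 + norm ?y) * (1 + s) \<le> (1 + norm ?y) * 2" using \<open>s \<le> 1\<close> by (intro mult_left_mono) auto
        finally have "(1 + norm x) ^ ?k \<le> ((1 + norm ?y) * 2) ^ ?k" by (intro power_mono) auto
        then have "(1 + norm x) ^ ?k * norm (iter_deriv [b] f ?y) \<le> ((1 + norm ?y) * 2) ^ ?k * norm (iter_deriv [b] f ?y)"
          by (intro mult_right_mono) auto
        also have "\<dots> = 2 ^ ?k * ((1 + norm ?y) ^ ?k * norm (iter_deriv [b] f ?y))"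
          by (simp only: power_mult_distrib mult_ac)
        also have "\<dots> \<le> 2 ^ ?k * B" by (intro mult_left_mono B) simp
        finally have *: "norm (iter_deriv [b] f ?y) * (1 + norm x) ^ ?k \<le> 2 ^ ?k * B" by (simp add: mult.commute)
        have "0 < (1 + norm x) ^ ?k" by (intro zero_less_power add_pos_nonneg) auto
        from pos_le_divide_eq[OF this] * show "norm (iter_deriv [b] f ?y) \<le> 2 ^ ?k * B * (1 / (1 + norm x) ^ ?k)" by simp
      qed simp
      then have "norm (f (x + ?t *\<^sub>R b) - f x) * real (Suc m) \<le> 2 ^ ?k * B * (1 / (1 + norm x) ^ ?k) * ?t * real (Suc m)"
        by (intro mult_right_mono) auto
      then show "norm (?q m x) \<le> 2 ^ ?k * B * (1 / (1 + norm x) ^ ?k)" by (simp add: mult.commute)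
    qed
  qed (use m' in measurable)
qed

text \<open>Integration by parts: the derivative of \<open>f x * expi \<xi> x\<close> has integral
  0, and the product rule splits it into the two terms.\<close>

lemma FT_partial:
  assumes f: "schwartz f" and b: "b \<in> Basis"
  shows "FT (iter_deriv [b] f) \<xi> = \<i> * complex_of_real (b \<bullet> \<xi>) * FT f \<xi>"
proof -
  have s: "smooth_fun f" using f by (rule schwartzD_smooth)
  have f': "schwartz (iter_deriv [b] f)" using schwartz_iter_deriv[OF f, of "[b]"] b by simp
  have b': "set [b] \<subseteq> Basis" using b by simp
  have "iter_deriv [b] (\<lambda>x. f x * expi \<xi> x) x = iter_deriv [b] f x * expi \<xi> x + (- \<i> * complex_of_real (b \<bullet> \<xi>)) * (f x * expi \<xi> x)" for x
    unfolding iter_deriv_mult[OF s smooth_fun_expi b'] using iter_deriv_expi[OF b', of \<xi>]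
    by (simp del: iter_deriv.simps(2))
  moreover have "(\<integral>x. iter_deriv [b] (\<lambda>x. f x * expi \<xi> x) x \<partial>lborel) = 0"
    by (intro integral_partial_zero schwartz_mult_expi f b)
  ultimately have "(\<integral>x. iter_deriv [b] f x * expi \<xi> x + (- \<i> * complex_of_real (b \<bullet> \<xi>)) * (f x * expi \<xi> x) \<partial>lborel) = 0"
    by simp
  moreover have "integrable lborel (\<lambda>x. iter_deriv [b] f x * expi \<xi> x)" "integrable lborel (\<lambda>x. f x * expi \<xi> x)"
    using f f' by (auto intro!: rapid_integrable_self schwartz_rapid schwartz_mult_expi simp del: iter_deriv.simps)
  ultimately have "(\<integral>x. iter_deriv [b] f x * expi \<xi> x \<partial>lborel) + (- \<i> * complex_of_real (b \<bullet> \<xi>)) * (\<integral>x. f x * expi \<xi> x \<partial>lborel) = 0"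
    by (subst (asm) Bochner_Integration.integral_add) auto
  then show ?thesis unfolding FT_def by (simp add: expi_commute[of \<xi>] algebra_simps del: iter_deriv.simps)
qed

lemma FT_partial_power:
  assumes f: "schwartz f" and b: "b \<in> Basis"
  shows "FT (iter_deriv (replicate k b) f) \<xi> = (\<i> * complex_of_real (b \<bullet> \<xi>)) ^ k * FT f \<xi>"
proof (induction k)
  case (Suc k)
  have "schwartz (iter_deriv (replicate k b) f)" using b by (intro schwartz_iter_deriv f) auto
  from FT_partial[OF this b] Suc show ?case by (simp add: mult_ac)
qed simp

text \<open>Repeated use of \<open>FT_partial\<close> in one direction controls powers of a single
  coordinate. Comparing \<open>1 + norm \<xi>\<close> with the largest of 1 and the coordinates
  turns such pure powers into the full weight.\<close>

lemma one_plus_norm_power_le: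
  fixes \<xi> :: "'a::euclidean_space"
  shows "(1 + norm \<xi>) ^ k \<le> (1 + real DIM('a)) ^ k * (1 + (\<Sum>b\<in>Basis. \<bar>b \<bullet> \<xi>\<bar> ^ k))"
proof -
  define M where "M = Max (insert 1 ((\<lambda>b. \<bar>b \<bullet> \<xi>\<bar>) ` Basis))"
  have M: "1 \<le> M" "\<And>b. b \<in> Basis \<Longrightarrow> \<bar>b \<bullet> \<xi>\<bar> \<le> M" unfolding M_def by (auto intro!: Max_ge simp del: Max_insert)
  have "norm \<xi> \<le> (\<Sum>b\<in>Basis. \<bar>\<xi> \<bullet> b\<bar>)" by (rule norm_le_l1)
  also have "\<dots> \<le> (\<Sum>b\<in>(Basis::'a set). M)" using M(2) by (intro sum_mono) (simp add: inner_commute)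
  finally have "1 + norm \<xi> \<le> (1 + real DIM('a)) * M" using M(1) by (simp add: algebra_simps)
  then have "(1 + norm \<xi>) ^ k \<le> (1 + real DIM('a)) ^ k * M ^ k"
    unfolding power_mult_distrib[symmetric] by (intro power_mono) auto
  also have "M ^ k \<le> 1 + (\<Sum>b\<in>Basis. \<bar>b \<bullet> \<xi>\<bar> ^ k)"
  proof -
    have "M \<in> insert 1 ((\<lambda>b. \<bar>b \<bullet> \<xi>\<bar>) ` Basis)" unfolding M_def by (rule Max_in) auto
    then consider "M = 1" | b where "b \<in> Basis" "M = \<bar>b \<bullet> \<xi>\<bar>" by blast
    then show ?thesis
    proof cases
      case 2
      then have "M ^ k \<le> (\<Sum>b\<in>Basis. \<bar>b \<bullet> \<xi>\<bar> ^ k)" by (auto intro!: member_le_sum)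
      then show ?thesis by simp
    qed (simp add: sum_nonneg)
  qed
  finally show ?thesis by (simp add: mult_left_mono)
qed

lemma rapid_FT:
  fixes f :: "'a::euclidean_space \<Rightarrow> complex"
  assumes f: "schwartz f" shows "rapid (FT f)"
  unfolding rapid_def
proof (intro conjI allI)
  show "continuous_on UNIV (FT f)" using f by (intro continuous_on_FT rapid_integrable_self schwartz_rapid)
  fix k
  let ?I = "\<lambda>b. \<integral>\<eta>. norm (iter_deriv (replicate k b) f \<eta>) \<partial>lborel"
  let ?J = "\<integral>\<eta>. norm (f \<eta>) \<partial>lborel"
  have "(1 + norm \<xi>) ^ k * norm (FT f \<xi>) \<le> (1 + real DIM('a)) ^ k * (?J + (\<Sum>b\<in>Basis. ?I b))" for \<xi>
  proof -
    have b: "\<bar>b \<bullet> \<xi>\<bar> ^ k * norm (FT f \<xi>) \<le> ?I b" if "b \<in> Basis" for b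
      using norm_FT_le[of "iter_deriv (replicate k b) f" \<xi>] FT_partial_power[OF f that, of k \<xi>]
      by (simp add: norm_mult norm_power)
    have "(1 + norm \<xi>) ^ k * norm (FT f \<xi>) \<le>
       (1 + real DIM('a)) ^ k * (1 + (\<Sum>b\<in>Basis. \<bar>b \<bullet> \<xi>\<bar> ^ k)) * norm (FT f \<xi>)"
      by (intro mult_right_mono one_plus_norm_power_le) auto
    also have "\<dots> = (1 + real DIM('a)) ^ k * (norm (FT f \<xi>) + (\<Sum>b\<in>Basis. \<bar>b \<bullet> \<xi>\<bar> ^ k * norm (FT f \<xi>)))"
      by (simp add: algebra_simps sum_distrib_left)
    also have "\<dots> \<le> (1 + real DIM('a)) ^ k * (?J + (\<Sum>b\<in>Basis. ?I b))"
      using b by (intro mult_left_mono add_mono norm_FT_le sum_mono) auto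
    finally show ?thesis .
  qed
  then show "\<exists>B. \<forall>\<eta>. (1 + norm \<eta>) ^ k * norm (FT f \<eta>) \<le> B" by blast
qed

lemma schwartz_FT_inversion:
  fixes f :: "'a::euclidean_space \<Rightarrow> complex"
  assumes f: "schwartz f"
  shows "FT (FT f) (- y) = complex_of_real ((gauss_mass TYPE('a))\<^sup>2) * f y"
proof -
  obtain B where B: "\<And>\<eta>. (1 + norm \<eta>) ^ 0 * norm (f \<eta>) \<le> B"
    using rapid_bound[OF schwartz_rapid[OF f]] by blast
  show ?thesis
  proof (rule FT_inversion)
    show "integrable lborel f" "integrable lborel (FT f)"
      using f by (auto intro: rapid_integrable_self schwartz_rapid rapid_FT)
    show "continuous_on UNIV f" using schwartz_rapid[OF f] unfolding rapid_def by simp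
    show "norm (f x) \<le> B" for x using B by simp
  qed
qed

section \<open>Tempered distributions acting on wave packets\<close>

lemma tempered_add: "tempered u \<Longrightarrow> schwartz f \<Longrightarrow> schwartz g \<Longrightarrow> u (\<lambda>x. f x + g x) = u f + u g"
  unfolding tempered_def by (drule conjunct1) (metis (no_types, lifting) ext mult_1)

lemma schwartz_zero: "schwartz (\<lambda>x. 0)"
  by (rule schwartzI_jet) (auto simp: smooth_fun_const jet_const_on[of UNIV _ 0])

lemma tempered_zero: "tempered u \<Longrightarrow> u (\<lambda>x. 0) = 0"
  using tempered_add[of u "\<lambda>x. 0" "\<lambda>x. 0"] schwartz_zero by simp

lemma tempered_cmult: "tempered u \<Longrightarrow> schwartz f \<Longrightarrow> u (\<lambda>x. c * f x) = c * u f"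
proof -
  assume u: "tempered u" and f: "schwartz f"
  have "u (\<lambda>x. c * f x + (\<lambda>x. 0) x) = c * u f + u (\<lambda>x. 0)"
    using u f schwartz_zero unfolding tempered_def by blast
  then show ?thesis using tempered_zero[OF u] by simp
qed

lemma tempered_diff: 
  assumes "tempered u" "schwartz f" "schwartz g" 
  shows "u (\<lambda>x. f x - g x) = u f - u g"
  using tempered_add[OF assms(1,2) schwartz_cmult[OF assms(3), of "-1"]] tempered_cmult[OF assms(1,3), of "-1"] by simp

lemma schwartz_sum:
  "finite A \<Longrightarrow> (\<And>i. i \<in> A \<Longrightarrow> schwartz (f i)) \<Longrightarrow> schwartz (\<lambda>x. \<Sum>i\<in>A. f i x)"
  by (induction A rule: finite_induct) (auto intro: schwartz_zero schwartz_add)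

lemma tempered_sum:
  assumes "tempered u"
  shows "finite A \<Longrightarrow> (\<And>i. i \<in> A \<Longrightarrow> schwartz (f i)) \<Longrightarrow> u (\<lambda>x. \<Sum>i\<in>A. f i x) = (\<Sum>i\<in>A. u (f i))"
proof (induction A rule: finite_induct)
  case (insert i A)
  then show ?case using tempered_add[OF assms, of "f i" "\<lambda>x. \<Sum>i\<in>A. f i x"] by (auto intro: schwartz_sum)
qed (simp add: tempered_zero assms)

text \<open>The form in which continuity of \<open>u\<close> enters every later estimate: one
  pointwise bound on the weighted jet replaces a sum of suprema.\<close>

lemma tempered_jet_bound:
  fixes u :: "('a::euclidean_space \<Rightarrow> complex) \<Rightarrow> complex"
  assumes "tempered u"
  obtains C N where "C \<ge> 0"
    "\<And>f B. schwartz f \<Longrightarrow> (\<And>y. (1 + norm y) ^ N * jet N f y \<le> B) \<Longrightarrow> norm (u f) \<le> C * B"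
proof -
  obtain C N where CN: "\<And>f. schwartz f \<Longrightarrow> norm (u f) \<le> C * schwartz_seminorm N f"
    using assms unfolding tempered_def by blast
  let ?n = "real (card (indices N :: 'a list set))"
  show thesis
  proof
    \<comment> \<open>The definition of \<open>tempered\<close> does not fix the sign of
      \<open>C\<close>, hence the absolute value; \<open>?n\<close> counts the suprema in the
      seminorm.\<close>
    show "0 \<le> \<bar>C\<bar> * ?n" by simp
    fix f :: "'a \<Rightarrow> complex" and B assume f: "schwartz f" and B: "\<And>y. (1 + norm y) ^ N * jet N f y \<le> B"
    have b: "(1 + norm y) ^ N * norm (iter_deriv vs f y) \<le> B" if "vs \<in> indices N" for vs y
      using that by (intro order_trans[OF mult_left_mono[OF iter_deriv_le_jet] B]) auto
    have "\<bar>SUP x. (1 + norm x) ^ N * norm (iter_deriv vs f x)\<bar> \<le> B" if "vs \<in> indices N" for vs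
    proof -
      have "(SUP x. (1 + norm x) ^ N * norm (iter_deriv vs f x)) \<le> B"
        by (rule cSUP_least) (use b that in auto)
      moreover have "(1 + norm (0::'a)) ^ N * norm (iter_deriv vs f 0) \<le> (SUP x. (1 + norm x) ^ N * norm (iter_deriv vs f x))"
        using b[OF that] by (intro cSUP_upper bdd_aboveI[of _ B]) auto
      moreover have "0 \<le> (1 + norm (0::'a)) ^ N * norm (iter_deriv vs f 0)" by simp
      ultimately show ?thesis by linarith
    qed
    then have "\<bar>schwartz_seminorm N f\<bar> \<le> ?n * B"
      unfolding schwartz_seminorm_def by (intro order_trans[OF sum_abs] sum_bounded_above) auto
    then have "\<bar>C\<bar> * \<bar>schwartz_seminorm N f\<bar> \<le> \<bar>C\<bar> * (?n * B)" by (intro mult_left_mono) auto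
    moreover have "C * schwartz_seminorm N f \<le> \<bar>C\<bar> * \<bar>schwartz_seminorm N f\<bar>"
      unfolding abs_mult[symmetric] by simp
    ultimately show "norm (u f) \<le> \<bar>C\<bar> * ?n * B" using CN[OF f] by (simp add: mult.assoc)
  qed
qed

definition wave_packet :: "real \<Rightarrow> ('a::euclidean_space \<Rightarrow> complex) \<Rightarrow> 'a \<Rightarrow> 'a \<Rightarrow> 'a \<Rightarrow> complex" where
  "wave_packet lam \<phi> x \<xi> y = cnj (scale_win lam \<phi> (y - x)) * expi \<xi> y"

lemma wpt_eq: "wpt (scale_win lam \<phi>) u x \<xi> = u (wave_packet lam \<phi> x \<xi>)"
  unfolding wpt_def wave_packet_def[abs_def] expi_def ..

lemma schwartz_wave_packet: "schwartz \<phi> \<Longrightarrow> lam \<ge> 1 \<Longrightarrow> schwartz (wave_packet lam \<phi> x \<xi>)"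
  unfolding wave_packet_def[abs_def]
  by (intro schwartz_mult_expi schwartz_cnj schwartz_translate schwartz_scale_win)

text \<open>A packet lives at distance about \<open>1 / sqrt lam\<close> from \<open>x\<close>, so
  the natural weight is in the rescaled distance. The powers of \<open>lam\<close> are rounded up
  (\<open>sqrt lam\<close> to \<open>lam\<close>, the normalisation to
  \<open>lam ^ DIM('a)\<close>): only polynomial growth matters, as it will be beaten by decay of
  arbitrary order.\<close>

lemma jet_wave_packet_le:
  fixes \<phi> :: "'a::euclidean_space \<Rightarrow> complex"
  assumes \<phi>: "schwartz \<phi>"
  obtains B where "B \<ge> 0"
    "\<And>lam x \<xi> y. lam \<ge> 1 \<Longrightarrow> (1 + sqrt lam * norm (y - x)) ^ L * jet N (wave_packet lam \<phi> x \<xi>) y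
       \<le> B * lam ^ (DIM('a) + N) * (1 + norm \<xi>) ^ N"
proof -
  obtain C where C: "C \<ge> 0" "\<And>f g (y::'a). smooth_fun f \<Longrightarrow> smooth_fun g \<Longrightarrow>
       jet N (\<lambda>x. f x * g x) y \<le> C * (jet N f y * jet N g y)" using jet_mult_le by blast
  obtain B where B: "B \<ge> 0" "\<And>y. (1 + norm y) ^ L * jet N \<phi> y \<le> B"
    using schwartz_jet_bound[OF \<phi>] by blast
  let ?n = "real (card (indices N :: 'a list set))"
  have s: "smooth_fun \<phi>" using \<phi> by (rule schwartzD_smooth)
  show thesis
  proof (rule that[of "C * B * ?n"])
    show "0 \<le> C * B * ?n" using C(1) B(1) by simp
    fix lam :: real and x \<xi> y :: 'a assume lam: "lam \<ge> 1"
    let ?k = "complex_of_real (lam powr (real DIM('a) / 4))"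
    have eq: "wave_packet lam \<phi> x \<xi> = (\<lambda>y. cnj (?k * \<phi> (sqrt lam *\<^sub>R (y - x))) * expi \<xi> y)"
      by (auto simp: wave_packet_def scale_win_def)
    have sa: "smooth_fun (\<lambda>y. \<phi> (sqrt lam *\<^sub>R (y - x)))" by (rule smooth_fun_affine[OF s])
    have sq: "sqrt lam \<ge> 1" using lam by simp
    have "jet N (wave_packet lam \<phi> x \<xi>) y \<le> C * (jet N (\<lambda>y. cnj (?k * \<phi> (sqrt lam *\<^sub>R (y - x)))) y * jet N (expi \<xi>) y)"
      unfolding eq by (intro C smooth_fun_cnj smooth_fun_cmult sa smooth_fun_expi)
    also have "jet N (\<lambda>y. cnj (?k * \<phi> (sqrt lam *\<^sub>R (y - x)))) y =
        lam powr (real DIM('a) / 4) * jet N (\<lambda>y. \<phi> (sqrt lam *\<^sub>R (y - x))) y"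
      by (subst jet_cnj[OF smooth_fun_cmult[OF sa]], subst jet_cmult[OF sa]) simp
    also have "C * (lam powr (real DIM('a) / 4) * jet N (\<lambda>y. \<phi> (sqrt lam *\<^sub>R (y - x))) y * jet N (expi \<xi>) y)
       \<le> C * (lam ^ DIM('a) * (lam ^ N * jet N \<phi> (sqrt lam *\<^sub>R (y - x))) * (?n * (1 + norm \<xi>) ^ N))"
    proof (intro mult_left_mono mult_mono jet_expi_le C(1))
      have "lam powr (real DIM('a) / 4) \<le> lam powr real DIM('a)" using lam by (intro powr_mono) auto
      then show "lam powr (real DIM('a) / 4) \<le> lam ^ DIM('a)" using lam by (simp add: powr_realpow)
      have "sqrt lam \<le> lam" using lam sqrt_le_D by (intro real_le_lsqrt) (auto simp: power2_eq_square)
      then have "sqrt lam ^ N \<le> lam ^ N" using lam by (intro power_mono) auto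
      then have "sqrt lam ^ N * jet N \<phi> (sqrt lam *\<^sub>R (y - x)) \<le> lam ^ N * jet N \<phi> (sqrt lam *\<^sub>R (y - x))"
        by (intro mult_right_mono) auto
      then show "jet N (\<lambda>y. \<phi> (sqrt lam *\<^sub>R (y - x))) y \<le> lam ^ N * jet N \<phi> (sqrt lam *\<^sub>R (y - x))"
        using jet_affine[OF s sq, of N x y] by linarith
    qed (use lam in auto)
    finally have "(1 + sqrt lam * norm (y - x)) ^ L * jet N (wave_packet lam \<phi> x \<xi>) y \<le>
      (1 + sqrt lam * norm (y - x)) ^ L * (C * (lam ^ DIM('a) * (lam ^ N * jet N \<phi> (sqrt lam *\<^sub>R (y - x))) * (?n * (1 + norm \<xi>) ^ N)))"
      using lam by (intro mult_left_mono) auto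
    also have "\<dots> = C * ((1 + norm (sqrt lam *\<^sub>R (y - x))) ^ L * jet N \<phi> (sqrt lam *\<^sub>R (y - x))) * ?n
         * lam ^ (DIM('a) + N) * (1 + norm \<xi>) ^ N"
      using lam by (simp add: power_add)
    also have "\<dots> \<le> C * B * ?n * lam ^ (DIM('a) + N) * (1 + norm \<xi>) ^ N"
      using lam by (intro mult_right_mono mult_left_mono B C(1)) auto
    finally show "(1 + sqrt lam * norm (y - x)) ^ L * jet N (wave_packet lam \<phi> x \<xi>) y
       \<le> C * B * ?n * lam ^ (DIM('a) + N) * (1 + norm \<xi>) ^ N" .
  qed
qed

text \<open>The weight in \<open>y\<close> demanded by \<open>u\<close> is moved to \<open>x\<close>
  by \<open>one_plus_norm_le\<close>; the remaining weight on the distance is absorbed by the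
  packet. One common exponent \<open>P\<close> serves all three variables.\<close>

lemma wave_packet_poly_bound:
  fixes \<phi> :: "'a::euclidean_space \<Rightarrow> complex"
  assumes u: "tempered u" and \<phi>: "schwartz \<phi>"
  obtains C P where "C \<ge> 0" "\<And>lam x \<xi>. lam \<ge> 1 \<Longrightarrow>
     norm (u (wave_packet lam \<phi> x \<xi>)) \<le> C * lam ^ P * (1 + norm x) ^ P * (1 + norm \<xi>) ^ P"
proof -
  obtain C N where C: "C \<ge> 0"
    "\<And>f B. schwartz f \<Longrightarrow> (\<And>y. (1 + norm y) ^ N * jet N f y \<le> B) \<Longrightarrow> norm (u f) \<le> C * B"
    using tempered_jet_bound[OF u] by blast
  obtain B where B: "B \<ge> 0"
    "\<And>lam x \<xi> y. lam \<ge> 1 \<Longrightarrow> (1 + sqrt lam * norm (y - x)) ^ N * jet N (wave_packet lam \<phi> x \<xi>) y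
       \<le> B * lam ^ (DIM('a) + N) * (1 + norm \<xi>) ^ N" using jet_wave_packet_le[OF \<phi>] by blast
  let ?P = "DIM('a) + N"
  show thesis
  proof (rule that[of "C * B" ?P])
    show "0 \<le> C * B" using C(1) B(1) by simp
    fix lam :: real and x \<xi> :: 'a assume lam: "lam \<ge> 1"
    have "norm (u (wave_packet lam \<phi> x \<xi>)) \<le> C * ((1 + norm x) ^ N * (B * lam ^ ?P * (1 + norm \<xi>) ^ N))"
    proof (rule C(2)[OF schwartz_wave_packet[OF \<phi> lam]])
      fix y
      have "1 + norm (y - x) \<le> 1 + sqrt lam * norm (y - x)"
        using lam mult_right_mono[of 1 "sqrt lam" "norm (y - x)"] by simp
      then have "(1 + norm x) * (1 + norm (y - x)) \<le> (1 + norm x) * (1 + sqrt lam * norm (y - x))"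
        by (intro mult_left_mono) auto
      then have "(1 + norm y) ^ N \<le> ((1 + norm x) * (1 + sqrt lam * norm (y - x))) ^ N"
        using one_plus_norm_le[of y x] by (intro power_mono) auto
      then have "(1 + norm y) ^ N * jet N (wave_packet lam \<phi> x \<xi>) y \<le>
         ((1 + norm x) * (1 + sqrt lam * norm (y - x))) ^ N * jet N (wave_packet lam \<phi> x \<xi>) y"
        by (intro mult_right_mono) auto
      also have "\<dots> = (1 + norm x) ^ N * ((1 + sqrt lam * norm (y - x)) ^ N * jet N (wave_packet lam \<phi> x \<xi>) y)"
        by (simp only: power_mult_distrib mult.assoc)
      also have "\<dots> \<le> (1 + norm x) ^ N * (B * lam ^ ?P * (1 + norm \<xi>) ^ N)"
        by (intro mult_left_mono B lam) auto
      finally show "(1 + norm y) ^ N * jet N (wave_packet lam \<phi> x \<xi>) y \<le> (1 + norm x) ^ N * (B * lam ^ ?P * (1 + norm \<xi>) ^ N)" .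
    qed
    also have "\<dots> \<le> C * ((1 + norm x) ^ ?P * (B * lam ^ ?P * (1 + norm \<xi>) ^ ?P))"
      using C(1) B(1) lam by (intro mult_left_mono mult_mono power_increasing) auto
    finally show "norm (u (wave_packet lam \<phi> x \<xi>)) \<le> C * B * lam ^ ?P * (1 + norm x) ^ ?P * (1 + norm \<xi>) ^ ?P"
      by (simp add: mult_ac)
  qed
qed

text \<open>Away from the window centre each power of \<open>(1 + sqrt lam * norm (y - x))\<close> buys half a
  power of \<open>lam\<close> and a full power of \<open>(1 + norm (y - x))\<close>.\<close>

lemma off_centre:
  assumes "\<delta> > 0" "lam \<ge> 1" "norm (y - x) \<ge> \<delta>"
  shows "sqrt lam * (1 + norm (y - x)) \<le> ((1 + \<delta>) / \<delta>) * (1 + sqrt lam * norm (y - x))"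
proof -
  let ?t = "norm (y - x)"
  have "\<delta> * (1 + ?t) \<le> (1 + \<delta>) * ?t" using assms by (simp add: algebra_simps)
  then have "sqrt lam * (\<delta> * (1 + ?t)) \<le> sqrt lam * ((1 + \<delta>) * ?t)" using assms by (intro mult_left_mono) auto
  also have "\<dots> \<le> (1 + \<delta>) * (1 + sqrt lam * ?t)" using assms by (simp add: algebra_simps)
  finally show ?thesis using assms by (simp add: field_simps)
qed

text \<open>Where \<open>a\<close> vanishes there is nothing to show; elsewhere
  \<open>off_centre\<close> converts window decay into inverse powers of \<open>lam\<close>. The
  constant is chosen before \<open>a\<close>, \<open>lam\<close>, \<open>x\<close> and
  \<open>\<xi>\<close>, with \<open>a\<close> entering only through its jet.\<close>

lemma jet_off_centre_le:
  fixes \<phi> :: "'a::euclidean_space \<Rightarrow> complex"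
  assumes \<phi>: "schwartz \<phi>" and \<delta>: "\<delta> > 0"
  obtains B where "B \<ge> 0"
    "\<And>a lam x \<xi> y. smooth_fun a \<Longrightarrow> lam \<ge> 1 \<Longrightarrow> (\<And>y. y \<in> ball x \<delta> \<Longrightarrow> a y = 0) \<Longrightarrow>
       lam ^ M * (1 + norm (y - x)) ^ M * jet N (\<lambda>y. a y * wave_packet lam \<phi> x \<xi> y) y
       \<le> B * jet N a y * (1 + norm \<xi>) ^ N"
proof -
  obtain C where C: "C \<ge> 0" "\<And>f g (y::'a). smooth_fun f \<Longrightarrow> smooth_fun g \<Longrightarrow>
       jet N (\<lambda>x. f x * g x) y \<le> C * (jet N f y * jet N g y)" using jet_mult_le by blast
  \<comment> \<open>Two powers of the window weight buy one power of \<open>lam\<close>: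
    \<open>M\<close> of these are to remain, and \<open>DIM('a) + N\<close> cancel the loss in
    \<open>jet_wave_packet_le\<close>.\<close>
  let ?L = "2 * (M + DIM('a) + N)"
  obtain B where B: "B \<ge> 0"
    "\<And>lam x \<xi> y. lam \<ge> 1 \<Longrightarrow> (1 + sqrt lam * norm (y - x)) ^ ?L * jet N (wave_packet lam \<phi> x \<xi>) y
       \<le> B * lam ^ (DIM('a) + N) * (1 + norm \<xi>) ^ N" using jet_wave_packet_le[OF \<phi>] by blast
  let ?\<kappa> = "((1 + \<delta>) / \<delta>) ^ ?L"
  have \<kappa>: "?\<kappa> \<ge> 0" using \<delta> by simp
  show thesis
  proof (rule that[of "?\<kappa> * C * B"])
    show "0 \<le> ?\<kappa> * C * B" using C(1) B(1) \<kappa> by simp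
    fix a :: "'a \<Rightarrow> complex" and lam :: real and x \<xi> y :: 'a
    assume a: "smooth_fun a" and lam: "lam \<ge> 1" and 0: "\<And>y. y \<in> ball x \<delta> \<Longrightarrow> a y = 0"
    let ?F = "\<lambda>y. a y * wave_packet lam \<phi> x \<xi> y"
    show "lam ^ M * (1 + norm (y - x)) ^ M * jet N ?F y \<le> ?\<kappa> * C * B * jet N a y * (1 + norm \<xi>) ^ N"
    proof (cases "y \<in> ball x \<delta>")
      case True
      have "jet N ?F y = norm (0::complex)"
        by (rule jet_const_on[of "ball x \<delta>"]) (use 0 True in auto)
      then show ?thesis using \<kappa> C(1) B(1) by simp
    next
      case False
      then have y: "norm (y - x) \<ge> \<delta>" by (simp add: dist_norm norm_minus_commute)
      let ?t = "1 + norm (y - x)"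
      have "(sqrt lam * ?t) ^ ?L \<le> (((1 + \<delta>) / \<delta>) * (1 + sqrt lam * norm (y - x))) ^ ?L"
        using off_centre[OF \<delta> lam y] lam by (intro power_mono) auto
      moreover have "sqrt lam ^ ?L = lam ^ (M + DIM('a) + N)"
        unfolding power_mult using lam by simp
      then have "(sqrt lam * ?t) ^ ?L = lam ^ (M + DIM('a) + N) * ?t ^ ?L"
        by (simp only: power_mult_distrib)
      ultimately have 1: "lam ^ (M + DIM('a) + N) * ?t ^ ?L \<le> ?\<kappa> * (1 + sqrt lam * norm (y - x)) ^ ?L"
        by (simp only: power_mult_distrib)
      have J: "jet N ?F y \<le> C * (jet N a y * jet N (wave_packet lam \<phi> x \<xi>) y)"
        by (intro C a schwartzD_smooth schwartz_wave_packet \<phi> lam)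
      have "lam ^ (DIM('a) + N) * (lam ^ M * ?t ^ M * jet N ?F y) = lam ^ (M + DIM('a) + N) * ?t ^ M * jet N ?F y"
        by (simp add: power_add)
      also have "\<dots> \<le> lam ^ (M + DIM('a) + N) * ?t ^ ?L * (C * (jet N a y * jet N (wave_packet lam \<phi> x \<xi>) y))"
        using lam by (intro mult_mono J mult_left_mono power_increasing) auto
      also have "\<dots> \<le> ?\<kappa> * (1 + sqrt lam * norm (y - x)) ^ ?L * (C * (jet N a y * jet N (wave_packet lam \<phi> x \<xi>) y))"
        using C(1) by (intro mult_right_mono 1) auto
      also have "\<dots> = ?\<kappa> * C * jet N a y * ((1 + sqrt lam * norm (y - x)) ^ ?L * jet N (wave_packet lam \<phi> x \<xi>) y)"
        by (simp only: mult_ac)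
      also have "\<dots> \<le> ?\<kappa> * C * jet N a y * (B * lam ^ (DIM('a) + N) * (1 + norm \<xi>) ^ N)"
        using \<kappa> C(1) by (intro mult_left_mono B lam) auto
      also have "\<dots> = lam ^ (DIM('a) + N) * (?\<kappa> * C * B * jet N a y * (1 + norm \<xi>) ^ N)" by (simp only: mult_ac)
      finally show ?thesis using lam by (subst (asm) mult_le_cancel_left_pos) auto
    qed
  qed
qed

text \<open>Meant for \<open>a = 1 - chi\<close> and \<open>x\<close> near \<open>x0\<close>. The
  exponent \<open>P\<close> is the order of \<open>u\<close> and does not depend on
  \<open>M\<close>, so \<open>M\<close> can afterwards be raised by \<open>P\<close> to absorb the
  growth in a frequency proportional to \<open>lam\<close>.\<close>

lemma negligible_bounded_cutoff:
  fixes \<phi> :: "'a::euclidean_space \<Rightarrow> complex"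
  assumes u: "tempered u" and \<phi>: "schwartz \<phi>" and \<delta>: "\<delta> > 0"
    and a: "smooth_fun a" "\<And>N. \<exists>A. \<forall>y. jet N a y \<le> A"
  obtains P where "\<And>M. \<exists>C\<ge>0. \<forall>lam x \<xi>. lam \<ge> 1 \<longrightarrow> (\<forall>y\<in>ball x \<delta>. a y = 0) \<longrightarrow>
     lam ^ M * norm (u (\<lambda>y. a y * wave_packet lam \<phi> x \<xi> y)) \<le> C * (1 + norm x) ^ P * (1 + norm \<xi>) ^ P"
proof -
  obtain C N where C: "C \<ge> 0"
    "\<And>f B. schwartz f \<Longrightarrow> (\<And>y. (1 + norm y) ^ N * jet N f y \<le> B) \<Longrightarrow> norm (u f) \<le> C * B"
    using tempered_jet_bound[OF u] by blast
  obtain A where A: "\<And>y. jet N a y \<le> A" using a(2) by blast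
  have A0: "A \<ge> 0" using order_trans[OF jet_nonneg A] .
  show thesis
  proof (rule that[of N])
    fix M
    \<comment> \<open>The additional \<open>N\<close> powers of \<open>1 + norm (y - x)\<close>
      serve to move the weight of order \<open>N\<close> from \<open>y\<close> to
      \<open>x\<close>.\<close>
    let ?M = "M + N"
    obtain B where B: "B \<ge> 0"
      "\<And>a lam x \<xi> y. smooth_fun a \<Longrightarrow> lam \<ge> 1 \<Longrightarrow> (\<And>y. y \<in> ball x \<delta> \<Longrightarrow> a y = 0) \<Longrightarrow>
       lam ^ ?M * (1 + norm (y - x)) ^ ?M * jet N (\<lambda>y. a y * wave_packet lam \<phi> x \<xi> y) y
       \<le> B * jet N a y * (1 + norm \<xi>) ^ N" using jet_off_centre_le[OF \<phi> \<delta>] by blast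
    show "\<exists>C\<ge>0. \<forall>lam x \<xi>. lam \<ge> 1 \<longrightarrow> (\<forall>y\<in>ball x \<delta>. a y = 0) \<longrightarrow>
     lam ^ M * norm (u (\<lambda>y. a y * wave_packet lam \<phi> x \<xi> y)) \<le> C * (1 + norm x) ^ N * (1 + norm \<xi>) ^ N"
    proof (intro exI[of _ "C * (B * A)"] conjI allI impI)
      show "0 \<le> C * (B * A)" using C(1) B(1) A0 by simp
      fix lam :: real and x \<xi> :: 'a assume lam: "lam \<ge> 1" and 0: "\<forall>y\<in>ball x \<delta>. a y = 0"
      let ?F = "\<lambda>y. a y * wave_packet lam \<phi> x \<xi> y"
      have F: "schwartz ?F"
      proof (rule schwartz_mult_moderate[OF a(1) schwartz_wave_packet[OF \<phi> lam]])
        fix N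
        obtain A where "\<forall>y. jet N a y \<le> A" using a(2) by blast
        then have "\<forall>y. jet N a y \<le> A * (1 + norm y) ^ 0" by simp
        then show "\<exists>A k. \<forall>y. jet N a y \<le> A * (1 + norm y) ^ k" by blast
      qed
      have "norm (u ?F) \<le> C * ((1 + norm x) ^ N * (B * A * (1 + norm \<xi>) ^ N) / lam ^ M)"
      proof (rule C(2)[OF F])
        fix y
        have "(1 + norm y) ^ N \<le> ((1 + norm x) * (1 + norm (y - x))) ^ N"
          using one_plus_norm_le[of y x] by (intro power_mono) auto
        then have "lam ^ M * ((1 + norm y) ^ N * jet N ?F y) \<le> lam ^ M * (((1 + norm x) * (1 + norm (y - x))) ^ N * jet N ?F y)"
          using lam by (intro mult_left_mono mult_right_mono) auto
        also have "\<dots> = (1 + norm x) ^ N * (lam ^ M * (1 + norm (y - x)) ^ N * jet N ?F y)"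
          by (simp only: power_mult_distrib mult_ac)
        also have "\<dots> \<le> (1 + norm x) ^ N * (lam ^ ?M * (1 + norm (y - x)) ^ ?M * jet N ?F y)"
          using lam by (intro mult_left_mono mult_right_mono mult_mono power_increasing) auto
        also have "\<dots> \<le> (1 + norm x) ^ N * (B * jet N a y * (1 + norm \<xi>) ^ N)"
          using 0 by (intro mult_left_mono B a(1) lam) auto
        also have "\<dots> \<le> (1 + norm x) ^ N * (B * A * (1 + norm \<xi>) ^ N)"
          using B(1) by (intro mult_left_mono mult_right_mono A) auto
        finally show "(1 + norm y) ^ N * jet N ?F y \<le> (1 + norm x) ^ N * (B * A * (1 + norm \<xi>) ^ N) / lam ^ M"
          using lam by (simp add: pos_le_divide_eq mult.commute)
      qed
      then have "lam ^ M * norm (u ?F) \<le> lam ^ M * (C * ((1 + norm x) ^ N * (B * A * (1 + norm \<xi>) ^ N) / lam ^ M))"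
        using lam by (intro mult_left_mono) auto
      also have "\<dots> = C * (B * A) * (1 + norm x) ^ N * (1 + norm \<xi>) ^ N" using lam by simp
      finally show "lam ^ M * norm (u ?F) \<le> C * (B * A) * (1 + norm x) ^ N * (1 + norm \<xi>) ^ N" .
    qed
  qed
qed

text \<open>Meant for \<open>a = chi\<close> and \<open>x\<close> far from its support, where an
  integral over an unbounded set of \<open>x\<close> follows. The decay in \<open>x\<close> arises
  by splitting its weight into one on \<open>y\<close>, absorbed by the Schwartz function
  \<open>a\<close>, and one on \<open>y - x\<close>, absorbed by the packet.\<close>

lemma negligible_schwartz_cutoff:
  fixes \<phi> :: "'a::euclidean_space \<Rightarrow> complex"
  assumes u: "tempered u" and \<phi>: "schwartz \<phi>" and \<delta>: "\<delta> > 0" and a: "schwartz a"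
  obtains P where "\<And>M. \<exists>C\<ge>0. \<forall>lam x \<xi>. lam \<ge> 1 \<longrightarrow> (\<forall>y\<in>ball x \<delta>. a y = 0) \<longrightarrow>
     lam ^ M * (1 + norm x) ^ M * norm (u (\<lambda>y. a y * wave_packet lam \<phi> x \<xi> y)) \<le> C * (1 + norm \<xi>) ^ P"
proof -
  obtain C N where C: "C \<ge> 0"
    "\<And>f B. schwartz f \<Longrightarrow> (\<And>y. (1 + norm y) ^ N * jet N f y \<le> B) \<Longrightarrow> norm (u f) \<le> C * B"
    using tempered_jet_bound[OF u] by blast
  show thesis
  proof (rule that[of N])
    fix M
    obtain A where A: "A \<ge> 0" "\<And>y. (1 + norm y) ^ (N + M) * jet N a y \<le> A"
      using schwartz_jet_bound[OF a] by blast
    obtain B where B: "B \<ge> 0"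
      "\<And>a lam x \<xi> y. smooth_fun a \<Longrightarrow> lam \<ge> 1 \<Longrightarrow> (\<And>y. y \<in> ball x \<delta> \<Longrightarrow> a y = 0) \<Longrightarrow>
       lam ^ M * (1 + norm (y - x)) ^ M * jet N (\<lambda>y. a y * wave_packet lam \<phi> x \<xi> y) y
       \<le> B * jet N a y * (1 + norm \<xi>) ^ N" using jet_off_centre_le[OF \<phi> \<delta>] by blast
    show "\<exists>C\<ge>0. \<forall>lam x \<xi>. lam \<ge> 1 \<longrightarrow> (\<forall>y\<in>ball x \<delta>. a y = 0) \<longrightarrow>
     lam ^ M * (1 + norm x) ^ M * norm (u (\<lambda>y. a y * wave_packet lam \<phi> x \<xi> y)) \<le> C * (1 + norm \<xi>) ^ N"
    proof (intro exI[of _ "C * (B * A)"] conjI allI impI)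
      show "0 \<le> C * (B * A)" using C(1) B(1) A(1) by simp
      fix lam :: real and x \<xi> :: 'a assume lam: "lam \<ge> 1" and 0: "\<forall>y\<in>ball x \<delta>. a y = 0"
      let ?F = "\<lambda>y. a y * wave_packet lam \<phi> x \<xi> y"
      let ?w = "lam ^ M * (1 + norm x) ^ M"
      have w: "?w > 0" using lam by (intro mult_pos_pos zero_less_power add_pos_nonneg) auto
      have F: "schwartz ?F"
      proof (rule schwartz_mult_moderate[OF schwartzD_smooth[OF a] schwartz_wave_packet[OF \<phi> lam]])
        fix N
        obtain A where "\<And>y. (1 + norm y) ^ 0 * jet N a y \<le> A" using schwartz_jet_bound[OF a] by blast
        then have "\<forall>y. jet N a y \<le> A * (1 + norm y) ^ 0" by simp
        then show "\<exists>A k. \<forall>y. jet N a y \<le> A * (1 + norm y) ^ k" by blast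
      qed
      have "norm (u ?F) \<le> C * ((B * A * (1 + norm \<xi>) ^ N) / ?w)"
      proof (rule C(2)[OF F])
        fix y
        have "(1 + norm x) ^ M \<le> ((1 + norm y) * (1 + norm (y - x))) ^ M"
          using one_plus_norm_le[of x y] by (intro power_mono) (auto simp: norm_minus_commute)
        then have "?w * ((1 + norm y) ^ N * jet N ?F y) \<le> (lam ^ M * ((1 + norm y) * (1 + norm (y - x))) ^ M) * ((1 + norm y) ^ N * jet N ?F y)"
          using lam by (intro mult_right_mono mult_left_mono) auto
        also have "\<dots> = (1 + norm y) ^ (N + M) * (lam ^ M * (1 + norm (y - x)) ^ M * jet N ?F y)"
          by (simp only: power_mult_distrib power_add mult_ac)
        also have "\<dots> \<le> (1 + norm y) ^ (N + M) * (B * jet N a y * (1 + norm \<xi>) ^ N)"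
          using 0 by (intro mult_left_mono B schwartzD_smooth a lam) auto
        also have "\<dots> = B * ((1 + norm y) ^ (N + M) * jet N a y) * (1 + norm \<xi>) ^ N" by (simp only: mult_ac)
        also have "\<dots> \<le> B * A * (1 + norm \<xi>) ^ N"
          using B(1) by (intro mult_left_mono mult_right_mono A) auto
        finally show "(1 + norm y) ^ N * jet N ?F y \<le> (B * A * (1 + norm \<xi>) ^ N) / ?w"
          by (subst pos_le_divide_eq[OF w]) (simp only: mult.commute)
      qed
      then have "?w * norm (u ?F) \<le> ?w * (C * ((B * A * (1 + norm \<xi>) ^ N) / ?w))"
        using w by (intro mult_left_mono) auto
      also have "\<dots> = C * (B * A) * (1 + norm \<xi>) ^ N"
      proof -
        have "v * (C * (X / v)) = C * X" if "v > 0" for v X :: real using that by simp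
        from this[OF w] show ?thesis by (simp only: mult.assoc)
      qed
      finally show "?w * norm (u ?F) \<le> C * (B * A) * (1 + norm \<xi>) ^ N" .
    qed
  qed
qed

section \<open>Oscillatory integrals and continuous dependence on parameters\<close>

lemma integrable_osc:
  fixes c :: "'b \<Rightarrow> complex"
  assumes [measurable]: "c \<in> borel_measurable M" "s \<in> borel_measurable M"
    and "integrable M (\<lambda>\<eta>. (1 + norm (s \<eta>)) ^ k * norm (c \<eta>))"
    and [measurable]: "g \<in> borel_measurable M" and "\<And>\<eta>. \<eta> \<in> space M \<Longrightarrow> norm (g \<eta>) \<le> A * (1 + norm (s \<eta>)) ^ k"
  shows "integrable M (\<lambda>\<eta>. c \<eta> * g \<eta>)"
proof (rule Bochner_Integration.integrable_bound)
  show "integrable M (\<lambda>\<eta>. A * ((1 + norm (s \<eta>)) ^ k * norm (c \<eta>)))" using assms(3) by simp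
  show "AE \<eta> in M. norm (c \<eta> * g \<eta>) \<le> norm (A * ((1 + norm (s \<eta>)) ^ k * norm (c \<eta>)))"
  proof (rule AE_I2)
    fix \<eta> assume "\<eta> \<in> space M"
    then have "norm (c \<eta> * g \<eta>) \<le> norm (c \<eta>) * (A * (1 + norm (s \<eta>)) ^ k)"
      unfolding norm_mult by (intro mult_left_mono assms) auto
    also have "\<dots> = A * ((1 + norm (s \<eta>)) ^ k * norm (c \<eta>))" by simp
    also have "\<dots> \<le> norm (A * ((1 + norm (s \<eta>)) ^ k * norm (c \<eta>)))" by simp
    finally show "norm (c \<eta> * g \<eta>) \<le> norm (A * ((1 + norm (s \<eta>)) ^ k * norm (c \<eta>)))" .
  qed
qed measurable

lemma norm_iexp_minus_linear: "norm (exp (- \<i> * complex_of_real t) - 1 + \<i> * complex_of_real t) \<le> t\<^sup>2"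
proof -
  have "norm (iexp (- t) - (\<Sum>k\<le>1. (\<i> * complex_of_real (- t)) ^ k / fact k)) \<le> \<bar>- t\<bar> ^ Suc 1 / fact (Suc 1)"
    by (rule iexp_approx1)
  also have "\<dots> \<le> t\<^sup>2" by (simp add: power2_eq_square abs_mult[symmetric])
  finally show ?thesis by (simp add: algebra_simps)
qed

lemma norm_iexp_minus_one: "norm (exp (- \<i> * complex_of_real t) - 1) \<le> \<bar>t\<bar>"
proof -
  have "norm (iexp (- t) - (\<Sum>k\<le>0. (\<i> * complex_of_real (- t)) ^ k / fact k)) \<le> \<bar>- t\<bar> ^ Suc 0 / fact (Suc 0)"
    by (rule iexp_approx1)
  then show ?thesis by simp
qed

lemma norm_expi_diff_le: "norm (expi \<xi> y - expi \<eta> y) \<le> norm y * norm (\<xi> - \<eta>)"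
proof -
  have "expi \<xi> y - expi \<eta> y = expi \<eta> y * (expi (\<xi> - \<eta>) y - 1)"
    using expi_add[of \<eta> "\<xi> - \<eta>" y] by (simp add: algebra_simps)
  then have "norm (expi \<xi> y - expi \<eta> y) = norm (expi (\<xi> - \<eta>) y - 1)" by (simp add: norm_mult)
  also have "\<dots> \<le> \<bar>y \<bullet> (\<xi> - \<eta>)\<bar>" unfolding expi_def by (rule norm_iexp_minus_one)
  also have "\<dots> \<le> norm y * norm (\<xi> - \<eta>)" by (rule Cauchy_Schwarz_ineq2)
  finally show ?thesis .
qed

text \<open>An amplitude \<open>c\<close> with a frequency map \<open>s\<close>. Two instances are
  needed side by side: \<open>s\<close> the identity, which gives \<open>FT c\<close>, and
  \<open>s\<close> a simple function, which gives a finite sum of characters. Finite moments of all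
  orders permit repeated differentiation under the integral.\<close>

locale moderate_family =
  fixes c :: "'a::euclidean_space \<Rightarrow> complex" and s :: "'a \<Rightarrow> 'a"
  assumes c_meas [measurable]: "c \<in> borel_measurable borel"
    and s_meas [measurable]: "s \<in> borel_measurable borel"
    and moments: "\<And>k. integrable lborel (\<lambda>\<eta>. (1 + norm (s \<eta>)) ^ k * norm (c \<eta>))"
begin

lemma integrable_times:
  assumes [measurable]: "g \<in> borel_measurable borel" and "\<And>\<eta>. norm (g \<eta>) \<le> A * (1 + norm (s \<eta>)) ^ k"
  shows "integrable lborel (\<lambda>\<eta>. c \<eta> * g \<eta>)"
  by (rule integrable_osc[OF _ _ moments[of k]]) (use assms in auto)

text \<open>The remainder is estimated explicitly: the second-order Taylor bound of the exponential
  leaves the squared increment times the second moment, so no limit theorem is involved.\<close>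

lemma has_derivative_osc:
  "((\<lambda>y. \<integral>\<eta>. c \<eta> * expi (s \<eta>) y \<partial>lborel) has_derivative
     (\<lambda>h. \<integral>\<eta>. c \<eta> * (- \<i> * complex_of_real (h \<bullet> s \<eta>) * expi (s \<eta>) y) \<partial>lborel)) (at y)"
proof (rule has_derivativeI_sandwich[of 1])
  let ?D = "\<lambda>h. \<integral>\<eta>. c \<eta> * (- \<i> * complex_of_real (h \<bullet> s \<eta>) * expi (s \<eta>) y) \<partial>lborel"
  let ?m = "\<lambda>k. \<integral>\<eta>. (1 + norm (s \<eta>)) ^ k * norm (c \<eta>) \<partial>lborel"
  have b1: "\<bar>h \<bullet> s \<eta>\<bar> \<le> norm h * (1 + norm (s \<eta>))" for h \<eta>
    using Cauchy_Schwarz_ineq2[of h "s \<eta>"] by (simp add: distrib_left add_increasing)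
  have i1: "integrable lborel (\<lambda>\<eta>. c \<eta> * (- \<i> * complex_of_real (h \<bullet> s \<eta>) * expi (s \<eta>) y))" for h
    by (rule integrable_times[of _ "norm h" 1]) (use b1 in \<open>auto simp: norm_mult\<close>)
  have i0: "integrable lborel (\<lambda>\<eta>. c \<eta> * expi (s \<eta>) z)" for z
    by (rule integrable_times[of _ 1 0]) auto
  show "bounded_linear ?D"
  proof (rule bounded_linear_intro[where K = "?m 1"])
    show "?D (h + k) = ?D h + ?D k" for h k
      by (subst Bochner_Integration.integral_add[OF i1 i1, symmetric]) (simp add: inner_add_left algebra_simps)
    show "?D (r *\<^sub>R h) = r *\<^sub>R ?D h" for r h
      by (subst integral_scaleR_right[symmetric]) (simp add: scaleR_conv_of_real mult_ac)
    show "norm (?D h) \<le> norm h * ?m 1" for h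
    proof -
      have "norm (?D h) \<le> (\<integral>\<eta>. norm h * ((1 + norm (s \<eta>)) ^ 1 * norm (c \<eta>)) \<partial>lborel)"
      proof (rule Bochner_Integration.integral_norm_bound_integral[OF i1])
        show "integrable lborel (\<lambda>\<eta>. norm h * ((1 + norm (s \<eta>)) ^ 1 * norm (c \<eta>)))"
          by (intro integrable_mult_right moments)
        show "norm (c \<eta> * (- \<i> * complex_of_real (h \<bullet> s \<eta>) * expi (s \<eta>) y)) \<le> norm h * ((1 + norm (s \<eta>)) ^ 1 * norm (c \<eta>))" for \<eta>
          using mult_right_mono[OF b1[of h \<eta>] norm_ge_zero[of "c \<eta>"]] by (simp add: norm_mult mult_ac)
      qed
      then show ?thesis by simp
    qed
  qed
  show "norm ((\<integral>\<eta>. c \<eta> * expi (s \<eta>) z \<partial>lborel) - (\<integral>\<eta>. c \<eta> * expi (s \<eta>) y \<partial>lborel) - ?D (z - y)) / norm (z - y)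
      \<le> norm (z - y) * ?m 2" if "z \<noteq> y" for z
  proof -
    let ?h = "z - y"
    let ?r = "\<lambda>\<eta>. c \<eta> * expi (s \<eta>) z - c \<eta> * expi (s \<eta>) y - c \<eta> * (- \<i> * complex_of_real (?h \<bullet> s \<eta>) * expi (s \<eta>) y)"
    have "norm (\<integral>\<eta>. ?r \<eta> \<partial>lborel) \<le> (\<integral>\<eta>. (norm ?h)\<^sup>2 * ((1 + norm (s \<eta>)) ^ 2 * norm (c \<eta>)) \<partial>lborel)"
    proof (rule Bochner_Integration.integral_norm_bound_integral)
      show "integrable lborel ?r" by (intro Bochner_Integration.integrable_diff i0 i1)
      show "integrable lborel (\<lambda>\<eta>. (norm ?h)\<^sup>2 * ((1 + norm (s \<eta>)) ^ 2 * norm (c \<eta>)))"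
        by (intro integrable_mult_right moments)
      fix \<eta>
      have "expi (s \<eta>) z = expi (s \<eta>) y * expi (s \<eta>) ?h"
        by (simp add: expi_add_right[symmetric])
      then have "?r \<eta> = c \<eta> * expi (s \<eta>) y * (expi (s \<eta>) ?h - 1 + \<i> * complex_of_real (?h \<bullet> s \<eta>))"
        by (simp add: algebra_simps)
      then have "norm (?r \<eta>) = norm (c \<eta>) * norm (expi (s \<eta>) ?h - 1 + \<i> * complex_of_real (?h \<bullet> s \<eta>))"
        by (simp only: norm_mult norm_expi mult_1_right)
      also have "\<dots> \<le> norm (c \<eta>) * (?h \<bullet> s \<eta>)\<^sup>2"
        unfolding expi_def by (intro mult_left_mono norm_iexp_minus_linear) auto
      also have "\<dots> \<le> norm (c \<eta>) * (norm ?h * (1 + norm (s \<eta>)))\<^sup>2"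
        using power_mono[OF b1[of ?h \<eta>], of 2] by (intro mult_left_mono) auto
      finally show "norm (?r \<eta>) \<le> (norm ?h)\<^sup>2 * ((1 + norm (s \<eta>)) ^ 2 * norm (c \<eta>))"
        by (simp add: power_mult_distrib mult_ac)
    qed
    moreover have "(\<integral>\<eta>. ?r \<eta> \<partial>lborel) = (\<integral>\<eta>. c \<eta> * expi (s \<eta>) z \<partial>lborel) - (\<integral>\<eta>. c \<eta> * expi (s \<eta>) y \<partial>lborel) - ?D ?h"
      by (simp only: Bochner_Integration.integral_diff[OF Bochner_Integration.integrable_diff[OF i0 i0] i1]
          Bochner_Integration.integral_diff[OF i0 i0])
    ultimately have "norm ((\<integral>\<eta>. c \<eta> * expi (s \<eta>) z \<partial>lborel) - (\<integral>\<eta>. c \<eta> * expi (s \<eta>) y \<partial>lborel) - ?D ?h) \<le> (norm ?h)\<^sup>2 * ?m 2"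
      by simp
    then show ?thesis using that by (simp add: divide_le_eq power2_eq_square mult_ac)
  qed
  have "((\<lambda>z. norm (z - y) * ?m 2) \<longlongrightarrow> norm (y - y) * ?m 2) (at y)"
    by (intro tendsto_intros)
  then show "((\<lambda>z. norm (z - y) * ?m 2) \<longlongrightarrow> 0) (at y)" by simp
qed auto

lemma moderate_family_mono_symb:
  assumes "set vs \<subseteq> Basis"
  shows "moderate_family (\<lambda>\<eta>. c \<eta> * mono_symb vs (s \<eta>)) s"
proof
  show m: "(\<lambda>\<eta>. c \<eta> * mono_symb vs (s \<eta>)) \<in> borel_measurable borel" "s \<in> borel_measurable borel" by measurable
  fix k
  show "integrable lborel (\<lambda>\<eta>. (1 + norm (s \<eta>)) ^ k * norm (c \<eta> * mono_symb vs (s \<eta>)))"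
  proof (rule Bochner_Integration.integrable_bound[OF moments[of "k + length vs"]])
    show "(\<lambda>\<eta>. (1 + norm (s \<eta>)) ^ k * norm (c \<eta> * mono_symb vs (s \<eta>))) \<in> borel_measurable lborel" by measurable
    show "AE \<eta> in lborel. norm ((1 + norm (s \<eta>)) ^ k * norm (c \<eta> * mono_symb vs (s \<eta>))) \<le>
       norm ((1 + norm (s \<eta>)) ^ (k + length vs) * norm (c \<eta>))"
    proof (rule AE_I2)
      fix \<eta>
      have "norm (mono_symb vs (s \<eta>)) \<le> (1 + norm (s \<eta>)) ^ length vs"
        by (rule order_trans[OF norm_mono_symb_le[OF assms]]) (auto intro: power_mono)
      then have "(1 + norm (s \<eta>)) ^ k * (norm (c \<eta>) * norm (mono_symb vs (s \<eta>))) \<le>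
        (1 + norm (s \<eta>)) ^ k * (norm (c \<eta>) * (1 + norm (s \<eta>)) ^ length vs)"
        by (intro mult_left_mono) auto
      then show "norm ((1 + norm (s \<eta>)) ^ k * norm (c \<eta> * mono_symb vs (s \<eta>))) \<le>
       norm ((1 + norm (s \<eta>)) ^ (k + length vs) * norm (c \<eta>))"
        by (simp add: norm_mult power_add mult_ac)
    qed
  qed
qed

lemma
  shows smooth_fun_osc: "smooth_fun (\<lambda>y. \<integral>\<eta>. c \<eta> * expi (s \<eta>) y \<partial>lborel)"
    and iter_deriv_osc: "set vs \<subseteq> Basis \<Longrightarrow> iter_deriv vs (\<lambda>y. \<integral>\<eta>. c \<eta> * expi (s \<eta>) y \<partial>lborel) =
      (\<lambda>y. \<integral>\<eta>. c \<eta> * mono_symb vs (s \<eta>) * expi (s \<eta>) y \<partial>lborel)"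
proof -
  define G where "G = (\<lambda>vs y. \<integral>\<eta>. c \<eta> * mono_symb vs (s \<eta>) * expi (s \<eta>) y \<partial>lborel)"
  have *: "\<exists>D. (G vs has_derivative D) (at x) \<and> (\<forall>v\<in>Basis. D v = G (v # vs) x)"
    if vs: "set vs \<subseteq> Basis" for vs x
  proof -
    interpret m: moderate_family "\<lambda>\<eta>. c \<eta> * mono_symb vs (s \<eta>)" s by (rule moderate_family_mono_symb[OF vs])
    show ?thesis
      unfolding G_def by (rule exI, rule conjI, rule m.has_derivative_osc) (simp add: mult_ac)
  qed
  have 0: "G [] = (\<lambda>y. \<integral>\<eta>. c \<eta> * expi (s \<eta>) y \<partial>lborel)" by (simp add: G_def)
  show "smooth_fun (\<lambda>y. \<integral>\<eta>. c \<eta> * expi (s \<eta>) y \<partial>lborel)"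
    using smooth_fun_family[OF 0 *] by blast
  show "iter_deriv vs (\<lambda>y. \<integral>\<eta>. c \<eta> * expi (s \<eta>) y \<partial>lborel) =
      (\<lambda>y. \<integral>\<eta>. c \<eta> * mono_symb vs (s \<eta>) * expi (s \<eta>) y \<partial>lborel)" if "set vs \<subseteq> Basis"
    using iter_deriv_eq_family[OF 0 * that] unfolding G_def by blast
qed

lemma integrable_osc_mono_symb:
  assumes "set vs \<subseteq> Basis"
  shows "integrable lborel (\<lambda>\<eta>. c \<eta> * mono_symb vs (s \<eta>) * expi (s \<eta>) y)"
proof -
  interpret m: moderate_family "\<lambda>\<eta>. c \<eta> * mono_symb vs (s \<eta>)" s by (rule moderate_family_mono_symb[OF assms])
  show ?thesis by (rule m.integrable_times[of _ 1 0]) auto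
qed

lemma jet_osc_bounded: "\<exists>A. \<forall>y. jet N (\<lambda>y. \<integral>\<eta>. c \<eta> * expi (s \<eta>) y \<partial>lborel) y \<le> A"
proof (intro exI allI)
  fix y
  show "jet N (\<lambda>y. \<integral>\<eta>. c \<eta> * expi (s \<eta>) y \<partial>lborel) y \<le>
     (\<Sum>vs\<in>indices N. \<integral>\<eta>. norm (c \<eta> * mono_symb vs (s \<eta>)) \<partial>lborel)"
    unfolding jet_def
  proof (rule sum_mono)
    fix vs :: "'a list" assume "vs \<in> indices N"
    then have vs: "set vs \<subseteq> Basis" by simp
    show "norm (iter_deriv vs (\<lambda>y. \<integral>\<eta>. c \<eta> * expi (s \<eta>) y \<partial>lborel) y) \<le> (\<integral>\<eta>. norm (c \<eta> * mono_symb vs (s \<eta>)) \<partial>lborel)"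
      unfolding iter_deriv_osc[OF vs]
      using integral_norm_bound[of lborel "\<lambda>\<eta>. c \<eta> * mono_symb vs (s \<eta>) * expi (s \<eta>) y"] by (simp add: norm_mult)
  qed
qed

end

section \<open>Continuous dependence of \<open>u\<close> on parameters of the test function\<close>

lemma iter_deriv_diff:
  assumes "smooth_fun f" "smooth_fun g" "set vs \<subseteq> Basis"
  shows "iter_deriv vs (\<lambda>x. f x - g x) = (\<lambda>x. iter_deriv vs f x - iter_deriv vs g x)"
proof -
  have "iter_deriv vs (\<lambda>x. f x + (-1) * g x) = (\<lambda>x. iter_deriv vs f x + (-1) * iter_deriv vs g x)"
    by (simp only: iter_deriv_add[OF assms(1) smooth_fun_cmult[OF assms(2)] assms(3)]
        iter_deriv_bounded_linear[OF assms(2) bounded_linear_mult_right assms(3)])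
  then show ?thesis by simp
qed

lemma smooth_fun_diff: "smooth_fun f \<Longrightarrow> smooth_fun g \<Longrightarrow> smooth_fun (\<lambda>x. f x - g x)"
  using smooth_fun_add[of f "\<lambda>x. (-1) * g x"] smooth_fun_cmult[of g "-1"] by simp

lemma schwartz_diff: "schwartz f \<Longrightarrow> schwartz g \<Longrightarrow> schwartz (\<lambda>x. f x - g x)"
  using schwartz_add[of f "\<lambda>x. (-1) * g x"] schwartz_cmult[of g "-1"] by simp

text \<open>The weighted jet of \<open>F p - F p0\<close> is split at a radius \<open>R\<close>.
  Beyond it, one spare power of the weight makes the locally uniform bounds small; inside, the
  derivatives are close uniformly in \<open>y\<close> because the ball is compact.\<close>

lemma tempered_continuous:
  fixes u :: "('a::euclidean_space \<Rightarrow> complex) \<Rightarrow> complex" and F :: "'p::metric_space \<Rightarrow> 'a \<Rightarrow> complex"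
  assumes u: "tempered u" and F: "\<And>p. schwartz (F p)"
    and cont: "\<And>vs. set vs \<subseteq> Basis \<Longrightarrow> continuous_on UNIV (\<lambda>(p, y). iter_deriv vs (F p) y)"
    and bound: "\<And>p0 k N. \<exists>d>0. \<exists>B. \<forall>p\<in>ball p0 d. \<forall>y. (1 + norm y) ^ k * jet N (F p) y \<le> B"
  shows "continuous_on UNIV (\<lambda>p. u (F p))"
  unfolding continuous_on_iff
proof (intro ballI allI impI)
  fix p0 and \<epsilon> :: real assume \<epsilon>: "\<epsilon> > 0"
  obtain C N where C: "C \<ge> 0"
    "\<And>f B. schwartz f \<Longrightarrow> (\<And>y. (1 + norm y) ^ N * jet N f y \<le> B) \<Longrightarrow> norm (u f) \<le> C * B"
    using tempered_jet_bound[OF u] by blast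
  \<comment> \<open>The denominator is \<open>C + 1\<close> because \<open>C\<close> may be
    0.\<close>
  define e where "e = \<epsilon> / (C + 1)"
  have e: "e > 0" unfolding e_def using \<epsilon> C(1) by simp
  obtain d B where d: "d > 0" and B: "\<And>p y. p \<in> ball p0 d \<Longrightarrow> (1 + norm y) ^ (N + 1) * jet N (F p) y \<le> B"
    using bound[of p0 "N + 1" N] by blast
  \<comment> \<open>Chosen so that the tail bound \<open>2 * B\<close>, divided by the spare factor
    \<open>1 + norm y\<close>, is at most \<open>e\<close> once \<open>norm y > R\<close>.\<close>
  define R where "R = max 0 (2 * B / e)"
  have R: "R \<ge> 0" "2 * B \<le> e * (1 + R)"
  proof -
    show "R \<ge> 0" unfolding R_def by simp
    have "2 * B / e \<le> 1 + R" unfolding R_def by simp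
    then show "2 * B \<le> e * (1 + R)" using e by (simp add: pos_divide_le_eq mult.commute)
  qed
  let ?n = "real (card (indices N :: 'a list set))"
  have n: "?n > 0"
  proof -
    have "[] \<in> (indices N :: 'a list set)" by simp
    then have "(indices N :: 'a list set) \<noteq> {}" by blast
    then show ?thesis using card_gt_0_iff[of "indices N :: 'a list set"] by simp
  qed
  have pR: "0 < (1 + R) ^ N" using R(1) by simp
  let ?e = "e / (?n * (1 + R) ^ N)"
  have e': "?e > 0" using e n pR by simp
  have "\<exists>X. p0 \<in> X \<and> open X \<and> (\<forall>p\<in>X. \<forall>y\<in>cball 0 R. dist (iter_deriv vs (F p) y) (iter_deriv vs (F p0) y) \<le> ?e)"
    if "vs \<in> indices N" for vs
  proof -
    have "continuous_on (UNIV \<times> cball 0 R) (\<lambda>(p, y). iter_deriv vs (F p) y)"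
      using cont[of vs] that continuous_on_subset by blast
    from this compact_cball UNIV_I[of p0] e' obtain X where X: "p0 \<in> X" "open X"
      "\<forall>p\<in>X \<inter> UNIV. \<forall>y\<in>cball 0 R. dist (case (p, y) of (p, y) \<Rightarrow> iter_deriv vs (F p) y) (case (p0, y) of (p, y) \<Rightarrow> iter_deriv vs (F p) y) \<le> ?e"
      by (rule continuous_on_prod_compactE)
    from X(3) have "\<forall>p\<in>X. \<forall>y\<in>cball 0 R. dist (iter_deriv vs (F p) y) (iter_deriv vs (F p0) y) \<le> ?e"
      by simp
    with X(1,2) show ?thesis by (intro exI[of _ X]) simp
  qed
  from bchoice[OF ballI[OF this]]
  obtain X where "\<forall>vs\<in>indices N. p0 \<in> X vs \<and> open (X vs) \<and>
      (\<forall>p\<in>X vs. \<forall>y\<in>cball 0 R. dist (iter_deriv vs (F p) y) (iter_deriv vs (F p0) y) \<le> ?e)" ..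
  note X = bspec[OF this]
  have "open (ball p0 d \<inter> (\<Inter>vs\<in>indices N. X vs))" using X by (intro open_Int open_INT) auto
  moreover have "p0 \<in> ball p0 d \<inter> (\<Inter>vs\<in>indices N. X vs)" using X d by auto
  ultimately obtain \<delta> where \<delta>: "\<delta> > 0" "ball p0 \<delta> \<subseteq> ball p0 d \<inter> (\<Inter>vs\<in>indices N. X vs)"
    using open_contains_ball by meson
  show "\<exists>\<delta>>0. \<forall>p\<in>UNIV. dist p p0 < \<delta> \<longrightarrow> dist (u (F p)) (u (F p0)) < \<epsilon>"
  proof (intro exI[of _ \<delta>] conjI ballI impI \<delta>(1))
    fix p assume "dist p p0 < \<delta>"
    then have p: "p \<in> ball p0 d" "\<And>vs. vs \<in> indices N \<Longrightarrow> p \<in> X vs" using \<delta>(2) by (auto simp: dist_commute subset_eq)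
    have p0: "p0 \<in> ball p0 d" using d by simp
    let ?G = "\<lambda>y. F p y - F p0 y"
    have sm: "smooth_fun (F p)" "smooth_fun (F p0)" using F schwartzD_smooth by blast+
    have jet: "jet N ?G y = (\<Sum>vs\<in>indices N. dist (iter_deriv vs (F p) y) (iter_deriv vs (F p0) y))" for y
      unfolding jet_def dist_norm by (rule sum.cong[OF refl]) (simp add: iter_deriv_diff[OF sm])
    have "norm (u ?G) \<le> C * e"
    proof (rule C(2)[OF schwartz_diff[OF F F]])
      fix y
      show "(1 + norm y) ^ N * jet N ?G y \<le> e"
      proof (cases "norm y \<le> R")
        case True
        have "jet N ?G y \<le> ?n * ?e"
          unfolding jet using X p True by (intro sum_bounded_above) auto
        then have "(1 + norm y) ^ N * jet N ?G y \<le> (1 + R) ^ N * (?n * ?e)"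
          using True R(1) by (intro mult_mono power_mono) auto
        also have "\<dots> = e"
        proof -
          have "a * (b * (e / (b * a))) = e" if "a > 0" "b > 0" for a b using that by simp
          from this[OF pR n] show ?thesis .
        qed
        finally show ?thesis .
      next
        case False
        have "jet N ?G y \<le> jet N (F p) y + jet N (F p0) y"
          unfolding jet_def sum.distrib[symmetric]
          by (intro sum_mono) (simp add: iter_deriv_diff[OF sm] norm_triangle_ineq4)
        then have "(1 + norm y) ^ (N + 1) * jet N ?G y \<le> (1 + norm y) ^ (N + 1) * (jet N (F p) y + jet N (F p0) y)"
          by (intro mult_left_mono) auto
        also have "\<dots> \<le> 2 * B" using B[OF p(1), of y] B[OF p0, of y] by (simp add: distrib_left)
        also have "\<dots> \<le> e * (1 + R)" by (rule R(2))
        also have "\<dots> \<le> e * (1 + norm y)" using False e by (intro mult_left_mono) auto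
        finally have "(1 + norm y) * ((1 + norm y) ^ N * jet N ?G y) \<le> (1 + norm y) * e" by (simp add: mult_ac)
        moreover have "0 < 1 + norm y" by (intro add_pos_nonneg) auto
        ultimately show ?thesis by (subst (asm) mult_le_cancel_left_pos)
      qed
    qed
    also have "C * e < \<epsilon>" unfolding e_def using C(1) \<epsilon> by (simp add: pos_divide_less_eq field_simps)
    finally show "dist (u (F p)) (u (F p0)) < \<epsilon>"
      using tempered_diff[OF u F F, of p p0] by (simp add: dist_norm)
  qed
qed

lemma continuous_on_sum_list:
  fixes f :: "'b \<Rightarrow> 'c::topological_space \<Rightarrow> 'd::real_normed_vector"
  assumes "\<And>p. p \<in> set ps \<Longrightarrow> continuous_on S (f p)"
  shows "continuous_on S (\<lambda>x. \<Sum>p\<leftarrow>ps. f p x)"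
  using assms by (induction ps) (auto intro!: continuous_intros)

text \<open>Joint continuity in \<open>(x, \<xi>)\<close> at fixed \<open>lam\<close> is what makes
  the integrands below Borel measurable. The Leibniz rule gives the derivatives explicitly, and on a
  unit ball of parameters the packets obey common weighted bounds.\<close>

lemma continuous_wave_packet:
  fixes \<phi> :: "'a::euclidean_space \<Rightarrow> complex"
  assumes u: "tempered u" and \<phi>: "schwartz \<phi>" and lam: "lam \<ge> 1"
  shows "continuous_on UNIV (\<lambda>(x, \<xi>). u (wave_packet lam \<phi> x \<xi>))"
proof -
  let ?F = "\<lambda>p. wave_packet lam \<phi> (fst p) (snd p)"
  have "continuous_on UNIV (\<lambda>p. u (?F p))"
  proof (rule tempered_continuous[OF u])
    show "schwartz (?F p)" for p by (rule schwartz_wave_packet[OF \<phi> lam])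
    fix vs :: "'a list" assume vs: "set vs \<subseteq> Basis"
    let ?w = "\<lambda>z. cnj (scale_win lam \<phi> z)"
    have w: "smooth_fun ?w" using \<phi> lam by (intro smooth_fun_cnj schwartzD_smooth schwartz_scale_win)
    have eq: "iter_deriv vs (?F p) y = (\<Sum>q\<leftarrow>splits vs. iter_deriv (fst q) ?w (y - fst p) * (mono_symb (snd q) (snd p) * expi (snd p) y))" for p y
    proof -
      have "iter_deriv vs (?F p) y = (\<Sum>q\<leftarrow>splits vs. iter_deriv (fst q) (\<lambda>y. ?w (y - fst p)) y * iter_deriv (snd q) (expi (snd p)) y)"
        unfolding wave_packet_def[abs_def]
        by (subst iter_deriv_mult[OF smooth_fun_translate[OF w] smooth_fun_expi vs]) simp
      also have "\<dots> = (\<Sum>q\<leftarrow>splits vs. iter_deriv (fst q) ?w (y - fst p) * (mono_symb (snd q) (snd p) * expi (snd p) y))"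
      proof (rule arg_cong[of _ _ sum_list], rule map_cong[OF refl])
        fix q assume "q \<in> set (splits vs)"
        then have q: "set (fst q) \<subseteq> Basis" "set (snd q) \<subseteq> Basis" using splits_bounds vs by blast+
        show "iter_deriv (fst q) (\<lambda>y. ?w (y - fst p)) y * iter_deriv (snd q) (expi (snd p)) y =
           iter_deriv (fst q) ?w (y - fst p) * (mono_symb (snd q) (snd p) * expi (snd p) y)"
          using iter_deriv_affine[OF w q(1), of 1 "fst p"] iter_deriv_expi[OF q(2), of "snd p"] by simp
      qed
      finally show ?thesis .
    qed
    have "continuous_on UNIV (\<lambda>r. \<Sum>q\<leftarrow>splits vs. iter_deriv (fst q) ?w (snd r - fst (fst r)) *
        (mono_symb (snd q) (snd (fst r)) * expi (snd (fst r)) (snd r)))"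
    proof (rule continuous_on_sum_list)
      fix q assume "q \<in> set (splits vs)"
      then have q: "set (fst q) \<subseteq> Basis" using splits_bounds vs by blast
      show "continuous_on UNIV (\<lambda>r. iter_deriv (fst q) ?w (snd r - fst (fst r)) *
        (mono_symb (snd q) (snd (fst r)) * expi (snd (fst r)) (snd r)))"
        by (intro continuous_intros continuous_on_compose2[OF continuous_on_iter_deriv[OF w q, of UNIV]]) auto
    qed
    then show "continuous_on UNIV (\<lambda>(p, y). iter_deriv vs (?F p) y)"
      unfolding eq by (simp add: case_prod_beta')
  next
    fix p0 :: "'a \<times> 'a" and k N
    obtain B where B: "B \<ge> 0"
      "\<And>lam x \<xi> y. lam \<ge> 1 \<Longrightarrow> (1 + sqrt lam * norm (y - x)) ^ k * jet N (wave_packet lam \<phi> x \<xi>) y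
       \<le> B * lam ^ (DIM('a) + N) * (1 + norm \<xi>) ^ N" using jet_wave_packet_le[OF \<phi>] by blast
    let ?K = "(2 + norm (fst p0)) ^ k * (B * lam ^ (DIM('a) + N) * (2 + norm (snd p0)) ^ N)"
    have "(1 + norm y) ^ k * jet N (?F p) y \<le> ?K" if "p \<in> ball p0 1" for p y
    proof -
      have n: "1 + norm (fst p) \<le> 2 + norm (fst p0)" "1 + norm (snd p) \<le> 2 + norm (snd p0)"
      proof -
        have "dist p p0 < 1" using that by (simp add: dist_commute)
        then have "norm (fst p - fst p0) \<le> 1" "norm (snd p - snd p0) \<le> 1"
          using dist_fst_le[of p p0] dist_snd_le[of p p0] unfolding dist_norm by linarith+
        then show "1 + norm (fst p) \<le> 2 + norm (fst p0)" "1 + norm (snd p) \<le> 2 + norm (snd p0)"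
          using norm_triangle_ineq2[of "fst p" "fst p0"] norm_triangle_ineq2[of "snd p" "snd p0"] by linarith+
      qed
      have "1 + norm (y - fst p) \<le> 1 + sqrt lam * norm (y - fst p)"
        using lam mult_right_mono[of 1 "sqrt lam" "norm (y - fst p)"] by simp
      then have "(1 + norm (fst p)) * (1 + norm (y - fst p)) \<le> (2 + norm (fst p0)) * (1 + sqrt lam * norm (y - fst p))"
        using n by (intro mult_mono) auto
      then have "(1 + norm y) ^ k \<le> ((2 + norm (fst p0)) * (1 + sqrt lam * norm (y - fst p))) ^ k"
        using one_plus_norm_le[of y "fst p"] by (intro power_mono) auto
      then have "(1 + norm y) ^ k * jet N (?F p) y \<le> ((2 + norm (fst p0)) * (1 + sqrt lam * norm (y - fst p))) ^ k * jet N (?F p) y"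
        by (intro mult_right_mono) auto
      also have "\<dots> = (2 + norm (fst p0)) ^ k * ((1 + sqrt lam * norm (y - fst p)) ^ k * jet N (?F p) y)"
        by (simp only: power_mult_distrib mult.assoc)
      also have "\<dots> \<le> (2 + norm (fst p0)) ^ k * (B * lam ^ (DIM('a) + N) * (1 + norm (snd p)) ^ N)"
        by (intro mult_left_mono B lam) auto
      also have "\<dots> \<le> ?K"
        using B(1) lam n by (intro mult_left_mono power_mono) auto
      finally show ?thesis .
    qed
    then show "\<exists>d>0. \<exists>B. \<forall>p\<in>ball p0 d. \<forall>y. (1 + norm y) ^ k * jet N (?F p) y \<le> B"
      by (intro exI[of _ 1] conjI exI[of _ ?K]) auto
  qed
  then show ?thesis by (simp add: case_prod_beta')
qed

text \<open>At \<open>lam = 1\<close> and centre 0 a packet is just a Schwartz function times a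
  character. Continuity and growth of the transform of \<open>\<psi> u\<close> thus become special
  cases of the results on packets.\<close>

lemma wave_packet_1: "wave_packet 1 (\<lambda>y. cnj (\<psi> y)) 0 \<xi> y = \<psi> y * expi \<xi> y"
  by (simp add: wave_packet_def scale_win_def)

lemma
  assumes u: "tempered u" and \<psi>: "schwartz \<psi>"
  shows continuous_tempered_expi: "continuous_on UNIV (\<lambda>\<xi>. u (\<lambda>y. \<psi> y * expi \<xi> y))"
    and tempered_expi_bound: "\<exists>C P. C \<ge> 0 \<and> (\<forall>\<xi>. norm (u (\<lambda>y. \<psi> y * expi \<xi> y)) \<le> C * (1 + norm \<xi>) ^ P)"
proof -
  have s: "schwartz (\<lambda>y. cnj (\<psi> y))" using \<psi> by (rule schwartz_cnj)
  have "continuous_on UNIV (\<lambda>\<xi>. (\<lambda>(x, \<xi>). u (wave_packet 1 (\<lambda>y. cnj (\<psi> y)) x \<xi>)) (0, \<xi>))"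
    by (rule continuous_on_compose2[OF continuous_wave_packet[OF u s]]) (auto intro: continuous_intros)
  then show "continuous_on UNIV (\<lambda>\<xi>. u (\<lambda>y. \<psi> y * expi \<xi> y))"
    by (simp add: wave_packet_1[abs_def])
  obtain C P where "C \<ge> 0" "\<And>lam x \<xi>. lam \<ge> 1 \<Longrightarrow>
     norm (u (wave_packet lam (\<lambda>y. cnj (\<psi> y)) x \<xi>)) \<le> C * lam ^ P * (1 + norm x) ^ P * (1 + norm \<xi>) ^ P"
    using wave_packet_poly_bound[OF u s] by blast
  from this(1) this(2)[of 1 0]
  show "\<exists>C P. C \<ge> 0 \<and> (\<forall>\<xi>. norm (u (\<lambda>y. \<psi> y * expi \<xi> y)) \<le> C * (1 + norm \<xi>) ^ P)"
    by (intro exI[of _ C] exI[of _ P]) (simp add: wave_packet_1[abs_def])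
qed

section \<open>Exchanging a tempered distribution with a Fourier integral\<close>

lemma jet_le_seminorm:
  assumes "schwartz f"
  shows "(1 + norm y) ^ N * jet N f y \<le> schwartz_seminorm N f"
  unfolding jet_def schwartz_seminorm_def sum_distrib_left
proof (rule sum_mono)
  fix vs :: "'a list" assume "vs \<in> indices N"
  then have "bounded (range (\<lambda>x. (1 + norm x) ^ N * norm (iter_deriv vs f x)))"
    using assms unfolding schwartz_def by blast
  then show "(1 + norm y) ^ N * norm (iter_deriv vs f y) \<le> (SUP x. (1 + norm x) ^ N * norm (iter_deriv vs f x))"
    by (intro cSUP_upper bounded_imp_bdd_above) auto
qed

lemma schwartz_mult_bounded:
  assumes "smooth_fun a" "\<And>N. \<exists>A. \<forall>y. jet N a y \<le> A" "schwartz f"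
  shows "schwartz (\<lambda>y. a y * f y)"
proof (rule schwartz_mult_moderate[OF assms(1,3)])
  fix N
  obtain A where "\<forall>y. jet N a y \<le> A" using assms(2) by blast
  then have "\<forall>y. jet N a y \<le> A * (1 + norm y) ^ 0" by simp
  then show "\<exists>A k. \<forall>y. jet N a y \<le> A * (1 + norm y) ^ k" by blast
qed

lemma schwartz_jet_bounded: "schwartz a \<Longrightarrow> \<exists>A. \<forall>y. jet N a y \<le> A"
  using schwartz_jet_bound[of a 0 N] by (metis mult_1 power_0)

text \<open>Makes \<open>a u\<close> a tempered distribution, so that continuity in the packet
  parameters carries over from \<open>u\<close> to \<open>chi u\<close>.\<close>

lemma tempered_mult:
  fixes u :: "('a::euclidean_space \<Rightarrow> complex) \<Rightarrow> complex"
  assumes u: "tempered u" and a: "smooth_fun a" "\<And>N. \<exists>A. \<forall>y. jet N a y \<le> A"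
  shows "tempered (\<lambda>f. u (\<lambda>y. a y * f y))"
  unfolding tempered_def
proof (intro conjI allI impI)
  fix f g :: "'a \<Rightarrow> complex" and c assume fg: "schwartz f" "schwartz g"
  then have af: "schwartz (\<lambda>y. a y * f y)" "schwartz (\<lambda>y. a y * g y)"
    using schwartz_mult_bounded[OF a] by blast+
  have "u (\<lambda>y. c * (a y * f y) + a y * g y) = c * u (\<lambda>y. a y * f y) + u (\<lambda>y. a y * g y)"
    using tempered_add[OF u schwartz_cmult[OF af(1)] af(2), of c] tempered_cmult[OF u af(1), of c] by simp
  then show "u (\<lambda>y. a y * (c * f y + g y)) = c * u (\<lambda>y. a y * f y) + u (\<lambda>y. a y * g y)"
    by (simp add: algebra_simps)
next
  obtain C N where C: "C \<ge> 0"
    "\<And>f B. schwartz f \<Longrightarrow> (\<And>y. (1 + norm y) ^ N * jet N f y \<le> B) \<Longrightarrow> norm (u f) \<le> C * B"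
    using tempered_jet_bound[OF u] by blast
  obtain D where D: "D \<ge> 0" "\<And>f g (y::'a). smooth_fun f \<Longrightarrow> smooth_fun g \<Longrightarrow>
       jet N (\<lambda>x. f x * g x) y \<le> D * (jet N f y * jet N g y)" using jet_mult_le by blast
  obtain A where A: "\<And>y. jet N a y \<le> A" using a(2) by blast
  have A0: "A \<ge> 0" using order_trans[OF jet_nonneg A] .
  have "norm (u (\<lambda>y. a y * f y)) \<le> C * (D * A) * schwartz_seminorm N f" if f: "schwartz f" for f
  proof -
    have "norm (u (\<lambda>y. a y * f y)) \<le> C * (D * A * schwartz_seminorm N f)"
    proof (rule C(2)[OF schwartz_mult_bounded[OF a f]])
      fix y
      have "(1 + norm y) ^ N * jet N (\<lambda>y. a y * f y) y \<le> (1 + norm y) ^ N * (D * (A * jet N f y))"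
        by (intro mult_left_mono order_trans[OF D(2)] mult_right_mono A a(1) schwartzD_smooth f D(1)) auto
      also have "\<dots> = D * A * ((1 + norm y) ^ N * jet N f y)" by (simp only: mult_ac)
      also have "\<dots> \<le> D * A * schwartz_seminorm N f"
        using D(1) A0 by (intro mult_left_mono jet_le_seminorm f) auto
      finally show "(1 + norm y) ^ N * jet N (\<lambda>y. a y * f y) y \<le> D * A * schwartz_seminorm N f" .
    qed
    then show ?thesis by (simp only: mult.assoc)
  qed
  then show "\<exists>C N. \<forall>f. schwartz f \<longrightarrow> norm (u (\<lambda>y. a y * f y)) \<le> C * schwartz_seminorm N f" by blast
qed

text \<open>The weights on the right do not involve \<open>g\<close>. The identity is therefore
  applicable twice with the same weights: to the characters, before \<open>u\<close> acts, and to
  the values of \<open>u\<close> on them, afterwards.\<close>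

lemma integral_simple_composition:
  fixes c g :: "'a::euclidean_space \<Rightarrow> complex"
  assumes c: "integrable lborel c" and s: "simple_function lborel s"
  shows "(\<integral>\<eta>. c \<eta> * g (s \<eta>) \<partial>lborel) =
    (\<Sum>v\<in>range s. (\<integral>\<eta>. c \<eta> * indicator (s -` {v}) \<eta> \<partial>lborel) * g v)"
proof -
  have fin: "finite (range s)" using simple_functionD(1)[OF s] by simp
  have meas: "s -` {v} \<in> sets lborel" for v using simple_functionD(2)[OF s, of "{v}"] by simp
  have i: "integrable lborel (\<lambda>\<eta>. c \<eta> * indicator (s -` {v}) \<eta> * g v)" for v
  proof (intro integrable_mult_left Bochner_Integration.integrable_bound[OF c])
    show "(\<lambda>\<eta>. c \<eta> * indicator (s -` {v}) \<eta>) \<in> borel_measurable lborel"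
      using c by (intro borel_measurable_times borel_measurable_indicator meas) auto
  qed (auto simp: indicator_def)
  have "c \<eta> * g (s \<eta>) = (\<Sum>v\<in>range s. c \<eta> * indicator (s -` {v}) \<eta> * g v)" for \<eta>
  proof -
    have "(\<Sum>v\<in>range s. c \<eta> * indicator (s -` {v}) \<eta> * g v) = (\<Sum>v\<in>range s. if v = s \<eta> then c \<eta> * g v else 0)"
      by (intro sum.cong refl) (auto simp: indicator_def)
    also have "\<dots> = c \<eta> * g (s \<eta>)" by (subst sum.delta[OF fin]) auto
    finally show ?thesis ..
  qed
  then have "(\<integral>\<eta>. c \<eta> * g (s \<eta>) \<partial>lborel) = (\<integral>\<eta>. (\<Sum>v\<in>range s. c \<eta> * indicator (s -` {v}) \<eta> * g v) \<partial>lborel)"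
    by simp
  also have "\<dots> = (\<Sum>v\<in>range s. (\<integral>\<eta>. c \<eta> * indicator (s -` {v}) \<eta> * g v \<partial>lborel))"
    by (rule Bochner_Integration.integral_sum) (rule i)
  finally show ?thesis by simp
qed

lemma rapid_moderate_family:
  assumes c: "rapid c" and s: "s \<in> borel_measurable borel" "\<And>\<eta>. norm (s \<eta>) \<le> 2 * norm \<eta>"
  shows "moderate_family c s"
proof
  show "c \<in> borel_measurable borel" "s \<in> borel_measurable borel" using rapid_measurable c s by auto
  fix k
  have [measurable]: "c \<in> borel_measurable borel" "s \<in> borel_measurable borel" using rapid_measurable c s by auto
  show "integrable lborel (\<lambda>\<eta>. (1 + norm (s \<eta>)) ^ k * norm (c \<eta>))"
  proof (rule Bochner_Integration.integrable_bound)
    show "integrable lborel (\<lambda>\<eta>. 2 ^ k * ((1 + norm \<eta>) ^ k * norm (c \<eta>)))"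
      by (intro integrable_mult_right rapid_integrable c)
    show "AE \<eta> in lborel. norm ((1 + norm (s \<eta>)) ^ k * norm (c \<eta>)) \<le> norm (2 ^ k * ((1 + norm \<eta>) ^ k * norm (c \<eta>)))"
    proof (rule AE_I2)
      fix \<eta>
      have "(1 + norm (s \<eta>)) ^ k \<le> (2 * (1 + norm \<eta>)) ^ k" using s(2)[of \<eta>] by (intro power_mono) auto
      then have "(1 + norm (s \<eta>)) ^ k * norm (c \<eta>) \<le> (2 * (1 + norm \<eta>)) ^ k * norm (c \<eta>)"
        by (intro mult_right_mono) auto
      also have "\<dots> = 2 ^ k * ((1 + norm \<eta>) ^ k * norm (c \<eta>))" by (simp only: power_mult_distrib mult.assoc)
      finally show "norm ((1 + norm (s \<eta>)) ^ k * norm (c \<eta>)) \<le> norm (2 ^ k * ((1 + norm \<eta>) ^ k * norm (c \<eta>)))"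
        by simp
    qed
  qed measurable
qed

text \<open>The two summands are the errors of replacing \<open>\<eta>\<close> by
  \<open>s i \<eta>\<close> in the symbol of a derivative and in the character; the latter is meant
  per unit of \<open>norm y\<close>.\<close>

lemma moment_difference_tendsto_0:
  assumes c: "rapid c" and s_meas: "\<And>i. s i \<in> borel_measurable borel"
    and s_lim: "\<And>\<eta>. (\<lambda>i. s i \<eta>) \<longlonglongrightarrow> \<eta>" and s_le: "\<And>i \<eta>. norm (s i \<eta>) \<le> 2 * norm \<eta>"
    and vs: "set vs \<subseteq> Basis"
  shows "(\<lambda>i. \<integral>\<eta>. norm (c \<eta>) * (norm (mono_symb vs (s i \<eta>) - mono_symb vs \<eta>) + norm (mono_symb vs \<eta>) * norm (s i \<eta> - \<eta>)) \<partial>lborel) \<longlonglongrightarrow> 0"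
    and "integrable lborel (\<lambda>\<eta>. norm (c \<eta>) * (norm (mono_symb vs (s i \<eta>) - mono_symb vs \<eta>) + norm (mono_symb vs \<eta>) * norm (s i \<eta> - \<eta>)))"
proof -
  note [measurable] = rapid_measurable[OF c] s_meas
  let ?d = "\<lambda>i \<eta>. norm (c \<eta>) * (norm (mono_symb vs (s i \<eta>) - mono_symb vs \<eta>) + norm (mono_symb vs \<eta>) * norm (s i \<eta> - \<eta>))"
  let ?k = "length vs + 1"
  have le: "norm (?d i \<eta>) \<le> (2 ^ ?k + 4) * ((1 + norm \<eta>) ^ ?k * norm (c \<eta>))" for i \<eta>
  proof -
    have 1: "norm (mono_symb vs \<eta>) \<le> (1 + norm \<eta>) ^ length vs"
      by (rule order_trans[OF norm_mono_symb_le[OF vs]]) (auto intro: power_mono)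
    have 2: "norm (mono_symb vs (s i \<eta>)) \<le> (2 * (1 + norm \<eta>)) ^ length vs"
      by (rule order_trans[OF norm_mono_symb_le[OF vs]]) (use s_le[of i \<eta>] in \<open>auto intro!: power_mono\<close>)
    have 3: "norm (s i \<eta> - \<eta>) \<le> 3 * (1 + norm \<eta>)"
      using norm_triangle_ineq4[of "s i \<eta>" \<eta>] s_le[of i \<eta>] by simp
    have p: "(1 + norm \<eta>) ^ length vs \<le> (1 + norm \<eta>) ^ ?k" "(2::real) ^ length vs \<le> 2 ^ ?k"
      by (auto intro!: power_increasing simp del: power_Suc)
    have "norm (mono_symb vs (s i \<eta>) - mono_symb vs \<eta>) \<le> 2 ^ length vs * (1 + norm \<eta>) ^ length vs + (1 + norm \<eta>) ^ length vs"
      using norm_triangle_ineq4[of "mono_symb vs (s i \<eta>)" "mono_symb vs \<eta>"] 1 2[unfolded power_mult_distrib] by linarith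
    also have "\<dots> \<le> 2 ^ ?k * (1 + norm \<eta>) ^ ?k + (1 + norm \<eta>) ^ ?k"
      using p by (intro add_mono mult_mono) auto
    finally have 4: "norm (mono_symb vs (s i \<eta>) - mono_symb vs \<eta>) \<le> 2 ^ ?k * (1 + norm \<eta>) ^ ?k + (1 + norm \<eta>) ^ ?k" .
    have 5: "norm (mono_symb vs \<eta>) * norm (s i \<eta> - \<eta>) \<le> (1 + norm \<eta>) ^ length vs * (3 * (1 + norm \<eta>))"
      by (intro mult_mono 1 3) auto
    have "norm (mono_symb vs (s i \<eta>) - mono_symb vs \<eta>) + norm (mono_symb vs \<eta>) * norm (s i \<eta> - \<eta>)
        \<le> (2 ^ ?k + 4) * (1 + norm \<eta>) ^ ?k"
      using add_mono[OF 4 5] by (simp add: algebra_simps)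
    then have "norm (c \<eta>) * (norm (mono_symb vs (s i \<eta>) - mono_symb vs \<eta>) + norm (mono_symb vs \<eta>) * norm (s i \<eta> - \<eta>))
        \<le> norm (c \<eta>) * ((2 ^ ?k + 4) * (1 + norm \<eta>) ^ ?k)" by (intro mult_left_mono) auto
    then show ?thesis by (simp add: mult_ac)
  qed
  have int: "integrable lborel (\<lambda>\<eta>. (2 ^ ?k + 4) * ((1 + norm \<eta>) ^ ?k * norm (c \<eta>)))"
    by (intro integrable_mult_right rapid_integrable c)
  show "integrable lborel (?d i)"
    by (rule Bochner_Integration.integrable_bound[OF int]) (use order_trans[OF le abs_ge_self] in auto)
  have "(\<lambda>i. \<integral>\<eta>. ?d i \<eta> \<partial>lborel) \<longlonglongrightarrow> integral\<^sup>L lborel (\<lambda>_::'a. 0 :: real)"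
  proof (rule integral_dominated_convergence[OF _ _ int])
    show "AE \<eta> in lborel. (\<lambda>i. ?d i \<eta>) \<longlonglongrightarrow> 0"
    proof (rule AE_I2)
      fix \<eta>
      have m: "(\<lambda>i. mono_symb vs (s i \<eta>)) \<longlonglongrightarrow> mono_symb vs \<eta>"
        by (rule continuous_on_tendsto_compose[OF continuous_on_mono_symb[OF continuous_on_id[of UNIV]] s_lim]) auto
      have "(\<lambda>i. ?d i \<eta>) \<longlonglongrightarrow> norm (c \<eta>) * (norm (mono_symb vs \<eta> - mono_symb vs \<eta>) + norm (mono_symb vs \<eta>) * norm (\<eta> - \<eta>))"
        by (intro tendsto_intros m s_lim)
      then show "(\<lambda>i. ?d i \<eta>) \<longlonglongrightarrow> 0" by simp
    qed
    show "AE \<eta> in lborel. norm (?d i \<eta>) \<le> (2 ^ ?k + 4) * ((1 + norm \<eta>) ^ ?k * norm (c \<eta>))" for i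
      using le by blast
  qed measurable
  then show "(\<lambda>i. \<integral>\<eta>. ?d i \<eta> \<partial>lborel) \<longlonglongrightarrow> 0" by simp
qed

text \<open>The functional passes under the integral: with \<open>\<eta>\<close> replaced by simple functions \<open>s i\<close> the
  integral is a finite sum, and these sums converge in every Schwartz seminorm.\<close>

lemma tempered_FT_product:
  fixes u :: "('a::euclidean_space \<Rightarrow> complex) \<Rightarrow> complex"
  assumes u: "tempered u" and \<psi>: "schwartz \<psi>" and c: "rapid c"
  shows "u (\<lambda>y. \<psi> y * FT c y) = (\<integral>\<eta>. c \<eta> * u (\<lambda>y. \<psi> y * expi \<eta> y) \<partial>lborel)"
proof -
  have [measurable]: "c \<in> borel_measurable borel" using c by (rule rapid_measurable)
  define U where "U = (\<lambda>\<eta>. u (\<lambda>y. \<psi> y * expi \<eta> y))"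
  have Uc: "continuous_on UNIV U" unfolding U_def by (rule continuous_tempered_expi[OF u \<psi>])
  then have [measurable]: "U \<in> borel_measurable borel" by (rule borel_measurable_continuous_onI)
  obtain K P where K: "K \<ge> 0" "\<And>\<xi>. norm (U \<xi>) \<le> K * (1 + norm \<xi>) ^ P"
    using tempered_expi_bound[OF u \<psi>] unfolding U_def by blast
  have "(\<lambda>\<eta>::'a. \<eta>) \<in> borel_measurable lborel" by simp
  from borel_measurable_implies_sequence_metric[OF this, of 0]
  \<comment> \<open>Simple functions tending to the identity; the bound
    \<open>2 * norm \<eta>\<close> provides integrable majorants that do not depend on
    \<open>i\<close>.\<close>
  obtain s :: "nat \<Rightarrow> 'a \<Rightarrow> 'a" where s: "\<And>i. simple_function lborel (s i)" "\<And>\<eta>. (\<lambda>i. s i \<eta>) \<longlonglongrightarrow> \<eta>"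
    "\<And>i \<eta>. norm (s i \<eta>) \<le> 2 * norm \<eta>" by auto
  have s_meas [measurable]: "s i \<in> borel_measurable borel" for i
    using borel_measurable_simple_function[OF s(1)] by simp
  have fam: "moderate_family c (s i)" for i by (rule rapid_moderate_family[OF c s_meas s(3)])
  have fam_id: "moderate_family c (\<lambda>\<eta>. \<eta>)" by (rule rapid_moderate_family[OF c]) auto
  define F where "F = (\<lambda>i y. \<integral>\<eta>. c \<eta> * expi (s i \<eta>) y \<partial>lborel)"
  have F_smooth: "smooth_fun (F i)" for i unfolding F_def by (rule moderate_family.smooth_fun_osc[OF fam])
  have FT_smooth: "smooth_fun (FT c)" unfolding FT_def[abs_def] by (rule moderate_family.smooth_fun_osc[OF fam_id])
  have \<psi>F: "schwartz (\<lambda>y. \<psi> y * F i y)" for i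
    using schwartz_mult_bounded[OF F_smooth _ \<psi>] moderate_family.jet_osc_bounded[OF fam]
    unfolding F_def by (simp add: mult.commute)
  have \<psi>FT: "schwartz (\<lambda>y. \<psi> y * FT c y)"
    using schwartz_mult_bounded[OF FT_smooth _ \<psi>] moderate_family.jet_osc_bounded[OF fam_id]
    unfolding FT_def[abs_def] by (simp add: mult.commute)
  have sums: "u (\<lambda>y. \<psi> y * F i y) = (\<integral>\<eta>. c \<eta> * U (s i \<eta>) \<partial>lborel)" for i
  proof -
    have ci: "integrable lborel c" by (rule rapid_integrable_self[OF c])
    have fin: "finite (range (s i))" using simple_functionD(1)[OF s(1)] by simp
    let ?a = "\<lambda>v. \<integral>\<eta>. c \<eta> * indicator (s i -` {v}) \<eta> \<partial>lborel"
    have "(\<lambda>y. \<psi> y * F i y) = (\<lambda>y. \<Sum>v\<in>range (s i). ?a v * (\<psi> y * expi v y))"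
      unfolding F_def integral_simple_composition[OF ci s(1), of "\<lambda>v. expi v _"]
      by (simp add: sum_distrib_left mult_ac)
    then have "u (\<lambda>y. \<psi> y * F i y) = (\<Sum>v\<in>range (s i). u (\<lambda>y. ?a v * (\<psi> y * expi v y)))"
      using tempered_sum[OF u fin, of "\<lambda>v y. ?a v * (\<psi> y * expi v y)"] schwartz_cmult[OF schwartz_mult_expi[OF \<psi>]] by simp
    also have "\<dots> = (\<Sum>v\<in>range (s i). ?a v * U v)"
      unfolding U_def by (intro sum.cong refl tempered_cmult[OF u schwartz_mult_expi[OF \<psi>]])
    also have "\<dots> = (\<integral>\<eta>. c \<eta> * U (s i \<eta>) \<partial>lborel)"
      by (rule integral_simple_composition[OF ci s(1), symmetric])
    finally show ?thesis .
  qed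
  have lim1: "(\<lambda>i. \<integral>\<eta>. c \<eta> * U (s i \<eta>) \<partial>lborel) \<longlonglongrightarrow> (\<integral>\<eta>. c \<eta> * U \<eta> \<partial>lborel)"
  proof (rule integral_dominated_convergence[where w = "\<lambda>\<eta>. K * 2 ^ P * ((1 + norm \<eta>) ^ P * norm (c \<eta>))"])
    show "integrable lborel (\<lambda>\<eta>. K * 2 ^ P * ((1 + norm \<eta>) ^ P * norm (c \<eta>)))"
      by (intro integrable_mult_right rapid_integrable c)
    show "AE \<eta> in lborel. (\<lambda>i. c \<eta> * U (s i \<eta>)) \<longlonglongrightarrow> c \<eta> * U \<eta>"
      by (intro AE_I2 tendsto_mult tendsto_const continuous_on_tendsto_compose[OF Uc s(2)]) auto
    show "AE \<eta> in lborel. norm (c \<eta> * U (s i \<eta>)) \<le> K * 2 ^ P * ((1 + norm \<eta>) ^ P * norm (c \<eta>))" for i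
    proof (rule AE_I2)
      fix \<eta>
      have "(1 + norm (s i \<eta>)) ^ P \<le> (2 * (1 + norm \<eta>)) ^ P" using s(3)[of i \<eta>] by (intro power_mono) auto
      then have "K * (1 + norm (s i \<eta>)) ^ P \<le> K * (2 * (1 + norm \<eta>)) ^ P" using K(1) by (intro mult_left_mono)
      then have "norm (U (s i \<eta>)) \<le> K * (2 * (1 + norm \<eta>)) ^ P" using K(2) order_trans by blast
      then have "norm (c \<eta>) * norm (U (s i \<eta>)) \<le> norm (c \<eta>) * (K * (2 * (1 + norm \<eta>)) ^ P)"
        by (intro mult_left_mono) auto
      also have "\<dots> = K * 2 ^ P * ((1 + norm \<eta>) ^ P * norm (c \<eta>))" by (simp only: power_mult_distrib mult_ac)
      finally show "norm (c \<eta> * U (s i \<eta>)) \<le> K * 2 ^ P * ((1 + norm \<eta>) ^ P * norm (c \<eta>))" by (simp only: norm_mult)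
    qed
  qed measurable
  obtain C N where C: "C \<ge> 0"
    "\<And>f B. schwartz f \<Longrightarrow> (\<And>y. (1 + norm y) ^ N * jet N f y \<le> B) \<Longrightarrow> norm (u f) \<le> C * B"
    using tempered_jet_bound[OF u] by blast
  obtain D where D: "D \<ge> 0" "\<And>f g (y::'a). smooth_fun f \<Longrightarrow> smooth_fun g \<Longrightarrow>
       jet N (\<lambda>x. f x * g x) y \<le> D * (jet N f y * jet N g y)" using jet_mult_le by blast
  \<comment> \<open>One power more than the order of \<open>u\<close>: the jet of
    \<open>F i - FT c\<close> is small only up to a factor \<open>1 + norm y\<close>, since two
    characters at \<open>y\<close> differ by up to \<open>norm y\<close> times the distance of their
    frequencies.\<close>
  obtain B where B: "B \<ge> 0" "\<And>y. (1 + norm y) ^ (N + 1) * jet N \<psi> y \<le> B"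
    using schwartz_jet_bound[OF \<psi>] by blast
  let ?d = "\<lambda>vs i \<eta>. norm (c \<eta>) * (norm (mono_symb vs (s i \<eta>) - mono_symb vs \<eta>) + norm (mono_symb vs \<eta>) * norm (s i \<eta> - \<eta>))"
  define E where "E = (\<lambda>i. \<Sum>vs\<in>(indices N :: 'a list set). \<integral>\<eta>. ?d vs i \<eta> \<partial>lborel)"
  have "E \<longlonglongrightarrow> (\<Sum>vs\<in>(indices N :: 'a list set). 0)"
    unfolding E_def by (intro tendsto_sum moment_difference_tendsto_0(1)[OF c s_meas s(2,3)]) auto
  then have E: "E \<longlonglongrightarrow> 0" by simp
  have jet: "jet N (\<lambda>y. F i y - FT c y) y \<le> (1 + norm y) * E i" for i y
    unfolding jet_def E_def sum_distrib_left
  proof (rule sum_mono)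
    fix vs :: "'a list" assume "vs \<in> indices N"
    then have vs: "set vs \<subseteq> Basis" by simp
    have i1: "integrable lborel (\<lambda>\<eta>. c \<eta> * mono_symb vs (s i \<eta>) * expi (s i \<eta>) y)"
      by (rule moderate_family.integrable_osc_mono_symb[OF fam vs])
    have i2: "integrable lborel (\<lambda>\<eta>. c \<eta> * mono_symb vs \<eta> * expi \<eta> y)"
      by (rule moderate_family.integrable_osc_mono_symb[OF fam_id vs])
    have "iter_deriv vs (\<lambda>y. F i y - FT c y) y = (\<integral>\<eta>. c \<eta> * mono_symb vs (s i \<eta>) * expi (s i \<eta>) y - c \<eta> * mono_symb vs \<eta> * expi \<eta> y \<partial>lborel)"
      unfolding iter_deriv_diff[OF F_smooth FT_smooth vs] Bochner_Integration.integral_diff[OF i1 i2]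
      unfolding F_def FT_def[abs_def] moderate_family.iter_deriv_osc[OF fam vs] moderate_family.iter_deriv_osc[OF fam_id vs] ..
    also have "norm \<dots> \<le> (\<integral>\<eta>. (1 + norm y) * ?d vs i \<eta> \<partial>lborel)"
    proof (rule Bochner_Integration.integral_norm_bound_integral)
      show "integrable lborel (\<lambda>\<eta>. c \<eta> * mono_symb vs (s i \<eta>) * expi (s i \<eta>) y - c \<eta> * mono_symb vs \<eta> * expi \<eta> y)"
        by (intro Bochner_Integration.integrable_diff i1 i2)
      show "integrable lborel (\<lambda>\<eta>. (1 + norm y) * ?d vs i \<eta>)"
        by (intro integrable_mult_right moment_difference_tendsto_0(2)[OF c s_meas s(2,3) vs])
      fix \<eta>
      let ?a = "norm (mono_symb vs (s i \<eta>) - mono_symb vs \<eta>)"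
      let ?b = "norm (mono_symb vs \<eta>) * norm (s i \<eta> - \<eta>)"
      have "c \<eta> * mono_symb vs (s i \<eta>) * expi (s i \<eta>) y - c \<eta> * mono_symb vs \<eta> * expi \<eta> y =
        c \<eta> * ((mono_symb vs (s i \<eta>) - mono_symb vs \<eta>) * expi (s i \<eta>) y + mono_symb vs \<eta> * (expi (s i \<eta>) y - expi \<eta> y))"
        by (simp add: algebra_simps)
      then have "norm (c \<eta> * mono_symb vs (s i \<eta>) * expi (s i \<eta>) y - c \<eta> * mono_symb vs \<eta> * expi \<eta> y) \<le>
         norm (c \<eta>) * (?a + norm (mono_symb vs \<eta>) * norm (expi (s i \<eta>) y - expi \<eta> y))"
        using norm_triangle_ineq[of "(mono_symb vs (s i \<eta>) - mono_symb vs \<eta>) * expi (s i \<eta>) y" "mono_symb vs \<eta> * (expi (s i \<eta>) y - expi \<eta> y)"]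
        by (simp add: norm_mult mult_left_mono)
      also have "\<dots> \<le> norm (c \<eta>) * (?a + norm (mono_symb vs \<eta>) * (norm y * norm (s i \<eta> - \<eta>)))"
        by (intro mult_left_mono add_left_mono norm_expi_diff_le) auto
      also have "\<dots> = norm (c \<eta>) * (?a + norm y * ?b)" by (simp only: mult_ac)
      also have "\<dots> \<le> norm (c \<eta>) * ((1 + norm y) * (?a + ?b))"
      proof (intro mult_left_mono)
        have "0 \<le> norm y * ?a" "0 \<le> ?b" by simp_all
        then show "?a + norm y * ?b \<le> (1 + norm y) * (?a + ?b)" unfolding distrib_left distrib_right by linarith
      qed simp
      finally show "norm (c \<eta> * mono_symb vs (s i \<eta>) * expi (s i \<eta>) y - c \<eta> * mono_symb vs \<eta> * expi \<eta> y) \<le> (1 + norm y) * ?d vs i \<eta>"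
        by (simp only: mult_ac)
    qed
    finally show "norm (iter_deriv vs (\<lambda>y. F i y - FT c y) y) \<le> (1 + norm y) * (\<integral>\<eta>. ?d vs i \<eta> \<partial>lborel)" by simp
  qed
  have E0: "E i \<ge> 0" for i unfolding E_def by (intro sum_nonneg integral_nonneg_AE) auto
  have close: "norm (u (\<lambda>y. \<psi> y * F i y) - u (\<lambda>y. \<psi> y * FT c y)) \<le> C * D * B * E i" for i
  proof -
    have e: "(\<lambda>y. \<psi> y * F i y - \<psi> y * FT c y) = (\<lambda>y. \<psi> y * (F i y - FT c y))" by (simp add: right_diff_distrib)
    have eq: "u (\<lambda>y. \<psi> y * F i y) - u (\<lambda>y. \<psi> y * FT c y) = u (\<lambda>y. \<psi> y * (F i y - FT c y))"
      and sch: "schwartz (\<lambda>y. \<psi> y * (F i y - FT c y))"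
      using tempered_diff[OF u \<psi>F[of i] \<psi>FT] schwartz_diff[OF \<psi>F[of i] \<psi>FT] by (simp_all only: e)
    have "norm (u (\<lambda>y. \<psi> y * (F i y - FT c y))) \<le> C * (D * B * E i)"
    proof (rule C(2)[OF sch])
      fix y
      have "(1 + norm y) ^ N * jet N (\<lambda>y. \<psi> y * (F i y - FT c y)) y \<le> (1 + norm y) ^ N * (D * (jet N \<psi> y * ((1 + norm y) * E i)))"
        by (intro mult_left_mono order_trans[OF D(2)] jet schwartzD_smooth \<psi> smooth_fun_diff F_smooth FT_smooth D(1)) auto
      also have "\<dots> = D * ((1 + norm y) ^ (N + 1) * jet N \<psi> y) * E i" by (simp add: mult_ac)
      also have "\<dots> \<le> D * B * E i" using D(1) E0 by (intro mult_right_mono mult_left_mono B)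
      finally show "(1 + norm y) ^ N * jet N (\<lambda>y. \<psi> y * (F i y - FT c y)) y \<le> D * B * E i" .
    qed
    then show ?thesis unfolding eq by (simp only: mult.assoc)
  qed
  have "(\<lambda>i. u (\<lambda>y. \<psi> y * F i y) - u (\<lambda>y. \<psi> y * FT c y)) \<longlonglongrightarrow> 0"
  proof (rule Lim_null_comparison)
    show "\<forall>\<^sub>F i in sequentially. norm (u (\<lambda>y. \<psi> y * F i y) - u (\<lambda>y. \<psi> y * FT c y)) \<le> C * D * B * E i"
      using close by simp
    show "(\<lambda>i. C * D * B * E i) \<longlonglongrightarrow> 0" using tendsto_mult_right_zero[OF E] by simp
  qed
  then have "(\<lambda>i. u (\<lambda>y. \<psi> y * F i y)) \<longlonglongrightarrow> u (\<lambda>y. \<psi> y * FT c y)" by (rule LIM_zero_cancel)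
  with lim1 show ?thesis unfolding sums U_def using LIMSEQ_unique by blast
qed

section \<open>Parseval and convolution identities for wave packets\<close>

lemma gauss_mass_sq_pos: "(gauss_mass TYPE('a::euclidean_space))\<^sup>2 > 0"
  using gauss_mass_pos[where 'a='a] by simp

lemma cnj_schwartz_inversion:
  fixes f :: "'a::euclidean_space \<Rightarrow> complex"
  assumes "schwartz f"
  shows "FT (\<lambda>\<eta>. cnj (FT f \<eta>)) z = complex_of_real ((gauss_mass TYPE('a))\<^sup>2) * cnj (f z)"
proof -
  have "FT (\<lambda>\<eta>. cnj (FT f \<eta>)) z = (\<integral>\<eta>. cnj (FT f \<eta> * expi \<eta> (- z)) \<partial>lborel)"
    unfolding FT_def[of "\<lambda>\<eta>. cnj (FT f \<eta>)"] by (simp add: cnj_expi')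
  also have "\<dots> = cnj (FT (FT f) (- z))"
    unfolding FT_def[of "FT f"] by (rule Bochner_Integration.integral_cnj)
  finally show ?thesis using schwartz_FT_inversion[OF assms, of z] by simp
qed

lemma FT_shift: "FT c (y - x) = FT (\<lambda>\<eta>. c \<eta> * cnj (expi \<eta> x)) y"
  unfolding FT_def by (simp add: expi_diff_right mult_ac)

definition cutoff_FT :: "(('a::euclidean_space \<Rightarrow> complex) \<Rightarrow> complex) \<Rightarrow> ('a \<Rightarrow> complex) \<Rightarrow> 'a \<Rightarrow> complex" where
  "cutoff_FT u chi \<xi> = u (\<lambda>y. chi y * expi \<xi> y)"

lemma cutoff_FT_eq: "FT_cutoff u chi = cutoff_FT u chi"
  unfolding FT_cutoff_def[abs_def] cutoff_FT_def[abs_def] expi_def ..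

text \<open>Inversion writes the conjugated window as a superposition of characters, and
  \<open>tempered_FT_product\<close> moves \<open>u\<close> inside. The variable \<open>x\<close>
  then occurs only in a character, which exhibits the packet transform as a Fourier transform in
  \<open>\<eta>\<close> and prepares for Plancherel.\<close>

lemma wave_packet_repr:
  fixes u :: "('a::euclidean_space \<Rightarrow> complex) \<Rightarrow> complex"
  assumes u: "tempered u" and chi: "schwartz chi" and \<phi>: "schwartz \<phi>" and lam: "lam \<ge> 1"
  shows "complex_of_real ((gauss_mass TYPE('a))\<^sup>2) * u (\<lambda>y. chi y * wave_packet lam \<phi> x \<xi> y) =
    FT (\<lambda>\<eta>. cnj (FT (scale_win lam \<phi>) \<eta>) * cutoff_FT u chi (\<xi> + \<eta>)) (- x)"
proof -
  let ?\<psi> = "scale_win lam \<phi>" and ?k = "complex_of_real ((gauss_mass TYPE('a))\<^sup>2)"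
  have \<psi>: "schwartz ?\<psi>" by (rule schwartz_scale_win[OF \<phi> lam])
  let ?c = "\<lambda>\<eta>. cnj (FT ?\<psi> \<eta>) * cnj (expi \<eta> x)"
  have c: "rapid ?c"
    by (rule rapid_mult_bounded[OF rapid_cnj[OF rapid_FT[OF \<psi>]], of _ 1]) (auto intro!: continuous_intros)
  have "?k * (chi y * wave_packet lam \<phi> x \<xi> y) = (chi y * expi \<xi> y) * FT ?c y" for y
    unfolding FT_shift[symmetric] cnj_schwartz_inversion[OF \<psi>] wave_packet_def by (simp add: mult_ac)
  then have "u (\<lambda>y. ?k * (chi y * wave_packet lam \<phi> x \<xi> y)) = u (\<lambda>y. (chi y * expi \<xi> y) * FT ?c y)" by (simp only:)
  also have "\<dots> = (\<integral>\<eta>. ?c \<eta> * u (\<lambda>y. chi y * expi \<xi> y * expi \<eta> y) \<partial>lborel)"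
    by (rule tempered_FT_product[OF u schwartz_mult_expi[OF chi] c])
  also have "\<dots> = FT (\<lambda>\<eta>. cnj (FT (scale_win lam \<phi>) \<eta>) * cutoff_FT u chi (\<xi> + \<eta>)) (- x)"
    unfolding FT_def[of "\<lambda>\<eta>. cnj (FT (scale_win lam \<phi>) \<eta>) * cutoff_FT u chi (\<xi> + \<eta>)"]
    unfolding cutoff_FT_def expi_add cnj_expi'
    by (simp add: mult_ac)
  finally show ?thesis
    using tempered_cmult[OF u schwartz_mult_bounded[OF schwartzD_smooth[OF chi] schwartz_jet_bounded[OF chi]
      schwartz_wave_packet[OF \<phi> lam]], of ?k x \<xi>] by simp
qed

lemma FT_scale_win:
  fixes \<phi> :: "'a::euclidean_space \<Rightarrow> complex"
  assumes "lam \<ge> 1"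
  shows "FT (scale_win lam \<phi>) (sqrt lam *\<^sub>R \<eta>) =
    complex_of_real (lam powr (real DIM('a) / 4) / sqrt lam ^ DIM('a)) * FT \<phi> \<eta>"
proof -
  have "FT \<phi> \<eta> = \<bar>sqrt lam\<bar> ^ DIM('a) *\<^sub>R (\<integral>y. \<phi> (0 + sqrt lam *\<^sub>R y) * expi (0 + sqrt lam *\<^sub>R y) \<eta> \<partial>lborel)"
    unfolding FT_def by (rule lborel_integral_affine) (use assms in auto)
  also have "\<dots> = complex_of_real (sqrt lam ^ DIM('a)) * (\<integral>y. \<phi> (sqrt lam *\<^sub>R y) * expi y (sqrt lam *\<^sub>R \<eta>) \<partial>lborel)"
    using assms by (simp add: scaleR_conv_of_real expi_scaleR)
  finally have 1: "FT \<phi> \<eta> = complex_of_real (sqrt lam ^ DIM('a)) * (\<integral>y. \<phi> (sqrt lam *\<^sub>R y) * expi y (sqrt lam *\<^sub>R \<eta>) \<partial>lborel)" .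
  have "FT (scale_win lam \<phi>) (sqrt lam *\<^sub>R \<eta>) =
     (\<integral>y. complex_of_real (lam powr (real DIM('a) / 4)) * (\<phi> (sqrt lam *\<^sub>R y) * expi y (sqrt lam *\<^sub>R \<eta>)) \<partial>lborel)"
    unfolding FT_def scale_win_def by (simp only: mult.assoc)
  also have "\<dots> = complex_of_real (lam powr (real DIM('a) / 4)) * (\<integral>y. \<phi> (sqrt lam *\<^sub>R y) * expi y (sqrt lam *\<^sub>R \<eta>) \<partial>lborel)"
    by (rule integral_mult_right_zero)
  finally show ?thesis unfolding 1 using assms by simp
qed

lemma cutoff_FT_continuous:
  "tempered u \<Longrightarrow> schwartz chi \<Longrightarrow> continuous_on UNIV (cutoff_FT u chi)"
  unfolding cutoff_FT_def[abs_def] by (rule continuous_tempered_expi)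

lemma cutoff_FT_bound:
  assumes "tempered u" "schwartz chi"
  obtains C P where "C \<ge> 0" "\<And>\<xi>. norm (cutoff_FT u chi \<xi>) \<le> C * (1 + norm \<xi>) ^ P"
  using tempered_expi_bound[OF assms] unfolding cutoff_FT_def by blast

text \<open>The square of \<open>wave_packet_repr\<close> carries the constant
  \<open>gauss_mass\<close> to the fourth power and Plancherel its second power, so the second power
  remains. The substitution of \<open>sqrt lam *\<^sub>R \<eta>\<close> for the frequency then
  removes \<open>lam\<close> from the window.\<close>

lemma wave_packet_parseval:
  fixes u :: "('a::euclidean_space \<Rightarrow> complex) \<Rightarrow> complex"
  assumes u: "tempered u" and chi: "schwartz chi" and \<phi>: "schwartz \<phi>" and lam: "lam \<ge> 1"
  shows "ennreal ((gauss_mass TYPE('a))\<^sup>2) * (\<integral>\<^sup>+x. ennreal ((norm (u (\<lambda>y. chi y * wave_packet lam \<phi> x \<xi> y)))\<^sup>2) \<partial>lborel) =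
    (\<integral>\<^sup>+\<eta>. ennreal ((norm (FT \<phi> \<eta>))\<^sup>2 * (norm (cutoff_FT u chi (\<xi> + sqrt lam *\<^sub>R \<eta>)))\<^sup>2) \<partial>lborel)"
proof -
  let ?k = "(gauss_mass TYPE('a))\<^sup>2" and ?\<psi> = "scale_win lam \<phi>"
  let ?g = "cutoff_FT u chi"
  have k: "?k > 0" by (rule gauss_mass_sq_pos)
  have \<psi>: "schwartz ?\<psi>" by (rule schwartz_scale_win[OF \<phi> lam])
  define h where "h = (\<lambda>\<eta>. cnj (FT ?\<psi> \<eta>) * ?g (\<xi> + \<eta>))"
  obtain C P where C: "C \<ge> 0" "\<And>\<xi>. norm (?g \<xi>) \<le> C * (1 + norm \<xi>) ^ P" using cutoff_FT_bound[OF u chi] by blast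
  have gc: "continuous_on UNIV ?g" by (rule cutoff_FT_continuous[OF u chi])
  then have [measurable]: "?g \<in> borel_measurable borel" by (rule borel_measurable_continuous_onI)
  have h: "rapid h" unfolding h_def
  proof (rule rapid_mult_poly[OF rapid_cnj[OF rapid_FT[OF \<psi>]]])
    show "continuous_on UNIV (\<lambda>\<eta>. ?g (\<xi> + \<eta>))"
      by (rule continuous_on_compose2[OF gc]) (auto intro: continuous_intros)
    show "norm (?g (\<xi> + \<eta>)) \<le> (C * (1 + norm \<xi>) ^ P) * (1 + norm \<eta>) ^ P" for \<eta>
    proof -
      have "(1 + norm (\<xi> + \<eta>)) ^ P \<le> ((1 + norm \<xi>) * (1 + norm \<eta>)) ^ P"
        using one_plus_norm_le[of "\<xi> + \<eta>" \<xi>] by (intro power_mono) auto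
      then have "C * (1 + norm (\<xi> + \<eta>)) ^ P \<le> C * ((1 + norm \<xi>) * (1 + norm \<eta>)) ^ P"
        using C(1) by (intro mult_left_mono)
      then show ?thesis using C(2)[of "\<xi> + \<eta>"] unfolding power_mult_distrib by (simp add: mult.assoc)
    qed
  qed
  have [measurable]: "h \<in> borel_measurable borel" by (rule rapid_measurable[OF h])
  obtain B where B: "\<And>\<eta>. (1 + norm \<eta>) ^ 0 * norm (h \<eta>) \<le> B" using rapid_bound[OF h] by blast
  have pl: "(\<integral>\<^sup>+x. ennreal ((norm (FT h x))\<^sup>2) \<partial>lborel) = ennreal ?k * (\<integral>\<^sup>+x. ennreal ((norm (h x))\<^sup>2) \<partial>lborel)"
    by (rule plancherel[OF rapid_integrable_self[OF h], of B]) (use h B in \<open>auto simp: rapid_def\<close>)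
  have eq: "ennreal ?k * (ennreal ?k * ennreal ((norm (u (\<lambda>y. chi y * wave_packet lam \<phi> x \<xi> y)))\<^sup>2)) = ennreal ((norm (FT h (- x)))\<^sup>2)" for x
  proof -
    have "norm (FT h (- x)) = ?k * norm (u (\<lambda>y. chi y * wave_packet lam \<phi> x \<xi> y))"
      unfolding h_def wave_packet_repr[OF assms, symmetric] norm_mult norm_of_real by simp
    then show ?thesis by (simp add: power2_eq_square[of "_ * _"] mult_ac flip: ennreal_mult' ) (simp add: power2_eq_square mult_ac)
  qed
  have "ennreal ?k * (ennreal ?k * (\<integral>\<^sup>+x. ennreal ((norm (u (\<lambda>y. chi y * wave_packet lam \<phi> x \<xi> y)))\<^sup>2) \<partial>lborel))
     = (\<integral>\<^sup>+x. ennreal ((norm (FT h (- x)))\<^sup>2) \<partial>lborel)"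
  proof -
    have "continuous_on UNIV (\<lambda>x. (\<lambda>(x, \<xi>). (\<lambda>f. u (\<lambda>y. chi y * f y)) (wave_packet lam \<phi> x \<xi>)) (x, \<xi>))"
      by (rule continuous_on_compose2[OF continuous_wave_packet[OF tempered_mult[OF u schwartzD_smooth[OF chi] schwartz_jet_bounded[OF chi]] \<phi> lam]])
         (auto intro: continuous_intros)
    then have "(\<lambda>x. u (\<lambda>y. chi y * wave_packet lam \<phi> x \<xi> y)) \<in> borel_measurable borel"
      by (intro borel_measurable_continuous_onI) simp
    then show ?thesis unfolding eq[symmetric] by (simp add: nn_integral_cmult)
  qed
  also have "\<dots> = (\<integral>\<^sup>+x. ennreal ((norm (FT h x))\<^sup>2) \<partial>lborel)"
    by (rule nn_integral_lborel_reflect) measurable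
  also note pl
  finally have "ennreal ?k * (\<integral>\<^sup>+x. ennreal ((norm (u (\<lambda>y. chi y * wave_packet lam \<phi> x \<xi> y)))\<^sup>2) \<partial>lborel)
     = (\<integral>\<^sup>+x. ennreal ((norm (h x))\<^sup>2) \<partial>lborel)"
    using k by (simp add: ennreal_mult_cancel_left)
  also have "\<dots> = ennreal (sqrt lam ^ DIM('a)) * (\<integral>\<^sup>+\<eta>. ennreal ((norm (h (0 + sqrt lam *\<^sub>R \<eta>)))\<^sup>2) \<partial>lborel)"
    by (rule nn_integral_lborel_affine) (use lam in auto)
  also have "\<dots> = (\<integral>\<^sup>+\<eta>. ennreal (sqrt lam ^ DIM('a)) * ennreal ((norm (h (sqrt lam *\<^sub>R \<eta>)))\<^sup>2) \<partial>lborel)"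
    by (subst nn_integral_cmult) auto
  also have "\<dots> = (\<integral>\<^sup>+\<eta>. ennreal ((norm (FT \<phi> \<eta>))\<^sup>2 * (norm (?g (\<xi> + sqrt lam *\<^sub>R \<eta>)))\<^sup>2) \<partial>lborel)"
  proof (rule nn_integral_cong)
    fix \<eta>
    let ?s = "sqrt lam ^ DIM('a)" and ?p = "lam powr (real DIM('a) / 4)"
    have s: "?s > 0" using lam by simp
    \<comment> \<open>Here the normalisation of \<open>scale_win\<close> pays off: the square of its
      prefactor equals the Jacobian \<open>sqrt lam ^ DIM('a)\<close>, and all powers of
      \<open>lam\<close> cancel.\<close>
    have "?p\<^sup>2 = lam powr (real DIM('a) / 2)" by (simp add: power2_eq_square flip: powr_add)
    also have "\<dots> = ?s" using lam by (simp add: powr_realpow[symmetric] powr_half_sqrt[symmetric] powr_powr)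
    finally have ps: "?p\<^sup>2 = ?s" .
    have "norm (h (sqrt lam *\<^sub>R \<eta>)) = ?p / ?s * norm (FT \<phi> \<eta>) * norm (?g (\<xi> + sqrt lam *\<^sub>R \<eta>))"
      unfolding h_def FT_scale_win[OF lam] norm_mult complex_mod_cnj norm_of_real using s lam by simp
    then have "?s * (norm (h (sqrt lam *\<^sub>R \<eta>)))\<^sup>2 = ?s * (?p\<^sup>2 / ?s\<^sup>2) * ((norm (FT \<phi> \<eta>))\<^sup>2 * (norm (?g (\<xi> + sqrt lam *\<^sub>R \<eta>)))\<^sup>2)"
      by (simp only: power_mult_distrib power_divide mult_ac)
    also have "?s * (?p\<^sup>2 / ?s\<^sup>2) = 1" unfolding ps using s lam by (simp add: power2_eq_square)
    finally show "ennreal ?s * ennreal ((norm (h (sqrt lam *\<^sub>R \<eta>)))\<^sup>2) =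
        ennreal ((norm (FT \<phi> \<eta>))\<^sup>2 * (norm (?g (\<xi> + sqrt lam *\<^sub>R \<eta>)))\<^sup>2)"
      using s by (simp flip: ennreal_mult)
  qed
  finally show ?thesis .
qed

text \<open>The product is split into \<open>sqrt (norm (c x))\<close> and
  \<open>sqrt (norm (c x)) * norm (F x)\<close>. In the non-integrable case the Bochner integral is
  0 and the bound is trivial.\<close>

lemma cauchy_schwarz_weighted:
  fixes c F :: "'a \<Rightarrow> complex"
  assumes [measurable]: "c \<in> borel_measurable M" "F \<in> borel_measurable M"
  shows "ennreal ((norm (\<integral>x. c x * F x \<partial>M))\<^sup>2) \<le>
    (\<integral>\<^sup>+x. ennreal (norm (c x)) \<partial>M) * (\<integral>\<^sup>+x. ennreal (norm (c x) * (norm (F x))\<^sup>2) \<partial>M)"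
proof (cases "integrable M (\<lambda>x. c x * F x)")
  case True
  have "ennreal (norm (\<integral>x. c x * F x \<partial>M)) \<le> (\<integral>\<^sup>+x. ennreal (norm (c x * F x)) \<partial>M)"
    by (rule integral_norm_bound_ennreal[OF True])
  also have "\<dots> = (\<integral>\<^sup>+x. ennreal (sqrt (norm (c x))) * ennreal (sqrt (norm (c x)) * norm (F x)) \<partial>M)"
    by (intro nn_integral_cong) (simp add: norm_mult mult.assoc[symmetric] flip: ennreal_mult)
  finally have "(ennreal (norm (\<integral>x. c x * F x \<partial>M)))\<^sup>2 \<le>
     (\<integral>\<^sup>+x. ennreal (sqrt (norm (c x))) * ennreal (sqrt (norm (c x)) * norm (F x)) \<partial>M)\<^sup>2"
    by (intro power_mono) auto
  also have "\<dots> \<le> (\<integral>\<^sup>+x. (ennreal (sqrt (norm (c x))))\<^sup>2 \<partial>M) * (\<integral>\<^sup>+x. (ennreal (sqrt (norm (c x)) * norm (F x)))\<^sup>2 \<partial>M)"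
    by (rule Cauchy_Schwarz_nn_integral) measurable
  also have "\<dots> = (\<integral>\<^sup>+x. ennreal (norm (c x)) \<partial>M) * (\<integral>\<^sup>+x. ennreal (norm (c x) * (norm (F x))\<^sup>2) \<partial>M)"
    by (simp add: ennreal_power power_mult_distrib)
  finally show ?thesis by (simp add: ennreal_power)
qed (simp add: not_integrable_integral_eq)

text \<open>Inversion writes \<open>chi\<close> as a superposition of characters, and multiplying a
  packet by a character only shifts its frequency. The argument \<open>- \<eta>\<close> appears
  because the transform of the reflected \<open>FT chi\<close> gives back \<open>chi\<close>. Since
  \<open>x\<close> is a mere parameter, the bound can later be integrated over any set of
  \<open>x\<close>.\<close>

lemma cutoff_convolution_bound:
  fixes u :: "('a::euclidean_space \<Rightarrow> complex) \<Rightarrow> complex"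
  assumes u: "tempered u" and chi: "schwartz chi" and \<phi>: "schwartz \<phi>"
  obtains D where "D \<ge> 0" "\<And>lam x \<xi>. lam \<ge> 1 \<Longrightarrow>
    ennreal ((norm (u (\<lambda>y. chi y * wave_packet lam \<phi> x \<xi> y)))\<^sup>2) \<le>
    ennreal D * (\<integral>\<^sup>+\<eta>. ennreal (norm (FT chi (- \<eta>)) * (norm (u (wave_packet lam \<phi> x (\<xi> + \<eta>))))\<^sup>2) \<partial>lborel)"
proof -
  let ?k = "(gauss_mass TYPE('a))\<^sup>2"
  have k: "?k > 0" by (rule gauss_mass_sq_pos)
  let ?c = "\<lambda>\<eta>. FT chi (- \<eta>)"
  have c: "rapid ?c" by (rule rapid_reflect[OF rapid_FT[OF chi]])
  have [measurable]: "?c \<in> borel_measurable borel" by (rule rapid_measurable[OF c])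
  let ?I = "\<integral>\<eta>. norm (?c \<eta>) \<partial>lborel"
  have I: "(\<integral>\<^sup>+\<eta>. ennreal (norm (?c \<eta>)) \<partial>lborel) = ennreal ?I"
    by (intro nn_integral_eq_integral integrable_norm rapid_integrable_self c) auto
  have I0: "?I \<ge> 0" by simp
  show thesis
  proof (rule that[of "?I / ?k\<^sup>2"])
    show "0 \<le> ?I / ?k\<^sup>2" by simp
    fix lam :: real and x \<xi> :: 'a assume lam: "lam \<ge> 1"
    let ?U = "\<lambda>\<eta>. u (wave_packet lam \<phi> x (\<xi> + \<eta>))"
    let ?v = "u (\<lambda>y. chi y * wave_packet lam \<phi> x \<xi> y)"
    have "continuous_on UNIV (\<lambda>\<eta>. (\<lambda>(x, \<xi>). u (wave_packet lam \<phi> x \<xi>)) (x, \<xi> + \<eta>))"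
      by (rule continuous_on_compose2[OF continuous_wave_packet[OF u \<phi> lam]]) (auto intro!: continuous_intros)
    then have [measurable]: "?U \<in> borel_measurable borel" by (intro borel_measurable_continuous_onI) simp
    have FTc: "FT ?c y = complex_of_real ?k * chi y" for y
    proof -
      have "FT ?c y = (\<integral>\<eta>. FT chi (- \<eta>) * expi (- (- \<eta>)) y \<partial>lborel)" by (simp add: FT_def[of ?c])
      also have "\<dots> = (\<integral>\<eta>. FT chi \<eta> * expi (- \<eta>) y \<partial>lborel)"
        by (rule lborel_integral_reflect[of "\<lambda>\<eta>. FT chi \<eta> * expi (- \<eta>) y"])
      also have "\<dots> = FT (FT chi) (- y)" by (simp add: FT_def[of "FT chi"] expi_minus)
      finally show ?thesis using schwartz_FT_inversion[OF chi] by simp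
    qed
    have "(\<lambda>y. complex_of_real ?k * (chi y * wave_packet lam \<phi> x \<xi> y)) = (\<lambda>y. wave_packet lam \<phi> x \<xi> y * FT ?c y)"
      unfolding FTc by (simp add: mult_ac)
    then have "complex_of_real ?k * ?v = u (\<lambda>y. wave_packet lam \<phi> x \<xi> y * FT ?c y)"
      using tempered_cmult[OF u schwartz_mult_bounded[OF schwartzD_smooth[OF chi] schwartz_jet_bounded[OF chi]
        schwartz_wave_packet[OF \<phi> lam]], of "complex_of_real ?k" x \<xi>] by simp
    also have "\<dots> = (\<integral>\<eta>. ?c \<eta> * u (\<lambda>y. wave_packet lam \<phi> x \<xi> y * expi \<eta> y) \<partial>lborel)"
      by (rule tempered_FT_product[OF u schwartz_wave_packet[OF \<phi> lam] c])
    also have "(\<lambda>\<eta>. u (\<lambda>y. wave_packet lam \<phi> x \<xi> y * expi \<eta> y)) = ?U"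
      unfolding wave_packet_def[abs_def] expi_add by (simp add: mult.assoc)
    finally have "complex_of_real ?k * ?v = (\<integral>\<eta>. ?c \<eta> * ?U \<eta> \<partial>lborel)" .
    then have "norm (complex_of_real ?k * ?v) = norm (\<integral>\<eta>. ?c \<eta> * ?U \<eta> \<partial>lborel)" by simp
    then have "(norm (\<integral>\<eta>. ?c \<eta> * ?U \<eta> \<partial>lborel))\<^sup>2 = (?k * norm ?v)\<^sup>2" unfolding norm_mult norm_of_real by simp
    then have eq: "(norm (\<integral>\<eta>. ?c \<eta> * ?U \<eta> \<partial>lborel))\<^sup>2 = ?k\<^sup>2 * (norm ?v)\<^sup>2" by (simp only: power_mult_distrib)
    have "ennreal (?k\<^sup>2 * (norm ?v)\<^sup>2) \<le> ennreal ?I * (\<integral>\<^sup>+\<eta>. ennreal (norm (?c \<eta>) * (norm (?U \<eta>))\<^sup>2) \<partial>lborel)"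
      using cauchy_schwarz_weighted[of ?c lborel ?U] unfolding I eq by simp
    then have "ennreal (1 / ?k\<^sup>2) * ennreal (?k\<^sup>2 * (norm ?v)\<^sup>2) \<le>
       ennreal (1 / ?k\<^sup>2) * (ennreal ?I * (\<integral>\<^sup>+\<eta>. ennreal (norm (?c \<eta>) * (norm (?U \<eta>))\<^sup>2) \<partial>lborel))"
      by (intro mult_left_mono) auto
    moreover have "ennreal (1 / ?k\<^sup>2) * ennreal (?k\<^sup>2 * (norm ?v)\<^sup>2) = ennreal ((norm ?v)\<^sup>2)"
      using k by (subst ennreal_mult[symmetric]) auto
    moreover have "ennreal (1 / ?k\<^sup>2) * (ennreal ?I * J) = ennreal (?I / ?k\<^sup>2) * J" for J
      unfolding mult.assoc[symmetric] by (subst ennreal_mult[symmetric]) auto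
    ultimately show "ennreal ((norm ?v)\<^sup>2) \<le> ennreal (?I / ?k\<^sup>2) * (\<integral>\<^sup>+\<eta>. ennreal (norm (?c \<eta>) * (norm (?U \<eta>))\<^sup>2) \<partial>lborel)"
      by simp
  qed
qed

section \<open>Frequency localisation and integration in polar form\<close>

lemma nn_integral_finite_transfer:
  assumes [measurable]: "A \<in> borel_measurable M" "e \<in> borel_measurable M"
    and le: "\<And>x. x \<in> space M \<Longrightarrow> A x \<le> ennreal C * J x + ennreal (e x)"
    and J: "(\<integral>\<^sup>+x. J x \<partial>M) < \<infinity>" and e: "(\<integral>\<^sup>+x. ennreal (e x) \<partial>M) < \<infinity>"
  shows "(\<integral>\<^sup>+x. A x \<partial>M) < \<infinity>"
proof -
  \<comment> \<open>Enlarging \<open>C\<close> to at least 1 makes it invertible.\<close>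
  define D where "D = max C 1"
  have D: "D > 0" "C \<le> D" by (auto simp: D_def)
  have 1: "ennreal (1 / D) * (A x - ennreal (e x)) \<le> J x" if "x \<in> space M" for x
  proof -
    have "A x \<le> ennreal (e x) + ennreal D * J x"
      using le[OF that] D(2) by (metis add.commute add_left_mono ennreal_leI mult_right_mono order_trans zero_le)
    then have "A x - ennreal (e x) \<le> ennreal D * J x" by (simp add: ennreal_minus_le_iff)
    then have "ennreal (1 / D) * (A x - ennreal (e x)) \<le> ennreal (1 / D) * (ennreal D * J x)"
      by (intro mult_left_mono) auto
    also have "\<dots> = J x" using D(1) by (simp add: mult.assoc[symmetric] ennreal_mult[symmetric])
    finally show ?thesis .
  qed
  have "ennreal (1 / D) * (\<integral>\<^sup>+x. (A x - ennreal (e x)) \<partial>M) = (\<integral>\<^sup>+x. ennreal (1 / D) * (A x - ennreal (e x)) \<partial>M)"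
    by (rule nn_integral_cmult[symmetric]) measurable
  also have "\<dots> \<le> (\<integral>\<^sup>+x. J x \<partial>M)" by (intro nn_integral_mono 1)
  finally have "ennreal (1 / D) * (\<integral>\<^sup>+x. (A x - ennreal (e x)) \<partial>M) < \<infinity>" using J by (rule le_less_trans)
  then have 2: "(\<integral>\<^sup>+x. (A x - ennreal (e x)) \<partial>M) < \<infinity>"
    using D(1) by (auto simp: ennreal_mult_less_top)
  have "A x \<le> ennreal (e x) + (A x - ennreal (e x))" for x
    using ennreal_minus_le_iff[of "A x" "ennreal (e x)" "A x - ennreal (e x)"] by simp
  then have "(\<integral>\<^sup>+x. A x \<partial>M) \<le> (\<integral>\<^sup>+x. ennreal (e x) + (A x - ennreal (e x)) \<partial>M)"
    by (intro nn_integral_mono)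
  also have "\<dots> = (\<integral>\<^sup>+x. ennreal (e x) \<partial>M) + (\<integral>\<^sup>+x. (A x - ennreal (e x)) \<partial>M)"
    by (rule nn_integral_add) measurable
  also have "\<dots> < \<infinity>" using 2 e by simp
  finally show ?thesis .
qed

lemma sets_borel_ball [measurable]: "ball c r \<in> sets borel"
  by simp

lemma nn_integral_inverse_weight:
  "\<exists>W\<ge>0. (\<integral>\<^sup>+\<eta>. ennreal (1 / (1 + norm (\<eta>::'a::euclidean_space)) ^ (2 * DIM('a))) \<partial>lborel) = ennreal W"
proof (intro exI conjI)
  show "(\<integral>\<^sup>+\<eta>. ennreal (1 / (1 + norm (\<eta>::'a)) ^ (2 * DIM('a))) \<partial>lborel) = ennreal (\<integral>\<eta>. 1 / (1 + norm (\<eta>::'a)) ^ (2 * DIM('a)) \<partial>lborel)"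
    by (intro nn_integral_eq_integral integrable_inverse_one_plus_norm_power) auto
qed simp

text \<open>If \<open>norm \<eta> < r * sqrt lam\<close>, the shift
  \<open>(\<tau> / lam) *\<^sub>R \<eta>\<close> is shorter than \<open>r\<close> and a translation
  carries the ball into its double. Otherwise the decay of \<open>w\<close> yields any inverse power
  of \<open>lam\<close>, which beats the polynomial growth of \<open>\<Psi>\<close>. The step
  \<open>\<tau>\<close> is free because two blurs are treated: \<open>sqrt lam\<close> for the
  window and 1 for the cutoff.\<close>

lemma near_far:
  fixes w :: "'a::euclidean_space \<Rightarrow> real" and \<Psi> :: "real \<Rightarrow> 'a \<Rightarrow> ennreal" and \<xi>0 :: 'a
  assumes w_meas [measurable]: "w \<in> borel_measurable borel" and w0: "\<And>\<eta>. w \<eta> \<ge> 0"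
    and w: "\<And>k. \<exists>B. \<forall>\<eta>. (1 + norm \<eta>) ^ k * w \<eta> \<le> B"
    and \<Psi>_meas: "\<And>lam. lam \<ge> 1 \<Longrightarrow> \<Psi> lam \<in> borel_measurable borel"
    and \<Psi>: "\<And>lam \<xi>. lam \<ge> 1 \<Longrightarrow> \<Psi> lam \<xi> \<le> ennreal (G * lam ^ P * (1 + norm \<xi>) ^ P)"
    and G: "G \<ge> 0" and r: "r > 0"
  obtains C where "C \<ge> 0" "\<And>lam \<tau>. lam \<ge> 1 \<Longrightarrow> 0 < \<tau> \<Longrightarrow> \<tau> \<le> sqrt lam \<Longrightarrow>
    (\<integral>\<^sup>+\<xi>\<in>ball \<xi>0 r. (\<integral>\<^sup>+\<eta>. ennreal (w \<eta>) * \<Psi> lam (lam *\<^sub>R \<xi> + \<tau> *\<^sub>R \<eta>) \<partial>lborel) \<partial>lborel) \<le>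
    ennreal C * (\<integral>\<^sup>+\<xi>\<in>ball \<xi>0 (2 * r). \<Psi> lam (lam *\<^sub>R \<xi>) \<partial>lborel) + ennreal (C / lam ^ M)"
proof -
  let ?n = "2 * DIM('a)"
  let ?R = "norm \<xi>0 + r"
  \<comment> \<open>The growth of \<open>\<Psi>\<close> at frequencies of size \<open>lam\<close>
    costs \<open>lam ^ (2 * P)\<close>, and \<open>lam ^ M\<close> is to be gained on top.\<close>
  define Q where "Q = 2 * P + M"
  \<comment> \<open>The exponent serves three ends: \<open>P\<close> for the growth of
    \<open>\<Psi>\<close> in \<open>\<eta>\<close>, \<open>?n\<close> for integrability in
    \<open>\<eta>\<close>, and \<open>2 * Q\<close> because two powers of
    \<open>norm \<eta> \<ge> r * sqrt lam\<close> give one power of \<open>lam\<close>.\<close>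
  obtain B where B: "\<And>\<eta>. (1 + norm \<eta>) ^ (P + ?n + 2 * Q) * w \<eta> \<le> B" using w by blast
  have B0: "B \<ge> 0" using order_trans[OF _ B[of 0]] w0[of 0] by simp
  obtain B1 where B1: "\<And>\<eta>. (1 + norm \<eta>) ^ ?n * w \<eta> \<le> B1" using w by blast
  have B10: "B1 \<ge> 0" using order_trans[OF _ B1[of 0]] w0[of 0] by simp
  obtain W where W: "W \<ge> 0" "(\<integral>\<^sup>+\<eta>. ennreal (1 / (1 + norm (\<eta>::'a)) ^ ?n) \<partial>lborel) = ennreal W"
    using nn_integral_inverse_weight by blast
  define K where "K = G * (1 + ?R) ^ P * B / (r\<^sup>2) ^ Q"
  have K: "K \<ge> 0" unfolding K_def using G B0 r by simp
  define \<mu> where "\<mu> = measure lborel (ball \<xi>0 r)"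
  have \<mu>: "emeasure lborel (ball \<xi>0 r) = ennreal \<mu>"
    unfolding \<mu>_def using emeasure_lborel_ball_finite[of \<xi>0 r] by (intro emeasure_eq_ennreal_measure) (auto simp: less_top)
  have \<mu>0: "\<mu> \<ge> 0" unfolding \<mu>_def by simp
  have pos: "0 < (1 + norm (\<eta>::'a)) ^ k" for \<eta> k by (intro zero_less_power add_pos_nonneg) auto
  show thesis
  proof (rule that[of "B1 * W + K * \<mu> * W"])
    show "0 \<le> B1 * W + K * \<mu> * W" using B10 W(1) K \<mu>0 by simp
    fix lam \<tau> :: real assume lam: "lam \<ge> 1" and \<tau>: "0 < \<tau>" "\<tau> \<le> sqrt lam"
    note [measurable] = \<Psi>_meas[OF lam]
    define h where "h = (\<integral>\<^sup>+\<xi>\<in>ball \<xi>0 (2 * r). \<Psi> lam (lam *\<^sub>R \<xi>) \<partial>lborel)"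
    define inn where "inn = (\<lambda>\<eta>. \<integral>\<^sup>+\<xi>\<in>ball \<xi>0 r. ennreal (w \<eta>) * \<Psi> lam (lam *\<^sub>R \<xi> + \<tau> *\<^sub>R \<eta>) \<partial>lborel)"
    have sq: "sqrt lam \<ge> 1" "sqrt lam \<le> lam" using lam
      by (auto intro!: real_le_lsqrt simp: power2_eq_square)
    have near: "inn \<eta> \<le> ennreal (w \<eta>) * h" if "norm \<eta> < r * sqrt lam" for \<eta>
    proof -
      let ?v = "(\<tau> / lam) *\<^sub>R \<eta>"
      have "norm ?v < r"
      proof -
        have "norm ?v = \<tau> * norm \<eta> / lam" using \<tau> lam by simp
        also have "\<dots> \<le> sqrt lam * norm \<eta> / lam" using \<tau> lam by (intro divide_right_mono mult_right_mono) auto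
        also have "\<dots> < sqrt lam * (r * sqrt lam) / lam"
          using that lam sq by (intro divide_strict_right_mono mult_strict_left_mono) auto
        also have "\<dots> = r"
        proof -
          have "sqrt lam * (r * sqrt lam) = r * (sqrt lam * sqrt lam)" by (simp only: mult_ac)
          also have "sqrt lam * sqrt lam = lam" using lam by simp
          finally have e: "sqrt lam * (r * sqrt lam) = r * lam" .
          show ?thesis unfolding e using lam by simp
        qed
        finally show ?thesis .
      qed
      let ?F = "\<lambda>\<xi>. \<Psi> lam (lam *\<^sub>R \<xi>) * indicator (ball \<xi>0 (2 * r)) \<xi>"
      have "inn \<eta> \<le> (\<integral>\<^sup>+\<xi>. ennreal (w \<eta>) * ?F (?v + \<xi>) \<partial>lborel)"
        unfolding inn_def
      proof (rule nn_integral_mono)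
        fix \<xi>
        have "lam *\<^sub>R (?v + \<xi>) = lam *\<^sub>R \<xi> + \<tau> *\<^sub>R \<eta>" using lam by (simp add: scaleR_add_right)
        moreover have "?v + \<xi> \<in> ball \<xi>0 (2 * r)" if "\<xi> \<in> ball \<xi>0 r"
        proof -
          have "norm (\<xi>0 - (?v + \<xi>)) \<le> norm (\<xi>0 - \<xi>) + norm ?v"
            using norm_triangle_ineq4[of "\<xi>0 - \<xi>" ?v] by (simp add: algebra_simps)
          then show ?thesis using that \<open>norm ?v < r\<close> by (simp only: mem_ball dist_norm)
        qed
        ultimately show "ennreal (w \<eta>) * \<Psi> lam (lam *\<^sub>R \<xi> + \<tau> *\<^sub>R \<eta>) * indicator (ball \<xi>0 r) \<xi> \<le> ennreal (w \<eta>) * ?F (?v + \<xi>)"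
          by (auto simp: indicator_def)
      qed
      also have "\<dots> = ennreal (w \<eta>) * (\<integral>\<^sup>+\<xi>. ?F (?v + \<xi>) \<partial>lborel)" by (rule nn_integral_cmult) measurable
      also have "(\<integral>\<^sup>+\<xi>. ?F (?v + \<xi>) \<partial>lborel) = h" unfolding h_def by (rule nn_integral_lborel_translate) measurable
      finally show ?thesis .
    qed
    have far: "inn \<eta> \<le> ennreal (K * \<mu> / lam ^ M * (1 / (1 + norm \<eta>) ^ ?n))" if \<eta>: "\<not> norm \<eta> < r * sqrt lam" for \<eta>
    proof -
      let ?t = "1 + norm \<eta>"
      have pw: "ennreal (w \<eta>) * \<Psi> lam (lam *\<^sub>R \<xi> + \<tau> *\<^sub>R \<eta>) \<le> ennreal (K / lam ^ M * (1 / ?t ^ ?n))" if \<xi>: "\<xi> \<in> ball \<xi>0 r" for \<xi>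
      proof -
        have n\<xi>: "norm \<xi> \<le> ?R" using \<xi> norm_triangle_ineq2[of \<xi> \<xi>0] by (simp add: dist_norm norm_minus_commute)
        have "norm (lam *\<^sub>R \<xi> + \<tau> *\<^sub>R \<eta>) \<le> lam * norm \<xi> + \<tau> * norm \<eta>"
          using norm_triangle_ineq[of "lam *\<^sub>R \<xi>" "\<tau> *\<^sub>R \<eta>"] lam \<tau> by simp
        also have "\<dots> \<le> lam * ?R + lam * norm \<eta>"
          using n\<xi> lam \<tau> sq by (intro add_mono mult_left_mono mult_right_mono) auto
        finally have "1 + norm (lam *\<^sub>R \<xi> + \<tau> *\<^sub>R \<eta>) \<le> lam + lam * ?R + lam * norm \<eta> + lam * ?R * norm \<eta>"
          using lam r by (simp add: add_increasing2)
        also have "\<dots> = lam * (1 + ?R) * ?t" by (simp add: algebra_simps)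
        finally have "(1 + norm (lam *\<^sub>R \<xi> + \<tau> *\<^sub>R \<eta>)) ^ P \<le> (lam * (1 + ?R) * ?t) ^ P"
          by (intro power_mono) auto
        then have "G * lam ^ P * (1 + norm (lam *\<^sub>R \<xi> + \<tau> *\<^sub>R \<eta>)) ^ P \<le> G * lam ^ P * (lam * (1 + ?R) * ?t) ^ P"
          using G lam by (intro mult_left_mono) auto
        then have "w \<eta> * (G * lam ^ P * (1 + norm (lam *\<^sub>R \<xi> + \<tau> *\<^sub>R \<eta>)) ^ P) \<le> w \<eta> * (G * lam ^ P * (lam * (1 + ?R) * ?t) ^ P)"
          by (rule mult_left_mono) (rule w0)
        also have "\<dots> = G * (1 + ?R) ^ P * lam ^ (2 * P) * (?t ^ P * w \<eta>)"
          by (simp add: power_mult_distrib power_mult power2_eq_square mult_ac)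
        also have "\<dots> \<le> K / lam ^ M * (1 / ?t ^ ?n)"
        proof -
          have "r * sqrt lam \<le> ?t" using \<eta> by simp
          then have "(r * sqrt lam) ^ (2 * Q) \<le> ?t ^ (2 * Q)" using r lam by (intro power_mono) auto
          moreover have "(r * sqrt lam) ^ (2 * Q) = (r\<^sup>2) ^ Q * lam ^ Q" using lam by (simp add: power_mult_distrib power_mult)
          ultimately have rQ: "(r\<^sup>2) ^ Q * lam ^ Q \<le> ?t ^ (2 * Q)" by simp
          have "(r\<^sup>2) ^ Q * lam ^ Q * (?t ^ ?n * (?t ^ P * w \<eta>)) \<le> ?t ^ (2 * Q) * (?t ^ ?n * (?t ^ P * w \<eta>))"
            using rQ w0 by (intro mult_right_mono) auto
          also have "\<dots> = ?t ^ (P + ?n + 2 * Q) * w \<eta>" by (simp add: power_add mult_ac)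
          also have "\<dots> \<le> B" by (rule B)
          finally have "?t ^ P * w \<eta> \<le> B / ((r\<^sup>2) ^ Q * lam ^ Q * ?t ^ ?n)"
            using r lam pos by (subst pos_le_divide_eq) (auto simp: mult_ac intro!: mult_pos_pos)
          then have "G * (1 + ?R) ^ P * lam ^ (2 * P) * (?t ^ P * w \<eta>) \<le> G * (1 + ?R) ^ P * lam ^ (2 * P) * (B / ((r\<^sup>2) ^ Q * lam ^ Q * ?t ^ ?n))"
            using G r lam by (intro mult_left_mono) auto
          also have "\<dots> = K / lam ^ M * (1 / ?t ^ ?n)"
            unfolding K_def Q_def using lam r by (simp add: power_add field_simps)
          finally show ?thesis .
        qed
        finally have "w \<eta> * (G * lam ^ P * (1 + norm (lam *\<^sub>R \<xi> + \<tau> *\<^sub>R \<eta>)) ^ P) \<le> K / lam ^ M * (1 / ?t ^ ?n)" .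
        then have "ennreal (w \<eta>) * ennreal (G * lam ^ P * (1 + norm (lam *\<^sub>R \<xi> + \<tau> *\<^sub>R \<eta>)) ^ P) \<le> ennreal (K / lam ^ M * (1 / ?t ^ ?n))"
          using w0 G lam by (subst ennreal_mult[symmetric]) (auto intro!: ennreal_leI)
        then show ?thesis by (rule order_trans[OF mult_left_mono[OF \<Psi>[OF lam] zero_le]])
      qed
      have "inn \<eta> \<le> (\<integral>\<^sup>+\<xi>. ennreal (K / lam ^ M * (1 / ?t ^ ?n)) * indicator (ball \<xi>0 r) \<xi> \<partial>lborel)"
        unfolding inn_def by (intro nn_integral_mono) (use pw in \<open>auto simp: indicator_def\<close>)
      also have "\<dots> = ennreal (K / lam ^ M * (1 / ?t ^ ?n)) * ennreal \<mu>"
        by (subst nn_integral_cmult_indicator) (auto simp: \<mu>)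
      also have "\<dots> = ennreal (K * \<mu> / lam ^ M * (1 / ?t ^ ?n))"
        using K \<mu>0 lam by (subst ennreal_mult[symmetric]) (auto simp: mult_ac)
      finally show ?thesis .
    qed
    have le: "inn \<eta> \<le> ennreal (B1 * (1 / (1 + norm \<eta>) ^ ?n)) * h + ennreal (K * \<mu> / lam ^ M * (1 / (1 + norm \<eta>) ^ ?n))" for \<eta>
    proof (cases "norm \<eta> < r * sqrt lam")
      case True
      have "w \<eta> \<le> B1 * (1 / (1 + norm \<eta>) ^ ?n)"
        using B1[of \<eta>] pos[of \<eta> ?n] by (simp add: pos_le_divide_eq mult.commute)
      then have "ennreal (w \<eta>) * h \<le> ennreal (B1 * (1 / (1 + norm \<eta>) ^ ?n)) * h"
        by (intro mult_right_mono ennreal_leI) auto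
      then show ?thesis using near[OF True] by (metis add_increasing2 order_trans zero_le)
    next
      case False
      then show ?thesis using far[OF False] by (metis add_increasing zero_le)
    qed
    have meas: "(\<lambda>(\<xi>, \<eta>). ennreal (w \<eta>) * \<Psi> lam (lam *\<^sub>R \<xi> + \<tau> *\<^sub>R \<eta>) * indicator (ball \<xi>0 r) \<xi>) \<in> borel_measurable (lborel \<Otimes>\<^sub>M lborel)"
      by measurable
    have "(\<integral>\<^sup>+\<xi>\<in>ball \<xi>0 r. (\<integral>\<^sup>+\<eta>. ennreal (w \<eta>) * \<Psi> lam (lam *\<^sub>R \<xi> + \<tau> *\<^sub>R \<eta>) \<partial>lborel) \<partial>lborel) =
      (\<integral>\<^sup>+\<xi>. (\<integral>\<^sup>+\<eta>. ennreal (w \<eta>) * \<Psi> lam (lam *\<^sub>R \<xi> + \<tau> *\<^sub>R \<eta>) * indicator (ball \<xi>0 r) \<xi> \<partial>lborel) \<partial>lborel)"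
      by (intro nn_integral_cong nn_integral_multc[symmetric]) measurable
    also have "\<dots> = (\<integral>\<^sup>+\<eta>. inn \<eta> \<partial>lborel)"
      unfolding inn_def by (rule lborel_pair.Fubini'[OF meas, symmetric])
    also have "\<dots> \<le> (\<integral>\<^sup>+\<eta>. ennreal (B1 * (1 / (1 + norm (\<eta>::'a)) ^ ?n)) * h + ennreal (K * \<mu> / lam ^ M * (1 / (1 + norm \<eta>) ^ ?n)) \<partial>lborel)"
      by (intro nn_integral_mono le)
    also have "\<dots> = (\<integral>\<^sup>+\<eta>. ennreal (B1 * (1 / (1 + norm (\<eta>::'a)) ^ ?n)) \<partial>lborel) * h + (\<integral>\<^sup>+\<eta>. ennreal (K * \<mu> / lam ^ M * (1 / (1 + norm (\<eta>::'a)) ^ ?n)) \<partial>lborel)"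
      by (subst nn_integral_add) (auto simp: nn_integral_multc)
    also have "(\<integral>\<^sup>+\<eta>. ennreal (B1 * (1 / (1 + norm (\<eta>::'a)) ^ ?n)) \<partial>lborel) = ennreal (B1 * W)"
      using B10 W by (simp only: ennreal_mult'[OF B10]) (simp add: nn_integral_cmult ennreal_mult)
    also have "(\<integral>\<^sup>+\<eta>. ennreal (K * \<mu> / lam ^ M * (1 / (1 + norm (\<eta>::'a)) ^ ?n)) \<partial>lborel) = ennreal (K * \<mu> / lam ^ M * W)"
    proof -
      have "0 \<le> K * \<mu> / lam ^ M" using K \<mu>0 lam by simp
      then show ?thesis using W by (simp only: ennreal_mult') (simp add: nn_integral_cmult ennreal_mult)
    qed
    also have "ennreal (B1 * W) * h + ennreal (K * \<mu> / lam ^ M * W) \<le> ennreal (B1 * W + K * \<mu> * W) * h + ennreal ((B1 * W + K * \<mu> * W) / lam ^ M)"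
    proof (intro add_mono mult_right_mono ennreal_leI)
      show "B1 * W \<le> B1 * W + K * \<mu> * W" using K \<mu>0 W(1) by simp
      have "K * \<mu> / lam ^ M * W = K * \<mu> * W / lam ^ M" by simp
      also have "\<dots> \<le> (B1 * W + K * \<mu> * W) / lam ^ M" using B10 W(1) lam by (intro divide_right_mono) auto
      finally show "K * \<mu> / lam ^ M * W \<le> (B1 * W + K * \<mu> * W) / lam ^ M" .
    qed simp
    finally show "(\<integral>\<^sup>+\<xi>\<in>ball \<xi>0 r. (\<integral>\<^sup>+\<eta>. ennreal (w \<eta>) * \<Psi> lam (lam *\<^sub>R \<xi> + \<tau> *\<^sub>R \<eta>) \<partial>lborel) \<partial>lborel) \<le>
      ennreal (B1 * W + K * \<mu> * W) * (\<integral>\<^sup>+\<xi>\<in>ball \<xi>0 (2 * r). \<Psi> lam (lam *\<^sub>R \<xi>) \<partial>lborel) + ennreal ((B1 * W + K * \<mu> * W) / lam ^ M)"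
      unfolding h_def .
  qed
qed

lemma nn_integral_ball_pos:
  fixes w :: "'a::euclidean_space \<Rightarrow> ennreal"
  assumes [measurable]: "w \<in> borel_measurable borel" and "(\<integral>\<^sup>+\<eta>. w \<eta> \<partial>lborel) > 0"
  obtains R where "R > 0" "(\<integral>\<^sup>+\<eta>\<in>ball 0 R. w \<eta> \<partial>lborel) > 0"
proof (rule ccontr)
  assume "\<not> thesis"
  with that have 0: "(\<integral>\<^sup>+\<eta>\<in>ball 0 R. w \<eta> \<partial>lborel) = 0" if "R > 0" for R
    using \<open>R > 0\<close> by (metis not_gr_zero)
  have "AE \<eta> in lborel. w \<eta> * indicator (ball 0 (real (Suc m))) \<eta> = 0" for m
  proof -
    have "(\<integral>\<^sup>+\<eta>\<in>ball 0 (real (Suc m)). w \<eta> \<partial>lborel) = 0" by (rule 0) simp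
    moreover have "(\<lambda>\<eta>. w \<eta> * indicator (ball 0 (real (Suc m))) \<eta>) \<in> borel_measurable lborel" by measurable
    ultimately show ?thesis using nn_integral_0_iff_AE by blast
  qed
  then have "AE \<eta> in lborel. \<forall>m. w \<eta> * indicator (ball 0 (real (Suc m))) \<eta> = 0"
    unfolding AE_all_countable by blast
  then have "AE \<eta> in lborel. w \<eta> = 0"
  proof eventually_elim
    case (elim \<eta>)
    obtain m where "norm \<eta> < real m" using reals_Archimedean2 by blast
    then have "\<eta> \<in> ball 0 (real (Suc m))" by simp
    then show ?case using spec[OF elim, of m] by (simp only: indicator_simps mult_1_right)
  qed
  then have "(\<integral>\<^sup>+\<eta>. w \<eta> \<partial>lborel) = 0" by (subst nn_integral_0_iff_AE) auto
  with assms(2) show False by simp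
qed

text \<open>Some ball of radius \<open>R\<close> carries positive \<open>w\<close>-mass. Once
  \<open>lam \<ge> (R / r)\<^sup>2\<close>, every shift by \<open>\<eta> / sqrt lam\<close> from
  that ball is shorter than \<open>r\<close>, so for each such \<open>\<eta>\<close> the integral
  over the doubled ball contains a translate of the integral on the left; averaging over
  \<open>\<eta>\<close> gives the claim with the reciprocal of that mass.\<close>

lemma near_lower:
  fixes w :: "'a::euclidean_space \<Rightarrow> real" and \<Psi> :: "real \<Rightarrow> 'a \<Rightarrow> ennreal" and \<xi>0 :: 'a
  assumes w: "integrable lborel w" and w0: "\<And>\<eta>. w \<eta> \<ge> 0" and wpos: "(\<integral>\<^sup>+\<eta>. ennreal (w \<eta>) \<partial>lborel) > 0"
    and \<Psi>_meas: "\<And>lam. lam \<ge> 1 \<Longrightarrow> \<Psi> lam \<in> borel_measurable borel"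
    and r: "r > 0"
  obtains C lam0 where "C \<ge> 0" "lam0 \<ge> 1" "\<And>lam. lam \<ge> lam0 \<Longrightarrow>
    (\<integral>\<^sup>+\<xi>\<in>ball \<xi>0 r. \<Psi> lam (lam *\<^sub>R \<xi>) \<partial>lborel) \<le>
    ennreal C * (\<integral>\<^sup>+\<xi>\<in>ball \<xi>0 (2 * r). (\<integral>\<^sup>+\<eta>. ennreal (w \<eta>) * \<Psi> lam (lam *\<^sub>R \<xi> + sqrt lam *\<^sub>R \<eta>) \<partial>lborel) \<partial>lborel)"
proof -
  from w have [measurable]: "w \<in> borel_measurable borel" by auto
  obtain R where R: "R > 0" "(\<integral>\<^sup>+\<eta>\<in>ball 0 R. ennreal (w \<eta>) \<partial>lborel) > 0"
    using nn_integral_ball_pos[OF _ wpos] by auto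
  let ?I = "\<integral>\<^sup>+\<eta>\<in>ball 0 R. ennreal (w \<eta>) \<partial>lborel"
  have "?I \<le> (\<integral>\<^sup>+\<eta>. ennreal (w \<eta>) \<partial>lborel)" by (intro nn_integral_mono) (auto simp: indicator_def)
  also have "\<dots> < \<infinity>" using w0 nn_integral_eq_integral[OF w] by simp
  finally have fin: "?I < \<infinity>" .
  define c where "c = enn2real ?I"
  have c: "?I = ennreal c" "c > 0" unfolding c_def using fin R(2) by (auto simp: enn2real_positive_iff)
  show thesis
  proof (rule that[of "1 / c" "max 1 ((R / r)\<^sup>2)"])
    show "0 \<le> 1 / c" "1 \<le> max 1 ((R / r)\<^sup>2)" using c(2) by auto
    fix lam assume "max 1 ((R / r)\<^sup>2) \<le> lam"
    then have lam: "lam \<ge> 1" and lamR: "(R / r)\<^sup>2 \<le> lam" by auto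
    note [measurable] = \<Psi>_meas[OF lam]
    have sq: "R \<le> r * sqrt lam"
    proof -
      have "R / r \<le> sqrt lam" using lamR by (rule real_le_rsqrt)
      then show ?thesis using r by (simp add: pos_divide_le_eq mult.commute)
    qed
    define h where "h = (\<integral>\<^sup>+\<xi>\<in>ball \<xi>0 r. \<Psi> lam (lam *\<^sub>R \<xi>) \<partial>lborel)"
    define inn where "inn = (\<lambda>\<eta>. \<integral>\<^sup>+\<xi>\<in>ball \<xi>0 (2 * r). ennreal (w \<eta>) * \<Psi> lam (lam *\<^sub>R \<xi> + sqrt lam *\<^sub>R \<eta>) \<partial>lborel)"
    have le: "ennreal (w \<eta>) * indicator (ball 0 R) \<eta> * h \<le> inn \<eta>" for \<eta>
    proof (cases "\<eta> \<in> ball 0 R")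
      case True
      let ?v = "(- (1 / sqrt lam)) *\<^sub>R \<eta>"
      have v: "norm ?v < r"
      proof -
        have "norm \<eta> < r * sqrt lam" using True sq by simp
        then show ?thesis using lam by (simp add: pos_divide_less_eq)
      qed
      let ?F = "\<lambda>\<xi>. \<Psi> lam (lam *\<^sub>R \<xi> + sqrt lam *\<^sub>R \<eta>) * indicator (ball \<xi>0 (2 * r)) \<xi>"
      have "h \<le> (\<integral>\<^sup>+\<xi>. ?F (?v + \<xi>) \<partial>lborel)"
        unfolding h_def
      proof (rule nn_integral_mono)
        fix \<xi>
        have "lam / sqrt lam = sqrt lam" using lam by (simp add: real_div_sqrt)
        then have "lam *\<^sub>R (?v + \<xi>) + sqrt lam *\<^sub>R \<eta> = lam *\<^sub>R \<xi>" by (simp add: scaleR_diff_right)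
        moreover have "?v + \<xi> \<in> ball \<xi>0 (2 * r)" if "\<xi> \<in> ball \<xi>0 r"
        proof -
          have "norm (\<xi>0 - (?v + \<xi>)) \<le> norm (\<xi>0 - \<xi>) + norm ?v"
            using norm_triangle_ineq4[of "\<xi>0 - \<xi>" ?v] by (simp add: algebra_simps)
          then show ?thesis using that v by (simp only: mem_ball dist_norm)
        qed
        ultimately show "\<Psi> lam (lam *\<^sub>R \<xi>) * indicator (ball \<xi>0 r) \<xi> \<le> ?F (?v + \<xi>)"
          by (cases "\<xi> \<in> ball \<xi>0 r") (simp_all del: mem_ball)
      qed
      also have "\<dots> = (\<integral>\<^sup>+\<xi>. ?F \<xi> \<partial>lborel)" by (rule nn_integral_lborel_translate) measurable
      finally have "ennreal (w \<eta>) * h \<le> ennreal (w \<eta>) * (\<integral>\<^sup>+\<xi>. ?F \<xi> \<partial>lborel)" by (intro mult_left_mono) auto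
      also have "\<dots> = inn \<eta>" unfolding inn_def by (subst nn_integral_cmult[symmetric]) (auto simp: mult.assoc)
      finally show ?thesis using True by simp
    qed simp
    have meas: "(\<lambda>(\<xi>, \<eta>). ennreal (w \<eta>) * \<Psi> lam (lam *\<^sub>R \<xi> + sqrt lam *\<^sub>R \<eta>) * indicator (ball \<xi>0 (2 * r)) \<xi>) \<in> borel_measurable (lborel \<Otimes>\<^sub>M lborel)"
      by measurable
    have "ennreal c * h = (\<integral>\<^sup>+\<eta>. ennreal (w \<eta>) * indicator (ball 0 R) \<eta> * h \<partial>lborel)"
      unfolding c(1)[symmetric] by (rule nn_integral_multc[symmetric]) measurable
    also have "\<dots> \<le> (\<integral>\<^sup>+\<eta>. inn \<eta> \<partial>lborel)" by (intro nn_integral_mono le)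
    also have "\<dots> = (\<integral>\<^sup>+\<xi>. (\<integral>\<^sup>+\<eta>. ennreal (w \<eta>) * \<Psi> lam (lam *\<^sub>R \<xi> + sqrt lam *\<^sub>R \<eta>) * indicator (ball \<xi>0 (2 * r)) \<xi> \<partial>lborel) \<partial>lborel)"
      unfolding inn_def by (rule lborel_pair.Fubini'[OF meas])
    also have "\<dots> = (\<integral>\<^sup>+\<xi>\<in>ball \<xi>0 (2 * r). (\<integral>\<^sup>+\<eta>. ennreal (w \<eta>) * \<Psi> lam (lam *\<^sub>R \<xi> + sqrt lam *\<^sub>R \<eta>) \<partial>lborel) \<partial>lborel)"
      by (intro nn_integral_cong nn_integral_multc) measurable
    finally have "ennreal (1 / c) * (ennreal c * h) \<le> ennreal (1 / c) * (\<integral>\<^sup>+\<xi>\<in>ball \<xi>0 (2 * r). (\<integral>\<^sup>+\<eta>. ennreal (w \<eta>) * \<Psi> lam (lam *\<^sub>R \<xi> + sqrt lam *\<^sub>R \<eta>) \<partial>lborel) \<partial>lborel)"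
      by (intro mult_left_mono) auto
    moreover have "ennreal (1 / c) * (ennreal c * h) = h"
      using c(2) by (simp add: mult.assoc[symmetric] ennreal_mult[symmetric])
    ultimately show "(\<integral>\<^sup>+\<xi>\<in>ball \<xi>0 r. \<Psi> lam (lam *\<^sub>R \<xi>) \<partial>lborel) \<le>
      ennreal (1 / c) * (\<integral>\<^sup>+\<xi>\<in>ball \<xi>0 (2 * r). (\<integral>\<^sup>+\<eta>. ennreal (w \<eta>) * \<Psi> lam (lam *\<^sub>R \<xi> + sqrt lam *\<^sub>R \<eta>) \<partial>lborel) \<partial>lborel)"
      unfolding h_def by simp
  qed
qed

section \<open>A substitute for polar coordinates around the direction \<open>\<xi>0\<close>\<close>

lemma powr_le_powr_ratio:
  fixes a b t x p :: real
  assumes "0 < a" "a * t \<le> x" "x \<le> b * t" "0 < t"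
  shows "x powr p \<le> (a powr p + b powr p) * t powr p"
proof -
  have "0 < a * t" using assms by simp
  then have x: "x > 0" using assms by linarith
  have b: "b > 0" using assms x by (metis mult_le_0_iff not_le order_trans less_imp_le)
  \<comment> \<open>The sign of \<open>p\<close> decides which end of the interval gives the larger
    power; the sum of both covers either case.\<close>
  show ?thesis
  proof (cases "p \<ge> 0")
    case True
    then have "x powr p \<le> (b * t) powr p" using x assms by (intro powr_mono2) auto
    also have "\<dots> = b powr p * t powr p" using b assms by (simp add: powr_mult)
    also have "\<dots> \<le> (a powr p + b powr p) * t powr p" by (intro mult_right_mono) auto
    finally show ?thesis .
  next
    case False
    then have "x powr p \<le> (a * t) powr p" using assms \<open>0 < a * t\<close> by (intro powr_mono2') auto
    also have "\<dots> = a powr p * t powr p" using assms by (simp add: powr_mult)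
    also have "\<dots> \<le> (a powr p + b powr p) * t powr p" by (intro mult_right_mono) auto
    finally show ?thesis .
  qed
qed

lemma japanese_ge: "1 \<le> japanese \<xi>" "norm \<xi> \<le> japanese \<xi>" and japanese_le: "japanese \<xi> \<le> 1 + norm \<xi>"
  unfolding japanese_def by (auto intro!: real_le_rsqrt real_le_lsqrt simp: power2_eq_square algebra_simps)

text \<open>A vector within \<open>norm \<xi>0 / 2\<close> of \<open>\<xi>0\<close> has norm between
  one half and three halves of \<open>norm \<xi>0\<close>. Multiplied by \<open>lam\<close>, this
  makes \<open>lam\<close> and \<open>japanese \<zeta>\<close> comparable.\<close>

lemma japanese_comparable:
  fixes \<xi>0 :: "'a::euclidean_space"
  assumes "\<rho> \<le> norm \<xi>0 / 2" "\<xi>0 \<noteq> 0" "lam \<ge> 1" "(1 / lam) *\<^sub>R \<zeta> \<in> ball \<xi>0 \<rho>"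
  shows "1 / (1 + 3 * norm \<xi>0 / 2) * japanese \<zeta> \<le> lam" "lam \<le> 2 / norm \<xi>0 * japanese \<zeta>"
proof -
  let ?m = "norm \<xi>0"
  have d: "norm (\<xi>0 - (1 / lam) *\<^sub>R \<zeta>) < ?m / 2" using assms by (simp add: dist_norm)
  have n: "norm ((1 / lam) *\<^sub>R \<zeta>) = norm \<zeta> / lam" using assms by simp
  have "norm \<zeta> / lam < 3 * ?m / 2" "?m / 2 < norm \<zeta> / lam"
    using d norm_triangle_ineq2[of "(1 / lam) *\<^sub>R \<zeta>" \<xi>0] norm_triangle_ineq2[of \<xi>0 "(1 / lam) *\<^sub>R \<zeta>"]
    unfolding n norm_minus_commute[of "(1 / lam) *\<^sub>R \<zeta>" \<xi>0] by linarith+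
  then have z: "norm \<zeta> < 3 * ?m / 2 * lam" "?m / 2 * lam < norm \<zeta>" using assms by (auto simp: field_simps)
  have "japanese \<zeta> \<le> lam + 3 * ?m / 2 * lam" using japanese_le[of \<zeta>] z assms by linarith
  then have "japanese \<zeta> \<le> (1 + 3 * ?m / 2) * lam" by (simp add: algebra_simps)
  moreover have "0 < 1 + 3 * ?m / 2" by (simp add: add_pos_nonneg)
  ultimately show "1 / (1 + 3 * ?m / 2) * japanese \<zeta> \<le> lam" by (simp add: pos_divide_le_eq mult.commute)
  have "?m / 2 * lam \<le> japanese \<zeta>" using z japanese_ge[of \<zeta>] by linarith
  then show "lam \<le> 2 / ?m * japanese \<zeta>" using assms by (simp add: field_simps)
qed

text \<open>Only the radii \<open>lam\<close> that bring \<open>\<zeta>\<close> back into the ball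
  count. On a cone around \<open>\<xi>0\<close> and away from the origin this behaves like
  \<open>japanese \<zeta> powr (2 * s)\<close>, the weight of the Sobolev norm.\<close>

definition polar_weight :: "real \<Rightarrow> real \<Rightarrow> 'a::euclidean_space \<Rightarrow> real \<Rightarrow> 'a \<Rightarrow> ennreal" where
  "polar_weight s lam0 \<xi>0 \<rho> \<zeta> =
     (\<integral>\<^sup>+lam\<in>{lam0..}. ennreal (lam powr (2 * s - 1)) * indicator (ball \<xi>0 \<rho>) ((1 / lam) *\<^sub>R \<zeta>) \<partial>lborel)"

text \<open>For fixed \<open>lam\<close> substitute \<open>\<zeta>\<close> for
  \<open>lam *\<^sub>R \<xi>\<close>; the Jacobian lowers the exponent by \<open>DIM('a)\<close> to
  \<open>2 * s - 1\<close>. Tonelli then gathers the integral over \<open>lam\<close> into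
  \<open>polar_weight\<close>, without any measure on the sphere.\<close>

lemma polar_swap:
  fixes G :: "'a::euclidean_space \<Rightarrow> ennreal"
  assumes [measurable]: "G \<in> borel_measurable borel" and lam0: "lam0 \<ge> 1"
  shows "(\<integral>\<^sup>+lam\<in>{lam0..}. ennreal (lam powr (real DIM('a) - 1 + 2 * s)) * (\<integral>\<^sup>+\<xi>\<in>ball \<xi>0 \<rho>. G (lam *\<^sub>R \<xi>) \<partial>lborel) \<partial>lborel)
    = (\<integral>\<^sup>+\<zeta>. G \<zeta> * polar_weight s lam0 \<xi>0 \<rho> \<zeta> \<partial>lborel)"
proof -
  let ?b = "\<lambda>lam \<zeta>. indicator (ball \<xi>0 \<rho>) ((1 / lam) *\<^sub>R \<zeta>) :: ennreal"
  have [measurable]: "(\<lambda>p. ?b (fst p) (snd p)) \<in> borel_measurable (lborel \<Otimes>\<^sub>M lborel)"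
    by (rule measurable_compose[OF _ borel_measurable_indicator[of "ball \<xi>0 \<rho>" borel]]) measurable
  have [measurable]: "?b lam \<in> borel_measurable borel" for lam
    by (rule measurable_compose[OF _ borel_measurable_indicator[of "ball \<xi>0 \<rho>" borel]]) measurable
  have [measurable]: "(\<lambda>lam. ?b lam \<zeta>) \<in> borel_measurable borel" for \<zeta>
    by (rule measurable_compose[OF _ borel_measurable_indicator[of "ball \<xi>0 \<rho>" borel]]) measurable
  have inner: "ennreal (lam powr (real DIM('a) - 1 + 2 * s)) * (\<integral>\<^sup>+\<xi>\<in>ball \<xi>0 \<rho>. G (lam *\<^sub>R \<xi>) \<partial>lborel) * indicator {lam0..} lam =
      (\<integral>\<^sup>+\<zeta>. G \<zeta> * (ennreal (lam powr (2 * s - 1)) * ?b lam \<zeta> * indicator {lam0..} lam) \<partial>lborel)" for lam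
  proof (cases "lam \<ge> lam0")
    case True
    then have lam: "lam > 0" using lam0 by simp
    have "(\<integral>\<^sup>+\<zeta>. G \<zeta> * ?b lam \<zeta> \<partial>lborel) = ennreal (lam ^ DIM('a)) * (\<integral>\<^sup>+\<xi>. G (0 + lam *\<^sub>R \<xi>) * ?b lam (0 + lam *\<^sub>R \<xi>) \<partial>lborel)"
      by (rule nn_integral_lborel_affine[OF _ lam]) measurable
    also have "\<dots> = ennreal (lam ^ DIM('a)) * (\<integral>\<^sup>+\<xi>\<in>ball \<xi>0 \<rho>. G (lam *\<^sub>R \<xi>) \<partial>lborel)" using lam by simp
    finally have *: "(\<integral>\<^sup>+\<zeta>. G \<zeta> * ?b lam \<zeta> \<partial>lborel) = ennreal (lam ^ DIM('a)) * (\<integral>\<^sup>+\<xi>\<in>ball \<xi>0 \<rho>. G (lam *\<^sub>R \<xi>) \<partial>lborel)" .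
    have pw: "lam powr (real DIM('a) - 1 + 2 * s) = lam powr (2 * s - 1) * lam ^ DIM('a)"
      using lam by (simp add: powr_realpow[symmetric] powr_add[symmetric] algebra_simps)
    have "(\<integral>\<^sup>+\<zeta>. G \<zeta> * (ennreal (lam powr (2 * s - 1)) * ?b lam \<zeta> * indicator {lam0..} lam) \<partial>lborel) =
      (\<integral>\<^sup>+\<zeta>. ennreal (lam powr (2 * s - 1)) * (G \<zeta> * ?b lam \<zeta>) \<partial>lborel)"
      using True by (intro nn_integral_cong) (simp add: mult_ac)
    also have "\<dots> = ennreal (lam powr (2 * s - 1)) * (\<integral>\<^sup>+\<zeta>. G \<zeta> * ?b lam \<zeta> \<partial>lborel)"
      by (rule nn_integral_cmult) measurable
    finally show ?thesis unfolding * pw using True lam by (simp add: ennreal_mult mult.assoc)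
  qed simp
  have "(\<integral>\<^sup>+lam\<in>{lam0..}. ennreal (lam powr (real DIM('a) - 1 + 2 * s)) * (\<integral>\<^sup>+\<xi>\<in>ball \<xi>0 \<rho>. G (lam *\<^sub>R \<xi>) \<partial>lborel) \<partial>lborel)
    = (\<integral>\<^sup>+lam. (\<integral>\<^sup>+\<zeta>. G \<zeta> * (ennreal (lam powr (2 * s - 1)) * ?b lam \<zeta> * indicator {lam0..} lam) \<partial>lborel) \<partial>lborel)"
    unfolding inner ..
  also have "\<dots> = (\<integral>\<^sup>+\<zeta>. (\<integral>\<^sup>+lam. G \<zeta> * (ennreal (lam powr (2 * s - 1)) * ?b lam \<zeta> * indicator {lam0..} lam) \<partial>lborel) \<partial>lborel)"
  proof (rule lborel_pair.Fubini'[symmetric])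
    have "(\<lambda>p. G (snd p) * (ennreal (fst p powr (2 * s - 1)) * ?b (fst p) (snd p) * indicator {lam0..} (fst p))) \<in> borel_measurable (lborel \<Otimes>\<^sub>M lborel)"
      by measurable
    then show "(\<lambda>(lam, \<zeta>). G \<zeta> * (ennreal (lam powr (2 * s - 1)) * ?b lam \<zeta> * indicator {lam0..} lam)) \<in> borel_measurable (lborel \<Otimes>\<^sub>M lborel)"
      by (simp add: case_prod_beta')
  qed
  also have "\<dots> = (\<integral>\<^sup>+\<zeta>. G \<zeta> * polar_weight s lam0 \<xi>0 \<rho> \<zeta> \<partial>lborel)"
    unfolding polar_weight_def by (intro nn_integral_cong nn_integral_cmult) measurable
  finally show ?thesis .
qed

text \<open>Contributing radii are comparable to \<open>japanese \<zeta>\<close>: they fill an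
  interval of length at most a multiple of it, on which the integrand is at most a multiple of its
  power \<open>2 * s - 1\<close>.\<close>

lemma polar_weight_upper:
  fixes \<xi>0 :: "'a::euclidean_space"
  assumes \<rho>: "\<rho> \<le> norm \<xi>0 / 2" and \<xi>0: "\<xi>0 \<noteq> 0"
  obtains C where "C \<ge> 0" "\<And>\<zeta>. polar_weight s 1 \<xi>0 \<rho> \<zeta> \<le> ennreal (C * japanese \<zeta> powr (2 * s))"
proof -
  let ?a = "1 / (1 + 3 * norm \<xi>0 / 2)" and ?b = "2 / norm \<xi>0"
  have a: "?a > 0" by (simp add: add_pos_nonneg)
  have b: "?b > 0" using \<xi>0 by simp
  let ?c = "?a powr (2 * s - 1) + ?b powr (2 * s - 1)"
  show thesis
  proof (rule that[of "?c * ?b"])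
    show "0 \<le> ?c * ?b" using b by simp
    fix \<zeta> :: 'a
    let ?t = "japanese \<zeta>"
    have t: "?t \<ge> 1" by (rule japanese_ge)
    have "polar_weight s 1 \<xi>0 \<rho> \<zeta> \<le> (\<integral>\<^sup>+lam. ennreal (?c * ?t powr (2 * s - 1)) * indicator {0..?b * ?t} lam \<partial>lborel)"
      unfolding polar_weight_def
    proof (rule nn_integral_mono)
      fix lam :: real
      show "ennreal (lam powr (2 * s - 1)) * indicator (ball \<xi>0 \<rho>) ((1 / lam) *\<^sub>R \<zeta>) * indicator {1..} lam
        \<le> ennreal (?c * ?t powr (2 * s - 1)) * indicator {0..?b * ?t} lam"
      proof (cases "lam \<ge> 1 \<and> (1 / lam) *\<^sub>R \<zeta> \<in> ball \<xi>0 \<rho>")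
        case True
        note j = japanese_comparable[OF \<rho> \<xi>0, of lam \<zeta>]
        have "lam powr (2 * s - 1) \<le> ?c * ?t powr (2 * s - 1)"
          using powr_le_powr_ratio[OF a j] True t by simp
        moreover have "lam \<in> {0..?b * ?t}" using j True by auto
        ultimately show ?thesis using True by (simp add: ennreal_leI)
      qed auto
    qed
    also have "\<dots> = ennreal (?c * ?t powr (2 * s - 1)) * ennreal (?b * ?t)"
      using b t by (subst nn_integral_cmult_indicator) auto
    also have "\<dots> = ennreal (?c * ?b * ?t powr (2 * s))"
    proof -
      have "?t powr (2 * s) = ?t powr (2 * s - 1) * ?t powr 1" unfolding powr_add[symmetric] by simp
      then have "?t powr (2 * s) = ?t powr (2 * s - 1) * ?t" using t by simp
      then show ?thesis using b t by (subst ennreal_mult[symmetric]) (auto simp: mult_ac)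
    qed
    finally show "polar_weight s 1 \<xi>0 \<rho> \<zeta> \<le> ennreal (?c * ?b * ?t powr (2 * s))" .
  qed
qed

text \<open>For \<open>\<zeta>\<close> on the ray through a point \<open>w\<close> of the half ball,
  all radii from \<open>t\<close> to \<open>t + \<kappa> * t\<close> contribute, an interval whose
  length is comparable to \<open>japanese \<zeta>\<close>.\<close>

lemma polar_weight_lower:
  fixes \<xi>0 :: "'a::euclidean_space"
  assumes \<rho>: "\<rho> \<le> norm \<xi>0 / 2" "\<rho> > 0" and \<xi>0: "\<xi>0 \<noteq> 0" and lam0: "lam0 \<ge> 1"
  obtains C where "C \<ge> 0" "\<And>t w. w \<in> ball \<xi>0 (\<rho> / 2) \<Longrightarrow> t \<ge> lam0 \<Longrightarrow>
     ennreal (japanese (t *\<^sub>R w) powr (2 * s)) \<le> ennreal C * polar_weight s lam0 \<xi>0 \<rho> (t *\<^sub>R w)"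
proof -
  let ?m = "norm \<xi>0"
  let ?a = "1 / (1 + 3 * ?m / 2)" and ?b = "2 / ?m"
  have m: "?m > 0" using \<xi>0 by simp
  have a: "?a > 0" by (simp add: add_pos_nonneg)
  \<comment> \<open>With \<open>norm w \<le> 3 * norm \<xi>0 / 2\<close>, a relative change of the
    radius by \<open>\<kappa>\<close> moves the point by at most \<open>\<rho> / 2\<close>, the
    margin between the half ball and the ball.\<close>
  define \<kappa> where "\<kappa> = \<rho> / (3 * ?m)"
  have \<kappa>: "\<kappa> > 0" unfolding \<kappa>_def using \<rho> m by simp
  let ?c = "(1 / ?b) powr (2 * s - 1) + (1 / ?a) powr (2 * s - 1)"
  show thesis
  proof (rule that[of "?c * (1 / ?a) / \<kappa>"])
    show "0 \<le> ?c * (1 / ?a) / \<kappa>" using a \<kappa> by (intro divide_nonneg_pos mult_nonneg_nonneg add_nonneg_nonneg) auto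
    fix t :: real and w :: 'a assume w: "w \<in> ball \<xi>0 (\<rho> / 2)" and t: "t \<ge> lam0"
    let ?z = "t *\<^sub>R w"
    let ?j = "japanese ?z"
    have t0: "t > 0" using t lam0 by simp
    have nw: "norm w \<le> 3 * ?m / 2"
      using w \<rho> norm_triangle_ineq2[of w \<xi>0] by (simp add: dist_norm norm_minus_commute)
    have j1: "?j \<ge> 1" by (rule japanese_ge)
    have in_ball: "(1 / lam) *\<^sub>R ?z \<in> ball \<xi>0 \<rho>" if "lam \<in> {t..t + \<kappa> * t}" for lam
    proof -
      have lam: "lam \<ge> t" "lam \<le> t + \<kappa> * t" "lam > 0" using that t0 by auto
      have "norm (\<xi>0 - (1 / lam) *\<^sub>R ?z) \<le> norm (\<xi>0 - w) + norm (w - (1 / lam) *\<^sub>R ?z)"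
        using norm_triangle_ineq[of "\<xi>0 - w" "w - (1 / lam) *\<^sub>R ?z"] by simp
      also have "w - (1 / lam) *\<^sub>R ?z = (1 - t / lam) *\<^sub>R w" by (simp add: scaleR_diff_left)
      also have "norm ((1 - t / lam) *\<^sub>R w) = (1 - t / lam) * norm w" using lam by simp
      also have "\<dots> \<le> \<kappa> * (3 * ?m / 2)"
      proof (intro mult_mono nw)
        have "lam - t \<le> \<kappa> * t" using lam by simp
        also have "\<dots> \<le> \<kappa> * lam" using \<kappa> lam by (intro mult_left_mono) auto
        finally show "1 - t / lam \<le> \<kappa>" using lam by (simp add: field_simps)
      qed (use \<kappa> in auto)
      also have "\<kappa> * (3 * ?m / 2) = \<rho> / 2" unfolding \<kappa>_def using m by simp
      finally show ?thesis using w by (simp add: dist_norm)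
    qed
    have low: "ennreal (1 / ?c * ?j powr (2 * s - 1)) * indicator {t..t + \<kappa> * t} lam \<le>
      ennreal (lam powr (2 * s - 1)) * indicator (ball \<xi>0 \<rho>) ((1 / lam) *\<^sub>R ?z) * indicator {lam0..} lam" for lam
    proof (cases "lam \<in> {t..t + \<kappa> * t}")
      case True
      then have lam: "lam \<ge> lam0" "lam \<ge> 1" using t lam0 by auto
      note j = japanese_comparable[OF \<rho>(1) \<xi>0 lam(2) in_ball[OF True]]
      have "?j powr (2 * s - 1) \<le> ?c * lam powr (2 * s - 1)"
      proof (rule powr_le_powr_ratio)
        show "0 < 1 / ?b" using m by simp
        show "1 / ?b * lam \<le> ?j" using j(2) m by (simp add: field_simps)
        show "?j \<le> 1 / ?a * lam" using j(1) a by (simp add: field_simps)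
        show "0 < lam" using lam by simp
      qed
      moreover have "?c > 0" using m by (intro add_pos_nonneg) auto
      ultimately have "1 / ?c * ?j powr (2 * s - 1) \<le> lam powr (2 * s - 1)"
        by (simp add: pos_divide_le_eq mult.commute)
      moreover have "indicator (ball \<xi>0 \<rho>) ((1 / lam) *\<^sub>R ?z) = (1::ennreal)" using in_ball[OF True] by (rule indicator_simps(1))
      ultimately show ?thesis using True lam by (simp add: ennreal_leI)
    qed simp
    have jt: "?a * ?j \<le> t"
    proof -
      have "t \<in> {t..t + \<kappa> * t}" using t0 \<kappa> by simp
      from japanese_comparable(1)[OF \<rho>(1) \<xi>0 _ in_ball[OF this]] t lam0 show ?thesis by simp
    qed
    have cpos: "?c > 0" using m by (intro add_pos_nonneg) auto
    have "ennreal (1 / ?c * ?j powr (2 * s - 1) * (\<kappa> * t)) = (\<integral>\<^sup>+lam. ennreal (1 / ?c * ?j powr (2 * s - 1)) * indicator {t..t + \<kappa> * t} lam \<partial>lborel)"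
      using \<kappa> t0 cpos by (subst nn_integral_cmult_indicator) (auto simp: ennreal_mult[symmetric])
    also have "\<dots> \<le> polar_weight s lam0 \<xi>0 \<rho> ?z" unfolding polar_weight_def by (intro nn_integral_mono low)
    finally have pl: "ennreal (1 / ?c * ?j powr (2 * s - 1) * (\<kappa> * t)) \<le> polar_weight s lam0 \<xi>0 \<rho> ?z" .
    have "?j powr (2 * s) = ?j powr (2 * s - 1) * ?j"
      using j1 powr_add[of ?j "2 * s - 1" 1] by simp
    also have "\<dots> \<le> ?j powr (2 * s - 1) * (1 / ?a * t)" using jt a by (intro mult_left_mono) (auto simp: field_simps)
    also have "\<dots> = ?c * (1 / ?a) / \<kappa> * (1 / ?c * ?j powr (2 * s - 1) * (\<kappa> * t))"
    proof -
      have "X * (A * t) = C * A / \<kappa> * (1 / C * X * (\<kappa> * t))" if "C > 0" for X A C :: real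
        using that \<kappa> by simp
      from this[OF cpos] show ?thesis .
    qed
    finally have "ennreal (?j powr (2 * s)) \<le> ennreal (?c * (1 / ?a) / \<kappa> * (1 / ?c * ?j powr (2 * s - 1) * (\<kappa> * t)))"
      by (rule ennreal_leI)
    also have "\<dots> = ennreal (?c * (1 / ?a) / \<kappa>) * ennreal (1 / ?c * ?j powr (2 * s - 1) * (\<kappa> * t))"
      using a \<kappa> t0 cpos by (intro ennreal_mult) (auto intro!: divide_nonneg_pos mult_nonneg_nonneg)
    also have "\<dots> \<le> ennreal (?c * (1 / ?a) / \<kappa>) * polar_weight s lam0 \<xi>0 \<rho> ?z"
      by (intro mult_left_mono pl) simp
    finally show "ennreal (?j powr (2 * s)) \<le> ennreal (?c * (1 / ?a) / \<kappa>) * polar_weight s lam0 \<xi>0 \<rho> ?z" .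
  qed
qed

section \<open>From the wave front set to wave packets\<close>

text \<open>A point outside the cone has no positive multiple in the ball, so its
  \<open>polar_weight\<close> is 0; inside, \<open>polar_weight_upper\<close> applies.\<close>

lemma polar_upper:
  fixes \<xi>0 :: "'a::euclidean_space"
  assumes \<rho>: "\<rho> \<le> norm \<xi>0 / 2" and \<xi>0: "\<xi>0 \<noteq> 0"
    and \<Gamma>: "ball \<xi>0 \<rho> \<subseteq> \<Gamma>" "\<And>\<xi> t. \<xi> \<in> \<Gamma> \<Longrightarrow> t > 0 \<Longrightarrow> t *\<^sub>R \<xi> \<in> \<Gamma>" "open \<Gamma>"
  obtains C where "C \<ge> 0" "\<And>G. G \<in> borel_measurable borel \<Longrightarrow>
    (\<integral>\<^sup>+lam\<in>{1..}. ennreal (lam powr (real DIM('a) - 1 + 2 * s)) * (\<integral>\<^sup>+\<xi>\<in>ball \<xi>0 \<rho>. G (lam *\<^sub>R \<xi>) \<partial>lborel) \<partial>lborel)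
      \<le> ennreal C * (\<integral>\<^sup>+\<zeta>\<in>\<Gamma>. ennreal (japanese \<zeta> powr (2 * s)) * G \<zeta> \<partial>lborel)"
proof -
  obtain C where C: "C \<ge> 0" "\<And>\<zeta>. polar_weight s 1 \<xi>0 \<rho> \<zeta> \<le> ennreal (C * japanese \<zeta> powr (2 * s))"
    using polar_weight_upper[OF \<rho> \<xi>0] by blast
  have zero: "polar_weight s 1 \<xi>0 \<rho> \<zeta> = 0" if "\<zeta> \<notin> \<Gamma>" for \<zeta>
  proof -
    have z: "(1 / lam) *\<^sub>R \<zeta> \<notin> ball \<xi>0 \<rho>" if "lam \<ge> 1" for lam
      using \<Gamma>(1) \<Gamma>(2)[of "(1 / lam) *\<^sub>R \<zeta>" lam] \<open>\<zeta> \<notin> \<Gamma>\<close> that by auto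
    have "polar_weight s 1 \<xi>0 \<rho> \<zeta> = (\<integral>\<^sup>+lam. 0 \<partial>(lborel :: real measure))"
      unfolding polar_weight_def by (intro nn_integral_cong) (use z in \<open>auto simp: indicator_def\<close>)
    then show ?thesis by simp
  qed
  show thesis
  proof (rule that[OF C(1)])
    fix G :: "'a \<Rightarrow> ennreal" assume [measurable]: "G \<in> borel_measurable borel"
    have [measurable]: "\<Gamma> \<in> sets borel" using \<Gamma>(3) by simp
    have [measurable]: "japanese \<in> borel_measurable (borel :: 'a measure)" unfolding japanese_def[abs_def] by measurable
    have "(\<integral>\<^sup>+\<zeta>. G \<zeta> * polar_weight s 1 \<xi>0 \<rho> \<zeta> \<partial>lborel) \<le>
      (\<integral>\<^sup>+\<zeta>. ennreal C * (ennreal (japanese \<zeta> powr (2 * s)) * G \<zeta> * indicator \<Gamma> \<zeta>) \<partial>lborel)"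
    proof (rule nn_integral_mono)
      fix \<zeta> :: 'a
      show "G \<zeta> * polar_weight s 1 \<xi>0 \<rho> \<zeta> \<le> ennreal C * (ennreal (japanese \<zeta> powr (2 * s)) * G \<zeta> * indicator \<Gamma> \<zeta>)"
      proof (cases "\<zeta> \<in> \<Gamma>")
        case True
        have "G \<zeta> * polar_weight s 1 \<xi>0 \<rho> \<zeta> \<le> G \<zeta> * ennreal (C * japanese \<zeta> powr (2 * s))"
          by (intro mult_left_mono C) simp
        then show ?thesis using True C(1) by (simp add: ennreal_mult mult_ac)
      qed (simp add: zero)
    qed
    also have "\<dots> = ennreal C * (\<integral>\<^sup>+\<zeta>\<in>\<Gamma>. ennreal (japanese \<zeta> powr (2 * s)) * G \<zeta> \<partial>lborel)"
      by (rule nn_integral_cmult) measurable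
    finally show "(\<integral>\<^sup>+lam\<in>{1..}. ennreal (lam powr (real DIM('a) - 1 + 2 * s)) * (\<integral>\<^sup>+\<xi>\<in>ball \<xi>0 \<rho>. G (lam *\<^sub>R \<xi>) \<partial>lborel) \<partial>lborel)
      \<le> ennreal C * (\<integral>\<^sup>+\<zeta>\<in>\<Gamma>. ennreal (japanese \<zeta> powr (2 * s)) * G \<zeta> \<partial>lborel)"
      by (subst polar_swap) auto
  qed
qed

definition cone_over :: "'a::real_normed_vector set \<Rightarrow> 'a set" where
  "cone_over B = (\<Union>t\<in>{0<..}. (\<lambda>w. t *\<^sub>R w) ` B)"

lemma conic_nbhd_cone_over: "r > 0 \<Longrightarrow> conic_nbhd (cone_over (ball \<xi>0 r)) \<xi>0"
  unfolding conic_nbhd_def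
proof (intro conjI ballI allI impI)
  assume r: "r > 0"
  show "open (cone_over (ball \<xi>0 r))"
    unfolding cone_over_def by (intro open_UN ballI open_scaling) auto
  have "\<xi>0 = 1 *\<^sub>R \<xi>0" "\<xi>0 \<in> ball \<xi>0 r" using r by auto
  then show "\<xi>0 \<in> cone_over (ball \<xi>0 r)" unfolding cone_over_def by (intro UN_I[of 1]) auto
  fix \<xi> t assume "\<xi> \<in> cone_over (ball \<xi>0 r)" "(t::real) > 0"
  then obtain t' w where "t' > 0" "w \<in> ball \<xi>0 r" "\<xi> = t' *\<^sub>R w" unfolding cone_over_def by auto
  then have "t * t' > 0" "t *\<^sub>R \<xi> = (t * t') *\<^sub>R w" using \<open>t > 0\<close> by auto
  then show "t *\<^sub>R \<xi> \<in> cone_over (ball \<xi>0 r)"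
    using \<open>w \<in> ball \<xi>0 r\<close> unfolding cone_over_def by (intro UN_I[of "t * t'"]) auto
qed

text \<open>The ball around the origin is removed because the right-hand side sees only
  \<open>lam \<ge> lam0\<close>; frequencies below that threshold have to be handled
  separately.\<close>

lemma polar_lower:
  fixes \<xi>0 :: "'a::euclidean_space"
  assumes \<rho>: "\<rho> \<le> norm \<xi>0 / 2" "\<rho> > 0" and \<xi>0: "\<xi>0 \<noteq> 0" and lam0: "lam0 \<ge> 1"
  obtains C R where "C \<ge> 0" "\<And>G. G \<in> borel_measurable borel \<Longrightarrow>
    (\<integral>\<^sup>+\<zeta>\<in>cone_over (ball \<xi>0 (\<rho> / 2)) - ball 0 R. ennreal (japanese \<zeta> powr (2 * s)) * G \<zeta> \<partial>lborel) \<le> ennreal C *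
    (\<integral>\<^sup>+lam\<in>{lam0..}. ennreal (lam powr (real DIM('a) - 1 + 2 * s)) * (\<integral>\<^sup>+\<xi>\<in>ball \<xi>0 \<rho>. G (lam *\<^sub>R \<xi>) \<partial>lborel) \<partial>lborel)"
proof -
  \<comment> \<open>A point \<open>t *\<^sub>R w\<close> of the cone has norm at most
    \<open>t * (3 * norm \<xi>0 / 2)\<close>, so a norm of at least \<open>?R\<close> forces
    \<open>t \<ge> lam0\<close>.\<close>
  let ?R = "3 * norm \<xi>0 / 2 * lam0"
  obtain C where C: "C \<ge> 0" "\<And>t w. w \<in> ball \<xi>0 (\<rho> / 2) \<Longrightarrow> t \<ge> lam0 \<Longrightarrow>
     ennreal (japanese (t *\<^sub>R w) powr (2 * s)) \<le> ennreal C * polar_weight s lam0 \<xi>0 \<rho> (t *\<^sub>R w)"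
    using polar_weight_lower[OF \<rho> \<xi>0 lam0] by blast
  have le: "ennreal (japanese \<zeta> powr (2 * s)) \<le> ennreal C * polar_weight s lam0 \<xi>0 \<rho> \<zeta>"
    if \<zeta>: "\<zeta> \<in> cone_over (ball \<xi>0 (\<rho> / 2)) - ball 0 ?R" for \<zeta>
  proof -
    obtain t w where tw: "t > 0" "w \<in> ball \<xi>0 (\<rho> / 2)" "\<zeta> = t *\<^sub>R w" using \<zeta> unfolding cone_over_def by (auto simp del: mem_ball)
    have nw: "norm w \<le> 3 * norm \<xi>0 / 2"
      using tw(2) \<rho> norm_triangle_ineq2[of w \<xi>0] by (simp add: dist_norm norm_minus_commute)
    have "3 * norm \<xi>0 / 2 * lam0 \<le> t * norm w" using that tw by simp
    also have "\<dots> \<le> t * (3 * norm \<xi>0 / 2)" using nw tw(1) by (intro mult_left_mono) auto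
    finally have "lam0 \<le> t" using \<xi>0 by (simp add: mult.commute)
    then show ?thesis using C(2)[OF tw(2)] tw(3) by simp
  qed
  have "open (cone_over (ball \<xi>0 (\<rho> / 2)))"
    using conic_nbhd_cone_over[of "\<rho> / 2" \<xi>0] \<rho>(2) unfolding conic_nbhd_def by simp
  then have [measurable]: "cone_over (ball \<xi>0 (\<rho> / 2)) \<in> sets borel" by simp
  show thesis
  proof (rule that[OF C(1), of ?R])
    fix G :: "'a \<Rightarrow> ennreal" assume [measurable]: "G \<in> borel_measurable borel"
    have [measurable]: "polar_weight s lam0 \<xi>0 \<rho> \<in> borel_measurable borel"
    proof -
      have "(\<lambda>p. indicator (ball \<xi>0 \<rho>) ((1 / snd p) *\<^sub>R fst p) :: ennreal) \<in> borel_measurable (borel \<Otimes>\<^sub>M lborel)"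
        by (rule measurable_compose[OF _ borel_measurable_indicator[of "ball \<xi>0 \<rho>" borel]]) measurable
      then have "(\<lambda>p. ennreal (snd p powr (2 * s - 1)) * indicator (ball \<xi>0 \<rho>) ((1 / snd p) *\<^sub>R fst p) * indicator {lam0..} (snd p))
          \<in> borel_measurable (borel \<Otimes>\<^sub>M lborel)" by measurable
      then show ?thesis unfolding polar_weight_def[abs_def]
        by (intro lborel.borel_measurable_nn_integral) (simp add: case_prod_beta')
    qed
    have "(\<integral>\<^sup>+\<zeta>\<in>cone_over (ball \<xi>0 (\<rho> / 2)) - ball 0 ?R. ennreal (japanese \<zeta> powr (2 * s)) * G \<zeta> \<partial>lborel)
      \<le> (\<integral>\<^sup>+\<zeta>. ennreal C * (G \<zeta> * polar_weight s lam0 \<xi>0 \<rho> \<zeta>) \<partial>lborel)"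
    proof (rule nn_integral_mono)
      fix \<zeta> :: 'a
      show "ennreal (japanese \<zeta> powr (2 * s)) * G \<zeta> * indicator (cone_over (ball \<xi>0 (\<rho> / 2)) - ball 0 ?R) \<zeta>
        \<le> ennreal C * (G \<zeta> * polar_weight s lam0 \<xi>0 \<rho> \<zeta>)"
      proof (cases "\<zeta> \<in> cone_over (ball \<xi>0 (\<rho> / 2)) - ball 0 ?R")
        case True
        have "ennreal (japanese \<zeta> powr (2 * s)) * G \<zeta> \<le> ennreal C * polar_weight s lam0 \<xi>0 \<rho> \<zeta> * G \<zeta>"
          by (intro mult_right_mono le True) simp
        then show ?thesis using True by (simp add: mult_ac)
      next
        case False
        then have "indicator (cone_over (ball \<xi>0 (\<rho> / 2)) - ball 0 ?R) \<zeta> = (0::ennreal)" by (rule indicator_simps(2))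
        then show ?thesis by (simp only: mult_zero_right zero_le)
      qed
    qed
    also have "\<dots> = ennreal C * (\<integral>\<^sup>+\<zeta>. G \<zeta> * polar_weight s lam0 \<xi>0 \<rho> \<zeta> \<partial>lborel)"
      by (rule nn_integral_cmult) measurable
    finally show "(\<integral>\<^sup>+\<zeta>\<in>cone_over (ball \<xi>0 (\<rho> / 2)) - ball 0 ?R. ennreal (japanese \<zeta> powr (2 * s)) * G \<zeta> \<partial>lborel) \<le> ennreal C *
      (\<integral>\<^sup>+lam\<in>{lam0..}. ennreal (lam powr (real DIM('a) - 1 + 2 * s)) * (\<integral>\<^sup>+\<xi>\<in>ball \<xi>0 \<rho>. G (lam *\<^sub>R \<xi>) \<partial>lborel) \<partial>lborel)"
      by (subst polar_swap[OF _ lam0]) auto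
  qed
qed

text \<open>The choice of \<open>M\<close> leaves at least the decay \<open>lam ^ -2\<close>. It is
  restated as a function without singularity on the whole line, so that integrability follows from
  the weight lemma in dimension 1.\<close>

lemma powr_times_inverse_power_le:
  assumes "lam \<ge> 1" "real M \<ge> p + 2"
  shows "lam powr p * (1 / lam ^ M) \<le> 4 * (1 / (1 + norm lam) ^ 2)"
proof -
  have "lam powr p * (1 / lam ^ M) = lam powr (p - real M)"
    using assms by (simp add: powr_diff powr_realpow)
  also have "\<dots> \<le> lam powr (- 2)" using assms by (intro powr_mono) auto
  also have "\<dots> = 1 / lam ^ 2" using assms by (simp add: powr_minus powr_realpow[of lam 2, simplified] inverse_eq_divide)
  also have "\<dots> \<le> 4 * (1 / (1 + norm lam) ^ 2)"
  proof -
    have "(1 + lam) ^ 2 \<le> (2 * lam) ^ 2" using assms by (intro power_mono) auto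
    then show ?thesis using assms by (simp add: field_simps)
  qed
  finally show ?thesis .
qed

lemma nn_integral_tail_finite: "(\<integral>\<^sup>+lam. ennreal (c * (4 * (1 / (1 + norm (lam::real)) ^ 2))) \<partial>lborel) < \<infinity>"
proof -
  have "integrable lborel (\<lambda>lam::real. c * (4 * (1 / (1 + norm lam) ^ 2)))"
    using integrable_inverse_one_plus_norm_power[where 'a=real, of 2] by (intro integrable_mult_right) simp
  then have "(\<integral>\<^sup>+lam. ennreal (norm (c * (4 * (1 / (1 + norm (lam::real)) ^ 2)))) \<partial>lborel) < \<infinity>"
    by (simp only: integrable_iff_bounded)
  moreover have "(\<integral>\<^sup>+lam. ennreal (c * (4 * (1 / (1 + norm (lam::real)) ^ 2))) \<partial>lborel)
      \<le> (\<integral>\<^sup>+lam. ennreal (norm (c * (4 * (1 / (1 + norm (lam::real)) ^ 2)))) \<partial>lborel)"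
    by (intro nn_integral_mono ennreal_leI) (simp only: real_norm_def abs_ge_self)
  ultimately show ?thesis by (rule le_less_trans[rotated])
qed

lemma
  fixes \<phi> :: "'a::euclidean_space \<Rightarrow> complex"
  assumes u: "tempered u" and \<phi>: "schwartz \<phi>" and lam: "lam \<ge> 1"
    and f: "f \<in> borel_measurable M" and h: "h \<in> borel_measurable M"
  shows measurable_wave_packet: "(\<lambda>p. u (wave_packet lam \<phi> (f p) (h p))) \<in> borel_measurable M"
    and measurable_cutoff_wave_packet: "schwartz chi \<Longrightarrow>
      (\<lambda>p. u (\<lambda>y. chi y * wave_packet lam \<phi> (f p) (h p) y)) \<in> borel_measurable M"
proof -
  have *: "(\<lambda>p. v (wave_packet lam \<phi> (f p) (h p))) \<in> borel_measurable M" if "tempered v" for v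
    using continuous_wave_packet[OF that \<phi> lam]
    by (intro borel_measurable_continuous_Pair[OF f h]) (simp add: case_prod_beta')
  show "(\<lambda>p. u (wave_packet lam \<phi> (f p) (h p))) \<in> borel_measurable M" by (rule *[OF u])
  show "(\<lambda>p. u (\<lambda>y. chi y * wave_packet lam \<phi> (f p) (h p) y)) \<in> borel_measurable M" if chi: "schwartz chi"
    by (rule *[OF tempered_mult[OF u schwartzD_smooth[OF chi] schwartz_jet_bounded[OF chi]]])
qed

lemma one_plus_scaled_power_le:
  assumes "lam \<ge> 1" "norm \<xi> \<le> R"
  shows "(1 + norm (lam *\<^sub>R \<xi>)) ^ P \<le> lam ^ P * (1 + R) ^ P"
proof -
  have "norm (lam *\<^sub>R \<xi>) \<le> lam * R" using assms by (simp add: mult_left_mono)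
  then have "1 + norm (lam *\<^sub>R \<xi>) \<le> lam * (1 + R)" unfolding distrib_left using assms by linarith
  then have "(1 + norm (lam *\<^sub>R \<xi>)) ^ P \<le> (lam * (1 + R)) ^ P" by (intro power_mono) auto
  then show ?thesis by (simp only: power_mult_distrib)
qed

lemma norm_ball_le: "\<xi> \<in> ball \<xi>0 r \<Longrightarrow> norm \<xi> \<le> norm \<xi>0 + r"
  using norm_triangle_ineq2[of \<xi> \<xi>0] by (simp add: dist_norm norm_minus_commute)

lemma emeasure_ball_eq: "emeasure lborel (ball (c::'a::euclidean_space) r) = ennreal (measure lborel (ball c r))"
  using emeasure_lborel_ball_finite[of c r] by (intro emeasure_eq_ennreal_measure) (auto simp: less_top)

lemma schwartz_sq_weight:
  assumes "rapid f"
  shows "\<exists>B. \<forall>\<eta>. (1 + norm \<eta>) ^ k * (norm (f \<eta>))\<^sup>2 \<le> B"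
proof -
  obtain B where B: "B \<ge> 0" "\<And>\<eta>. (1 + norm \<eta>) ^ k * norm (f \<eta>) \<le> B" using rapid_bound[OF assms] by blast
  obtain B' where B': "B' \<ge> 0" "\<And>\<eta>. (1 + norm \<eta>) ^ 0 * norm (f \<eta>) \<le> B'" using rapid_bound[OF assms] by blast
  have "(1 + norm \<eta>) ^ k * (norm (f \<eta>))\<^sup>2 \<le> B * B'" for \<eta>
  proof -
    have "(1 + norm \<eta>) ^ k * (norm (f \<eta>))\<^sup>2 = ((1 + norm \<eta>) ^ k * norm (f \<eta>)) * ((1 + norm \<eta>) ^ 0 * norm (f \<eta>))"
      by (simp add: power2_eq_square)
    also have "\<dots> \<le> B * B'" using B(1) by (intro mult_mono B(2) B'(2)) auto
    finally show ?thesis .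
  qed
  then show ?thesis by blast
qed

lemma cutoff_FT_sq_bound:
  assumes u: "tempered u" and chi: "schwartz chi"
  obtains G P where "G \<ge> 0" "\<And>lam \<xi>. lam \<ge> 1 \<Longrightarrow> ennreal ((norm (cutoff_FT u chi \<xi>))\<^sup>2) \<le> ennreal (G * lam ^ P * (1 + norm \<xi>) ^ P)"
proof -
  obtain C P where C: "C \<ge> 0" "\<And>\<xi>. norm (cutoff_FT u chi \<xi>) \<le> C * (1 + norm \<xi>) ^ P" using cutoff_FT_bound[OF u chi] by blast
  show thesis
  proof (rule that[of "C\<^sup>2" "2 * P"])
    show "0 \<le> C\<^sup>2" by simp
    fix lam :: real and \<xi> assume lam: "lam \<ge> 1"
    have "(norm (cutoff_FT u chi \<xi>))\<^sup>2 \<le> (C * (1 + norm \<xi>) ^ P)\<^sup>2" by (intro power_mono C) auto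
    also have "\<dots> = C\<^sup>2 * 1 * (1 + norm \<xi>) ^ (2 * P)" by (simp add: power_mult_distrib flip: power_mult) (simp add: mult.commute)
    also have "\<dots> \<le> C\<^sup>2 * lam ^ (2 * P) * (1 + norm \<xi>) ^ (2 * P)"
      using lam by (intro mult_right_mono mult_left_mono one_le_power) auto
    finally show "ennreal ((norm (cutoff_FT u chi \<xi>))\<^sup>2) \<le> ennreal (C\<^sup>2 * lam ^ (2 * P) * (1 + norm \<xi>) ^ (2 * P))" by (rule ennreal_leI)
  qed
qed

lemma parseval_cutoff:
  fixes u :: "('a::euclidean_space \<Rightarrow> complex) \<Rightarrow> complex"
  assumes "tempered u" "schwartz chi" "schwartz \<phi>" "lam \<ge> 1"
  shows "(\<integral>\<^sup>+x. ennreal ((norm (u (\<lambda>y. chi y * wave_packet lam \<phi> x \<xi> y)))\<^sup>2) \<partial>lborel) =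
    ennreal (1 / (gauss_mass TYPE('a))\<^sup>2) *
    (\<integral>\<^sup>+\<eta>. ennreal ((norm (FT \<phi> \<eta>))\<^sup>2) * ennreal ((norm (cutoff_FT u chi (\<xi> + sqrt lam *\<^sub>R \<eta>)))\<^sup>2) \<partial>lborel)" (is "?I = _")
proof -
  have k: "(gauss_mass TYPE('a))\<^sup>2 > 0" by (rule gauss_mass_sq_pos)
  have "?I = ennreal (1 / (gauss_mass TYPE('a))\<^sup>2) * (ennreal ((gauss_mass TYPE('a))\<^sup>2) * ?I)"
    using k by (simp add: mult.assoc[symmetric] ennreal_mult[symmetric])
  then show ?thesis unfolding wave_packet_parseval[OF assms] by (simp add: ennreal_mult)
qed

text \<open>\<open>K\<close> and \<open>V\<close> are read off from the cutoff and the cone of the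
  hypothesis before any window is given, which is the order of quantifiers in (iii); only constants
  depend on \<open>\<phi>\<close>.\<close>

lemma not_in_WF_imp_wp_integral_finite:
  fixes u :: "('a::euclidean_space \<Rightarrow> complex) \<Rightarrow> complex"
  assumes u: "tempered u" and \<xi>0: "\<xi>0 \<noteq> 0" and WF: "not_in_WF s u x0 \<xi>0"
  obtains K V where "open K" "x0 \<in> K" "open V" "\<xi>0 \<in> V" "\<And>\<phi>. schwartz \<phi> \<Longrightarrow> wp_integral s \<phi> u K V < \<infinity>"
proof -
  let ?n = "DIM('a)"
  let ?\<kappa> = "(gauss_mass TYPE('a))\<^sup>2"
  obtain \<Gamma> chi U where \<Gamma>: "conic_nbhd \<Gamma> \<xi>0" and test: "test_fun chi" and U: "open U" "x0 \<in> U" "\<And>x. x \<in> U \<Longrightarrow> chi x = 1"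
    and fin: "(\<integral>\<^sup>+ \<xi>\<in>\<Gamma>. ennreal ((japanese \<xi> powr s * norm (FT_cutoff u chi \<xi>))\<^sup>2) \<partial>lborel) < \<infinity>"
    using WF unfolding not_in_WF_def by blast
  have chi: "schwartz chi" by (rule test_fun_schwartz[OF test])
  obtain r0 where r0: "r0 > 0" "ball \<xi>0 r0 \<subseteq> \<Gamma>" using \<Gamma> unfolding conic_nbhd_def open_contains_ball by blast
  obtain d0 where d0: "d0 > 0" "ball x0 d0 \<subseteq> U" using U(1,2) unfolding open_contains_ball by blast
  \<comment> \<open>The blur doubles the radius, and the doubled ball must lie in the cone and
    within \<open>norm \<xi>0 / 2\<close> of \<open>\<xi>0\<close>.\<close>
  define r where "r = min (r0 / 2) (norm \<xi>0 / 4)"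
  \<comment> \<open>For \<open>x\<close> within \<open>\<delta>\<close> of \<open>x0\<close> the
    whole ball of radius \<open>\<delta>\<close> around \<open>x\<close> lies where
    \<open>chi = 1\<close>, so \<open>1 - chi\<close> vanishes there.\<close>
  define \<delta> where "\<delta> = d0 / 2"
  have r: "r > 0" "2 * r \<le> norm \<xi>0 / 2" "ball \<xi>0 (2 * r) \<subseteq> \<Gamma>"
  proof -
    show "r > 0" "2 * r \<le> norm \<xi>0 / 2" using r0(1) \<xi>0 unfolding r_def by auto
    have "ball \<xi>0 (2 * r) \<subseteq> ball \<xi>0 r0" unfolding r_def by (intro subset_ball) simp
    then show "ball \<xi>0 (2 * r) \<subseteq> \<Gamma>" using r0(2) by blast
  qed
  have \<delta>: "\<delta> > 0" using d0(1) by (simp add: \<delta>_def)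
  let ?K = "ball x0 \<delta>" and ?V = "ball \<xi>0 r"
  let ?g = "cutoff_FT u chi"
  let ?p = "real ?n - 1 + 2 * s"
  have [measurable]: "?g \<in> borel_measurable borel"
    by (rule borel_measurable_continuous_onI[OF cutoff_FT_continuous[OF u chi]])
  obtain M where M: "real M \<ge> ?p + 2" using real_arch_simple by blast
  define h where "h = (\<lambda>lam. \<integral>\<^sup>+\<xi>\<in>ball \<xi>0 (2 * r). ennreal ((norm (?g (lam *\<^sub>R \<xi>)))\<^sup>2) \<partial>lborel)"
  have h_meas [measurable]: "h \<in> borel_measurable borel"
    unfolding h_def by measurable
  define a where "a = (\<lambda>y. 1 + (-1) * chi y)"
  have a_smooth: "smooth_fun a"
    unfolding a_def by (intro smooth_fun_add smooth_fun_const smooth_fun_cmult schwartzD_smooth chi)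
  have a_jet: "\<exists>A. \<forall>y. jet N a y \<le> A" for N
  proof -
    obtain A where A: "\<And>y. jet N chi y \<le> A" using schwartz_jet_bounded[OF chi] by blast
    have "jet N a y \<le> 1 + A" for y
    proof -
      have "jet N a y \<le> jet N (\<lambda>y. 1) y + jet N (\<lambda>y. (-1) * chi y) y"
        unfolding a_def by (intro jet_add_le smooth_fun_const smooth_fun_cmult schwartzD_smooth chi)
      also have "jet N (\<lambda>y. 1) y = norm (1::complex)" by (rule jet_const_on[of UNIV]) auto
      also have "jet N (\<lambda>y. (-1) * chi y) y = norm (-1::complex) * jet N chi y" by (rule jet_cmult[OF schwartzD_smooth[OF chi]])
      finally show ?thesis using A[of y] by simp
    qed
    then show ?thesis by blast
  qed
  \<comment> \<open>The leading term: by \<open>polar_upper\<close> it is dominated by the integral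
    over \<open>\<Gamma>\<close> that the hypothesis declares finite. All other contributions are of
    order \<open>lam ^ -M\<close>.\<close>
  have tail: "(\<integral>\<^sup>+lam\<in>{1..}. ennreal (lam powr ?p) * h lam \<partial>lborel) < \<infinity>"
  proof -
    obtain C where C: "C \<ge> 0" "\<And>G. G \<in> borel_measurable borel \<Longrightarrow>
      (\<integral>\<^sup>+lam\<in>{1..}. ennreal (lam powr ?p) * (\<integral>\<^sup>+\<xi>\<in>ball \<xi>0 (2 * r). G (lam *\<^sub>R \<xi>) \<partial>lborel) \<partial>lborel)
        \<le> ennreal C * (\<integral>\<^sup>+\<zeta>\<in>\<Gamma>. ennreal (japanese \<zeta> powr (2 * s)) * G \<zeta> \<partial>lborel)"
      using polar_upper[OF r(2) \<xi>0 r(3), of s] \<Gamma> unfolding conic_nbhd_def by blast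
    have "(\<integral>\<^sup>+lam\<in>{1..}. ennreal (lam powr ?p) * h lam \<partial>lborel) \<le>
      ennreal C * (\<integral>\<^sup>+\<zeta>\<in>\<Gamma>. ennreal (japanese \<zeta> powr (2 * s)) * ennreal ((norm (?g \<zeta>))\<^sup>2) \<partial>lborel)"
      unfolding h_def by (rule C(2)) measurable
    also have "(\<integral>\<^sup>+\<zeta>\<in>\<Gamma>. ennreal (japanese \<zeta> powr (2 * s)) * ennreal ((norm (?g \<zeta>))\<^sup>2) \<partial>lborel) =
      (\<integral>\<^sup>+ \<xi>\<in>\<Gamma>. ennreal ((japanese \<xi> powr s * norm (FT_cutoff u chi \<xi>))\<^sup>2) \<partial>lborel)"
    proof (intro nn_integral_cong)
      fix \<zeta> :: 'a
      have "(japanese \<zeta> powr s)\<^sup>2 = japanese \<zeta> powr (2 * s)" by (simp add: power2_eq_square flip: powr_add)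
      then show "ennreal (japanese \<zeta> powr (2 * s)) * ennreal ((norm (?g \<zeta>))\<^sup>2) * indicator \<Gamma> \<zeta> =
        ennreal ((japanese \<zeta> powr s * norm (FT_cutoff u chi \<zeta>))\<^sup>2) * indicator \<Gamma> \<zeta>"
        by (simp add: cutoff_FT_eq power_mult_distrib flip: ennreal_mult)
    qed
    also have "ennreal C * \<dots> < \<infinity>" using fin by (simp add: ennreal_mult_less_top)
    finally show ?thesis .
  qed
  show thesis
  proof (rule that[of ?K ?V])
    show "open ?K" "x0 \<in> ?K" "open ?V" "\<xi>0 \<in> ?V" using \<delta> r by auto
    fix \<phi> :: "'a \<Rightarrow> complex" assume \<phi>: "schwartz \<phi>"
    have f: "rapid (FT \<phi>)" by (rule rapid_FT[OF \<phi>])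
    have [measurable]: "FT \<phi> \<in> borel_measurable borel" by (rule rapid_measurable[OF f])
    obtain G P where GP: "G \<ge> 0" "\<And>lam \<xi>. lam \<ge> 1 \<Longrightarrow> ennreal ((norm (?g \<xi>))\<^sup>2) \<le> ennreal (G * lam ^ P * (1 + norm \<xi>) ^ P)"
      using cutoff_FT_sq_bound[OF u chi] by blast
    obtain C1 where C1: "C1 \<ge> 0" "\<And>lam \<tau>. lam \<ge> 1 \<Longrightarrow> 0 < \<tau> \<Longrightarrow> \<tau> \<le> sqrt lam \<Longrightarrow>
      (\<integral>\<^sup>+\<xi>\<in>?V. (\<integral>\<^sup>+\<eta>. ennreal ((norm (FT \<phi> \<eta>))\<^sup>2) * ennreal ((norm (?g (lam *\<^sub>R \<xi> + \<tau> *\<^sub>R \<eta>)))\<^sup>2) \<partial>lborel) \<partial>lborel) \<le>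
      ennreal C1 * (\<integral>\<^sup>+\<xi>\<in>ball \<xi>0 (2 * r). ennreal ((norm (?g (lam *\<^sub>R \<xi>)))\<^sup>2) \<partial>lborel) + ennreal (C1 / lam ^ M)"
    proof (rule near_far[of "\<lambda>\<eta>. (norm (FT \<phi> \<eta>))\<^sup>2" "\<lambda>lam \<xi>. ennreal ((norm (?g \<xi>))\<^sup>2)" G P r \<xi>0 M])
      show "\<exists>B. \<forall>\<eta>. (1 + norm \<eta>) ^ k * (norm (FT \<phi> \<eta>))\<^sup>2 \<le> B" for k by (rule schwartz_sq_weight[OF f])
    qed (use GP r in \<open>auto\<close>)
    obtain P2 where P2: "\<And>M. \<exists>C\<ge>0. \<forall>lam x \<xi>. lam \<ge> 1 \<longrightarrow> (\<forall>y\<in>ball x \<delta>. a y = 0) \<longrightarrow>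
       lam ^ M * norm (u (\<lambda>y. a y * wave_packet lam \<phi> x \<xi> y)) \<le> C * (1 + norm x) ^ P2 * (1 + norm \<xi>) ^ P2"
      using negligible_bounded_cutoff[OF u \<phi> \<delta> a_smooth a_jet] by blast
    \<comment> \<open>The surplus \<open>P2\<close> cancels the factor \<open>lam ^ P2\<close> that
      the weight at the frequency \<open>lam *\<^sub>R \<xi>\<close> produces.\<close>
    obtain C2 where C2: "C2 \<ge> 0" "\<And>lam x \<xi>. lam \<ge> 1 \<Longrightarrow> (\<forall>y\<in>ball x \<delta>. a y = 0) \<Longrightarrow>
       lam ^ (M + P2) * norm (u (\<lambda>y. a y * wave_packet lam \<phi> x \<xi> y)) \<le> C2 * (1 + norm x) ^ P2 * (1 + norm \<xi>) ^ P2"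
      using P2[of "M + P2"] by blast
    define E where "E = C2 * (1 + (norm x0 + \<delta>)) ^ P2 * (1 + (norm \<xi>0 + r)) ^ P2"
    have E: "E \<ge> 0" unfolding E_def using C2(1) \<delta> r by simp
    have small: "(norm (u (\<lambda>y. a y * wave_packet lam \<phi> x (lam *\<^sub>R \<xi>) y)))\<^sup>2 \<le> E\<^sup>2 / lam ^ M"
      if lam: "lam \<ge> 1" and x: "x \<in> ?K" and \<xi>: "\<xi> \<in> ?V" for lam x \<xi>
    proof -
      let ?v = "norm (u (\<lambda>y. a y * wave_packet lam \<phi> x (lam *\<^sub>R \<xi>) y))"
      have "\<forall>y\<in>ball x \<delta>. a y = 0"
      proof
        fix y assume "y \<in> ball x \<delta>"
        then have "dist x0 y < d0" using x dist_triangle[of x0 y x] unfolding \<delta>_def by simp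
        then show "a y = 0" using U(3) d0(2) by (auto simp: a_def subset_eq)
      qed
      from C2(2)[OF lam this]
      have "lam ^ (M + P2) * ?v \<le> C2 * (1 + norm x) ^ P2 * (1 + norm (lam *\<^sub>R \<xi>)) ^ P2" .
      also have "\<dots> \<le> C2 * (1 + (norm x0 + \<delta>)) ^ P2 * (lam ^ P2 * (1 + (norm \<xi>0 + r)) ^ P2)"
        using C2(1) norm_ball_le[OF x] norm_ball_le[OF \<xi>] lam \<delta>
        by (intro mult_mono mult_left_mono power_mono one_plus_scaled_power_le) auto
      finally have "lam ^ P2 * (lam ^ M * ?v) \<le> lam ^ P2 * E" unfolding E_def by (simp add: power_add mult_ac)
      then have le: "lam ^ M * ?v \<le> E" using lam by (subst (asm) mult_le_cancel_left_pos) auto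
      \<comment> \<open>Squaring would give \<open>lam ^ (2 * M)\<close>; one factor
        \<open>lam ^ M\<close> is given away to keep a single exponent for all errors.\<close>
      have "lam ^ M * ?v\<^sup>2 \<le> lam ^ M * ?v\<^sup>2 * lam ^ M" using mult_left_mono[OF one_le_power[OF lam, of M], of "lam ^ M * ?v\<^sup>2"] lam by simp
      also have "\<dots> = (lam ^ M * ?v)\<^sup>2" by (simp add: power2_eq_square)
      also have "\<dots> \<le> E\<^sup>2" using le lam by (intro power_mono) auto
      finally show ?thesis using lam by (simp add: pos_le_divide_eq mult.commute)
    qed
    let ?\<mu> = "measure lborel ?K" and ?\<nu> = "measure lborel ?V"
    let ?C = "2 / ?\<kappa> * C1" and ?E = "2 / ?\<kappa> * C1 + 2 * E\<^sup>2 * ?\<mu> * ?\<nu>"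
    have k: "?\<kappa> > 0" by (rule gauss_mass_sq_pos)
    have inner: "(\<integral>\<^sup>+\<xi>\<in>?V. (\<integral>\<^sup>+x\<in>?K. ennreal ((norm (wpt (scale_win lam \<phi>) u x (lam *\<^sub>R \<xi>)))\<^sup>2) \<partial>lborel) \<partial>lborel)
      \<le> ennreal ?C * h lam + ennreal (?E / lam ^ M)" if lam: "lam \<ge> 1" for lam
    proof -
      let ?T = "\<lambda>\<xi>. \<integral>\<^sup>+\<eta>. ennreal ((norm (FT \<phi> \<eta>))\<^sup>2) * ennreal ((norm (?g (lam *\<^sub>R \<xi> + sqrt lam *\<^sub>R \<eta>)))\<^sup>2) \<partial>lborel"
      have in_x: "(\<integral>\<^sup>+x\<in>?K. ennreal ((norm (wpt (scale_win lam \<phi>) u x (lam *\<^sub>R \<xi>)))\<^sup>2) \<partial>lborel)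
        \<le> ennreal (2 / ?\<kappa>) * ?T \<xi> + ennreal (2 * E\<^sup>2 / lam ^ M * ?\<mu>)" if \<xi>: "\<xi> \<in> ?V" for \<xi>
      proof -
        let ?u1 = "\<lambda>x. u (\<lambda>y. chi y * wave_packet lam \<phi> x (lam *\<^sub>R \<xi>) y)"
        let ?u2 = "\<lambda>x. u (\<lambda>y. a y * wave_packet lam \<phi> x (lam *\<^sub>R \<xi>) y)"
        have [measurable]: "?u1 \<in> borel_measurable borel"
          by (rule measurable_cutoff_wave_packet[OF u \<phi> lam _ _ chi]) auto
        have pw: "ennreal ((norm (wpt (scale_win lam \<phi>) u x (lam *\<^sub>R \<xi>)))\<^sup>2) \<le> ennreal 2 * ennreal ((norm (?u1 x))\<^sup>2) + ennreal (2 * E\<^sup>2 / lam ^ M)"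
          if x: "x \<in> ?K" for x
        proof -
          have wp: "schwartz (wave_packet lam \<phi> x (lam *\<^sub>R \<xi>))" by (rule schwartz_wave_packet[OF \<phi> lam])
          have "wave_packet lam \<phi> x (lam *\<^sub>R \<xi>) =
             (\<lambda>y. chi y * wave_packet lam \<phi> x (lam *\<^sub>R \<xi>) y + a y * wave_packet lam \<phi> x (lam *\<^sub>R \<xi>) y)"
            by (auto simp: a_def algebra_simps)
          then have "u (wave_packet lam \<phi> x (lam *\<^sub>R \<xi>)) =
            u (\<lambda>y. chi y * wave_packet lam \<phi> x (lam *\<^sub>R \<xi>) y + a y * wave_packet lam \<phi> x (lam *\<^sub>R \<xi>) y)"
            by (rule arg_cong)
          also have "\<dots> = ?u1 x + ?u2 x"
            by (intro tempered_add[OF u] schwartz_mult_bounded[OF schwartzD_smooth[OF chi] schwartz_jet_bounded[OF chi] wp]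
                schwartz_mult_bounded[OF a_smooth a_jet wp])
          finally have "norm (wpt (scale_win lam \<phi>) u x (lam *\<^sub>R \<xi>)) \<le> norm (?u1 x) + norm (?u2 x)"
            unfolding wpt_eq using norm_triangle_ineq by metis
          then have "(norm (wpt (scale_win lam \<phi>) u x (lam *\<^sub>R \<xi>)))\<^sup>2 \<le> (norm (?u1 x) + norm (?u2 x))\<^sup>2"
            by (intro power_mono) auto
          also have "\<dots> \<le> 2 * (norm (?u1 x))\<^sup>2 + 2 * (norm (?u2 x))\<^sup>2"
            using sum_squares_bound[of "norm (?u1 x)" "norm (?u2 x)"] by (simp add: power2_sum)
          also have "\<dots> \<le> 2 * (norm (?u1 x))\<^sup>2 + 2 * E\<^sup>2 / lam ^ M" using small[OF lam x \<xi>] by simp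
          finally have "ennreal ((norm (wpt (scale_win lam \<phi>) u x (lam *\<^sub>R \<xi>)))\<^sup>2) \<le> ennreal (2 * (norm (?u1 x))\<^sup>2 + 2 * E\<^sup>2 / lam ^ M)"
            by (rule ennreal_leI)
          then show ?thesis using lam by (simp add: ennreal_plus ennreal_mult)
        qed
        \<comment> \<open>The part with \<open>chi\<close> is enlarged to all \<open>x\<close>,
          where Parseval applies; the negligible part is bounded by a constant on
          \<open>?K\<close>.\<close>
        have "(\<integral>\<^sup>+x\<in>?K. ennreal ((norm (wpt (scale_win lam \<phi>) u x (lam *\<^sub>R \<xi>)))\<^sup>2) \<partial>lborel)
          \<le> (\<integral>\<^sup>+x. ennreal 2 * ennreal ((norm (?u1 x))\<^sup>2) + ennreal (2 * E\<^sup>2 / lam ^ M) * indicator ?K x \<partial>lborel)"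
          by (intro nn_integral_mono) (use pw in \<open>auto simp: indicator_def\<close>)
        also have "\<dots> = ennreal 2 * (\<integral>\<^sup>+x. ennreal ((norm (?u1 x))\<^sup>2) \<partial>lborel) + ennreal (2 * E\<^sup>2 / lam ^ M) * ennreal ?\<mu>"
          by (subst nn_integral_add) (auto simp: nn_integral_cmult nn_integral_cmult_indicator emeasure_ball_eq)
        also have "\<dots> = ennreal (2 / ?\<kappa>) * ?T \<xi> + ennreal (2 * E\<^sup>2 / lam ^ M * ?\<mu>)"
        proof -
          have "ennreal 2 * ennreal (1 / ?\<kappa>) = ennreal (2 / ?\<kappa>)" using k by (subst ennreal_mult[symmetric]) auto
          moreover have "ennreal (2 * E\<^sup>2 / lam ^ M) * ennreal ?\<mu> = ennreal (2 * E\<^sup>2 / lam ^ M * ?\<mu>)"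
            using lam by (subst ennreal_mult[symmetric]) auto
          ultimately show ?thesis by (simp only: parseval_cutoff[OF u chi \<phi> lam] mult.assoc[symmetric])
        qed
        finally show ?thesis .
      qed
      have "(\<integral>\<^sup>+\<xi>\<in>?V. (\<integral>\<^sup>+x\<in>?K. ennreal ((norm (wpt (scale_win lam \<phi>) u x (lam *\<^sub>R \<xi>)))\<^sup>2) \<partial>lborel) \<partial>lborel)
        \<le> (\<integral>\<^sup>+\<xi>. ennreal (2 / ?\<kappa>) * (?T \<xi> * indicator ?V \<xi>) + ennreal (2 * E\<^sup>2 / lam ^ M * ?\<mu>) * indicator ?V \<xi> \<partial>lborel)"
        by (intro nn_integral_mono) (use in_x in \<open>auto simp: indicator_def\<close>)
      also have "\<dots> = ennreal (2 / ?\<kappa>) * (\<integral>\<^sup>+\<xi>\<in>?V. ?T \<xi> \<partial>lborel) + ennreal (2 * E\<^sup>2 / lam ^ M * ?\<mu>) * ennreal ?\<nu>"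
        by (subst nn_integral_add) (auto simp: nn_integral_cmult nn_integral_cmult_indicator emeasure_ball_eq)
      also have "\<dots> \<le> ennreal (2 / ?\<kappa>) * (ennreal C1 * h lam + ennreal (C1 / lam ^ M)) + ennreal (2 * E\<^sup>2 / lam ^ M * ?\<mu>) * ennreal ?\<nu>"
        using C1(2)[OF lam, of "sqrt lam"] lam unfolding h_def by (intro add_mono mult_left_mono) auto
      also have "\<dots> = ennreal ?C * h lam + ennreal (?E / lam ^ M)"
      proof -
        have "ennreal (2 / ?\<kappa>) * ennreal (C1 / lam ^ M) + ennreal (2 * E\<^sup>2 / lam ^ M * ?\<mu>) * ennreal ?\<nu> = ennreal (?E / lam ^ M)"
          using k C1(1) lam by (simp add: ennreal_mult[symmetric] ennreal_plus[symmetric] add_divide_distrib mult_ac del: ennreal_plus)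
        moreover have "ennreal (2 / ?\<kappa>) * (ennreal C1 * h lam) = ennreal ?C * h lam"
          using k C1(1) unfolding mult.assoc[symmetric] by (subst ennreal_mult[symmetric]) auto
        ultimately show ?thesis by (simp only: distrib_left add.assoc)
      qed
      finally show ?thesis .
    qed
    have Epos: "?E \<ge> 0" using k C1(1) by simp
    \<comment> \<open>The integrand on the left is not known to be measurable in \<open>lam\<close>,
      but monotonicity suffices and the majorant is measurable.\<close>
    have "wp_integral s \<phi> u ?K ?V \<le> (\<integral>\<^sup>+lam. ennreal ?C * (ennreal (lam powr ?p) * h lam * indicator {1..} lam) + ennreal (?E * (4 * (1 / (1 + norm lam) ^ 2))) \<partial>lborel)"
      unfolding wp_integral_def
    proof (rule nn_integral_mono)
      fix lam :: real
      show "ennreal (lam powr ?p) * (\<integral>\<^sup>+\<xi>\<in>?V. (\<integral>\<^sup>+x\<in>?K. ennreal ((norm (wpt (scale_win lam \<phi>) u x (lam *\<^sub>R \<xi>)))\<^sup>2) \<partial>lborel) \<partial>lborel) * indicator {1..} lam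
        \<le> ennreal ?C * (ennreal (lam powr ?p) * h lam * indicator {1..} lam) + ennreal (?E * (4 * (1 / (1 + norm lam) ^ 2)))"
      proof (cases "lam \<ge> 1")
        case True
        have "ennreal (lam powr ?p) * (\<integral>\<^sup>+\<xi>\<in>?V. (\<integral>\<^sup>+x\<in>?K. ennreal ((norm (wpt (scale_win lam \<phi>) u x (lam *\<^sub>R \<xi>)))\<^sup>2) \<partial>lborel) \<partial>lborel)
          \<le> ennreal (lam powr ?p) * (ennreal ?C * h lam + ennreal (?E / lam ^ M))"
          by (intro mult_left_mono inner True) simp
        also have "\<dots> = ennreal ?C * (ennreal (lam powr ?p) * h lam) + ennreal (lam powr ?p) * ennreal (?E / lam ^ M)"
          by (simp only: distrib_left mult_ac)
        also have "ennreal (lam powr ?p) * ennreal (?E / lam ^ M) = ennreal (?E * (lam powr ?p * (1 / lam ^ M)))"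
          using Epos True by (subst ennreal_mult[symmetric]) (auto simp: mult_ac)
        also have "\<dots> \<le> ennreal (?E * (4 * (1 / (1 + norm lam) ^ 2)))"
          using powr_times_inverse_power_le[OF True M] Epos by (intro ennreal_leI mult_left_mono)
        finally show ?thesis using True by (simp add: add_left_mono)
      qed simp
    qed
    also have "\<dots> = ennreal ?C * (\<integral>\<^sup>+lam\<in>{1..}. ennreal (lam powr ?p) * h lam \<partial>lborel) + (\<integral>\<^sup>+lam. ennreal (?E * (4 * (1 / (1 + norm (lam::real)) ^ 2))) \<partial>lborel)"
    proof -
      have "(\<integral>\<^sup>+lam. ennreal ?C * (ennreal (lam powr ?p) * h lam * indicator {1..} lam) \<partial>lborel) =
          ennreal ?C * (\<integral>\<^sup>+lam\<in>{1..}. ennreal (lam powr ?p) * h lam \<partial>lborel)"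
        by (rule nn_integral_cmult) measurable
      moreover have "(\<integral>\<^sup>+lam. ennreal ?C * (ennreal (lam powr ?p) * h lam * indicator {1..} lam) + ennreal (?E * (4 * (1 / (1 + norm lam) ^ 2))) \<partial>lborel)
          = (\<integral>\<^sup>+lam. ennreal ?C * (ennreal (lam powr ?p) * h lam * indicator {1..} lam) \<partial>lborel) +
            (\<integral>\<^sup>+lam. ennreal (?E * (4 * (1 / (1 + norm (lam::real)) ^ 2))) \<partial>lborel)"
        by (rule nn_integral_add) measurable
      ultimately show ?thesis by (simp only:)
    qed
    also have "\<dots> < \<infinity>"
      using tail nn_integral_tail_finite[of ?E] by (auto simp: ennreal_mult_less_top)
    finally show "wp_integral s \<phi> u ?K ?V < \<infinity>" .
  qed
qed

section \<open>From wave packets to the wave front set\<close>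

text \<open>If the transform vanished almost everywhere, inversion would make \<open>\<phi>\<close>
  itself zero. The positive mass is what \<open>near_lower\<close> requires of its weight.\<close>

lemma FT_sq_integral_pos:
  fixes \<phi> :: "'a::euclidean_space \<Rightarrow> complex"
  assumes \<phi>: "schwartz \<phi>" "\<phi> \<noteq> (\<lambda>_. 0)"
  shows "(\<integral>\<^sup>+\<eta>. ennreal ((norm (FT \<phi> \<eta>))\<^sup>2) \<partial>lborel) > 0"
proof (rule ccontr)
  have [measurable]: "FT \<phi> \<in> borel_measurable borel" by (rule rapid_measurable[OF rapid_FT[OF \<phi>(1)]])
  assume "\<not> ?thesis"
  then have "(\<integral>\<^sup>+\<eta>. ennreal ((norm (FT \<phi> \<eta>))\<^sup>2) \<partial>lborel) = 0" by simp
  then have "AE \<eta> in lborel. ennreal ((norm (FT \<phi> \<eta>))\<^sup>2) = 0" by (subst (asm) nn_integral_0_iff_AE) auto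
  then have AE0: "AE \<eta> in lborel. FT \<phi> \<eta> = 0" by simp
  have "FT (FT \<phi>) (- y) = 0" for y
  proof -
    have "FT (FT \<phi>) (- y) = (\<integral>\<eta>. 0 \<partial>(lborel :: 'a measure))"
      unfolding FT_def[of "FT \<phi>"] by (rule integral_cong_AE) (use AE0 in auto)
    then show ?thesis by simp
  qed
  then have "\<phi> y = 0" for y
    using schwartz_FT_inversion[OF \<phi>(1), of y] gauss_mass_sq_pos[where 'a='a] by simp
  then show False using \<phi>(2) by auto
qed

text \<open>Supplies the growth hypothesis of \<open>near_far\<close> when \<open>\<Psi>\<close> is
  the packet energy over a fixed ball of \<open>x\<close>.\<close>

lemma local_wave_packet_energy_bound:
  fixes \<phi> :: "'a::euclidean_space \<Rightarrow> complex"
  assumes u: "tempered u" and \<phi>: "schwartz \<phi>"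
  obtains G P where "G \<ge> 0" "\<And>lam \<xi>. lam \<ge> 1 \<Longrightarrow>
    (\<integral>\<^sup>+x\<in>ball x0 d. ennreal ((norm (u (wave_packet lam \<phi> x \<xi>)))\<^sup>2) \<partial>lborel) \<le> ennreal (G * lam ^ P * (1 + norm \<xi>) ^ P)"
proof -
  obtain C P where C: "C \<ge> 0" "\<And>lam x \<xi>. lam \<ge> 1 \<Longrightarrow>
     norm (u (wave_packet lam \<phi> x \<xi>)) \<le> C * lam ^ P * (1 + norm x) ^ P * (1 + norm \<xi>) ^ P"
    using wave_packet_poly_bound[OF u \<phi>] by blast
  let ?X = "1 + \<bar>norm x0 + d\<bar>"
  let ?\<mu> = "measure lborel (ball x0 d)"
  show thesis
  proof (rule that[of "(C * ?X ^ P)\<^sup>2 * ?\<mu>" "2 * P"])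
    show "0 \<le> (C * ?X ^ P)\<^sup>2 * ?\<mu>" by simp
    fix lam :: real and \<xi> :: 'a assume lam: "lam \<ge> 1"
    let ?B = "(C * lam ^ P * ?X ^ P * (1 + norm \<xi>) ^ P)\<^sup>2"
    have "(norm (u (wave_packet lam \<phi> x \<xi>)))\<^sup>2 \<le> ?B" if "x \<in> ball x0 d" for x
    proof -
      have "C * lam ^ P * (1 + norm x) ^ P * (1 + norm \<xi>) ^ P \<le> C * lam ^ P * ?X ^ P * (1 + norm \<xi>) ^ P"
        using norm_ball_le[OF that] C(1) lam by (intro mult_right_mono mult_left_mono power_mono) auto
      then show ?thesis using C(2)[OF lam, of x \<xi>] by (intro power_mono) auto
    qed
    then have "(\<integral>\<^sup>+x\<in>ball x0 d. ennreal ((norm (u (wave_packet lam \<phi> x \<xi>)))\<^sup>2) \<partial>lborel)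
        \<le> (\<integral>\<^sup>+x. ennreal ?B * indicator (ball x0 d) x \<partial>lborel)"
      by (intro nn_integral_mono) (auto simp: indicator_def intro!: ennreal_leI)
    also have "\<dots> = ennreal (?B * ?\<mu>)"
      by (subst nn_integral_cmult_indicator) (auto simp: emeasure_ball_eq ennreal_mult)
    also have "?B * ?\<mu> = (C * ?X ^ P)\<^sup>2 * ?\<mu> * lam ^ (2 * P) * (1 + norm \<xi>) ^ (2 * P)"
      by (simp only: power_mult_distrib power_mult[symmetric] mult_ac)
    finally show "(\<integral>\<^sup>+x\<in>ball x0 d. ennreal ((norm (u (wave_packet lam \<phi> x \<xi>)))\<^sup>2) \<partial>lborel)
      \<le> ennreal ((C * ?X ^ P)\<^sup>2 * ?\<mu> * lam ^ (2 * P) * (1 + norm \<xi>) ^ (2 * P))" .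
  qed
qed

text \<open>Multiplication by \<open>chi\<close> acts on the frequency variable as a convolution with the
  \<open>lam\<close>-independent, rapidly decreasing transform of \<open>chi\<close>.\<close>

lemma cutoff_energy_near:
  fixes \<phi> :: "'a::euclidean_space \<Rightarrow> complex"
  assumes u: "tempered u" and \<phi>: "schwartz \<phi>" and chi: "schwartz chi" and r: "r > 0"
  obtains C where "C \<ge> 0" "\<And>lam. lam \<ge> 1 \<Longrightarrow>
    (\<integral>\<^sup>+\<xi>\<in>ball \<xi>0 r. (\<integral>\<^sup>+x\<in>ball x0 d. ennreal ((norm (u (\<lambda>y. chi y * wave_packet lam \<phi> x (lam *\<^sub>R \<xi>) y)))\<^sup>2) \<partial>lborel) \<partial>lborel)
    \<le> ennreal C * (\<integral>\<^sup>+\<xi>\<in>ball \<xi>0 (2 * r). (\<integral>\<^sup>+x\<in>ball x0 d. ennreal ((norm (u (wave_packet lam \<phi> x (lam *\<^sub>R \<xi>))))\<^sup>2) \<partial>lborel) \<partial>lborel)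
      + ennreal (C / lam ^ M)"
proof -
  let ?w = "\<lambda>\<eta>. norm (FT chi (- \<eta>))"
  let ?\<Psi> = "\<lambda>lam \<xi>. \<integral>\<^sup>+x\<in>ball x0 d. ennreal ((norm (u (wave_packet lam \<phi> x \<xi>)))\<^sup>2) \<partial>lborel"
  have w: "rapid (\<lambda>\<eta>. FT chi (- \<eta>))" by (rule rapid_reflect[OF rapid_FT[OF chi]])
  have w_meas [measurable]: "?w \<in> borel_measurable borel" using rapid_measurable[OF w] by measurable
  obtain D where D: "D \<ge> 0" "\<And>lam x \<xi>. lam \<ge> 1 \<Longrightarrow>
    ennreal ((norm (u (\<lambda>y. chi y * wave_packet lam \<phi> x \<xi> y)))\<^sup>2) \<le>
    ennreal D * (\<integral>\<^sup>+\<eta>. ennreal (norm (FT chi (- \<eta>)) * (norm (u (wave_packet lam \<phi> x (\<xi> + \<eta>))))\<^sup>2) \<partial>lborel)"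
    using cutoff_convolution_bound[OF u chi \<phi>] by blast
  obtain G P where GP: "G \<ge> 0" "\<And>lam \<xi>. lam \<ge> 1 \<Longrightarrow> ?\<Psi> lam \<xi> \<le> ennreal (G * lam ^ P * (1 + norm \<xi>) ^ P)"
    using local_wave_packet_energy_bound[OF u \<phi>] by blast
  have \<Psi>_meas: "?\<Psi> lam \<in> borel_measurable borel" if lam: "lam \<ge> 1" for lam
  proof -
    have "(\<lambda>p. u (wave_packet lam \<phi> (snd p) (fst p))) \<in> borel_measurable (borel \<Otimes>\<^sub>M lborel)"
      by (rule measurable_wave_packet[OF u \<phi> lam]) auto
    then have "(\<lambda>p. ennreal ((norm (u (wave_packet lam \<phi> (snd p) (fst p))))\<^sup>2) * indicator (ball x0 d) (snd p)) \<in> borel_measurable (borel \<Otimes>\<^sub>M lborel)"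
      by measurable
    then show ?thesis by (intro lborel.borel_measurable_nn_integral) (simp add: case_prod_beta')
  qed
  obtain C where C: "C \<ge> 0" "\<And>lam \<tau>. lam \<ge> 1 \<Longrightarrow> 0 < \<tau> \<Longrightarrow> \<tau> \<le> sqrt lam \<Longrightarrow>
    (\<integral>\<^sup>+\<xi>\<in>ball \<xi>0 r. (\<integral>\<^sup>+\<eta>. ennreal (?w \<eta>) * ?\<Psi> lam (lam *\<^sub>R \<xi> + \<tau> *\<^sub>R \<eta>) \<partial>lborel) \<partial>lborel) \<le>
    ennreal C * (\<integral>\<^sup>+\<xi>\<in>ball \<xi>0 (2 * r). ?\<Psi> lam (lam *\<^sub>R \<xi>) \<partial>lborel) + ennreal (C / lam ^ M)"
  proof (rule near_far[of ?w ?\<Psi> G P r \<xi>0 M])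
    show "\<exists>B. \<forall>\<eta>. (1 + norm \<eta>) ^ k * ?w \<eta> \<le> B" for k using rapid_bound[OF w, of k] by blast
  qed (use GP r w_meas \<Psi>_meas in \<open>auto\<close>)
  show thesis
  proof (rule that[of "D * C"])
    show "0 \<le> D * C" using D(1) C(1) by simp
    fix lam :: real assume lam: "lam \<ge> 1"
    note \<Psi>_meas[OF lam, measurable]
    let ?U = "\<lambda>x \<xi>. ennreal ((norm (u (wave_packet lam \<phi> x \<xi>)))\<^sup>2)"
    have in_x: "(\<integral>\<^sup>+x\<in>ball x0 d. ennreal ((norm (u (\<lambda>y. chi y * wave_packet lam \<phi> x \<xi> y)))\<^sup>2) \<partial>lborel)
       \<le> ennreal D * (\<integral>\<^sup>+\<eta>. ennreal (?w \<eta>) * ?\<Psi> lam (\<xi> + \<eta>) \<partial>lborel)" for \<xi>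
    proof -
      have U: "(\<lambda>p. u (wave_packet lam \<phi> (fst p) (\<xi> + snd p))) \<in> borel_measurable (lborel \<Otimes>\<^sub>M lborel)"
        by (rule measurable_wave_packet[OF u \<phi> lam]) auto
      have U1: "(\<lambda>x. u (wave_packet lam \<phi> x \<zeta>)) \<in> borel_measurable borel" for \<zeta>
        by (rule measurable_wave_packet[OF u \<phi> lam]) auto
      have U2: "(\<lambda>\<eta>. u (wave_packet lam \<phi> x (\<xi> + \<eta>))) \<in> borel_measurable borel" for x
        by (rule measurable_wave_packet[OF u \<phi> lam]) auto
      note [measurable] = U U1 U2
      let ?F = "\<lambda>x \<eta>. ennreal (?w \<eta>) * ?U x (\<xi> + \<eta>) * indicator (ball x0 d) x"
      have meas: "(\<lambda>p. ?F (fst p) (snd p)) \<in> borel_measurable (lborel \<Otimes>\<^sub>M lborel)" by measurable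
      have "(\<integral>\<^sup>+x\<in>ball x0 d. ennreal ((norm (u (\<lambda>y. chi y * wave_packet lam \<phi> x \<xi> y)))\<^sup>2) \<partial>lborel)
        \<le> (\<integral>\<^sup>+x. ennreal D * (\<integral>\<^sup>+\<eta>. ?F x \<eta> \<partial>lborel) \<partial>lborel)"
      proof (rule nn_integral_mono)
        fix x
        have "ennreal ((norm (u (\<lambda>y. chi y * wave_packet lam \<phi> x \<xi> y)))\<^sup>2) \<le> ennreal D * (\<integral>\<^sup>+\<eta>. ennreal (?w \<eta>) * ?U x (\<xi> + \<eta>) \<partial>lborel)"
          using D(2)[OF lam, of x \<xi>] by (simp add: ennreal_mult)
        then show "ennreal ((norm (u (\<lambda>y. chi y * wave_packet lam \<phi> x \<xi> y)))\<^sup>2) * indicator (ball x0 d) x \<le> ennreal D * (\<integral>\<^sup>+\<eta>. ?F x \<eta> \<partial>lborel)"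
          by (cases "x \<in> ball x0 d") (simp_all del: mem_ball)
      qed
      also have "\<dots> = ennreal D * (\<integral>\<^sup>+x. (\<integral>\<^sup>+\<eta>. ?F x \<eta> \<partial>lborel) \<partial>lborel)"
      proof (rule nn_integral_cmult)
        show "(\<lambda>x. \<integral>\<^sup>+\<eta>. ?F x \<eta> \<partial>lborel) \<in> borel_measurable lborel"
          using meas by (intro lborel.borel_measurable_nn_integral) (simp add: case_prod_beta')
      qed
      also have "(\<integral>\<^sup>+x. (\<integral>\<^sup>+\<eta>. ?F x \<eta> \<partial>lborel) \<partial>lborel) = (\<integral>\<^sup>+\<eta>. (\<integral>\<^sup>+x. ?F x \<eta> \<partial>lborel) \<partial>lborel)"
        using meas by (intro lborel_pair.Fubini'[symmetric]) (simp add: case_prod_beta')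
      also have "\<dots> = (\<integral>\<^sup>+\<eta>. ennreal (?w \<eta>) * ?\<Psi> lam (\<xi> + \<eta>) \<partial>lborel)"
      proof (rule nn_integral_cong)
        fix \<eta>
        have "(\<integral>\<^sup>+x. ?F x \<eta> \<partial>lborel) = (\<integral>\<^sup>+x. ennreal (?w \<eta>) * (?U x (\<xi> + \<eta>) * indicator (ball x0 d) x) \<partial>lborel)"
          by (simp only: mult.assoc)
        also have "\<dots> = ennreal (?w \<eta>) * ?\<Psi> lam (\<xi> + \<eta>)" by (rule nn_integral_cmult) measurable
        finally show "(\<integral>\<^sup>+x. ?F x \<eta> \<partial>lborel) = ennreal (?w \<eta>) * ?\<Psi> lam (\<xi> + \<eta>)" .
      qed
      finally show ?thesis .
    qed
    \<comment> \<open>The factor \<open>1 *\<^sub>R \<eta>\<close> is written out to meet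
      \<open>near_far\<close> with \<open>\<tau> = 1\<close>: the transform of \<open>chi\<close>
      does not scale with \<open>lam\<close>.\<close>
    have "(\<integral>\<^sup>+\<xi>\<in>ball \<xi>0 r. (\<integral>\<^sup>+x\<in>ball x0 d. ennreal ((norm (u (\<lambda>y. chi y * wave_packet lam \<phi> x (lam *\<^sub>R \<xi>) y)))\<^sup>2) \<partial>lborel) \<partial>lborel)
      \<le> (\<integral>\<^sup>+\<xi>. ennreal D * ((\<integral>\<^sup>+\<eta>. ennreal (?w \<eta>) * ?\<Psi> lam (lam *\<^sub>R \<xi> + 1 *\<^sub>R \<eta>) \<partial>lborel) * indicator (ball \<xi>0 r) \<xi>) \<partial>lborel)"
      using in_x by (intro nn_integral_mono) (simp add: mult.assoc[symmetric] mult_right_mono)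
    also have "\<dots> = ennreal D * (\<integral>\<^sup>+\<xi>\<in>ball \<xi>0 r. (\<integral>\<^sup>+\<eta>. ennreal (?w \<eta>) * ?\<Psi> lam (lam *\<^sub>R \<xi> + 1 *\<^sub>R \<eta>) \<partial>lborel) \<partial>lborel)"
    proof (rule nn_integral_cmult)
      have "(\<lambda>p. ?\<Psi> lam (lam *\<^sub>R fst p + 1 *\<^sub>R snd p)) \<in> borel_measurable (lborel \<Otimes>\<^sub>M lborel)"
        by (rule measurable_compose[OF _ \<Psi>_meas[OF lam]]) measurable
      then have "(\<lambda>p. ennreal (?w (snd p)) * ?\<Psi> lam (lam *\<^sub>R fst p + 1 *\<^sub>R snd p)) \<in> borel_measurable (lborel \<Otimes>\<^sub>M lborel)"
        by measurable
      then have "(\<lambda>\<xi>. \<integral>\<^sup>+\<eta>. ennreal (?w \<eta>) * ?\<Psi> lam (lam *\<^sub>R \<xi> + 1 *\<^sub>R \<eta>) \<partial>lborel) \<in> borel_measurable lborel"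
        by (intro lborel.borel_measurable_nn_integral) (simp add: case_prod_beta')
      then show "(\<lambda>\<xi>. (\<integral>\<^sup>+\<eta>. ennreal (?w \<eta>) * ?\<Psi> lam (lam *\<^sub>R \<xi> + 1 *\<^sub>R \<eta>) \<partial>lborel) * indicator (ball \<xi>0 r) \<xi>) \<in> borel_measurable lborel"
        by (intro borel_measurable_times_ennreal borel_measurable_indicator) auto
    qed
    also have "\<dots> \<le> ennreal D * (ennreal C * (\<integral>\<^sup>+\<xi>\<in>ball \<xi>0 (2 * r). ?\<Psi> lam (lam *\<^sub>R \<xi>) \<partial>lborel) + ennreal (C / lam ^ M))"
      using lam by (intro mult_left_mono C(2)) auto
    also have "\<dots> = ennreal (D * C) * (\<integral>\<^sup>+\<xi>\<in>ball \<xi>0 (2 * r). ?\<Psi> lam (lam *\<^sub>R \<xi>) \<partial>lborel) + ennreal (D * C / lam ^ M)"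
    proof -
      have "ennreal D * ennreal (C / lam ^ M) = ennreal (D * C / lam ^ M)"
        using D(1) C(1) lam by (subst ennreal_mult[symmetric]) auto
      then show ?thesis using D(1) C(1) by (simp only: distrib_left ennreal_mult mult.assoc)
    qed
    finally show "(\<integral>\<^sup>+\<xi>\<in>ball \<xi>0 r. (\<integral>\<^sup>+x\<in>ball x0 d. ennreal ((norm (u (\<lambda>y. chi y * wave_packet lam \<phi> x (lam *\<^sub>R \<xi>) y)))\<^sup>2) \<partial>lborel) \<partial>lborel)
      \<le> ennreal (D * C) * (\<integral>\<^sup>+\<xi>\<in>ball \<xi>0 (2 * r). ?\<Psi> lam (lam *\<^sub>R \<xi>) \<partial>lborel) + ennreal (D * C / lam ^ M)" .
  qed
qed

text \<open>If \<open>x\<close> is at least \<open>2 * \<delta>\<close> from \<open>x0\<close>, the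
  ball of radius \<open>\<delta>\<close> around it misses the support of \<open>chi\<close>, so the
  packet meets \<open>chi\<close> only in its tail. The additional decay in \<open>x\<close> makes
  the integral over this unbounded region converge.\<close>

lemma cutoff_energy_outside:
  fixes \<phi> :: "'a::euclidean_space \<Rightarrow> complex"
  assumes u: "tempered u" and \<phi>: "schwartz \<phi>" and chi: "schwartz chi" and \<delta>: "\<delta> > 0"
    and supp: "\<And>y. y \<notin> ball x0 \<delta> \<Longrightarrow> chi y = 0" and r: "r > 0"
  obtains C where "C \<ge> 0" "\<And>lam \<xi>. lam \<ge> 1 \<Longrightarrow> \<xi> \<in> ball \<xi>0 r \<Longrightarrow>
    (\<integral>\<^sup>+x\<in>- ball x0 (2 * \<delta>). ennreal ((norm (u (\<lambda>y. chi y * wave_packet lam \<phi> x (lam *\<^sub>R \<xi>) y)))\<^sup>2) \<partial>lborel) \<le> ennreal (C / lam ^ M)"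
proof -
  let ?n = "DIM('a)"
  obtain P where P: "\<And>M. \<exists>C\<ge>0. \<forall>lam x \<xi>. lam \<ge> 1 \<longrightarrow> (\<forall>y\<in>ball x \<delta>. chi y = 0) \<longrightarrow>
     lam ^ M * (1 + norm x) ^ M * norm (u (\<lambda>y. chi y * wave_packet lam \<phi> x \<xi> y)) \<le> C * (1 + norm \<xi>) ^ P"
    using negligible_schwartz_cutoff[OF u \<phi> \<delta> chi] by blast
  \<comment> \<open>In the exponent, \<open>P\<close> pays for the growth at frequency
    \<open>lam *\<^sub>R \<xi>\<close>, and \<open>?n\<close> becomes, after squaring, the
    integrable weight of exponent \<open>2 * ?n\<close> in \<open>x\<close>.\<close>
  obtain C where C: "C \<ge> 0" "\<And>lam x \<xi>. lam \<ge> 1 \<Longrightarrow> (\<forall>y\<in>ball x \<delta>. chi y = 0) \<Longrightarrow>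
     lam ^ (M + P + ?n) * (1 + norm x) ^ (M + P + ?n) * norm (u (\<lambda>y. chi y * wave_packet lam \<phi> x \<xi> y)) \<le> C * (1 + norm \<xi>) ^ P"
    using P[of "M + P + ?n"] by blast
  obtain W where W: "W \<ge> 0" "(\<integral>\<^sup>+\<eta>. ennreal (1 / (1 + norm (\<eta>::'a)) ^ (2 * ?n)) \<partial>lborel) = ennreal W"
    using nn_integral_inverse_weight by blast
  define E where "E = C * (1 + (norm \<xi>0 + r)) ^ P"
  have E: "E \<ge> 0" unfolding E_def using C(1) r by simp
  show thesis
  proof (rule that[of "E\<^sup>2 * W"])
    show "0 \<le> E\<^sup>2 * W" using W(1) by simp
    fix lam :: real and \<xi> assume lam: "lam \<ge> 1" and \<xi>: "\<xi> \<in> ball \<xi>0 r"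
    have pw: "(norm (u (\<lambda>y. chi y * wave_packet lam \<phi> x (lam *\<^sub>R \<xi>) y)))\<^sup>2 \<le> E\<^sup>2 / lam ^ M * (1 / (1 + norm x) ^ (2 * ?n))"
      if x: "x \<notin> ball x0 (2 * \<delta>)" for x
    proof -
      let ?v = "norm (u (\<lambda>y. chi y * wave_packet lam \<phi> x (lam *\<^sub>R \<xi>) y))"
      let ?t = "1 + norm x"
      have t: "?t > 0" by (intro add_pos_nonneg) auto
      have "\<forall>y\<in>ball x \<delta>. chi y = 0"
      proof
        fix y assume "y \<in> ball x \<delta>"
        then have "y \<notin> ball x0 \<delta>" using x dist_triangle[of x0 x y] by (auto simp: dist_commute)
        then show "chi y = 0" by (rule supp)
      qed
      from C(2)[OF lam this]
      have "lam ^ (M + P + ?n) * ?t ^ (M + P + ?n) * ?v \<le> C * (1 + norm (lam *\<^sub>R \<xi>)) ^ P" .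
      also have "\<dots> \<le> C * (lam ^ P * (1 + (norm \<xi>0 + r)) ^ P)"
        by (intro mult_left_mono one_plus_scaled_power_le norm_ball_le \<xi> lam C(1))
      also have "\<dots> = lam ^ P * E" unfolding E_def by simp
      finally have 1: "lam ^ (M + P + ?n) * ?t ^ (M + P + ?n) * ?v \<le> lam ^ P * E" .
      have "lam ^ P * (lam ^ M * ?t ^ ?n * ?v) = lam ^ (M + P) * ?t ^ ?n * ?v" by (simp add: power_add)
      also have "\<dots> \<le> lam ^ (M + P + ?n) * ?t ^ (M + P + ?n) * ?v"
        using lam by (intro mult_right_mono mult_mono power_increasing) auto
      finally have "lam ^ P * (lam ^ M * ?t ^ ?n * ?v) \<le> lam ^ P * E" using 1 by linarith
      then have 2: "lam ^ M * ?t ^ ?n * ?v \<le> E" using lam by (subst (asm) mult_le_cancel_left_pos) auto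
      have "lam ^ M * ?t ^ (2 * ?n) * ?v\<^sup>2 \<le> lam ^ M * (lam ^ M * ?t ^ (2 * ?n) * ?v\<^sup>2)"
        using mult_right_mono[OF one_le_power[OF lam, of M], of "lam ^ M * ?t ^ (2 * ?n) * ?v\<^sup>2"] lam by simp
      also have "\<dots> = (lam ^ M * ?t ^ ?n * ?v)\<^sup>2"
      proof -
        have "?t ^ (2 * ?n) = ?t ^ ?n * ?t ^ ?n" by (simp only: mult_2 power_add)
        then show ?thesis by (simp only: power2_eq_square mult_ac)
      qed
      also have "\<dots> \<le> E\<^sup>2" using 2 lam by (intro power_mono) auto
      finally have "?v\<^sup>2 * (lam ^ M * ?t ^ (2 * ?n)) \<le> E\<^sup>2" by (simp only: mult_ac)
      moreover have "0 < lam ^ M * ?t ^ (2 * ?n)" using lam t by (intro mult_pos_pos zero_less_power) auto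
      ultimately have "?v\<^sup>2 \<le> E\<^sup>2 / (lam ^ M * ?t ^ (2 * ?n))" by (subst pos_le_divide_eq)
      then show ?thesis by simp
    qed
    have "(\<integral>\<^sup>+x\<in>- ball x0 (2 * \<delta>). ennreal ((norm (u (\<lambda>y. chi y * wave_packet lam \<phi> x (lam *\<^sub>R \<xi>) y)))\<^sup>2) \<partial>lborel)
      \<le> (\<integral>\<^sup>+x. ennreal (E\<^sup>2 / lam ^ M) * ennreal (1 / (1 + norm (x::'a)) ^ (2 * ?n)) \<partial>lborel)"
    proof (rule nn_integral_mono)
      fix x :: 'a
      show "ennreal ((norm (u (\<lambda>y. chi y * wave_packet lam \<phi> x (lam *\<^sub>R \<xi>) y)))\<^sup>2) * indicator (- ball x0 (2 * \<delta>)) x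
        \<le> ennreal (E\<^sup>2 / lam ^ M) * ennreal (1 / (1 + norm x) ^ (2 * ?n))"
      proof (cases "x \<in> ball x0 (2 * \<delta>)")
        case False
        then have "indicator (- ball x0 (2 * \<delta>)) x = (1::ennreal)" by (simp add: indicator_def)
        moreover have "ennreal ((norm (u (\<lambda>y. chi y * wave_packet lam \<phi> x (lam *\<^sub>R \<xi>) y)))\<^sup>2)
            \<le> ennreal (E\<^sup>2 / lam ^ M * (1 / (1 + norm x) ^ (2 * ?n)))" by (rule ennreal_leI[OF pw[OF False]])
        moreover have "ennreal (E\<^sup>2 / lam ^ M * (1 / (1 + norm x) ^ (2 * ?n))) = ennreal (E\<^sup>2 / lam ^ M) * ennreal (1 / (1 + norm x) ^ (2 * ?n))"
          using lam by (intro ennreal_mult) auto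
        ultimately show ?thesis by (simp only: mult_1_right)
      next
        case True
        then have "indicator (- ball x0 (2 * \<delta>)) x = (0::ennreal)" by (simp add: indicator_def)
        then show ?thesis by (simp only: mult_zero_right zero_le)
      qed
    qed
    also have "\<dots> = ennreal (E\<^sup>2 / lam ^ M) * ennreal W" unfolding W(2)[symmetric] by (rule nn_integral_cmult) measurable
    also have "\<dots> = ennreal (E\<^sup>2 * W / lam ^ M)" using lam W(1) by (subst ennreal_mult[symmetric]) auto
    finally show "(\<integral>\<^sup>+x\<in>- ball x0 (2 * \<delta>). ennreal ((norm (u (\<lambda>y. chi y * wave_packet lam \<phi> x (lam *\<^sub>R \<xi>) y)))\<^sup>2) \<partial>lborel)
      \<le> ennreal (E\<^sup>2 * W / lam ^ M)" .
  qed
qed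

text \<open>\<open>near_lower\<close> bounds the energy of \<open>g\<close> on a small ball by its
  blurred version, which Parseval identifies with the packet energy of \<open>chi u\<close> over all
  \<open>x\<close>. The part near \<open>x0\<close> is controlled by the packets of \<open>u\<close>
  itself, the rest is negligible. Here the cutoff is free and is taken to be a bump supported well
  inside \<open>K\<close>.\<close>

lemma wp_integral_finite_imp_not_in_WF:
  fixes u :: "('a::euclidean_space \<Rightarrow> complex) \<Rightarrow> complex"
  assumes u: "tempered u" and \<xi>0: "\<xi>0 \<noteq> 0" and \<phi>: "schwartz \<phi>" "\<phi> \<noteq> (\<lambda>_. 0)"
    and K: "open K" "x0 \<in> K" and V: "open V" "\<xi>0 \<in> V" and fin: "wp_integral s \<phi> u K V < \<infinity>"
  shows "not_in_WF s u x0 \<xi>0"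
proof -
  let ?n = "DIM('a)"
  let ?\<kappa> = "(gauss_mass TYPE('a))\<^sup>2"
  let ?p = "real ?n - 1 + 2 * s"
  have k: "?\<kappa> > 0" by (rule gauss_mass_sq_pos)
  obtain d0 where d0: "d0 > 0" "ball x0 d0 \<subseteq> K" using K unfolding open_contains_ball by blast
  obtain r0 where r0: "r0 > 0" "ball \<xi>0 r0 \<subseteq> V" using V unfolding open_contains_ball by blast
  \<comment> \<open>The bump is supported in the ball of radius \<open>\<delta>\<close>, and the
    near region of radius \<open>2 * \<delta>\<close> still fits into \<open>K\<close>.\<close>
  define \<delta> where "\<delta> = d0 / 2"
  \<comment> \<open>Two blurs follow each other: the window takes the radius from
    \<open>\<rho>\<close> to \<open>2 * \<rho>\<close>, the cutoff from there to
    \<open>4 * \<rho>\<close>, which must stay inside \<open>V\<close>. The bound by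
    \<open>norm \<xi>0 / 2\<close> is the one demanded by the polar weight.\<close>
  define \<rho> where "\<rho> = min (r0 / 4) (norm \<xi>0 / 2)"
  have \<delta>: "\<delta> > 0" "ball x0 (2 * \<delta>) \<subseteq> K" using d0 by (auto simp: \<delta>_def)
  have \<rho>: "\<rho> > 0" "\<rho> \<le> norm \<xi>0 / 2" "ball \<xi>0 (2 * (2 * \<rho>)) \<subseteq> V"
  proof -
    show "\<rho> > 0" "\<rho> \<le> norm \<xi>0 / 2" using r0(1) \<xi>0 unfolding \<rho>_def by auto
    have "ball \<xi>0 (2 * (2 * \<rho>)) \<subseteq> ball \<xi>0 r0" unfolding \<rho>_def by (intro subset_ball) simp
    then show "ball \<xi>0 (2 * (2 * \<rho>)) \<subseteq> V" using r0(2) by blast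
  qed
  obtain chi where test: "test_fun chi" and chi1: "\<And>x. x \<in> ball x0 (\<delta> / 2) \<Longrightarrow> chi x = 1"
    and chi0: "\<And>x. x \<notin> ball x0 \<delta> \<Longrightarrow> chi x = 0" using bump_function[OF \<delta>(1)] by blast
  have chi: "schwartz chi" by (rule test_fun_schwartz[OF test])
  let ?g = "cutoff_FT u chi"
  have gc: "continuous_on UNIV ?g" by (rule cutoff_FT_continuous[OF u chi])
  then have [measurable]: "?g \<in> borel_measurable borel" by (rule borel_measurable_continuous_onI)
  obtain M where M: "real M \<ge> ?p + 2" using real_arch_simple by blast
  have f: "rapid (FT \<phi>)" by (rule rapid_FT[OF \<phi>(1)])
  have [measurable]: "FT \<phi> \<in> borel_measurable borel" by (rule rapid_measurable[OF f])
  have f2: "integrable lborel (\<lambda>\<eta>. (norm (FT \<phi> \<eta>))\<^sup>2)"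
  proof -
    obtain B where B: "\<And>\<eta>. (1 + norm \<eta>) ^ 0 * norm (FT \<phi> \<eta>) \<le> B" using rapid_bound[OF f] by blast
    have "integrable lborel (\<lambda>\<eta>. B * norm (FT \<phi> \<eta>))"
      by (intro integrable_mult_right integrable_norm rapid_integrable_self f)
    then show ?thesis
    proof (rule Bochner_Integration.integrable_bound)
      have "(norm (FT \<phi> \<eta>))\<^sup>2 \<le> B * norm (FT \<phi> \<eta>)" for \<eta>
        using mult_right_mono[of "norm (FT \<phi> \<eta>)" B "norm (FT \<phi> \<eta>)"] B[of \<eta>] by (simp add: power2_eq_square)
      then show "AE \<eta> in lborel. norm ((norm (FT \<phi> \<eta>))\<^sup>2) \<le> norm (B * norm (FT \<phi> \<eta>))"
        by (intro AE_I2) (metis abs_ge_self order_trans real_norm_def abs_of_nonneg zero_le_power2)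
    qed measurable
  qed
  define h where "h = (\<lambda>lam. \<integral>\<^sup>+\<xi>\<in>ball \<xi>0 \<rho>. ennreal ((norm (?g (lam *\<^sub>R \<xi>)))\<^sup>2) \<partial>lborel)"
  have h_meas [measurable]: "h \<in> borel_measurable borel" unfolding h_def by measurable
  let ?I = "\<lambda>lam. \<integral>\<^sup>+\<xi>\<in>V. (\<integral>\<^sup>+x\<in>K. ennreal ((norm (wpt (scale_win lam \<phi>) u x (lam *\<^sub>R \<xi>)))\<^sup>2) \<partial>lborel) \<partial>lborel"
  let ?U = "\<lambda>lam \<xi> x. ennreal ((norm (u (\<lambda>y. chi y * wave_packet lam \<phi> x (lam *\<^sub>R \<xi>) y)))\<^sup>2)"
  obtain C0 lam0 where C0: "C0 \<ge> 0" "lam0 \<ge> 1" "\<And>lam. lam \<ge> lam0 \<Longrightarrow> h lam \<le>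
    ennreal C0 * (\<integral>\<^sup>+\<xi>\<in>ball \<xi>0 (2 * \<rho>). (\<integral>\<^sup>+\<eta>. ennreal ((norm (FT \<phi> \<eta>))\<^sup>2) * ennreal ((norm (?g (lam *\<^sub>R \<xi> + sqrt lam *\<^sub>R \<eta>)))\<^sup>2) \<partial>lborel) \<partial>lborel)"
  proof (rule near_lower[of "\<lambda>\<eta>. (norm (FT \<phi> \<eta>))\<^sup>2" "\<lambda>lam \<xi>. ennreal ((norm (?g \<xi>))\<^sup>2)" \<rho> \<xi>0])
    show "0 < (\<integral>\<^sup>+\<eta>. ennreal ((norm (FT \<phi> \<eta>))\<^sup>2) \<partial>lborel)" by (rule FT_sq_integral_pos[OF \<phi>])
  qed (use f2 \<rho> in \<open>auto simp: h_def\<close>)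
  have rho2: "2 * \<rho> > 0" using \<rho>(1) by simp
  obtain C1 where C1: "C1 \<ge> 0" "\<And>lam. lam \<ge> 1 \<Longrightarrow>
    (\<integral>\<^sup>+\<xi>\<in>ball \<xi>0 (2 * \<rho>). (\<integral>\<^sup>+x\<in>ball x0 (2 * \<delta>). ?U lam \<xi> x \<partial>lborel) \<partial>lborel)
    \<le> ennreal C1 * (\<integral>\<^sup>+\<xi>\<in>ball \<xi>0 (2 * (2 * \<rho>)). (\<integral>\<^sup>+x\<in>ball x0 (2 * \<delta>). ennreal ((norm (u (wave_packet lam \<phi> x (lam *\<^sub>R \<xi>))))\<^sup>2) \<partial>lborel) \<partial>lborel)
      + ennreal (C1 / lam ^ M)"
    using cutoff_energy_near[OF u \<phi>(1) chi rho2, where ?\<xi>0.0 = \<xi>0 and ?x0.0 = x0 and d = "2 * \<delta>" and M = M] by blast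
  obtain C2 where C2: "C2 \<ge> 0" "\<And>lam \<xi>. lam \<ge> 1 \<Longrightarrow> \<xi> \<in> ball \<xi>0 (2 * \<rho>) \<Longrightarrow>
    (\<integral>\<^sup>+x\<in>- ball x0 (2 * \<delta>). ?U lam \<xi> x \<partial>lborel) \<le> ennreal (C2 / lam ^ M)"
    using cutoff_energy_outside[OF u \<phi>(1) chi \<delta>(1) chi0 rho2, where ?\<xi>0.0 = \<xi>0 and M = M] by blast
  let ?\<nu> = "measure lborel (ball \<xi>0 (2 * \<rho>))"
  let ?C = "C0 * ?\<kappa> * C1" and ?E = "C0 * ?\<kappa> * (C1 + C2 * ?\<nu>)"
  have Cpos: "?C \<ge> 0" "?E \<ge> 0" using C0(1) C1(1) C2(1) k by auto
  have main: "h lam \<le> ennreal ?C * ?I lam + ennreal (?E / lam ^ M)" if "lam \<ge> lam0" for lam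
  proof -
    have lam: "lam \<ge> 1" using that C0(2) by simp
    have meas2: "(\<lambda>p. u (\<lambda>y. chi y * wave_packet lam \<phi> (snd p) (lam *\<^sub>R fst p) y)) \<in> borel_measurable (borel \<Otimes>\<^sub>M lborel)"
      by (rule measurable_cutoff_wave_packet[OF u \<phi>(1) lam _ _ chi]) auto
    have meas1 [measurable]: "(\<lambda>x. u (\<lambda>y. chi y * wave_packet lam \<phi> x (lam *\<^sub>R \<xi>) y)) \<in> borel_measurable borel" for \<xi>
      by (rule measurable_cutoff_wave_packet[OF u \<phi>(1) lam _ _ chi]) auto
    have meas3: "(\<lambda>\<xi>. \<integral>\<^sup>+x\<in>ball x0 (2 * \<delta>). ?U lam \<xi> x \<partial>lborel) \<in> borel_measurable borel"
    proof -
      from meas2 have "(\<lambda>p. ?U lam (fst p) (snd p) * indicator (ball x0 (2 * \<delta>)) (snd p)) \<in> borel_measurable (borel \<Otimes>\<^sub>M lborel)"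
        by measurable
      then show ?thesis by (intro lborel.borel_measurable_nn_integral) (simp add: case_prod_beta')
    qed
    have split: "(\<integral>\<^sup>+x. ?U lam \<xi> x \<partial>lborel) \<le> (\<integral>\<^sup>+x\<in>ball x0 (2 * \<delta>). ?U lam \<xi> x \<partial>lborel) + ennreal (C2 / lam ^ M)"
      if \<xi>: "\<xi> \<in> ball \<xi>0 (2 * \<rho>)" for \<xi>
    proof -
      have "(\<integral>\<^sup>+x. ?U lam \<xi> x \<partial>lborel) = (\<integral>\<^sup>+x. ?U lam \<xi> x * indicator (ball x0 (2 * \<delta>)) x + ?U lam \<xi> x * indicator (- ball x0 (2 * \<delta>)) x \<partial>lborel)"
        by (intro nn_integral_cong) (simp add: indicator_def)
      also have "\<dots> = (\<integral>\<^sup>+x\<in>ball x0 (2 * \<delta>). ?U lam \<xi> x \<partial>lborel) + (\<integral>\<^sup>+x\<in>- ball x0 (2 * \<delta>). ?U lam \<xi> x \<partial>lborel)"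
        by (rule nn_integral_add) measurable
      also have "\<dots> \<le> (\<integral>\<^sup>+x\<in>ball x0 (2 * \<delta>). ?U lam \<xi> x \<partial>lborel) + ennreal (C2 / lam ^ M)"
        by (intro add_left_mono C2(2) lam \<xi>)
      finally show ?thesis .
    qed
    \<comment> \<open>Parseval turns the blurred frequency energy into packet energy over all
      \<open>x\<close>, which can then be split at the ball of radius
      \<open>2 * \<delta>\<close>.\<close>
    have pars: "(\<integral>\<^sup>+\<eta>. ennreal ((norm (FT \<phi> \<eta>))\<^sup>2) * ennreal ((norm (?g (lam *\<^sub>R \<xi> + sqrt lam *\<^sub>R \<eta>)))\<^sup>2) \<partial>lborel)
       = ennreal ?\<kappa> * (\<integral>\<^sup>+x. ?U lam \<xi> x \<partial>lborel)" for \<xi>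
      unfolding wave_packet_parseval[OF u chi \<phi>(1) lam] by (simp add: ennreal_mult)
    have "h lam \<le> ennreal C0 * (\<integral>\<^sup>+\<xi>\<in>ball \<xi>0 (2 * \<rho>). ennreal ?\<kappa> * (\<integral>\<^sup>+x. ?U lam \<xi> x \<partial>lborel) \<partial>lborel)"
      using C0(3)[OF that] unfolding pars .
    also have "\<dots> \<le> ennreal C0 * (\<integral>\<^sup>+\<xi>. ennreal ?\<kappa> * ((\<integral>\<^sup>+x\<in>ball x0 (2 * \<delta>). ?U lam \<xi> x \<partial>lborel) * indicator (ball \<xi>0 (2 * \<rho>)) \<xi>
        + ennreal (C2 / lam ^ M) * indicator (ball \<xi>0 (2 * \<rho>)) \<xi>) \<partial>lborel)"
    proof (intro mult_left_mono nn_integral_mono)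
      fix \<xi>
      show "ennreal ?\<kappa> * (\<integral>\<^sup>+x. ?U lam \<xi> x \<partial>lborel) * indicator (ball \<xi>0 (2 * \<rho>)) \<xi> \<le> ennreal ?\<kappa> * ((\<integral>\<^sup>+x\<in>ball x0 (2 * \<delta>). ?U lam \<xi> x \<partial>lborel) * indicator (ball \<xi>0 (2 * \<rho>)) \<xi>
        + ennreal (C2 / lam ^ M) * indicator (ball \<xi>0 (2 * \<rho>)) \<xi>)"
        using split[of \<xi>] by (cases "\<xi> \<in> ball \<xi>0 (2 * \<rho>)") (simp_all del: mem_ball add: mult_left_mono)
    qed simp
    also have "\<dots> = ennreal C0 * (ennreal ?\<kappa> * ((\<integral>\<^sup>+\<xi>\<in>ball \<xi>0 (2 * \<rho>). (\<integral>\<^sup>+x\<in>ball x0 (2 * \<delta>). ?U lam \<xi> x \<partial>lborel) \<partial>lborel) + ennreal (C2 / lam ^ M) * ennreal ?\<nu>))"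
    proof -
      have m: "(\<lambda>\<xi>. (\<integral>\<^sup>+x\<in>ball x0 (2 * \<delta>). ?U lam \<xi> x \<partial>lborel) * indicator (ball \<xi>0 (2 * \<rho>)) \<xi>) \<in> borel_measurable lborel"
        using meas3 by (intro borel_measurable_times_ennreal borel_measurable_indicator) auto
      have c: "(\<integral>\<^sup>+\<xi>. ennreal (C2 / lam ^ M) * indicator (ball \<xi>0 (2 * \<rho>)) \<xi> \<partial>lborel) = ennreal (C2 / lam ^ M) * ennreal ?\<nu>"
        by (subst nn_integral_cmult_indicator) (auto simp: emeasure_ball_eq)
      show ?thesis unfolding c[symmetric]
        by (subst nn_integral_cmult, intro borel_measurable_add m, measurable, subst nn_integral_add[OF m]) auto
    qed
    also have "\<dots> \<le> ennreal C0 * (ennreal ?\<kappa> * ((ennreal C1 * ?I lam + ennreal (C1 / lam ^ M)) + ennreal (C2 / lam ^ M) * ennreal ?\<nu>))"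
    proof (intro mult_left_mono add_right_mono)
      have "(\<integral>\<^sup>+\<xi>\<in>ball \<xi>0 (2 * (2 * \<rho>)). (\<integral>\<^sup>+x\<in>ball x0 (2 * \<delta>). ennreal ((norm (u (wave_packet lam \<phi> x (lam *\<^sub>R \<xi>))))\<^sup>2) \<partial>lborel) \<partial>lborel) \<le> ?I lam"
        unfolding wpt_eq using \<rho>(3) \<delta>(2)
        by (intro nn_integral_mono mult_mono) (auto simp: indicator_def)
      then have "ennreal C1 * (\<integral>\<^sup>+\<xi>\<in>ball \<xi>0 (2 * (2 * \<rho>)). (\<integral>\<^sup>+x\<in>ball x0 (2 * \<delta>). ennreal ((norm (u (wave_packet lam \<phi> x (lam *\<^sub>R \<xi>))))\<^sup>2) \<partial>lborel) \<partial>lborel) + ennreal (C1 / lam ^ M)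
          \<le> ennreal C1 * ?I lam + ennreal (C1 / lam ^ M)"
        by (intro add_right_mono mult_left_mono) auto
      with C1(2)[OF lam]
      show "(\<integral>\<^sup>+\<xi>\<in>ball \<xi>0 (2 * \<rho>). (\<integral>\<^sup>+x\<in>ball x0 (2 * \<delta>). ?U lam \<xi> x \<partial>lborel) \<partial>lborel) \<le> ennreal C1 * ?I lam + ennreal (C1 / lam ^ M)"
        by (rule order_trans)
    qed auto
    also have "\<dots> = ennreal ?C * ?I lam + ennreal (?E / lam ^ M)"
    proof -
      have "ennreal (C1 / lam ^ M) + ennreal (C2 / lam ^ M) * ennreal ?\<nu> = ennreal ((C1 + C2 * ?\<nu>) / lam ^ M)"
        using C1(1) C2(1) lam by (simp add: ennreal_mult[symmetric] ennreal_plus[symmetric] add_divide_distrib del: ennreal_plus)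
      moreover have "ennreal C0 * (ennreal ?\<kappa> * ennreal ((C1 + C2 * ?\<nu>) / lam ^ M)) = ennreal (?E / lam ^ M)"
        using C0(1) C1(1) C2(1) k lam by (simp add: ennreal_mult[symmetric] mult.assoc)
      moreover have "ennreal C0 * (ennreal ?\<kappa> * (ennreal C1 * ?I lam)) = ennreal ?C * ?I lam"
        using C0(1) C1(1) k by (simp only: mult.assoc[symmetric] ennreal_mult mult_nonneg_nonneg less_imp_le)
      ultimately show ?thesis by (simp only: distrib_left add.assoc)
    qed
    finally show ?thesis .
  qed
  \<comment> \<open>\<open>?I lam\<close> is not known to be measurable in \<open>lam\<close>, hence
    \<open>nn_integral_finite_transfer\<close>; \<open>h\<close> is measurable because
    \<open>?g\<close> is continuous.\<close>
  have tail: "(\<integral>\<^sup>+lam\<in>{lam0..}. ennreal (lam powr ?p) * h lam \<partial>lborel) < \<infinity>"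
  proof (rule nn_integral_finite_transfer)
    show "(\<lambda>lam. ennreal (lam powr ?p) * h lam * indicator {lam0..} lam) \<in> borel_measurable lborel" by measurable
    show "(\<lambda>lam::real. ?E * (4 * (1 / (1 + norm lam) ^ 2))) \<in> borel_measurable lborel" by measurable
    show "(\<integral>\<^sup>+lam\<in>{1..}. ennreal (lam powr ?p) * ?I lam \<partial>lborel) < \<infinity>" using fin unfolding wp_integral_def .
    show "(\<integral>\<^sup>+lam. ennreal (?E * (4 * (1 / (1 + norm (lam::real)) ^ 2))) \<partial>lborel) < \<infinity>" by (rule nn_integral_tail_finite)
    fix lam :: real
    show "ennreal (lam powr ?p) * h lam * indicator {lam0..} lam \<le>
      ennreal ?C * (ennreal (lam powr ?p) * ?I lam * indicator {1..} lam) + ennreal (?E * (4 * (1 / (1 + norm lam) ^ 2)))"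
    proof (cases "lam \<ge> lam0")
      case True
      then have lam: "lam \<ge> 1" using C0(2) by simp
      have "ennreal (lam powr ?p) * h lam \<le> ennreal (lam powr ?p) * (ennreal ?C * ?I lam + ennreal (?E / lam ^ M))"
        by (intro mult_left_mono main True) simp
      also have "\<dots> = ennreal ?C * (ennreal (lam powr ?p) * ?I lam) + ennreal (lam powr ?p) * ennreal (?E / lam ^ M)"
        by (simp only: distrib_left mult_ac)
      also have "ennreal (lam powr ?p) * ennreal (?E / lam ^ M) = ennreal (?E * (lam powr ?p * (1 / lam ^ M)))"
        using Cpos(2) lam by (subst ennreal_mult[symmetric]) (auto simp: mult_ac)
      also have "\<dots> \<le> ennreal (?E * (4 * (1 / (1 + norm lam) ^ 2)))"
        by (intro ennreal_leI mult_left_mono powr_times_inverse_power_le[OF lam M] Cpos(2))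
      finally show ?thesis using True lam by (simp add: add_left_mono)
    qed simp
  qed
  let ?\<Gamma> = "cone_over (ball \<xi>0 (\<rho> / 2))"
  have conic: "conic_nbhd ?\<Gamma> \<xi>0" by (rule conic_nbhd_cone_over) (use \<rho> in simp)
  then have [measurable]: "?\<Gamma> \<in> sets borel" unfolding conic_nbhd_def by simp
  have [measurable]: "japanese \<in> borel_measurable (borel :: 'a measure)" unfolding japanese_def[abs_def] by measurable
  let ?G = "\<lambda>\<zeta>. ennreal (japanese \<zeta> powr (2 * s)) * ennreal ((norm (?g \<zeta>))\<^sup>2)"
  obtain C R where CR: "C \<ge> 0" "\<And>G. G \<in> borel_measurable borel \<Longrightarrow>
    (\<integral>\<^sup>+\<zeta>\<in>?\<Gamma> - ball 0 R. ennreal (japanese \<zeta> powr (2 * s)) * G \<zeta> \<partial>lborel) \<le> ennreal C *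
    (\<integral>\<^sup>+lam\<in>{lam0..}. ennreal (lam powr ?p) * (\<integral>\<^sup>+\<xi>\<in>ball \<xi>0 \<rho>. G (lam *\<^sub>R \<xi>) \<partial>lborel) \<partial>lborel)"
    using polar_lower[OF \<rho>(2,1) \<xi>0 C0(2), of s] by blast
  have high: "(\<integral>\<^sup>+\<zeta>\<in>?\<Gamma> - ball 0 R. ?G \<zeta> \<partial>lborel) < \<infinity>"
  proof (rule le_less_trans[OF CR(2)])
    show "ennreal C * (\<integral>\<^sup>+lam\<in>{lam0..}. ennreal (lam powr ?p) * (\<integral>\<^sup>+\<xi>\<in>ball \<xi>0 \<rho>. ennreal ((norm (?g (lam *\<^sub>R \<xi>)))\<^sup>2) \<partial>lborel) \<partial>lborel) < \<infinity>"
      using tail unfolding h_def by (simp add: ennreal_mult_less_top)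
  qed measurable
  \<comment> \<open>The frequencies that the threshold \<open>lam0\<close> left out are bounded, and
    there the continuous function \<open>?g\<close> and the weight are bounded.\<close>
  have low: "(\<integral>\<^sup>+\<zeta>\<in>ball 0 R. ?G \<zeta> \<partial>lborel) < \<infinity>"
  proof -
    have "continuous_on (cball 0 R) (\<lambda>\<zeta>. japanese \<zeta> powr (2 * s) * (norm (?g \<zeta>))\<^sup>2)"
    proof (intro continuous_intros continuous_on_subset[OF gc] continuous_on_powr)
      show "continuous_on (cball 0 R) japanese" unfolding japanese_def[abs_def] by (intro continuous_intros)
      show "\<forall>x\<in>cball 0 R. japanese (x::'a) \<noteq> 0"
        using japanese_ge(1) by (metis not_one_le_zero)
    qed auto
    then have "compact ((\<lambda>\<zeta>. japanese \<zeta> powr (2 * s) * (norm (?g \<zeta>))\<^sup>2) ` cball 0 R)"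
      by (rule compact_continuous_image) simp
    from compact_imp_bounded[OF this] obtain B where B: "\<And>\<zeta>. \<zeta> \<in> cball 0 R \<Longrightarrow> japanese \<zeta> powr (2 * s) * (norm (?g \<zeta>))\<^sup>2 \<le> B"
      unfolding bounded_iff by fastforce
    have "(\<integral>\<^sup>+\<zeta>\<in>ball 0 R. ?G \<zeta> \<partial>lborel) \<le> (\<integral>\<^sup>+\<zeta>. ennreal B * indicator (ball 0 R) \<zeta> \<partial>(lborel::'a measure))"
    proof (rule nn_integral_mono)
      fix \<zeta> :: 'a
      have "?G \<zeta> \<le> ennreal B" if "\<zeta> \<in> ball 0 R"
        using B[of \<zeta>] that by (simp add: ennreal_mult[symmetric] ennreal_leI)
      then show "?G \<zeta> * indicator (ball 0 R) \<zeta> \<le> ennreal B * indicator (ball 0 R) \<zeta>"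
        by (cases "\<zeta> \<in> ball 0 R") (simp_all del: mem_ball)
    qed
    also have "\<dots> = ennreal B * emeasure lborel (ball (0::'a) R)" by (rule nn_integral_cmult_indicator) simp
    also have "\<dots> < \<infinity>" unfolding emeasure_ball_eq by (simp add: ennreal_mult_less_top)
    finally show ?thesis .
  qed
  have "(\<integral>\<^sup>+\<zeta>\<in>?\<Gamma>. ennreal ((japanese \<zeta> powr s * norm (FT_cutoff u chi \<zeta>))\<^sup>2) \<partial>lborel) \<le>
    (\<integral>\<^sup>+\<zeta>. ?G \<zeta> * indicator (?\<Gamma> - ball 0 R) \<zeta> + ?G \<zeta> * indicator (ball 0 R) \<zeta> \<partial>lborel)"
  proof (rule nn_integral_mono)
    fix \<zeta> :: 'a
    have "(japanese \<zeta> powr s)\<^sup>2 = japanese \<zeta> powr (2 * s)" by (simp add: power2_eq_square flip: powr_add)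
    then have "ennreal ((japanese \<zeta> powr s * norm (FT_cutoff u chi \<zeta>))\<^sup>2) = ?G \<zeta>"
      by (simp add: cutoff_FT_eq power_mult_distrib flip: ennreal_mult)
    then show "ennreal ((japanese \<zeta> powr s * norm (FT_cutoff u chi \<zeta>))\<^sup>2) * indicator ?\<Gamma> \<zeta>
       \<le> ?G \<zeta> * indicator (?\<Gamma> - ball 0 R) \<zeta> + ?G \<zeta> * indicator (ball 0 R) \<zeta>"
      by (simp add: indicator_def)
  qed
  also have "\<dots> = (\<integral>\<^sup>+\<zeta>\<in>?\<Gamma> - ball 0 R. ?G \<zeta> \<partial>lborel) + (\<integral>\<^sup>+\<zeta>\<in>ball 0 R. ?G \<zeta> \<partial>lborel)"
    by (rule nn_integral_add) measurable
  also have "\<dots> < \<infinity>" using high low by simp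
  finally have fin': "(\<integral>\<^sup>+\<zeta>\<in>?\<Gamma>. ennreal ((japanese \<zeta> powr s * norm (FT_cutoff u chi \<zeta>))\<^sup>2) \<partial>lborel) < \<infinity>" .
  have "open (ball x0 (\<delta> / 2)) \<and> x0 \<in> ball x0 (\<delta> / 2) \<and> (\<forall>x\<in>ball x0 (\<delta> / 2). chi x = 1)"
    using \<delta>(1) chi1 by auto
  then show ?thesis unfolding not_in_WF_def using conic test fin' by blast
qed

text \<open>Condition (iii) quantifies over all windows; an actual window is needed to pass from it
  to (ii).\<close>

lemma exists_schwartz_nonzero: "\<exists>\<phi>::'a::euclidean_space \<Rightarrow> complex. schwartz \<phi> \<and> \<phi> \<noteq> (\<lambda>_. 0)"
proof -
  obtain chi :: "'a \<Rightarrow> complex" where chi: "test_fun chi" "\<And>x. x \<in> ball 0 (1 / 2) \<Longrightarrow> chi x = 1"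
    using bump_function[of 1 "0::'a"] by (metis zero_less_one)
  have "chi 0 = 1" by (rule chi(2)) simp
  then have "chi \<noteq> (\<lambda>_. 0)" by auto
  then show ?thesis using test_fun_schwartz[OF chi(1)] by blast
qed

theorem theorem1p2:
  fixes s :: real and x0 \<xi>0 :: "'a::euclidean_space"
    and u :: "('a \<Rightarrow> complex) \<Rightarrow> complex"
  assumes "\<xi>0 \<noteq> 0" and "tempered u"
  shows "(not_in_WF s u x0 \<xi>0 \<longleftrightarrow>
           (\<exists>\<phi> K V. schwartz \<phi> \<and> \<phi> \<noteq> (\<lambda>_. 0) \<and> open K \<and> x0 \<in> K \<and> open V \<and> \<xi>0 \<in> V \<and>
              wp_integral s \<phi> u K V < \<infinity>))
       \<and> (not_in_WF s u x0 \<xi>0 \<longleftrightarrow>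
           (\<exists>K V. open K \<and> x0 \<in> K \<and> open V \<and> \<xi>0 \<in> V \<and>
              (\<forall>\<phi>. schwartz \<phi> \<and> \<phi> \<noteq> (\<lambda>_. 0) \<longrightarrow> wp_integral s \<phi> u K V < \<infinity>)))"
    (is "(?i \<longleftrightarrow> ?ii) \<and> (?i \<longleftrightarrow> ?iii)")
proof -
  have "?iii" if "?i"
    using not_in_WF_imp_wp_integral_finite[OF assms(2,1) that] by metis
  moreover have "?ii" if "?iii" using that exists_schwartz_nonzero by blast
  moreover have "?i" if "?ii" using that wp_integral_finite_imp_not_in_WF[OF assms(2,1)] by blast
  ultimately show ?thesis by blast
qed

end
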